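(* Let $\mathrm{HDA}^\Sigma$ be the full subcategory of $\mathcal{P}_\Sigma=\square_S^{op}\mathrm{Set}\downarrow\,!^S\Sigma$ of labelled symmetric precubical sets satisfying the HDA paradigm. There exists a unique combinatorial model category structure on $\mathrm{HDA}^\Sigma$ such that the class of cofibrations is generated by $$I=\{\partial\square_S[a_1,\dots,a_n]\subset\square_S[a_1,\dots,a_n]\mid n\ge 1,\ a_1,\dots,a_n\in\Sigma\}\cup\{C:\varnothing\to\{0\},\ R:\{0,1\}\to\{0\}\}$$ and such that a fibrant object is a $\Lambda_{\mathcal{P}_\Sigma}(V_{\mathcal P},\varnothing,I)$-injective object of $\mathrm{HDA}^\Sigma$, where $V_{\mathcal P}=(!^S(\Sigma\times\{0,1\})/\!/\Sigma)$. All objects are cofibrant.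
   Context: Fix a nonempty set $\Sigma$ of labels. Let $[n]=\{0,1\}^n$. Let $\square_S$ be the subcategory of $\mathrm{Set}$ with objects $[n]$, $n\ge 0$, generated by the face maps $\delta_i^\alpha:[n-1]\to[n]$ ($1\le i\le n$, $\alpha\in\{0,1\}$), inserting $\alpha$ at position $i$, and the symmetry maps $\sigma_i:[n]\to[n]$ ($1\le i\le n-1$), swapping coordinates $i$ and $i+1$. A symmetric precubical set is a presheaf $K$ on $\square_S$; $K_n:=K([n])$. $\square_S[n]=\square_S(-,[n])$, and $\partial\square_S[n]\subset\square_S[n]$ agrees with it in degrees $<n$ and is empty in degrees $\ge n$. For a set $A$, $!^SA$ has $(!^SA)_n=A^n$, the face operators $\partial_i^0=\partial_i^1$ deleting the $i$-th letter and the symmetry operators $s_i$ exchanging the $i$-th and $(i+1)$-st letters. A labelled symmetric precubical set $(K/\!/\Sigma)$ is an object $K\to\,!^S\Sigma$ of the slice category $\mathcal P_\Sigma$. $\square_S[a_1,\dots,a_n]$ is $\square_S[n]\to\,!^S\Sigma$ corresponding to $(a_1,\dots,a_n)\in\Sigma^n$; $\partial\square_S[a_1,\dots,a_n]$ is its restriction to $\partial\square_S[n]$. A set is identified with a coproduct of copies of $\square_S[0]$. $(K/\!/\Sigma)$ satisfies the HDA paradigm if for every $p\ge2$, every commutative square with top map $\partial\square_S[p]\to K$, left map the inclusion $\partial\square_S[p]\subset\square_S[p]$, right map the labelling map $K\to\,!^S\Sigma$ and bottom map $\square_S[p]\to\,!^S\Sigma$ admits at most one lift $\square_S[p]\to K$.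 The category $\mathrm{HDA}^\Sigma$ is a full reflective locally presentable subcategory of $\mathcal P_\Sigma$. $V_{\mathcal P}=(!^S(\Sigma\times\{0,1\})/\!/\Sigma)$ is induced by the projection $\Sigma\times\{0,1\}\to\Sigma$; the maps $\gamma^k:\mathbf 1=(!^S\Sigma/\!/\Sigma)\to V_{\mathcal P}$ ($k=0,1$) are induced by $\Sigma\cong\Sigma\times\{k\}$. These give natural maps $\gamma^k_X:X\to V_{\mathcal P}\times X$ and $\gamma_X=\gamma^0_X\sqcup\gamma_X^1:X\sqcup X\to V_{\mathcal P}\times X$. For $f:X\to Y$, $f\star\gamma^k: Y\sqcup_X(V_{\mathcal P}\times X)\to V_{\mathcal P}\times Y$ and $f\star\gamma:(Y\sqcup Y)\sqcup_{X\sqcup X}(V_{\mathcal P}\times X)\to V_{\mathcal P}\times Y$ are the canonical maps (computed in $\mathcal P_\Sigma$). Put $\Lambda^0=(I\star\gamma^0)\cup(I\star\gamma^1)$, $\Lambda^{n+1}=\Lambda^n\star\gamma$, $\Lambda_{\mathcal P_\Sigma}(V_{\mathcal P},\varnothing,I)=\bigcup_{n\ge0}\Lambda^n$. An object $T$ is injective with respect to a set of maps if every map from the source of a member to $T$ extends along that member. "Generated by $I$" means that the cofibrations are the maps having the left lifting property with respect to all maps having the right lifting property with respect to $I$. *)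

theory Defs
  imports Main "HOL-Library.FuncSet"
begin

unbundle cardinal_syntax

section \<open>A universe of small sets\<close>

text \<open>
  The category of sets is represented by the small subsets of a type \<open>'u\<close>, where small means of
  smaller cardinality than \<open>'u\<close> itself.  The predicate \<open>universe\<close> says that these
  cardinalities are those of the members of an (uncountable) Grothendieck universe, that is, that
  the cardinality of \<open>'u\<close> is strongly inaccessible.
\<close>

definition small :: "'u itself \<Rightarrow> 'a set \<Rightarrow> bool" where
  "small U A \<longleftrightarrow> |A| <o |UNIV :: 'u set|"

definition universe :: "'u itself \<Rightarrow> bool" where
  "universe U \<longleftrightarrow>
     small U (UNIV :: nat set) \<and>
     (\<forall>A :: 'u set. small U A \<longrightarrow> small U (Pow A)) \<and>
     (\<forall>(I :: 'u set) (A :: 'u \<Rightarrow> 'u set).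
        small U I \<and> (\<forall>i\<in>I. small U (A i)) \<longrightarrow> small U (\<Union>i\<in>I. A i))"


section \<open>Categories, limits and colimits\<close>

record ('o, 'm) category =
  obj :: "'o set"
  mor :: "'m set"
  source :: "'m \<Rightarrow> 'o"
  target :: "'m \<Rightarrow> 'o"
  idm :: "'o \<Rightarrow> 'm"
  cmp :: "'m \<Rightarrow> 'm \<Rightarrow> 'm"  \<comment> \<open>\<open>cmp C g f\<close> is \<open>g\<close> after \<open>f\<close>\<close>

definition hom :: "('o, 'm) category \<Rightarrow> 'o \<Rightarrow> 'o \<Rightarrow> 'm set" where
  "hom C X Y = {f \<in> mor C. source C f = X \<and> target C f = Y}"

definition is_category :: "('o, 'm) category \<Rightarrow> bool" where
  "is_category C \<longleftrightarrow>
     (\<forall>f\<in>mor C. source C f \<in> obj C \<and> target C f \<in> obj C) \<and>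
     (\<forall>X\<in>obj C. idm C X \<in> hom C X X) \<and>
     (\<forall>X Y Z f g. f \<in> hom C X Y \<and> g \<in> hom C Y Z \<longrightarrow> cmp C g f \<in> hom C X Z) \<and>
     (\<forall>X Y f. f \<in> hom C X Y \<longrightarrow> cmp C f (idm C X) = f \<and> cmp C (idm C Y) f = f) \<and>
     (\<forall>W X Y Z f g h. f \<in> hom C W X \<and> g \<in> hom C X Y \<and> h \<in> hom C Y Z \<longrightarrow>
        cmp C h (cmp C g f) = cmp C (cmp C h g) f)"

definition op_cat :: "('o, 'm) category \<Rightarrow> ('o, 'm) category" where
  "op_cat C = \<lparr>obj = obj C, mor = mor C, source = target C, target = source C, idm = idm C,
     cmp = (\<lambda>g f. cmp C f g)\<rparr>"

definition full_subcategory :: "('o, 'm) category \<Rightarrow> 'o set \<Rightarrow> ('o, 'm) category" where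
  "full_subcategory C S = \<lparr>obj = obj C \<inter> S,
     mor = {f \<in> mor C. source C f \<in> S \<and> target C f \<in> S},
     source = source C, target = target C, idm = idm C, cmp = cmp C\<rparr>"

definition is_functor ::
  "('j, 'k) category \<Rightarrow> ('o, 'm) category \<Rightarrow> ('j \<Rightarrow> 'o) \<Rightarrow> ('k \<Rightarrow> 'm) \<Rightarrow> bool" where
  "is_functor J C Fo Fm \<longleftrightarrow>
     (\<forall>j\<in>obj J. Fo j \<in> obj C) \<and>
     (\<forall>i j u. u \<in> hom J i j \<longrightarrow> Fm u \<in> hom C (Fo i) (Fo j)) \<and>
     (\<forall>j\<in>obj J. Fm (idm J j) = idm C (Fo j)) \<and>
     (\<forall>i j k u v. u \<in> hom J i j \<and> v \<in> hom J j k \<longrightarrow> Fm (cmp J v u) = cmp C (Fm v) (Fm u))"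

definition is_cone ::
  "('j, 'k) category \<Rightarrow> ('o, 'm) category \<Rightarrow> ('j \<Rightarrow> 'o) \<Rightarrow> ('k \<Rightarrow> 'm) \<Rightarrow> 'o \<Rightarrow> ('j \<Rightarrow> 'm) \<Rightarrow> bool"
  where
  "is_cone J C Fo Fm L \<pi> \<longleftrightarrow> L \<in> obj C \<and> (\<forall>j\<in>obj J. \<pi> j \<in> hom C L (Fo j)) \<and>
     (\<forall>i j u. u \<in> hom J i j \<longrightarrow> cmp C (Fm u) (\<pi> i) = \<pi> j)"

definition is_limit ::
  "('j, 'k) category \<Rightarrow> ('o, 'm) category \<Rightarrow> ('j \<Rightarrow> 'o) \<Rightarrow> ('k \<Rightarrow> 'm) \<Rightarrow> 'o \<Rightarrow> ('j \<Rightarrow> 'm) \<Rightarrow> bool"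
  where
  "is_limit J C Fo Fm L \<pi> \<longleftrightarrow> is_cone J C Fo Fm L \<pi> \<and>
     (\<forall>M \<mu>. is_cone J C Fo Fm M \<mu> \<longrightarrow>
        (\<exists>!h. h \<in> hom C M L \<and> (\<forall>j\<in>obj J. cmp C (\<pi> j) h = \<mu> j)))"

definition is_colimit ::
  "('j, 'k) category \<Rightarrow> ('o, 'm) category \<Rightarrow> ('j \<Rightarrow> 'o) \<Rightarrow> ('k \<Rightarrow> 'm) \<Rightarrow> 'o \<Rightarrow> ('j \<Rightarrow> 'm) \<Rightarrow> bool"
  where
  "is_colimit J C Fo Fm L \<iota> \<longleftrightarrow> is_limit (op_cat J) (op_cat C) Fo Fm L \<iota>"

definition complete :: "'u itself \<Rightarrow> ('o, 'm) category \<Rightarrow> bool" where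
  "complete U C \<longleftrightarrow>
     (\<forall>(J :: ('u, 'u) category) Fo Fm.
        is_category J \<and> small U (obj J) \<and> small U (mor J) \<and> is_functor J C Fo Fm \<longrightarrow>
        (\<exists>L \<pi>. is_limit J C Fo Fm L \<pi>))"

definition cocomplete :: "'u itself \<Rightarrow> ('o, 'm) category \<Rightarrow> bool" where
  "cocomplete U C \<longleftrightarrow>
     (\<forall>(J :: ('u, 'u) category) Fo Fm.
        is_category J \<and> small U (obj J) \<and> small U (mor J) \<and> is_functor J C Fo Fm \<longrightarrow>
        (\<exists>L \<iota>. is_colimit J C Fo Fm L \<iota>))"

definition is_initial :: "('o, 'm) category \<Rightarrow> 'o \<Rightarrow> bool" where
  "is_initial C Z \<longleftrightarrow> Z \<in> obj C \<and> (\<forall>X\<in>obj C. \<exists>!f. f \<in> hom C Z X)"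

definition is_terminal :: "('o, 'm) category \<Rightarrow> 'o \<Rightarrow> bool" where
  "is_terminal C Z \<longleftrightarrow> Z \<in> obj C \<and> (\<forall>X\<in>obj C. \<exists>!f. f \<in> hom C X Z)"


subsection \<open>Chosen binary products, coproducts and pushouts\<close>

definition is_product :: "('o, 'm) category \<Rightarrow> 'o \<Rightarrow> 'o \<Rightarrow> 'o \<times> 'm \<times> 'm \<Rightarrow> bool" where
  "is_product C X Y = (\<lambda>(P, p, q). P \<in> obj C \<and> p \<in> hom C P X \<and> q \<in> hom C P Y \<and>
     (\<forall>Z f g. f \<in> hom C Z X \<and> g \<in> hom C Z Y \<longrightarrow>
        (\<exists>!h. h \<in> hom C Z P \<and> cmp C p h = f \<and> cmp C q h = g)))"

definition product :: "('o, 'm) category \<Rightarrow> 'o \<Rightarrow> 'o \<Rightarrow> 'o \<times> 'm \<times> 'm" where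
  "product C X Y = (SOME t. is_product C X Y t)"

definition pairing :: "('o, 'm) category \<Rightarrow> 'm \<Rightarrow> 'm \<Rightarrow> 'm" where
  "pairing C f g = (case product C (target C f) (target C g) of (P, p, q) \<Rightarrow>
     (THE h. h \<in> hom C (source C f) P \<and> cmp C p h = f \<and> cmp C q h = g))"

definition prod_map :: "('o, 'm) category \<Rightarrow> 'm \<Rightarrow> 'm \<Rightarrow> 'm" where
  "prod_map C f g = (case product C (source C f) (source C g) of (P, p, q) \<Rightarrow>
     pairing C (cmp C f p) (cmp C g q))"

definition copairing :: "('o, 'm) category \<Rightarrow> 'm \<Rightarrow> 'm \<Rightarrow> 'm" where
  "copairing C = pairing (op_cat C)"

definition coprod_map :: "('o, 'm) category \<Rightarrow> 'm \<Rightarrow> 'm \<Rightarrow> 'm" where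
  "coprod_map C = prod_map (op_cat C)"

definition is_pushout :: "('o, 'm) category \<Rightarrow> 'm \<Rightarrow> 'm \<Rightarrow> 'o \<times> 'm \<times> 'm \<Rightarrow> bool" where
  "is_pushout C f g = (\<lambda>(Q, i, j). Q \<in> obj C \<and>
     i \<in> hom C (target C f) Q \<and> j \<in> hom C (target C g) Q \<and> cmp C i f = cmp C j g \<and>
     (\<forall>Z a b. a \<in> hom C (target C f) Z \<and> b \<in> hom C (target C g) Z \<and> cmp C a f = cmp C b g \<longrightarrow>
        (\<exists>!h. h \<in> hom C Q Z \<and> cmp C h i = a \<and> cmp C h j = b)))"

definition pushout :: "('o, 'm) category \<Rightarrow> 'm \<Rightarrow> 'm \<Rightarrow> 'o \<times> 'm \<times> 'm" where
  "pushout C f g = (SOME t. is_pushout C f g t)"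

text \<open>
  For a commutative square \<open>v g = h f\<close>, \<open>corner C f g h v\<close> is the canonical map from
  the pushout of \<open>f\<close> and \<open>g\<close> to the common target of \<open>h\<close> and \<open>v\<close>.
\<close>

definition corner :: "('o, 'm) category \<Rightarrow> 'm \<Rightarrow> 'm \<Rightarrow> 'm \<Rightarrow> 'm \<Rightarrow> 'm" where
  "corner C f g h v = (case pushout C f g of (Q, i, j) \<Rightarrow>
     (THE k. k \<in> hom C Q (target C h) \<and> cmp C k i = h \<and> cmp C k j = v))"


subsection \<open>Locally presentable categories\<close>

definition regular_cardinal :: "'u itself \<Rightarrow> 'u rel \<Rightarrow> bool" where
  "regular_cardinal U \<kappa> \<longleftrightarrow> Card_order \<kappa> \<and> infinite (Field \<kappa>) \<and> regularCard \<kappa> \<and>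
     \<kappa> <o |UNIV :: 'u set|"

definition poset_cat :: "'u set \<Rightarrow> 'u rel \<Rightarrow> ('u, 'u \<times> 'u) category" where
  "poset_cat P R = \<lparr>obj = P, mor = R, source = fst, target = snd, idm = (\<lambda>x. (x, x)),
     cmp = (\<lambda>g f. (fst f, snd g))\<rparr>"

definition directed_poset :: "'u itself \<Rightarrow> 'u rel \<Rightarrow> 'u set \<Rightarrow> 'u rel \<Rightarrow> bool" where
  "directed_poset U \<kappa> P R \<longleftrightarrow> small U P \<and> R \<subseteq> P \<times> P \<and> refl_on P R \<and> trans R \<and> antisym R \<and>
     (\<forall>S\<subseteq>P. |S| <o \<kappa> \<longrightarrow> (\<exists>u\<in>P. \<forall>s\<in>S. (s, u) \<in> R))"

text \<open>
  The two conclusions say that the canonical map from the colimit of the sets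
  \<open>hom C A (Fo j)\<close> to \<open>hom C A L\<close> is surjective and injective, i.e. that
  \<open>hom C A\<close> preserves the given directed colimit.
\<close>

definition presentable :: "'u itself \<Rightarrow> 'u rel \<Rightarrow> ('o, 'm) category \<Rightarrow> 'o \<Rightarrow> bool" where
  "presentable U \<kappa> C A \<longleftrightarrow> A \<in> obj C \<and>
     (\<forall>P R Fo Fm L \<iota>.
        directed_poset U \<kappa> P R \<and> is_functor (poset_cat P R) C Fo Fm \<and>
        is_colimit (poset_cat P R) C Fo Fm L \<iota> \<longrightarrow>
        (\<forall>f\<in>hom C A L. \<exists>j\<in>P. \<exists>g\<in>hom C A (Fo j). f = cmp C (\<iota> j) g) \<and>
        (\<forall>i\<in>P. \<forall>j\<in>P. \<forall>g\<in>hom C A (Fo i). \<forall>h\<in>hom C A (Fo j).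
           cmp C (\<iota> i) g = cmp C (\<iota> j) h \<longrightarrow>
           (\<exists>k. (i, k) \<in> R \<and> (j, k) \<in> R \<and> cmp C (Fm (i, k)) g = cmp C (Fm (j, k)) h)))"

definition locally_presentable :: "'u itself \<Rightarrow> ('o, 'm) category \<Rightarrow> bool" where
  "locally_presentable U C \<longleftrightarrow> is_category C \<and> cocomplete U C \<and>
     (\<forall>X\<in>obj C. \<forall>Y\<in>obj C. small U (hom C X Y)) \<and>
     (\<exists>\<kappa>. regular_cardinal U \<kappa> \<and>
       (\<exists>G. small U G \<and> (\<forall>A\<in>G. presentable U \<kappa> C A) \<and>
         (\<forall>X\<in>obj C. \<exists>P R Fo Fm \<iota>.
            directed_poset U \<kappa> P R \<and> is_functor (poset_cat P R) C Fo Fm \<and>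
            (\<forall>j\<in>P. Fo j \<in> G) \<and> is_colimit (poset_cat P R) C Fo Fm X \<iota>)))"


subsection \<open>Combinatorial model categories\<close>

definition has_lifts :: "('o, 'm) category \<Rightarrow> 'm \<Rightarrow> 'm \<Rightarrow> bool" where
  "has_lifts C i p \<longleftrightarrow>
     (\<forall>u v. u \<in> hom C (source C i) (source C p) \<and> v \<in> hom C (target C i) (target C p) \<and>
        cmp C p u = cmp C v i \<longrightarrow>
        (\<exists>h\<in>hom C (target C i) (source C p). cmp C h i = u \<and> cmp C p h = v))"

definition rlp :: "('o, 'm) category \<Rightarrow> 'm set \<Rightarrow> 'm set" where
  "rlp C S = {p \<in> mor C. \<forall>i\<in>S. has_lifts C i p}"

definition llp :: "('o, 'm) category \<Rightarrow> 'm set \<Rightarrow> 'm set" where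
  "llp C S = {i \<in> mor C. \<forall>p\<in>S. has_lifts C i p}"

definition injective :: "('o, 'm) category \<Rightarrow> 'm set \<Rightarrow> 'o \<Rightarrow> bool" where
  "injective C S T \<longleftrightarrow>
     (\<forall>f\<in>S. \<forall>g\<in>hom C (source C f) T. \<exists>h\<in>hom C (target C f) T. cmp C h f = g)"

definition retract_of :: "('o, 'm) category \<Rightarrow> 'm \<Rightarrow> 'm \<Rightarrow> bool" where
  "retract_of C f g \<longleftrightarrow> f \<in> mor C \<and> g \<in> mor C \<and>
     (\<exists>a\<in>hom C (source C f) (source C g). \<exists>b\<in>hom C (source C g) (source C f).
      \<exists>a'\<in>hom C (target C f) (target C g). \<exists>b'\<in>hom C (target C g) (target C f).
        cmp C b a = idm C (source C f) \<and> cmp C b' a' = idm C (target C f) \<and>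
        cmp C g a = cmp C a' f \<and> cmp C f b = cmp C b' g)"

definition retract_closed :: "('o, 'm) category \<Rightarrow> 'm set \<Rightarrow> bool" where
  "retract_closed C S \<longleftrightarrow> (\<forall>f g. retract_of C f g \<and> g \<in> S \<longrightarrow> f \<in> S)"

record 'm model_data =
  weqs :: "'m set"
  cofs :: "'m set"
  fibs :: "'m set"

definition model_structure :: "'u itself \<Rightarrow> ('o, 'm) category \<Rightarrow> 'm model_data \<Rightarrow> bool" where
  "model_structure U C M \<longleftrightarrow>
     is_category C \<and> complete U C \<and> cocomplete U C \<and>
     weqs M \<subseteq> mor C \<and> cofs M \<subseteq> mor C \<and> fibs M \<subseteq> mor C \<and>
     (\<forall>X Y Z f g. f \<in> hom C X Y \<and> g \<in> hom C Y Z \<longrightarrow>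
        (f \<in> weqs M \<and> g \<in> weqs M \<longrightarrow> cmp C g f \<in> weqs M) \<and>
        (f \<in> weqs M \<and> cmp C g f \<in> weqs M \<longrightarrow> g \<in> weqs M) \<and>
        (g \<in> weqs M \<and> cmp C g f \<in> weqs M \<longrightarrow> f \<in> weqs M)) \<and>
     retract_closed C (weqs M) \<and> retract_closed C (cofs M) \<and> retract_closed C (fibs M) \<and>
     (\<forall>i\<in>cofs M. \<forall>p\<in>fibs M. i \<in> weqs M \<or> p \<in> weqs M \<longrightarrow> has_lifts C i p) \<and>
     (\<forall>f\<in>mor C. \<exists>i\<in>cofs M \<inter> weqs M. \<exists>p\<in>fibs M. target C i = source C p \<and> f = cmp C p i) \<and>
     (\<forall>f\<in>mor C. \<exists>i\<in>cofs M. \<exists>p\<in>fibs M \<inter> weqs M. target C i = source C p \<and> f = cmp C p i)"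

text \<open>
  Combinatorial means cofibrantly generated with locally presentable underlying category.  In a
  locally presentable category every object is presentable, so every small set of maps permits the
  small object argument and no smallness condition on the sources of the generating maps is needed.
\<close>

definition combinatorial_model_structure ::
  "'u itself \<Rightarrow> ('o, 'm) category \<Rightarrow> 'm model_data \<Rightarrow> bool" where
  "combinatorial_model_structure U C M \<longleftrightarrow>
     model_structure U C M \<and> locally_presentable U C \<and>
     (\<exists>I\<subseteq>mor C. \<exists>J\<subseteq>mor C. small U I \<and> small U J \<and>
        fibs M = rlp C J \<and> fibs M \<inter> weqs M = rlp C I)"

definition cofibrant :: "('o, 'm) category \<Rightarrow> 'm model_data \<Rightarrow> 'o \<Rightarrow> bool" where
  "cofibrant C M X \<longleftrightarrow> (\<exists>Z f. is_initial C Z \<and> f \<in> hom C Z X \<and> f \<in> cofs M)"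

definition fibrant :: "('o, 'm) category \<Rightarrow> 'm model_data \<Rightarrow> 'o \<Rightarrow> bool" where
  "fibrant C M X \<longleftrightarrow> (\<exists>Z f. is_terminal C Z \<and> f \<in> hom C X Z \<and> f \<in> fibs M)"


section \<open>Symmetric precubical sets\<close>

definition vert :: "nat \<Rightarrow> bool list set" where
  "vert n = {x. length x = n}"

text \<open>
  Positions are counted from 1.  A map out of \<open>vert m\<close> is represented by a function that is
  \<open>undefined\<close> outside \<open>vert m\<close>.
\<close>

definition face_map :: "nat \<Rightarrow> nat \<Rightarrow> bool \<Rightarrow> bool list \<Rightarrow> bool list" where
  "face_map n i \<alpha> = (\<lambda>x\<in>vert (n - 1). take (i - 1) x @ \<alpha> # drop (i - 1) x)"

definition symmetry_map :: "nat \<Rightarrow> nat \<Rightarrow> bool list \<Rightarrow> bool list" where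
  "symmetry_map n i = (\<lambda>x\<in>vert n. x[i - 1 := x ! i, i := x ! (i - 1)])"

inductive box :: "nat \<Rightarrow> nat \<Rightarrow> (bool list \<Rightarrow> bool list) \<Rightarrow> bool" where
  box_id: "box n n (\<lambda>x\<in>vert n. x)"
| box_face: "1 \<le> i \<Longrightarrow> i \<le> n \<Longrightarrow> box (n - 1) n (face_map n i \<alpha>)"
| box_symmetry: "1 \<le> i \<Longrightarrow> i < n \<Longrightarrow> box n n (symmetry_map n i)"
| box_comp: "box l m f \<Longrightarrow> box m n g \<Longrightarrow> box l n (compose (vert l) g f)"

text \<open>For \<open>f : [m] \<rightarrow> [n]\<close>, \<open>act K m n f\<close> is the map from the \<open>n\<close>-cells to the \<open>m\<close>-cells.\<close>

record 'a presheaf_data =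
  cells :: "nat \<Rightarrow> 'a set"
  act :: "nat \<Rightarrow> nat \<Rightarrow> (bool list \<Rightarrow> bool list) \<Rightarrow> 'a \<Rightarrow> 'a"

definition sym_precubical_set :: "'a presheaf_data \<Rightarrow> bool" where
  "sym_precubical_set K \<longleftrightarrow>
     (\<forall>m n f. box m n f \<longrightarrow> act K m n f \<in> cells K n \<rightarrow> cells K m) \<and>
     (\<forall>n. \<forall>x\<in>cells K n. act K n n (\<lambda>v\<in>vert n. v) x = x) \<and>
     (\<forall>l m n f g. box l m f \<and> box m n g \<longrightarrow>
        (\<forall>x\<in>cells K n. act K l n (compose (vert l) g f) x = act K l m f (act K m n g x)))"

definition presheaf_map ::
  "'a presheaf_data \<Rightarrow> 'b presheaf_data \<Rightarrow> (nat \<Rightarrow> 'a \<Rightarrow> 'b) \<Rightarrow> bool" where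
  "presheaf_map K L \<phi> \<longleftrightarrow> (\<forall>n. \<phi> n \<in> cells K n \<rightarrow> cells L n) \<and>
     (\<forall>m n f. box m n f \<longrightarrow>
        (\<forall>x\<in>cells K n. \<phi> m (act K m n f x) = act L m n f (\<phi> n x)))"

definition cube :: "nat \<Rightarrow> (bool list \<Rightarrow> bool list) presheaf_data" where
  "cube n = \<lparr>cells = (\<lambda>m. {f. box m n f}), act = (\<lambda>l m g f. compose (vert l) f g)\<rparr>"

definition boundary :: "nat \<Rightarrow> (bool list \<Rightarrow> bool list) presheaf_data" where
  "boundary n = (cube n)\<lparr>cells := (\<lambda>m. if m < n then cells (cube n) m else {})\<rparr>"

text \<open>
  The coproduct of copies of the presheaf represented by \<open>[0]\<close> indexed by \<open>A\<close>; that presheaf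
  has a single cell, in degree 0.
\<close>

definition discrete :: "'a set \<Rightarrow> 'a presheaf_data" where
  "discrete A = \<lparr>cells = (\<lambda>n. if n = 0 then A else {}), act = (\<lambda>m n f x. x)\<rparr>"

text \<open>
  Every coordinate of \<open>[m]\<close> is copied by a map \<open>f : [m] \<rightarrow> [n]\<close> of the box category to
  exactly one coordinate of \<open>[n]\<close>.  The \<open>i\<close>-th letter of \<open>word_act m n f w\<close> is the letter
  of \<open>w\<close> at the coordinate to which \<open>f\<close> copies the coordinate \<open>i\<close>.  The lemmas below show
  that this is the contravariant action which deletes letters along face maps and exchanges letters
  along symmetry maps.
\<close>

definition word_act :: "nat \<Rightarrow> nat \<Rightarrow> (bool list \<Rightarrow> bool list) \<Rightarrow> 'a list \<Rightarrow> 'a list" where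
  "word_act m n f w = map (\<lambda>i. w ! (THE j. j < n \<and> (\<forall>x\<in>vert m. f x ! j = x ! i))) [0..<m]"

text \<open>The presheaf \<open>!\<^sup>SA\<close>, for \<open>A\<close> the set of all elements of the type \<open>'a\<close>.\<close>

definition words :: "'a list presheaf_data" where
  "words = \<lparr>cells = (\<lambda>n. {w. length w = n}), act = word_act\<rparr>"


definition copies :: "nat \<Rightarrow> nat \<Rightarrow> (bool list \<Rightarrow> bool list) \<Rightarrow> (nat \<Rightarrow> nat) \<Rightarrow> bool" where
  "copies m n f \<pi> \<longleftrightarrow> f \<in> vert m \<rightarrow> vert n \<and>
     (\<forall>i<m. \<pi> i < n \<and> (\<forall>x\<in>vert m. f x ! \<pi> i = x ! i)) \<and>
     (\<forall>j<n. j \<notin> \<pi> ` {..<m} \<longrightarrow> (\<exists>c. \<forall>x\<in>vert m. f x ! j = c))"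

lemma coordinate_inj:
  assumes "\<And>x. x \<in> vert m \<Longrightarrow> x ! i = x ! i'" "i < m" "i' < m"
  shows "i = i'"
  using assms(1)[of "(replicate m False)[i := True]"] assms(2,3)
  by (auto simp: vert_def nth_list_update split: if_splits)

lemma coordinate_not_const:
  assumes "\<And>x. x \<in> vert m \<Longrightarrow> x ! i = c" "i < m"
  shows False
  using assms(1)[of "replicate m False"] assms(1)[of "replicate m True"] assms(2)
  by (auto simp: vert_def)

lemma copies_THE:
  assumes "copies m n f \<pi>" "i < m"
  shows "(THE j. j < n \<and> (\<forall>x\<in>vert m. f x ! j = x ! i)) = \<pi> i"
proof (rule the_equality)
  show "\<pi> i < n \<and> (\<forall>x\<in>vert m. f x ! \<pi> i = x ! i)"
    using assms by (auto simp: copies_def)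
next
  fix j assume j: "j < n \<and> (\<forall>x\<in>vert m. f x ! j = x ! i)"
  show "j = \<pi> i"
  proof (cases "j \<in> \<pi> ` {..<m}")
    case True
    then obtain i' where i': "i' < m" "j = \<pi> i'" by auto
    have "i = i'"
      using assms i' j by (intro coordinate_inj[of m]) (auto simp: copies_def)
    then show ?thesis using i' by simp
  next
    case False
    then obtain c where "\<forall>x\<in>vert m. f x ! j = c"
      using assms(1) j unfolding copies_def by blast
    then show ?thesis
      using coordinate_not_const[of m i c] j assms(2) by auto
  qed
qed

lemma word_act_copies:
  "copies m n f \<pi> \<Longrightarrow> word_act m n f w = map (\<lambda>i. w ! \<pi> i) [0..<m]"
  by (simp add: word_act_def copies_THE)

lemma copies_id: "copies n n (\<lambda>x\<in>vert n. x) id"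
  by (auto simp: copies_def)

lemma copies_face:
  assumes "1 \<le> i" "i \<le> n"
  shows "copies (n - 1) n (face_map n i \<alpha>) (\<lambda>k. if k < i - 1 then k else k + 1)"
  unfolding copies_def
proof (intro conjI allI impI)
  show "face_map n i \<alpha> \<in> vert (n - 1) \<rightarrow> vert n"
    using assms by (auto simp: face_map_def vert_def)
next
  fix k assume "k < n - 1"
  then show "(if k < i - 1 then k else k + 1) < n" by auto
  show "\<forall>x\<in>vert (n - 1). face_map n i \<alpha> x ! (if k < i - 1 then k else k + 1) = x ! k"
    using assms \<open>k < n - 1\<close> by (auto simp: face_map_def vert_def nth_append nth_Cons')
next
  fix j assume j: "j < n" "j \<notin> (\<lambda>k. if k < i - 1 then k else k + 1) ` {..<n - 1}"
  have "j = i - 1"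
  proof (rule ccontr)
    assume ne: "j \<noteq> i - 1"
    have "j = (\<lambda>k. if k < i - 1 then k else k + 1) (if j < i - 1 then j else j - 1)"
      using ne by auto
    moreover have "(if j < i - 1 then j else j - 1) \<in> {..<n - 1}"
      using ne j(1) assms by auto
    ultimately show False using j(2) by blast
  qed
  then show "\<exists>c. \<forall>x\<in>vert (n - 1). face_map n i \<alpha> x ! j = c"
    using assms by (intro exI[of _ \<alpha>]) (auto simp: face_map_def vert_def nth_append)
qed

lemma copies_symmetry:
  assumes "1 \<le> i" "i < n"
  shows "copies n n (symmetry_map n i) (\<lambda>k. if k = i - 1 then i else if k = i then i - 1 else k)"
    (is "copies n n _ ?p")
proof -
  have "?p ` {..<n} = {..<n}"
  proof -
    have "j \<in> ?p ` {..<n}" if "j < n" for j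
      using that assms by (intro image_eqI[of _ _ "?p j"]) auto
    then show ?thesis using assms by auto
  qed
  then show ?thesis
    using assms by (auto simp: copies_def symmetry_map_def vert_def nth_list_update)
qed

lemma copies_comp:
  assumes "copies l m f \<pi>" "copies m n g \<rho>"
  shows "copies l n (compose (vert l) g f) (\<rho> \<circ> \<pi>)"
  unfolding copies_def
proof (intro conjI allI impI)
  show "compose (vert l) g f \<in> vert l \<rightarrow> vert n"
    using assms by (auto simp: copies_def compose_def Pi_iff)
next
  fix i assume "i < l"
  then show "(\<rho> \<circ> \<pi>) i < n" "\<forall>x\<in>vert l. compose (vert l) g f x ! (\<rho> \<circ> \<pi>) i = x ! i"
    using assms by (auto simp: copies_def compose_def Pi_iff)
next
  fix j assume j: "j < n" "j \<notin> (\<rho> \<circ> \<pi>) ` {..<l}"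
  show "\<exists>c. \<forall>x\<in>vert l. compose (vert l) g f x ! j = c"
  proof (cases "j \<in> \<rho> ` {..<m}")
    case True
    then obtain k where k: "k < m" "j = \<rho> k" by auto
    then have "k \<notin> \<pi> ` {..<l}" using j by auto
    then obtain c where "\<forall>x\<in>vert l. f x ! k = c"
      using assms(1) k(1) unfolding copies_def by blast
    then have "\<forall>x\<in>vert l. compose (vert l) g f x ! j = c"
      using assms k by (auto simp: copies_def compose_def Pi_iff)
    then show ?thesis by blast
  next
    case False
    then obtain c where "\<forall>y\<in>vert m. g y ! j = c"
      using assms(2) j(1) unfolding copies_def by blast
    then have "\<forall>x\<in>vert l. compose (vert l) g f x ! j = c"
      using assms(1) by (auto simp: copies_def compose_def Pi_iff)
    then show ?thesis by blast
  qed
qed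

lemma box_copies: "box m n f \<Longrightarrow> \<exists>\<pi>. copies m n f \<pi>"
proof (induction rule: box.induct)
  case (box_id n) then show ?case using copies_id by blast
next
  case (box_face i n \<alpha>) then show ?case using copies_face by blast
next
  case (box_symmetry i n) then show ?case using copies_symmetry by blast
next
  case (box_comp l m f n g) then show ?case using copies_comp by blast
qed

lemma word_act_id: "length w = n \<Longrightarrow> word_act n n (\<lambda>x\<in>vert n. x) w = w"
  using word_act_copies[OF copies_id, of n w] by (auto intro: nth_equalityI)

lemma word_act_face:
  assumes "1 \<le> i" "i \<le> n" "length w = n"
  shows "word_act (n - 1) n (face_map n i \<alpha>) w = take (i - 1) w @ drop i w"
  unfolding word_act_copies[OF copies_face[OF assms(1,2)]]
  using assms by (auto intro!: nth_equalityI simp: nth_append)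

lemma word_act_symmetry:
  assumes "1 \<le> i" "i < n" "length w = n"
  shows "word_act n n (symmetry_map n i) w = w[i - 1 := w ! i, i := w ! (i - 1)]"
  unfolding word_act_copies[OF copies_symmetry[OF assms(1,2)]]
  using assms by (auto intro!: nth_equalityI simp: nth_list_update)

lemma word_act_compose:
  assumes "box l m f" "box m n g"
  shows "word_act l n (compose (vert l) g f) w = word_act l m f (word_act m n g w)"
proof -
  obtain \<pi> \<rho> where *: "copies l m f \<pi>" "copies m n g \<rho>" using assms box_copies by blast
  then have "\<forall>i<l. \<pi> i < m" by (auto simp: copies_def)
  then show ?thesis
    by (simp add: word_act_copies[OF copies_comp[OF *]] word_act_copies[OF *(1)]
        word_act_copies[OF *(2)])
qed

lemma sym_precubical_set_words: "sym_precubical_set words"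
  by (auto simp: sym_precubical_set_def words_def word_act_id word_act_compose)
     (simp add: word_act_def)


section \<open>Labelled symmetric precubical sets\<close>

text \<open>The set of labels is the set of all elements of the type \<open>'l\<close>.\<close>

record ('a, 'l) lps =
  und :: "'a presheaf_data"
  lab :: "nat \<Rightarrow> 'a \<Rightarrow> 'l list"

definition lps_object :: "('a, 'l) lps \<Rightarrow> bool" where
  "lps_object X \<longleftrightarrow> sym_precubical_set (und X) \<and> presheaf_map (und X) words (lab X)"

definition lps_map :: "('a, 'l) lps \<Rightarrow> ('b, 'l) lps \<Rightarrow> (nat \<Rightarrow> 'a \<Rightarrow> 'b) \<Rightarrow> bool" where
  "lps_map X Y \<phi> \<longleftrightarrow> presheaf_map (und X) (und Y) \<phi> \<and>
     (\<forall>n. \<forall>x\<in>cells (und X) n. lab Y n (\<phi> n x) = lab X n x)"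

definition lcube :: "'l list \<Rightarrow> (bool list \<Rightarrow> bool list, 'l) lps" where
  "lcube as = \<lparr>und = cube (length as), lab = (\<lambda>m f. word_act m (length as) f as)\<rparr>"

definition lboundary :: "'l list \<Rightarrow> (bool list \<Rightarrow> bool list, 'l) lps" where
  "lboundary as = (lcube as)\<lparr>und := boundary (length as)\<rparr>"

definition ldiscrete :: "'a set \<Rightarrow> ('a, 'l) lps" where
  "ldiscrete A = \<lparr>und = discrete A, lab = (\<lambda>_ _. [])\<rparr>"

definition lwords :: "('l list, 'l) lps" where
  "lwords = \<lparr>und = words, lab = (\<lambda>_ w. w)\<rparr>"

definition V_lps :: "(('l \<times> bool) list, 'l) lps" where
  "V_lps = \<lparr>und = words, lab = (\<lambda>_. map fst)\<rparr>"

definition hda_paradigm :: "('a, 'l) lps \<Rightarrow> bool" where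
  "hda_paradigm X \<longleftrightarrow>
     (\<forall>p\<ge>2. \<forall>\<phi> \<psi>.
        presheaf_map (boundary p) (und X) \<phi> \<and> presheaf_map (cube p) words \<psi> \<and>
        (\<forall>n. \<forall>x\<in>cells (boundary p) n. lab X n (\<phi> n x) = \<psi> n x) \<longrightarrow>
        (\<forall>h h'.
           (\<forall>k\<in>{h, h'}. presheaf_map (cube p) (und X) k \<and>
              (\<forall>n. \<forall>x\<in>cells (boundary p) n. k n x = \<phi> n x) \<and>
              (\<forall>n. \<forall>x\<in>cells (cube p) n. lab X n (k n x) = \<psi> n x)) \<longrightarrow>
           (\<forall>n. \<forall>x\<in>cells (cube p) n. h n x = h' n x)))"

type_synonym ('u, 'l) lmor = "('u, 'l) lps \<times> (nat \<Rightarrow> 'u \<Rightarrow> 'u) \<times> ('u, 'l) lps"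

definition P_cat :: "(('u, 'l) lps, ('u, 'l) lmor) category" where
  "P_cat = \<lparr>
     obj = {X. lps_object X \<and> (\<forall>n. small TYPE('u) (cells (und X) n))},
     mor = {(X, \<phi>, Y). lps_object X \<and> (\<forall>n. small TYPE('u) (cells (und X) n)) \<and>
              lps_object Y \<and> (\<forall>n. small TYPE('u) (cells (und Y) n)) \<and>
              lps_map X Y \<phi> \<and> (\<forall>n. \<phi> n \<in> extensional (cells (und X) n))},
     source = (\<lambda>(X, \<phi>, Y). X),
     target = (\<lambda>(X, \<phi>, Y). Y),
     idm = (\<lambda>X. (X, \<lambda>n. \<lambda>x\<in>cells (und X) n. x, X)),
     cmp = (\<lambda>(Y, \<psi>, Z) (X, \<phi>, Y'). (X, \<lambda>n. compose (cells (und X) n) (\<psi> n) (\<phi> n), Z))\<rparr>"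

definition HDA :: "(('u, 'l) lps, ('u, 'l) lmor) category" where
  "HDA = full_subcategory P_cat {X. hda_paradigm X}"


subsection \<open>Transport to cells of type \<open>'u\<close>\<close>

text \<open>
  The objects defined above have cells in various types.  These are replaced by isomorphic objects of
  \<open>P_cat\<close> along an injection of the type of cells into \<open>'u\<close>, which exists when \<open>'u\<close> is
  a universe and the type of labels is small.
\<close>

definition emb :: "'a \<Rightarrow> 'u" where
  "emb = (SOME e. inj e)"

definition place :: "('a, 'l) lps \<Rightarrow> ('u, 'l) lps" where
  "place X = \<lparr>
     und = \<lparr>cells = (\<lambda>n. emb ` cells (und X) n),
            act = (\<lambda>m n f x. emb (act (und X) m n f (inv emb x)))\<rparr>,
     lab = (\<lambda>n x. lab X n (inv emb x))\<rparr>"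

definition place_map ::
  "('a, 'l) lps \<Rightarrow> ('b, 'l) lps \<Rightarrow> (nat \<Rightarrow> 'a \<Rightarrow> 'b) \<Rightarrow> ('u, 'l) lmor" where
  "place_map X Y \<phi> =
     (place X, \<lambda>n. \<lambda>x\<in>emb ` cells (und X) n. emb (\<phi> n (inv emb x)), place Y)"


subsection \<open>The generating cofibrations and the set \<open>\<Lambda>\<close>\<close>

definition gen_cofs :: "('u, 'l) lmor set" where
  "gen_cofs = {place_map (lboundary as) (lcube as) (\<lambda>n x. x) | as. length as \<ge> 1} \<union>
     {place_map (ldiscrete ({} :: nat set)) (ldiscrete {0 :: nat}) (\<lambda>n x. x),
      place_map (ldiscrete {0, 1 :: nat}) (ldiscrete {0 :: nat}) (\<lambda>n x. 0)}"

definition one_P :: "('u, 'l) lps" where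
  "one_P = place lwords"

definition V_P :: "('u, 'l) lps" where
  "V_P = place V_lps"

definition gamma :: "bool \<Rightarrow> ('u, 'l) lmor" where
  "gamma k = place_map lwords V_lps (\<lambda>n. map (\<lambda>a. (a, k)))"

text \<open>
  \<open>gamma_at k X : X \<rightarrow> V \<times> X\<close> has components \<open>X \<rightarrow> 1 \<rightarrow> V\<close> and the identity;
  \<open>gamma2_at X : X \<squnion> X \<rightarrow> V \<times> X\<close>.
\<close>

definition gamma_at :: "bool \<Rightarrow> ('u, 'l) lps \<Rightarrow> ('u, 'l) lmor" where
  "gamma_at k X =
     pairing P_cat (cmp P_cat (gamma k) (THE t. t \<in> hom P_cat X one_P)) (idm P_cat X)"

definition gamma2_at :: "('u, 'l) lps \<Rightarrow> ('u, 'l) lmor" where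
  "gamma2_at X = copairing P_cat (gamma_at False X) (gamma_at True X)"

definition V_times :: "('u, 'l) lmor \<Rightarrow> ('u, 'l) lmor" where
  "V_times f = prod_map P_cat (idm P_cat V_P) f"

definition star_gamma :: "bool \<Rightarrow> ('u, 'l) lmor \<Rightarrow> ('u, 'l) lmor" where
  "star_gamma k f = corner P_cat f (gamma_at k (source P_cat f))
     (gamma_at k (target P_cat f)) (V_times f)"

definition star_gamma2 :: "('u, 'l) lmor \<Rightarrow> ('u, 'l) lmor" where
  "star_gamma2 f = corner P_cat (coprod_map P_cat f f) (gamma2_at (source P_cat f))
     (gamma2_at (target P_cat f)) (V_times f)"

primrec Lambda_n :: "nat \<Rightarrow> ('u, 'l) lmor set" where
  "Lambda_n 0 = star_gamma False ` gen_cofs \<union> star_gamma True ` gen_cofs"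
| "Lambda_n (Suc n) = star_gamma2 ` Lambda_n n"

definition Lambda :: "('u, 'l) lmor set" where
  "Lambda = (\<Union>n. Lambda_n n)"

end

theory Submission
  imports Defs
begin

text \<open>
  A map into an object satisfying the HDA paradigm is determined by its values on vertices and edges,
  and the higher cells of such a map are found by filling shells.  Hence the cofibrations are the maps
  that are injective on edges, and both factorizations can be written down explicitly, without a small
  object argument.

  Call two cells of the same dimension parallel if they have the same label and the same vertices, and
  call an object local if parallel cells are equal.  The weak equivalences are the maps inverted by the
  reflection onto local objects: they are bijective on vertices and reach every cell up to
  parallelism.  An object is fibrant if and only if every shell with the vertices and the label of a
  cell has a filler.  Every map in \<open>Lambda\<close> is injective on edges and a weak equivalence, since the
  cells of a cylinder over the same cell are parallel; so fibrant objects are injective.  Conversely,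
  the maps in \<open>Lambda\<close> obtained from the inclusions of the boundaries of cubes produce the fillers.

  For uniqueness, the cofibrations determine the trivial fibrations.  Local objects are fibrant, and a
  cylinder argument shows that they are orthogonal to the trivial cofibrations of any structure as in
  the theorem, so that its weak equivalences are among those above.  For the converse one reduces to a
  map between fibrant objects, which is compared with the trivial fibrations of its source and its
  target onto their common local reflection.
\<close>

text \<open>Parallelism is the right relation because the empty word is the only vertex of
  \<open>V_lps\<close>: the product \<open>V \<times> X\<close> has the same vertices as
  \<open>X\<close>, and its cells over a given cell differ only in a bit for each direction. A
  homotopy therefore moves neither vertices nor labels. That nothing is required of cofibrations on
  vertices is the effect of \<open>R\<close>: a map has the right lifting property with respect to
  it only if it is injective on vertices. Above dimension 1 nothing is required because there the
  HDA paradigm determines a map from its values on faces.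

  The obstacle is that the maps in \<open>Lambda\<close> are built from pushouts in
  \<open>P_cat\<close>, where the HDA paradigm may fail. So \<open>cofib\<close>,
  \<open>weq\<close>, \<open>fib\<close> and \<open>tfib\<close> are conditions on cells that make
  sense for all labelled symmetric precubical sets, with cells in any type, and the lifting lemmas
  ask for the HDA paradigm only on the object that receives the lift. The fibrations are given by
  lifting against one inclusion for each nonempty word: two cubes glued along their vertices, and
  the same without one top cell.\<close>

abbreviation cel :: "('a, 'l) lps \<Rightarrow> nat \<Rightarrow> 'a set" where
  "cel X \<equiv> cells (und X)"

abbreviation res :: "('a, 'l) lps \<Rightarrow> nat \<Rightarrow> nat \<Rightarrow> (bool list \<Rightarrow> bool list) \<Rightarrow> 'a \<Rightarrow> 'a" where
  "res X \<equiv> act (und X)"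

abbreviation idb :: "nat \<Rightarrow> bool list \<Rightarrow> bool list" where
  "idb n \<equiv> (\<lambda>v\<in>vert n. v)"

abbreviation cb :: "nat \<Rightarrow> (bool list \<Rightarrow> bool list) \<Rightarrow> (bool list \<Rightarrow> bool list) \<Rightarrow>
    bool list \<Rightarrow> bool list" where
  "cb l g f \<equiv> compose (vert l) g f"

section \<open>The box category\<close>

lemma box_maps: "box m n f \<Longrightarrow> x \<in> vert m \<Longrightarrow> f x \<in> vert n"
  using box_copies by (fastforce simp: copies_def)

text \<open>Distinct coordinates of the source are copied to distinct coordinates of the target, so
  a map of the box category never lowers the dimension.\<close>

lemma box_le:
  assumes "box m n f"
  shows "m \<le> n"
proof -
  obtain p where p: "copies m n f p" using box_copies[OF assms] by blast
  have "inj_on p {..<m}"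
  proof (rule inj_onI)
    fix i j assume "i \<in> {..<m}" "j \<in> {..<m}" "p i = p j"
    then have "x ! i = x ! j" if "x \<in> vert m" for x
      using p that unfolding copies_def by (metis lessThan_iff)
    then show "i = j" using \<open>i \<in> {..<m}\<close> \<open>j \<in> {..<m}\<close> by (intro coordinate_inj[of m]) auto
  qed
  moreover have "p ` {..<m} \<subseteq> {..<n}" using p by (auto simp: copies_def)
  ultimately have "card {..<m} \<le> card {..<n}" by (intro card_inj_on_le) auto
  then show ?thesis by simp
qed

lemma box_ext: "box m n f \<Longrightarrow> f \<in> extensional (vert m)"
  by (induction rule: box.induct) (auto simp: face_map_def symmetry_map_def compose_def extensional_def)

lemma box_eqI:
  assumes "box m n f" "box m n g" "\<And>x. x \<in> vert m \<Longrightarrow> f x = g x"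
  shows "f = g"
  using assms box_ext by (metis extensionalityI)

lemma cb_id_left: "box m n f \<Longrightarrow> cb m (idb n) f = f"
  by (rule extensionalityI[of _ "vert m"]) (auto simp: box_ext compose_def box_maps)

lemma cb_id_right: "box m n f \<Longrightarrow> cb m f (idb m) = f"
  by (rule extensionalityI[of _ "vert m"]) (auto simp: box_ext compose_def box_maps)

lemma cb_assoc: "box l m h \<Longrightarrow> cb l (cb m f g) h = cb l f (cb l g h)"
  by (auto simp: compose_def restrict_def box_maps)

lemma finite_vert: "finite (vert n)"
proof -
  have "vert n = {xs :: bool list. set xs \<subseteq> UNIV \<and> length xs = n}" by (auto simp: vert_def)
  then show ?thesis using finite_lists_length_eq[of "UNIV :: bool set" n] by simp
qed

text \<open>Finite hom-sets make every cell generate a finite subobject; local presentability at the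
  countable cardinal rests on this.\<close>

lemma finite_box: "finite {f. box m n f}"
proof (rule finite_subset)
  show "{f. box m n f} \<subseteq> (\<Pi>\<^sub>E x\<in>vert m. vert n)"
    using box_ext by (auto simp: PiE_iff box_maps extensional_def)
  show "finite (\<Pi>\<^sub>E x\<in>vert m. vert n)" by (intro finite_PiE finite_vert)
qed

lemma box_00: "box 0 0 f \<longleftrightarrow> f = idb 0"
proof
  assume f: "box 0 0 f"
  have "f x = x" if "x \<in> vert 0" for x using box_maps[OF f that] that by (simp add: vert_def)
  then show "f = idb 0" by (intro box_eqI[OF f box_id]) auto
qed (auto intro: box_id)

text \<open>The only coordinate is copied, and the reversal does not belong to the box category.
  Vertices and edges thus have no symmetries, so on them compatibility with restriction only
  concerns endpoints.\<close>

lemma box_11: "box (Suc 0) (Suc 0) f \<longleftrightarrow> f = idb (Suc 0)"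
proof
  assume f: "box (Suc 0) (Suc 0) f"
  then obtain p where p: "copies (Suc 0) (Suc 0) f p" using box_copies by blast
  have "f x = x" if "x \<in> vert (Suc 0)" for x
    using p that box_maps[OF f that] by (auto simp: copies_def vert_def intro!: nth_equalityI)
  then show "f = idb (Suc 0)" by (intro box_eqI[OF f box_id]) auto
qed (auto intro: box_id)

text \<open>The induction splits off the first coordinate, which a face map inserts. Since all
  vertices of a cube are reached, a box map out of it is determined by its restrictions to
  vertices.\<close>

lemma box_vertex: "x \<in> vert n \<Longrightarrow> box 0 n (\<lambda>_\<in>vert 0. x)"
proof (induction n arbitrary: x)
  case 0
  then have "(\<lambda>_\<in>vert 0. x) = idb 0" by (auto simp: vert_def restrict_def)
  then show ?case using box_id[of 0] by metis
next
  case (Suc n)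
  then obtain a y where xy: "x = a # y" "y \<in> vert n" by (cases x) (auto simp: vert_def)
  have f: "box n (Suc n) (face_map (Suc n) 1 a)" using box_face[of 1 "Suc n" a] by simp
  have "box 0 (Suc n) (cb 0 (face_map (Suc n) 1 a) (\<lambda>_\<in>vert 0. y))"
    by (rule box_comp[OF Suc.IH[OF xy(2)] f])
  moreover have "cb 0 (face_map (Suc n) 1 a) (\<lambda>_\<in>vert 0. y) = (\<lambda>_\<in>vert 0. x)"
    using xy by (auto simp: compose_def face_map_def restrict_def)
  ultimately show ?case by metis
qed

text \<open>Serves to tell apart the two copies in \<open>dcube\<close>: a cell of dimension at
  least 2 shows its mark on an edge, since on vertices the marks are forgotten.\<close>

lemma box_edge: "n \<ge> Suc 0 \<Longrightarrow> \<exists>g. box (Suc 0) n g"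
proof (induction n)
  case (Suc n)
  have f: "box (Suc n - 1) (Suc n) (face_map (Suc n) 1 True)" by (rule box_face) auto
  show ?case
  proof (cases n)
    case 0 then show ?thesis using box_id by blast
  next
    case (Suc k)
    then obtain g where "box (Suc 0) n g" using Suc.IH by auto
    then show ?thesis using box_comp f by fastforce
  qed
qed simp

section \<open>Labelled symmetric precubical sets\<close>

lemma lps_objectI:
  assumes "\<And>m n f x. box m n f \<Longrightarrow> x \<in> cel X n \<Longrightarrow> res X m n f x \<in> cel X m"
    and "\<And>n x. x \<in> cel X n \<Longrightarrow> res X n n (idb n) x = x"
    and "\<And>l m n f g x. box l m f \<Longrightarrow> box m n g \<Longrightarrow> x \<in> cel X n \<Longrightarrow>
           res X l n (cb l g f) x = res X l m f (res X m n g x)"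
    and "\<And>n x. x \<in> cel X n \<Longrightarrow> length (lab X n x) = n"
    and "\<And>m n f x. box m n f \<Longrightarrow> x \<in> cel X n \<Longrightarrow> lab X m (res X m n f x) = word_act m n f (lab X n x)"
  shows "lps_object X"
  using assms by (auto simp: lps_object_def sym_precubical_set_def presheaf_map_def words_def Pi_iff)

context
  fixes X :: "('a, 'l) lps"
  assumes X: "lps_object X"
begin

lemma res_cel: "box m n f \<Longrightarrow> x \<in> cel X n \<Longrightarrow> res X m n f x \<in> cel X m"
  using X by (auto simp: lps_object_def sym_precubical_set_def presheaf_map_def words_def Pi_iff)

lemma res_id: "x \<in> cel X n \<Longrightarrow> res X n n (idb n) x = x"
  using X by (auto simp: lps_object_def sym_precubical_set_def presheaf_map_def words_def Pi_iff)

lemma res_comp: "box l m f \<Longrightarrow> box m n g \<Longrightarrow> x \<in> cel X n \<Longrightarrow>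
    res X l n (cb l g f) x = res X l m f (res X m n g x)"
  using X by (auto simp: lps_object_def sym_precubical_set_def presheaf_map_def words_def Pi_iff)

lemma length_lab: "x \<in> cel X n \<Longrightarrow> length (lab X n x) = n"
  using X by (auto simp: lps_object_def sym_precubical_set_def presheaf_map_def words_def Pi_iff)

lemma lab_res: "box m n f \<Longrightarrow> x \<in> cel X n \<Longrightarrow> lab X m (res X m n f x) = word_act m n f (lab X n x)"
  using X by (auto simp: lps_object_def sym_precubical_set_def presheaf_map_def words_def Pi_iff)

end

lemma lps_mapI:
  assumes "\<And>n x. x \<in> cel X n \<Longrightarrow> \<phi> n x \<in> cel Y n"
    and "\<And>m n f x. box m n f \<Longrightarrow> x \<in> cel X n \<Longrightarrow> \<phi> m (res X m n f x) = res Y m n f (\<phi> n x)"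
    and "\<And>n x. x \<in> cel X n \<Longrightarrow> lab Y n (\<phi> n x) = lab X n x"
  shows "lps_map X Y \<phi>"
  using assms by (auto simp: lps_map_def presheaf_map_def)

context
  fixes X :: "('a, 'l) lps" and Y :: "('b, 'l) lps" and \<phi>
  assumes map: "lps_map X Y \<phi>"
begin

lemma map_cel: "x \<in> cel X n \<Longrightarrow> \<phi> n x \<in> cel Y n"
  using map by (auto simp: lps_map_def presheaf_map_def)

lemma map_res: "box m n f \<Longrightarrow> x \<in> cel X n \<Longrightarrow> \<phi> m (res X m n f x) = res Y m n f (\<phi> n x)"
  using map by (auto simp: lps_map_def presheaf_map_def)

lemma map_lab: "x \<in> cel X n \<Longrightarrow> lab Y n (\<phi> n x) = lab X n x"
  using map by (auto simp: lps_map_def presheaf_map_def)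

end

lemma lps_map_id: "lps_map X X (\<lambda>n x. x)"
  by (auto intro: lps_mapI)

lemma lps_map_comp: "lps_map X Y \<phi> \<Longrightarrow> lps_map Y Z \<psi> \<Longrightarrow> lps_map X Z (\<lambda>n x. \<psi> n (\<phi> n x))"
  by (auto intro!: lps_mapI simp: map_cel map_lab map_res)

lemma lps_map_cong:
  assumes "lps_object X" "lps_map X Y \<phi>" "\<And>n x. x \<in> cel X n \<Longrightarrow> \<psi> n x = \<phi> n x"
  shows "lps_map X Y \<psi>"
  using assms by (intro lps_mapI) (auto simp: map_cel map_lab map_res res_cel)

lemma lwords_simps [simp]:
  "cel lwords n = {w. length w = n}" "res lwords = word_act" "lab lwords n w = w"
  by (auto simp: lwords_def words_def)

lemma lps_object_lwords: "lps_object lwords"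
  by (intro lps_objectI) (auto simp: word_act_id word_act_compose, simp_all add: word_act_def)

lemma lps_map_lab: "lps_object X \<Longrightarrow> lps_map X lwords (lab X)"
  by (auto intro!: lps_mapI simp: length_lab lab_res)

subsection \<open>Cubes and their boundaries\<close>

lemma lcube_simps [simp]:
  "cel (lcube as) m = {f. box m (length as) f}" "res (lcube as) l m g f = cb l f g"
  "lab (lcube as) m f = word_act m (length as) f as"
  by (auto simp: lcube_def cube_def)

lemma lboundary_simps [simp]:
  "cel (lboundary as) m = {f. box m (length as) f \<and> m < length as}"
  "res (lboundary as) l m g f = cb l f g"
  "lab (lboundary as) m f = word_act m (length as) f as"
  by (auto simp: lboundary_def lcube_def boundary_def cube_def)

lemma lps_object_lcube: "lps_object (lcube as)"
  by (intro lps_objectI)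
    (auto simp: cb_id_right cb_assoc word_act_compose intro: box_comp, simp_all add: word_act_def)

lemma lps_object_lboundary: "lps_object (lboundary as)"
  by (intro lps_objectI)
    (auto simp: cb_id_right cb_assoc word_act_compose dest: box_le intro: box_comp,
      simp_all add: word_act_def)

lemma yoneda:
  assumes "lps_object X" "x \<in> cel X n" "lab X n x = as"
  shows "lps_map (lcube as) X (\<lambda>m f. res X m n f x)"
  using assms by (auto intro!: lps_mapI simp: length_lab res_cel res_comp lab_res)

lemma yoneda_inverse:
  assumes "lps_map (lcube as) X h" "box m (length as) f"
  shows "h m f = res X m (length as) f (h (length as) (idb (length as)))"
  using map_res[OF assms(1) assms(2), of "idb (length as)"] cb_id_left[OF assms(2)]
  by (simp add: box_id)

section \<open>Shells, that is, maps from the boundary of a cube with labels forgotten, and the HDA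
  paradigm\<close>

definition shell :: "('a, 'l) lps \<Rightarrow> nat \<Rightarrow> (nat \<Rightarrow> (bool list \<Rightarrow> bool list) \<Rightarrow> 'a) \<Rightarrow> bool" where
  "shell X n b \<longleftrightarrow> (\<forall>m f. box m n f \<longrightarrow> m < n \<longrightarrow> b m f \<in> cel X m \<and>
     (\<forall>l g. box l m g \<longrightarrow> b l (cb l f g) = res X l m g (b m f)))"

lemma shellI:
  assumes "\<And>m f. box m n f \<Longrightarrow> m < n \<Longrightarrow> b m f \<in> cel X m"
    and "\<And>l m f g. box m n f \<Longrightarrow> m < n \<Longrightarrow> box l m g \<Longrightarrow> b l (cb l f g) = res X l m g (b m f)"
  shows "shell X n b"
  using assms by (auto simp: shell_def)

lemma shell_cel: "shell X n b \<Longrightarrow> box m n f \<Longrightarrow> m < n \<Longrightarrow> b m f \<in> cel X m"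
  by (auto simp: shell_def)

lemma shell_res: "shell X n b \<Longrightarrow> box m n f \<Longrightarrow> m < n \<Longrightarrow> box l m g \<Longrightarrow>
    b l (cb l f g) = res X l m g (b m f)"
  by (auto simp: shell_def)

lemma lps_map_lboundary_iff:
  "lps_map (lboundary as) X b \<longleftrightarrow> shell X (length as) b \<and>
     (\<forall>m f. box m (length as) f \<longrightarrow> m < length as \<longrightarrow>
        lab X m (b m f) = word_act m (length as) f as)"
  unfolding shell_def lps_map_def presheaf_map_def lboundary_simps by auto

text \<open>The HDA paradigm as a condition on cells. It quantifies over no maps, so it can be
  checked for explicit objects and is inherited along injections.\<close>

definition hda1 :: "('a, 'l) lps \<Rightarrow> bool" where
  "hda1 X \<longleftrightarrow> (\<forall>n\<ge>2. \<forall>x\<in>cel X n. \<forall>y\<in>cel X n. lab X n x = lab X n y \<longrightarrow>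
     (\<forall>m f. box m n f \<longrightarrow> m < n \<longrightarrow> res X m n f x = res X m n f y) \<longrightarrow> x = y)"

lemma hda1D:
  assumes "hda1 X" "n \<ge> 2" "x \<in> cel X n" "y \<in> cel X n" "lab X n x = lab X n y"
    and "\<And>m f. box m n f \<Longrightarrow> m < n \<Longrightarrow> res X m n f x = res X m n f y"
  shows "x = y"
  using assms unfolding hda1_def by blast

text \<open>By the Yoneda lemma a lift is a cell, its restriction to the boundary is the family of
  proper faces of that cell, and the bottom map is its label. Two lifts in one square are thus two
  cells with the same proper faces and the same label.\<close>

lemma hda_paradigm_iff:
  assumes X: "lps_object X"
  shows "hda_paradigm X \<longleftrightarrow> hda1 X"
proof
  assume hda: "hda_paradigm X"
  show "hda1 X" unfolding hda1_def
  proof (intro allI ballI impI)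
    fix n :: nat and x y
    assume n: "n \<ge> 2" and x: "x \<in> cel X n" and y: "y \<in> cel X n" and l: "lab X n x = lab X n y"
      and eq: "\<forall>m f. box m n f \<longrightarrow> m < n \<longrightarrow> res X m n f x = res X m n f y"
    let ?\<psi> = "\<lambda>m f. word_act m n f (lab X n x)"
    let ?h = "\<lambda>x m f. res X m n f x"
    have len: "length (lab X n x) = n" using X x by (rule length_lab)
    have 1: "presheaf_map (cube n) (und X) (?h z)" if "z \<in> cel X n" for z
      using that X by (auto simp: presheaf_map_def cube_def res_cel res_comp)
    have 2: "presheaf_map (cube n) words ?\<psi>"
      using len by (auto simp: presheaf_map_def cube_def words_def word_act_compose)
        (simp add: word_act_def)
    have 3: "presheaf_map (boundary n) (und X) (?h x)"
      using x X by (auto simp: presheaf_map_def cube_def boundary_def res_cel res_comp dest: box_le)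
    have 4: "\<forall>m. \<forall>f\<in>cells (boundary n) m. lab X m (?h x m f) = ?\<psi> m f"
      using x X by (auto simp: boundary_def cube_def lab_res)
    have 5: "presheaf_map (cube n) (und X) k \<and>
        (\<forall>m. \<forall>f\<in>cells (boundary n) m. k m f = ?h x m f) \<and>
        (\<forall>m. \<forall>f\<in>cells (cube n) m. lab X m (k m f) = ?\<psi> m f)" if k: "k \<in> {?h x, ?h y}" for k
    proof -
      obtain z where z: "k = ?h z" "z \<in> cel X n" "lab X n z = lab X n x"
        "\<And>m f. box m n f \<Longrightarrow> m < n \<Longrightarrow> res X m n f z = res X m n f x"
        using k x y l eq by auto
      then show ?thesis using X 1[OF z(2)] by (auto simp: boundary_def cube_def lab_res)
    qed
    have "\<forall>m. \<forall>f\<in>cells (cube n) m. ?h x m f = ?h y m f"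
      using hda[unfolded hda_paradigm_def, THEN spec, THEN mp, OF n, THEN spec, THEN spec, THEN mp,
          OF conjI[OF 3 conjI[OF 2 4]], THEN spec, THEN spec, THEN mp, OF ballI, OF 5] .
    then have "?h x n (idb n) = ?h y n (idb n)" by (auto simp: cube_def box_id)
    then show "x = y" using x y X by (simp add: res_id)
  qed
next
  assume hda: "hda1 X"
  have nat: "k m f = res X m p f (k p (idb p))"
    if "presheaf_map (cube p) (und X) k" "box m p f" for k m p f
  proof -
    have "k m (cb m (idb p) f) = res X m p f (k p (idb p))"
      using that box_id[of p] by (auto simp: presheaf_map_def cube_def)
    then show ?thesis using cb_id_left[OF that(2)] by simp
  qed
  have key: "h n x = h' n x"
    if p: "p \<ge> 2" and h: "presheaf_map (cube p) (und X) h" "presheaf_map (cube p) (und X) h'"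
      and l: "lab X p (h p (idb p)) = lab X p (h' p (idb p))"
      and eq: "\<And>m f. box m p f \<Longrightarrow> m < p \<Longrightarrow> h m f = h' m f" and x: "box n p x" for p h h' n x
  proof -
    have "h p (idb p) = h' p (idb p)"
    proof (rule hda1D[OF hda p _ _ l])
      show "h p (idb p) \<in> cel X p" "h' p (idb p) \<in> cel X p"
        using h box_id[of p] by (auto simp: presheaf_map_def cube_def Pi_iff)
      fix m f assume f: "box m p f" "m < p"
      show "res X m p f (h p (idb p)) = res X m p f (h' p (idb p))"
        using nat[OF h(1) f(1)] nat[OF h(2) f(1)] eq[OF f] by metis
    qed
    then show ?thesis using nat[OF h(1) x] nat[OF h(2) x] by metis
  qed
  show "hda_paradigm X" unfolding hda_paradigm_def
    apply (intro allI impI ballI)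
    subgoal for p \<phi> \<psi> h h' n x
      by (rule key[of p h h' n x]) (auto simp: boundary_def cube_def box_id)
    done
qed

lemma hda1_lwords: "hda1 lwords"
  unfolding hda1_def
proof (intro allI ballI impI)
  fix n and x y :: "'a list"
  assume "lab lwords n x = lab lwords n y"
  then show "x = y" by simp
qed

text \<open>A cell of a cube is a function on vertices, and its values are its restrictions to
  vertices, which are proper faces as \<open>n \<ge> 2\<close>.\<close>

lemma hda1_lcube: "hda1 (lcube as)"
  unfolding hda1_def
proof (intro allI ballI impI)
  fix n :: nat and f g
  assume n: "n \<ge> 2" and f: "f \<in> cel (lcube as) n" and g: "g \<in> cel (lcube as) n"
    and eq: "\<forall>m h. box m n h \<longrightarrow> m < n \<longrightarrow> res (lcube as) m n h f = res (lcube as) m n h g"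
  have "f x = g x" if "x \<in> vert n" for x
  proof -
    have "cb 0 f (\<lambda>_\<in>vert 0. x) = cb 0 g (\<lambda>_\<in>vert 0. x)"
      using eq box_vertex[OF that] n by auto
    then have "cb 0 f (\<lambda>_\<in>vert 0. x) [] = cb 0 g (\<lambda>_\<in>vert 0. x) []" by simp
    then show ?thesis by (simp add: compose_def vert_def)
  qed
  then show "f = g" using f g by (auto intro: box_eqI)
qed

lemma hda1_lboundary: "hda1 (lboundary as)"
  unfolding hda1_def
proof (intro allI ballI impI)
  fix n :: nat and f g
  assume "n \<ge> 2" "f \<in> cel (lboundary as) n" "g \<in> cel (lboundary as) n"
    "lab (lboundary as) n f = lab (lboundary as) n g"
    "\<forall>m h. box m n h \<longrightarrow> m < n \<longrightarrow> res (lboundary as) m n h f = res (lboundary as) m n h g"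
  then show "f = g" using hda1D[OF hda1_lcube[of as], of n f g] by simp
qed

section \<open>Lifting\<close>

definition par :: "('a, 'l) lps \<Rightarrow> nat \<Rightarrow> 'a \<Rightarrow> 'a \<Rightarrow> bool" where
  "par X n x y \<longleftrightarrow> lab X n x = lab X n y \<and> (\<forall>f. box 0 n f \<longrightarrow> res X 0 n f x = res X 0 n f y)"

definition cofib :: "('a, 'l) lps \<Rightarrow> ('b, 'l) lps \<Rightarrow> (nat \<Rightarrow> 'a \<Rightarrow> 'b) \<Rightarrow> bool" where
  "cofib X Y \<phi> \<longleftrightarrow> inj_on (\<phi> (Suc 0)) (cel X (Suc 0))"

text \<open>Surjectivity on vertices is contained in the second clause, since parallel vertices are
  equal. The first clause makes the map reflect parallelism.\<close>

definition weq :: "('a, 'l) lps \<Rightarrow> ('b, 'l) lps \<Rightarrow> (nat \<Rightarrow> 'a \<Rightarrow> 'b) \<Rightarrow> bool" where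
  "weq X Y \<phi> \<longleftrightarrow> inj_on (\<phi> 0) (cel X 0) \<and>
     (\<forall>n. \<forall>y\<in>cel Y n. \<exists>x\<in>cel X n. par Y n (\<phi> n x) y)"

definition fills :: "('a, 'l) lps \<Rightarrow> ('b, 'l) lps \<Rightarrow> (nat \<Rightarrow> 'a \<Rightarrow> 'b) \<Rightarrow> nat \<Rightarrow>
    (nat \<Rightarrow> (bool list \<Rightarrow> bool list) \<Rightarrow> 'a) \<Rightarrow> 'b \<Rightarrow> bool" where
  "fills X Y \<phi> n b y \<longleftrightarrow>
     (\<exists>z\<in>cel X n. \<phi> n z = y \<and> (\<forall>m f. box m n f \<longrightarrow> m < n \<longrightarrow> res X m n f z = b m f))"

definition over :: "('b, 'l) lps \<Rightarrow> (nat \<Rightarrow> 'a \<Rightarrow> 'b) \<Rightarrow> nat \<Rightarrow>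
    (nat \<Rightarrow> (bool list \<Rightarrow> bool list) \<Rightarrow> 'a) \<Rightarrow> 'b \<Rightarrow> bool" where
  "over Y \<phi> n b y \<longleftrightarrow> (\<forall>m f. box m n f \<longrightarrow> m < n \<longrightarrow> \<phi> m (b m f) = res Y m n f y)"

text \<open>Bijectivity on vertices encodes lifting against \<open>C\<close> and \<open>R\<close>;
  the filling of shells encodes lifting against the boundaries of cubes.\<close>

definition tfib :: "('a, 'l) lps \<Rightarrow> ('b, 'l) lps \<Rightarrow> (nat \<Rightarrow> 'a \<Rightarrow> 'b) \<Rightarrow> bool" where
  "tfib X Y \<phi> \<longleftrightarrow> bij_betw (\<phi> 0) (cel X 0) (cel Y 0) \<and>
     (\<forall>n\<ge>Suc 0. \<forall>b. \<forall>y\<in>cel Y n. shell X n b \<and> over Y \<phi> n b y \<longrightarrow> fills X Y \<phi> n b y)"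

text \<open>The cell \<open>x\<close> certifies that the vertices of the shell and the label occur
  together in \<open>X\<close>. It is the image of the unmarked cube of \<open>dhorn\<close>, and
  the shell is the image of what remains of the marked one.\<close>

definition fib :: "('a, 'l) lps \<Rightarrow> ('b, 'l) lps \<Rightarrow> (nat \<Rightarrow> 'a \<Rightarrow> 'b) \<Rightarrow> bool" where
  "fib X Y \<phi> \<longleftrightarrow> (\<forall>n\<ge>Suc 0. \<forall>b. \<forall>x\<in>cel X n. \<forall>y\<in>cel Y n.
     shell X n b \<and> over Y \<phi> n b y \<and> lab X n x = lab Y n y \<and>
     (\<forall>f. box 0 n f \<longrightarrow> b 0 f = res X 0 n f x) \<longrightarrow> fills X Y \<phi> n b y)"

text \<open>Above dimension 1 a value is determined by its proper faces and its label, so agreement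
  propagates upwards from the edges.\<close>

lemma maps_eqI:
  assumes X: "lps_object X" "lps_object Y" "hda1 Y" and u: "lps_map X Y u" and v: "lps_map X Y v"
    and 0: "\<And>x. x \<in> cel X 0 \<Longrightarrow> u 0 x = v 0 x"
    and 1: "\<And>x. x \<in> cel X (Suc 0) \<Longrightarrow> u (Suc 0) x = v (Suc 0) x"
    and x: "x \<in> cel X n"
  shows "u n x = v n x"
  using x
proof (induction n arbitrary: x rule: less_induct)
  case (less n)
  consider "n = 0" | "n = Suc 0" | "n \<ge> 2" by linarith
  then show ?case
  proof cases
    case 3
    show ?thesis
    proof (rule hda1D[OF X(3) 3])
      fix m f assume "box m n f" "m < n"
      then show "res Y m n f (u n x) = res Y m n f (v n x)"
        using less map_res[OF u, of m n f x] map_res[OF v, of m n f x] res_cel[OF X(1)] by simp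
    qed (use less.prems u v in \<open>auto simp: map_cel map_lab\<close>)
  qed (use 0 1 less.prems in auto)
qed

text \<open>By recursion on the dimension: the values on the proper faces of a cell form a shell,
  and any filler of it over \<open>v\<close> may be chosen as the value. The choices are made cell
  by cell, with no regard to symmetries; the HDA paradigm of \<open>E\<close> makes them compatible
  with symmetries afterwards.\<close>

lemma extend_from_edges:
  fixes E :: "('e, 'l) lps" and Y :: "('y, 'l) lps" and B :: "('b, 'l) lps"
  assumes Y: "lps_object Y" and E: "lps_object E" "hda1 E" and B: "lps_object B"
    and \<phi>: "lps_map E B \<phi>" and v: "lps_map Y B v"
    and uv: "\<And>y. y \<in> cel Y 0 \<Longrightarrow> uv y \<in> cel E 0 \<and> \<phi> 0 (uv y) = v 0 y"
    and ue: "\<And>y. y \<in> cel Y (Suc 0) \<Longrightarrow> ue y \<in> cel E (Suc 0) \<and> \<phi> (Suc 0) (ue y) = v (Suc 0) y"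
    and uve: "\<And>y f. y \<in> cel Y (Suc 0) \<Longrightarrow> box 0 (Suc 0) f \<Longrightarrow>
                res E 0 (Suc 0) f (ue y) = uv (res Y 0 (Suc 0) f y)"
    and fill: "\<And>n y b. n \<ge> 2 \<Longrightarrow> y \<in> cel Y n \<Longrightarrow> shell E n b \<Longrightarrow> over B \<phi> n b (v n y) \<Longrightarrow>
                (\<And>f. box 0 n f \<Longrightarrow> b 0 f = uv (res Y 0 n f y)) \<Longrightarrow> fills E B \<phi> n b (v n y)"
  shows "\<exists>u. lps_map Y E u \<and> (\<forall>n. \<forall>y\<in>cel Y n. \<phi> n (u n y) = v n y) \<and>
    (\<forall>y\<in>cel Y 0. u 0 y = uv y) \<and> (\<forall>y\<in>cel Y (Suc 0). u (Suc 0) y = ue y)"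
proof -
  define good where "good u n y z \<longleftrightarrow> z \<in> cel E n \<and> \<phi> n z = v n y \<and>
    (\<forall>m f. box m n f \<longrightarrow> m < n \<longrightarrow> res E m n f z = u m (res Y m n f y))"
    for u :: "nat \<Rightarrow> 'y \<Rightarrow> 'e" and n y z
  define H where "H u n = (if n = 0 then uv else if n = Suc 0 then ue else (\<lambda>y. SOME z. good u n y z))"
    for u :: "nat \<Rightarrow> 'y \<Rightarrow> 'e" and n
  define u where "u = wfrec {(m, n). m < n} H"
  have wf: "wf {(m :: nat, n). m < n}" using wf_less by simp
  \<comment> \<open>The predicate \<open>good\<close> reads \<open>u\<close> in lower dimensions
    only, so the cut in the recursion can be removed.\<close>
  have good_cut: "good (cut u {(m, n). m < n} n) n = good u n" for n
    by (intro ext) (auto simp: good_def cut_apply)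
  have "u n = H (cut u {(m, n). m < n} n) n" for n
    unfolding u_def by (rule wfrec[OF wf])
  then have un: "u n = H u n" for n
    by (simp add: H_def good_cut)
  have u_0: "u 0 = uv" and u_1: "u (Suc 0) = ue" and u_n: "n \<ge> 2 \<Longrightarrow> u n y = (SOME z. good u n y z)"
    for n y using un by (auto simp: H_def)
  have main: "u n y \<in> cel E n \<and> \<phi> n (u n y) = v n y \<and>
      (\<forall>m f. box m n f \<longrightarrow> res E m n f (u n y) = u m (res Y m n f y))" if "y \<in> cel Y n" for n y
    using that
  proof (induction n arbitrary: y rule: less_induct)
    case (less n)
    consider "n = 0" | "n = Suc 0" | "n \<ge> 2" by linarith
    then show ?case
    proof cases
      case 1
      have "res E m n f (u n y) = u m (res Y m n f y)" if f: "box m n f" for m f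
      proof -
        have "m = 0" using box_le[OF f] 1 by simp
        then show ?thesis using f 1 uv less.prems E Y by (simp add: u_0 box_00 res_id)
      qed
      then show ?thesis using less.prems uv 1 by (auto simp: u_0)
    next
      case n1: 2
      have "res E m n f (u n y) = u m (res Y m n f y)" if f: "box m n f" for m f
      proof -
        consider "m = 0" | "m = Suc 0" using box_le[OF f] n1 by linarith
        then show ?thesis
        proof cases
          case 1 then show ?thesis using f n1 uve less.prems by (simp add: u_0 u_1)
        next
          case 2 then show ?thesis
            using f n1 ue less.prems E Y by (simp add: u_1 box_11 res_id)
        qed
      qed
      then show ?thesis using less.prems ue n1 by (auto simp: u_1)
    next
      case 3
      have ex: "good u n y (u n y)" if y: "y \<in> cel Y n" for y
      proof -
        define b where "b m f = u m (res Y m n f y)" for m f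
        have "shell E n b"
        proof (rule shellI)
          fix m f assume f: "box m n f" "m < n"
          then show "b m f \<in> cel E m" using less.IH y res_cel[OF Y] by (auto simp: b_def)
          fix l g assume g: "box l m g"
          show "b l (cb l f g) = res E l m g (b m f)"
            using less.IH[OF f(2)] f g y by (simp add: b_def res_comp[OF Y g f(1)] res_cel[OF Y])
        qed
        moreover have "over B \<phi> n b (v n y)"
          using less.IH y res_cel[OF Y] map_res[OF v] by (auto simp: over_def b_def)
        moreover have "b 0 f = uv (res Y 0 n f y)" if "box 0 n f" for f
          by (simp add: b_def u_0)
        ultimately have "fills E B \<phi> n b (v n y)" using fill 3 y by blast
        then have "\<exists>z. good u n y z" by (auto simp: fills_def good_def b_def)
        then show ?thesis unfolding u_n[OF 3] by (rule someI_ex)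
      qed
      have "res E m n f (u n y) = u m (res Y m n f y)" if f: "box m n f" for m f
      proof (cases "m < n")
        case True
        then show ?thesis using ex[OF less.prems] f by (auto simp: good_def)
      next
        case False
        then have m: "m = n" using box_le[OF f] by simp
        have y': "res Y n n f y \<in> cel Y n" using f less.prems m by (auto intro: res_cel[OF Y])
        \<comment> \<open>Here \<open>f\<close> preserves the dimension, and the two sides come from
          independent choices; they agree because their labels and their proper faces do.\<close>
        have "res E n n f (u n y) = u n (res Y n n f y)"
        proof (rule hda1D[OF E(2) 3])
          show c: "res E n n f (u n y) \<in> cel E n"
            using ex[OF less.prems] f m by (auto simp: good_def intro: res_cel[OF E(1)])
          show "u n (res Y n n f y) \<in> cel E n" using ex[OF y'] by (auto simp: good_def)
          have "\<phi> n (res E n n f (u n y)) = \<phi> n (u n (res Y n n f y))"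
            using ex[OF y'] ex[OF less.prems] f m less.prems
            by (simp add: good_def map_res[OF \<phi>] map_res[OF v])
          then show "lab E n (res E n n f (u n y)) = lab E n (u n (res Y n n f y))"
            using c ex[OF y'] by (metis map_lab[OF \<phi>] good_def)
          fix k g assume g: "box k n g" "k < n"
          have fg: "box k n (cb k f g)" using g f m by (auto intro: box_comp)
          have "res E k n g (res E n n f (u n y)) = res E k n (cb k f g) (u n y)"
            using res_comp[OF E(1) g(1), of n f "u n y"] ex[OF less.prems] f m by (simp add: good_def)
          also have "\<dots> = u k (res Y k n (cb k f g) y)"
            using ex[OF less.prems] fg g(2) by (simp add: good_def)
          also have "\<dots> = u k (res Y k n g (res Y n n f y))"
            using res_comp[OF Y g(1), of n f y] f m less.prems by simp
          also have "\<dots> = res E k n g (u n (res Y n n f y))"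
            using ex[OF y'] g by (simp add: good_def)
          finally show "res E k n g (res E n n f (u n y)) = res E k n g (u n (res Y n n f y))" .
        qed
        then show ?thesis by (simp add: m)
      qed
      then show ?thesis using ex[OF less.prems] by (auto simp: good_def)
    qed
  qed
  have "lps_map Y E u"
  proof (rule lps_mapI)
    fix n y assume y: "y \<in> cel Y n"
    show "lab E n (u n y) = lab Y n y"
      using main[OF y] map_lab[OF \<phi>, of "u n y" n] map_lab[OF v y] by simp
  qed (use main in auto)
  then show ?thesis using main by (auto simp: u_0 u_1 intro!: exI[of _ u])
qed

text \<open>The common core of both lifting axioms, which differ only in where the lift
  \<open>uv\<close> on vertices comes from. On edges in the image of \<open>\<iota>\<close> the lift
  is forced, consistently because \<open>\<iota>\<close> is injective there; the other edges and the
  higher cells are found by filling. Agreement with \<open>u\<close> above dimension 1 then follows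
  from \<open>maps_eqI\<close>.\<close>

lemma lift_general:
  assumes A: "lps_object A" and B: "lps_object B" and X: "lps_object X" "hda1 X" and Y: "lps_object Y"
    and \<iota>: "lps_map A B \<iota>" "cofib A B \<iota>" and \<phi>: "lps_map X Y \<phi>"
    and u: "lps_map A X u" and v: "lps_map B Y v"
    and sq: "\<And>n a. a \<in> cel A n \<Longrightarrow> \<phi> n (u n a) = v n (\<iota> n a)"
    and uv: "\<And>y. y \<in> cel B 0 \<Longrightarrow> uv y \<in> cel X 0 \<and> \<phi> 0 (uv y) = v 0 y"
    and uv': "\<And>a. a \<in> cel A 0 \<Longrightarrow> uv (\<iota> 0 a) = u 0 a"
    and fill: "\<And>n y b. n \<ge> Suc 0 \<Longrightarrow> y \<in> cel B n \<Longrightarrow> shell X n b \<Longrightarrow> over Y \<phi> n b (v n y) \<Longrightarrow>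
                (\<And>f. box 0 n f \<Longrightarrow> b 0 f = uv (res B 0 n f y)) \<Longrightarrow> fills X Y \<phi> n b (v n y)"
  shows "\<exists>h. lps_map B X h \<and> (\<forall>n. \<forall>a\<in>cel A n. h n (\<iota> n a) = u n a) \<and>
    (\<forall>n. \<forall>b\<in>cel B n. \<phi> n (h n b) = v n b)"
proof -
  define good where "good y x \<longleftrightarrow> x \<in> cel X (Suc 0) \<and> \<phi> (Suc 0) x = v (Suc 0) y \<and>
    (\<forall>f. box 0 (Suc 0) f \<longrightarrow> res X 0 (Suc 0) f x = uv (res B 0 (Suc 0) f y))" for y x
  define ue where "ue y = (if y \<in> \<iota> (Suc 0) ` cel A (Suc 0)
    then u (Suc 0) (inv_into (cel A (Suc 0)) (\<iota> (Suc 0)) y) else (SOME x. good y x))" for y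
  have ue_\<iota>: "ue (\<iota> (Suc 0) a) = u (Suc 0) a" if "a \<in> cel A (Suc 0)" for a
    using that \<iota>(2) by (simp add: ue_def cofib_def)
  have good: "good y (ue y)" if y: "y \<in> cel B (Suc 0)" for y
  proof (cases "y \<in> \<iota> (Suc 0) ` cel A (Suc 0)")
    case True
    then obtain a where a: "a \<in> cel A (Suc 0)" "y = \<iota> (Suc 0) a" by auto
    then show ?thesis
      using sq[OF a(1)] map_cel[OF u a(1)] uv' res_cel[OF A] map_res[OF \<iota>(1)] map_res[OF u]
      by (simp add: good_def ue_\<iota>) metis
  next
    case False
    \<comment> \<open>A shell of dimension 1 consists of two endpoints, so only the values at
      \<open>m = 0\<close> matter.\<close>
    define b where "b m f = uv (res B 0 (Suc 0) f y)" for m :: nat and f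
    have c: "uv (res B 0 (Suc 0) f y) \<in> cel X 0" if "box 0 (Suc 0) f" for f
      using uv res_cel[OF B that y] by auto
    have "shell X (Suc 0) b"
    proof (rule shellI)
      fix l m f g assume *: "box m (Suc 0) f" "m < Suc 0" "box l m g"
      then have "m = 0" "l = 0" "g = idb 0" using box_le[OF *(3)] by (auto simp: box_00)
      then show "b l (cb l f g) = res X l m g (b m f)"
        using * c by (simp add: b_def cb_id_right res_id[OF X(1)])
    qed (use c in \<open>auto simp: b_def\<close>)
    moreover have "over Y \<phi> (Suc 0) b (v (Suc 0) y)"
      using uv res_cel[OF B _ y] map_res[OF v _ y] by (auto simp: over_def b_def)
    ultimately have "fills X Y \<phi> (Suc 0) b (v (Suc 0) y)"
      using fill[of "Suc 0" y b] y by (auto simp: b_def)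
    then have "\<exists>x. good y x" by (auto simp: fills_def good_def b_def)
    then show ?thesis using False by (simp add: ue_def someI_ex)
  qed
  obtain h where h: "lps_map B X h" "\<forall>n. \<forall>b\<in>cel B n. \<phi> n (h n b) = v n b"
    "\<forall>b\<in>cel B 0. h 0 b = uv b" "\<forall>b\<in>cel B (Suc 0). h (Suc 0) b = ue b"
    using extend_from_edges[OF B X Y \<phi> v, of uv ue] uv good fill by (auto simp: good_def)
  have "h n (\<iota> n a) = u n a" if a: "a \<in> cel A n" for n a
    by (rule maps_eqI[OF A X lps_map_comp[OF \<iota>(1) h(1)] u _ _ a])
      (use h(3,4) uv' ue_\<iota> map_cel[OF \<iota>(1)] in auto)
  then show ?thesis using h by blast
qed

text \<open>On vertices the lift is forced, since \<open>\<phi>\<close> is bijective there;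
  commutativity of the square makes it extend \<open>u\<close>.\<close>

lemma lift_cofib_tfib:
  assumes "lps_object A" and B: "lps_object B" and X: "lps_object X" "hda1 X" and "lps_object Y"
    and \<iota>: "lps_map A B \<iota>" "cofib A B \<iota>" and \<phi>: "lps_map X Y \<phi>" "tfib X Y \<phi>"
    and u: "lps_map A X u" and v: "lps_map B Y v"
    and sq: "\<And>n a. a \<in> cel A n \<Longrightarrow> \<phi> n (u n a) = v n (\<iota> n a)"
  shows "\<exists>h. lps_map B X h \<and> (\<forall>n. \<forall>a\<in>cel A n. h n (\<iota> n a) = u n a) \<and>
    (\<forall>n. \<forall>b\<in>cel B n. \<phi> n (h n b) = v n b)"
proof (rule lift_general[OF assms(1-5) \<iota> \<phi>(1) u v sq,
  where uv = "\<lambda>y. inv_into (cel X 0) (\<phi> 0) (v 0 y)"])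
  have bij: "bij_betw (\<phi> 0) (cel X 0) (cel Y 0)" using \<phi>(2) by (simp add: tfib_def)
  show "inv_into (cel X 0) (\<phi> 0) (v 0 y) \<in> cel X 0 \<and> \<phi> 0 (inv_into (cel X 0) (\<phi> 0) (v 0 y)) = v 0 y"
    if "y \<in> cel B 0" for y
    using bij map_cel[OF v that] by (auto simp: bij_betw_def inv_into_into f_inv_into_f)
  show "inv_into (cel X 0) (\<phi> 0) (v 0 (\<iota> 0 a)) = u 0 a" if "a \<in> cel A 0" for a
    using bij sq[OF that, symmetric] map_cel[OF u that] by (simp add: bij_betw_def)
qed (use \<phi>(2) map_cel[OF v] in \<open>auto simp: tfib_def\<close>)

section \<open>Parallel cells, and lifting against trivial cofibrations\<close>

lemma par_0: "lps_object X \<Longrightarrow> x \<in> cel X 0 \<Longrightarrow> y \<in> cel X 0 \<Longrightarrow> par X 0 x y \<longleftrightarrow> x = y"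
  by (auto simp: par_def box_00 res_id)

lemma par_sym: "par X n x y \<Longrightarrow> par X n y x"
  by (auto simp: par_def)

lemma par_refl [simp]: "par X n x x"
  by (auto simp: par_def)

lemma par_trans: "par X n x y \<Longrightarrow> par X n y z \<Longrightarrow> par X n x z"
  by (auto simp: par_def)

lemma par_res:
  assumes X: "lps_object X" and f: "box m n f" and x: "x \<in> cel X n" "y \<in> cel X n" and p: "par X n x y"
  shows "par X m (res X m n f x) (res X m n f y)"
  unfolding par_def
proof (intro conjI allI impI)
  show "lab X m (res X m n f x) = lab X m (res X m n f y)"
    using p by (simp add: par_def lab_res[OF X f] x)
  fix g assume g: "box 0 m g"
  have "box 0 n (cb 0 f g)" using g f by (rule box_comp)
  then have "res X 0 n (cb 0 f g) x = res X 0 n (cb 0 f g) y" using p by (simp only: par_def)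
  then show "res X 0 m g (res X m n f x) = res X 0 m g (res X m n f y)"
    by (simp only: res_comp[OF X g f x(1)] res_comp[OF X g f x(2)])
qed

lemma par_map:
  assumes \<phi>: "lps_map X Y \<phi>" and x: "x \<in> cel X n" "y \<in> cel X n" and p: "par X n x y"
  shows "par Y n (\<phi> n x) (\<phi> n y)"
  unfolding par_def
proof (intro conjI allI impI)
  show "lab Y n (\<phi> n x) = lab Y n (\<phi> n y)" using p x by (simp add: par_def map_lab[OF \<phi>])
  fix f assume f: "box 0 n f"
  have "\<phi> 0 (res X 0 n f x) = \<phi> 0 (res X 0 n f y)" using p f by (simp only: par_def)
  then show "res Y 0 n f (\<phi> n x) = res Y 0 n f (\<phi> n y)"
    by (simp only: map_res[OF \<phi> f x(1)] map_res[OF \<phi> f x(2)])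
qed

text \<open>Parallelism is tested on labels, which maps preserve, and on vertices, where the map is
  injective.\<close>

lemma par_reflect:
  assumes X: "lps_object X" and \<phi>: "lps_map X Y \<phi>" and inj: "inj_on (\<phi> 0) (cel X 0)"
    and x: "x \<in> cel X n" "y \<in> cel X n" and p: "par Y n (\<phi> n x) (\<phi> n y)"
  shows "par X n x y"
  unfolding par_def
proof (intro conjI allI impI)
  show "lab X n x = lab X n y" using p x by (simp add: par_def map_lab[OF \<phi>])
  fix f assume f: "box 0 n f"
  have "\<phi> 0 (res X 0 n f x) = \<phi> 0 (res X 0 n f y)"
    using p f by (simp only: par_def map_res[OF \<phi> f x(1)] map_res[OF \<phi> f x(2)])
  then show "res X 0 n f x = res X 0 n f y"
    using inj_onD[OF inj] res_cel[OF X f] x by blast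
qed

lemma weq_bij:
  assumes Y: "lps_object Y" and \<phi>: "lps_map X Y \<phi>" and w: "weq X Y \<phi>"
  shows "bij_betw (\<phi> 0) (cel X 0) (cel Y 0)"
proof -
  have "y \<in> \<phi> 0 ` cel X 0" if y: "y \<in> cel Y 0" for y
  proof -
    obtain x where "x \<in> cel X 0" "par Y 0 (\<phi> 0 x) y" using w y by (auto simp: weq_def)
    then show ?thesis using par_0[OF Y _ y] map_cel[OF \<phi>] by blast
  qed
  then show ?thesis using w map_cel[OF \<phi>] by (auto simp: bij_betw_def weq_def)
qed

text \<open>A cell of \<open>B\<close> is parallel to the image of some cell \<open>a\<close> of
  \<open>A\<close>; then \<open>u n a\<close> has the required label and the vertices of the shell
  to be filled, as the definition of \<open>fib\<close> demands. On vertices \<open>\<iota>\<close>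
  is bijective, so the lift there is forced.\<close>

lemma lift_weq_cofib_fib:
  assumes A: "lps_object A" and B: "lps_object B" and X: "lps_object X" "hda1 X" and "lps_object Y"
    and \<iota>: "lps_map A B \<iota>" "cofib A B \<iota>" and w: "weq A B \<iota>" and \<phi>: "lps_map X Y \<phi>" "fib X Y \<phi>"
    and u: "lps_map A X u" and v: "lps_map B Y v"
    and sq: "\<And>n a. a \<in> cel A n \<Longrightarrow> \<phi> n (u n a) = v n (\<iota> n a)"
  shows "\<exists>h. lps_map B X h \<and> (\<forall>n. \<forall>a\<in>cel A n. h n (\<iota> n a) = u n a) \<and>
    (\<forall>n. \<forall>b\<in>cel B n. \<phi> n (h n b) = v n b)"
proof -
  have bij: "bij_betw (\<iota> 0) (cel A 0) (cel B 0)" using weq_bij B \<iota>(1) w by blast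
  let ?uv = "\<lambda>y. u 0 (inv_into (cel A 0) (\<iota> 0) y)"
  have uv: "?uv (\<iota> 0 a) = u 0 a" if "a \<in> cel A 0" for a using that bij by (simp add: bij_betw_def)
  show ?thesis
  proof (rule lift_general[OF assms(1-5) \<iota> \<phi>(1) u v sq, where uv = ?uv])
    show "?uv y \<in> cel X 0 \<and> \<phi> 0 (?uv y) = v 0 y" if y: "y \<in> cel B 0" for y
    proof -
      obtain a where "a \<in> cel A 0" "y = \<iota> 0 a" using bij y by (auto simp: bij_betw_def)
      then show ?thesis using uv sq map_cel[OF u] by auto
    qed
    fix n y b
    assume n: "n \<ge> Suc 0" and y: "y \<in> cel B n" and b: "shell X n b" "over Y \<phi> n b (v n y)"
      and b0: "\<And>f. box 0 n f \<Longrightarrow> b 0 f = ?uv (res B 0 n f y)"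
    obtain a where a: "a \<in> cel A n" "par B n (\<iota> n a) y" using w y by (auto simp: weq_def)
    have "lab X n (u n a) = lab Y n (v n y)"
      using a map_lab[OF u a(1)] map_lab[OF v y] map_lab[OF \<iota>(1) a(1)] by (simp add: par_def)
    moreover have "b 0 f = res X 0 n f (u n a)" if f: "box 0 n f" for f
      using b0[OF f] a(2) f map_res[OF \<iota>(1) f a(1)] uv[OF res_cel[OF A f a(1)]] map_res[OF u f a(1)]
      by (simp add: par_def)
    ultimately show "fills X Y \<phi> n b (v n y)"
      using \<phi>(2) n map_cel[OF u a(1)] map_cel[OF v y] b unfolding fib_def by blast
  qed (use uv in auto)
qed

section \<open>Small sets\<close>

locale small_labels =
  fixes U :: "'u itself" and L :: "'l itself"
  assumes universe: "universe TYPE('u)" and small_labels: "small TYPE('u) (UNIV :: 'l set)"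
begin

lemma small_inj:
  assumes "small TYPE('u) B" "inj_on f A" "f ` A \<subseteq> B"
  shows "small TYPE('u) A"
proof -
  have "|A| \<le>o |B|" using iffD1[OF card_of_ordLeq, of A B] assms(2,3) by (metis (no_types))
  then show ?thesis using ordLeq_ordLess_trans assms(1) unfolding small_def by (metis (no_types))
qed

lemma small_subset: "small TYPE('u) A \<Longrightarrow> B \<subseteq> A \<Longrightarrow> small TYPE('u) B"
  by (rule small_inj[of A id]) auto

lemma small_image: "small TYPE('u) A \<Longrightarrow> small TYPE('u) (f ` A)"
  by (rule small_inj[of A "inv_into A f"]) (auto intro: inj_on_inv_into inv_into_into)

lemma small_code:
  assumes "small TYPE('u) (A :: 'a set)"
  shows "\<exists>e :: 'a \<Rightarrow> 'u. inj_on e A"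
proof -
  have "|A| \<le>o |UNIV :: 'u set|" using ordLess_imp_ordLeq[OF assms[unfolded small_def]] .
  then show ?thesis using iffD2[OF card_of_ordLeq, of A "UNIV :: 'u set"] by (metis (no_types))
qed

lemma small_nat: "small TYPE('u) (A :: nat set)"
  using universe small_subset[of UNIV] by (auto simp: universe_def)

lemma small_finite: "finite A \<Longrightarrow> small TYPE('u) A"
  using finite_imp_inj_to_nat_seg small_inj[OF small_nat[of UNIV]] by (metis subset_UNIV)

lemma infinite_u: "infinite (UNIV :: 'u set)"
proof
  assume "finite (UNIV :: 'u set)"
  moreover obtain e :: "nat \<Rightarrow> 'u" where "inj e" using small_code[OF small_nat[of UNIV]] by blast
  ultimately show False using finite_imageD[of e UNIV] rev_finite_subset by auto
qed

lemma small_Pow: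
  assumes "small TYPE('u) A"
  shows "small TYPE('u) (Pow A)"
proof -
  obtain e :: "_ \<Rightarrow> 'u" where e: "inj_on e A" using small_code[OF assms] by blast
  have "small TYPE('u) (Pow (e ` A))" using universe small_image[OF assms, of e]
    by (auto simp: universe_def)
  moreover have "inj_on ((`) e) (Pow A)" using inj_on_image_Pow[OF e] .
  ultimately show ?thesis by (rule small_inj) auto
qed

text \<open>The axiom on unions speaks of subsets of \<open>'u\<close> indexed by a subset of
  \<open>'u\<close>. A general family is coded into one of that kind by tagging the code of an
  element with the code of an index; a pairing on \<open>'u\<close> exists because \<open>'u\<close>
  is infinite.\<close>

lemma small_UN:
  assumes I: "small TYPE('u) I" and A: "\<And>i. i \<in> I \<Longrightarrow> small TYPE('u) (A i)"
  shows "small TYPE('u) (\<Union>i\<in>I. A i)"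
proof -
  obtain c :: "_ \<Rightarrow> 'u" where c: "inj_on c I" using small_code[OF I] by blast
  have "\<exists>e :: _ \<Rightarrow> 'u. inj_on e (A i)" if "i \<in> I" for i using small_code[OF A[OF that]] by blast
  then obtain e :: "_ \<Rightarrow> _ \<Rightarrow> 'u" where e: "\<And>i. i \<in> I \<Longrightarrow> inj_on (e i) (A i)" by metis
  have "|(UNIV :: 'u set) \<times> (UNIV :: 'u set)| \<le>o |UNIV :: 'u set|"
    using card_of_Times_same_infinite[OF infinite_u] ordIso_imp_ordLeq by blast
  then obtain p :: "'u \<times> 'u \<Rightarrow> 'u" where p: "inj p"
    using card_of_ordLeq[of "UNIV \<times> UNIV :: ('u \<times> 'u) set" "UNIV :: 'u set"] by auto
  define B where "B u = (\<lambda>x. p (u, x)) ` e (inv_into I c u) ` A (inv_into I c u)" for u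
  have "small TYPE('u) (\<Union>u\<in>c ` I. B u)"
  proof -
    have "small TYPE('u) (B u)" if "u \<in> c ` I" for u
      using that A c unfolding B_def by (intro small_image) auto
    then have B: "\<forall>u\<in>c ` I. small TYPE('u) (B u)" by (rule ballI)
    have "\<forall>(I :: 'u set) (A :: 'u \<Rightarrow> 'u set). small TYPE('u) I \<and> (\<forall>i\<in>I. small TYPE('u) (A i)) \<longrightarrow>
        small TYPE('u) (\<Union>i\<in>I. A i)"
      using universe unfolding universe_def by (elim conjE)
    then show ?thesis by (elim allE[of _ "c ` I"] allE[of _ B] mp) (rule conjI[OF small_image[OF I] B])
  qed
  define k where "k a = (SOME i. i \<in> I \<and> a \<in> A i)" for a
  have k: "k a \<in> I \<and> a \<in> A (k a)" if "a \<in> (\<Union>i\<in>I. A i)" for a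
    using that someI_ex[of "\<lambda>i. i \<in> I \<and> a \<in> A i"] unfolding k_def by blast
  let ?f = "\<lambda>a. p (c (k a), e (k a) a)"
  have "inj_on ?f (\<Union>i\<in>I. A i)"
  proof (rule inj_onI)
    fix a b assume ab: "a \<in> (\<Union>i\<in>I. A i)" "b \<in> (\<Union>i\<in>I. A i)" "?f a = ?f b"
    then have 1: "c (k a) = c (k b)" "e (k a) a = e (k b) b" using injD[OF p] by auto
    then have "k a = k b" using c k ab by (auto dest: inj_onD)
    then show "a = b" using 1 e[of "k a"] k ab inj_onD by metis
  qed
  moreover have "?f ` (\<Union>i\<in>I. A i) \<subseteq> (\<Union>u\<in>c ` I. B u)"
  proof
    fix y assume "y \<in> ?f ` (\<Union>i\<in>I. A i)"
    then obtain a where a: "a \<in> (\<Union>i\<in>I. A i)" "y = ?f a" by blast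
    have "y \<in> B (c (k a))" using a k[OF a(1)] c by (auto simp: B_def)
    then show "y \<in> (\<Union>u\<in>c ` I. B u)" using k[OF a(1)] by blast
  qed
  ultimately show ?thesis using small_inj \<open>small TYPE('u) (\<Union>u\<in>c ` I. B u)\<close> by blast
qed

lemma small_Sigma: "small TYPE('u) I \<Longrightarrow> (\<And>i. i \<in> I \<Longrightarrow> small TYPE('u) (A i)) \<Longrightarrow> small TYPE('u) (Sigma I A)"
proof -
  assume *: "small TYPE('u) I" "\<And>i. i \<in> I \<Longrightarrow> small TYPE('u) (A i)"
  have "Sigma I A = (\<Union>i\<in>I. Pair i ` A i)" by auto
  moreover have "small TYPE('u) (\<Union>i\<in>I. Pair i ` A i)"
    by (intro small_UN small_image *)
  ultimately show ?thesis by (simp only:)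
qed

text \<open>A function on \<open>I\<close> is coded by its graph, a subset of the small set
  \<open>Sigma I A\<close>.\<close>

lemma small_PiE:
  assumes "small TYPE('u) I" "\<And>i. i \<in> I \<Longrightarrow> small TYPE('u) (A i)"
  shows "small TYPE('u) (PiE I A)"
proof (rule small_inj[OF small_Pow[OF small_Sigma[OF assms]]])
  let ?g = "\<lambda>f. (\<lambda>i. (i, f i)) ` I"
  show "inj_on ?g (PiE I A)"
  proof (rule inj_onI)
    fix f g assume *: "f \<in> PiE I A" "g \<in> PiE I A" "?g f = ?g g"
    have "f i = g i" if "i \<in> I" for i
    proof -
      have "(i, f i) \<in> ?g g" unfolding *(3)[symmetric] using that by (rule imageI)
      then show ?thesis by auto
    qed
    then show "f = g" using PiE_ext[OF *(1,2)] by metis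
  qed
  show "?g ` PiE I A \<subseteq> Pow (Sigma I A)" by auto
qed

lemma small_UNIV_fun: "small TYPE('u) (UNIV :: 'a set) \<Longrightarrow> small TYPE('u) (UNIV :: 'b set) \<Longrightarrow>
  small TYPE('u) (UNIV :: ('a \<Rightarrow> 'b) set)"
  using small_PiE[of "UNIV :: 'a set" "\<lambda>_. UNIV :: 'b set"] by simp

lemma small_UNIV_set: "small TYPE('u) (UNIV :: 'a set) \<Longrightarrow> small TYPE('u) (UNIV :: 'a set set)"
  using small_Pow[of "UNIV :: 'a set"] by simp

lemma small_UNIV_prod: "small TYPE('u) (UNIV :: 'a set) \<Longrightarrow> small TYPE('u) (UNIV :: 'b set) \<Longrightarrow>
  small TYPE('u) (UNIV :: ('a \<times> 'b) set)"
  using small_Sigma[of "UNIV :: 'a set" "\<lambda>_. UNIV :: 'b set"] by simp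

text \<open>A list is coded by the function that sends a position to the singleton of its entry, and
  to the empty set beyond the length.\<close>

lemma small_UNIV_list:
  assumes "small TYPE('u) (UNIV :: 'a set)"
  shows "small TYPE('u) (UNIV :: 'a list set)"
proof (rule small_inj)
  show "small TYPE('u) (UNIV :: (nat \<Rightarrow> 'a set) set)"
    by (intro small_UNIV_fun small_UNIV_set small_nat assms)
  let ?f = "\<lambda>(xs :: 'a list) n. if n < length xs then {xs ! n} else {}"
  show "inj ?f"
  proof (rule injI)
    fix xs ys :: "'a list" assume eq: "?f xs = ?f ys"
    have 1: "n < length xs \<longleftrightarrow> n < length ys" for n
      using fun_cong[OF eq, of n] by (auto split: if_splits)
    have "length xs = length ys" using 1 by (metis less_irrefl linorder_cases)
    moreover have "xs ! n = ys ! n" if "n < length xs" for n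
      using fun_cong[OF eq, of n] that 1 by auto
    ultimately show "xs = ys" by (intro nth_equalityI) auto
  qed
qed auto

lemma small_bool: "small TYPE('u) (A :: bool set)"
  by (intro small_finite) simp

lemma small_box: "small TYPE('u) (A :: (bool list \<Rightarrow> bool list) set)"
  by (rule small_subset[OF small_UNIV_fun]) (auto intro: small_UNIV_list small_bool)

lemma emb_inj: "small TYPE('u) (UNIV :: 'a set) \<Longrightarrow> inj (emb :: 'a \<Rightarrow> 'u)"
  unfolding emb_def by (rule someI_ex[OF small_code])

lemma small_words: "small TYPE('u) {w :: 'l list. P w}"
  by (rule small_subset[OF small_UNIV_list[OF small_labels]]) auto

end

section \<open>Transport along bijections\<close>

definition lps_iso :: "('a, 'l) lps \<Rightarrow> ('b, 'l) lps \<Rightarrow> (nat \<Rightarrow> 'a \<Rightarrow> 'b) \<Rightarrow> (nat \<Rightarrow> 'b \<Rightarrow> 'a) \<Rightarrow> bool" where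
  "lps_iso X Y \<phi> \<psi> \<longleftrightarrow> lps_map X Y \<phi> \<and> lps_map Y X \<psi> \<and>
     (\<forall>n. \<forall>x\<in>cel X n. \<psi> n (\<phi> n x) = x) \<and> (\<forall>n. \<forall>y\<in>cel Y n. \<phi> n (\<psi> n y) = y)"

lemma lps_isoD:
  assumes "lps_iso X Y \<phi> \<psi>"
  shows "lps_map X Y \<phi>" "lps_map Y X \<psi>" "x \<in> cel X n \<Longrightarrow> \<psi> n (\<phi> n x) = x"
    "y \<in> cel Y n \<Longrightarrow> \<phi> n (\<psi> n y) = y"
  using assms by (auto simp: lps_iso_def)

lemma hda1_inj:
  assumes \<psi>: "lps_map Y X \<psi>" and inj: "\<And>n. inj_on (\<psi> n) (cel Y n)" and X: "hda1 X"
  shows "hda1 Y"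
  unfolding hda1_def
proof (intro allI ballI impI)
  fix n :: nat and x y
  assume n: "n \<ge> 2" and x: "x \<in> cel Y n" and y: "y \<in> cel Y n" and l: "lab Y n x = lab Y n y"
    and eq: "\<forall>m f. box m n f \<longrightarrow> m < n \<longrightarrow> res Y m n f x = res Y m n f y"
  have "\<psi> n x = \<psi> n y"
  proof (rule hda1D[OF X n])
    fix m f assume "box m n f" "m < n"
    then show "res X m n f (\<psi> n x) = res X m n f (\<psi> n y)"
      using eq x y map_res[OF \<psi>, of m n f] by metis
  qed (use x y l \<psi> in \<open>auto simp: map_cel map_lab\<close>)
  then show "x = y" using inj x y by (auto dest: inj_onD)
qed

lemma lps_iso_hda1:
  assumes "lps_iso X Y \<phi> \<psi>" "hda1 X"
  shows "hda1 Y"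
  using assms(2) lps_isoD[OF assms(1)] by (intro hda1_inj[of Y X \<psi>] inj_onI) (auto, metis)

definition transport :: "(nat \<Rightarrow> 'a \<Rightarrow> 'b) \<Rightarrow> (nat \<Rightarrow> 'b \<Rightarrow> 'a) \<Rightarrow> ('a, 'l) lps \<Rightarrow> ('b, 'l) lps" where
  "transport e d K = \<lparr>und = \<lparr>cells = (\<lambda>n. e n ` cel K n), act = (\<lambda>m n f x. e m (res K m n f (d n x)))\<rparr>,
     lab = (\<lambda>n x. lab K n (d n x))\<rparr>"

lemma transport_simps [simp]:
  "cel (transport e d K) n = e n ` cel K n"
  "res (transport e d K) m n f x = e m (res K m n f (d n x))"
  "lab (transport e d K) n x = lab K n (d n x)"
  by (auto simp: transport_def)

text \<open>Only \<open>d n (e n x) = x\<close> on cells is asked for, so \<open>inv_into\<close> of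
  a coding of the cells alone can serve as \<open>d\<close>.\<close>

lemma transport_iso:
  assumes K: "lps_object K" and d: "\<And>n x. x \<in> cel K n \<Longrightarrow> d n (e n x) = x"
  shows "lps_object (transport e d K)" "lps_iso K (transport e d K) e d"
proof -
  show "lps_object (transport e d K)"
    using K by (intro lps_objectI) (auto simp: d res_cel res_id res_comp length_lab lab_res)
  show "lps_iso K (transport e d K) e d"
    unfolding lps_iso_def by (auto intro!: lps_mapI simp: d res_cel[OF K])
qed

lemma place_transport: "place K = transport (\<lambda>_. emb) (\<lambda>_. inv emb) K"
  by (simp add: place_def transport_def)

section \<open>The categories of labelled symmetric precubical sets\<close>

text \<open>Morphisms of \<open>P_cat\<close> are extensional. Restricting to the cells lets every
  \<open>lps_map\<close> stand for a morphism and turns equality of morphisms into agreement on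
  cells.\<close>

definition mk :: "('u, 'l) lps \<Rightarrow> (nat \<Rightarrow> 'u \<Rightarrow> 'u) \<Rightarrow> ('u, 'l) lps \<Rightarrow> ('u, 'l) lmor" where
  "mk X \<phi> Y = (X, \<lambda>n. \<lambda>x\<in>cel X n. \<phi> n x, Y)"

definition ob :: "bool \<Rightarrow> ('u, 'l) lps \<Rightarrow> bool" where
  "ob b X \<longleftrightarrow> lps_object X \<and> (\<forall>n. small TYPE('u) (cel X n)) \<and> (b \<longrightarrow> hda1 X)"

text \<open>Treats \<open>P_cat\<close> and \<open>HDA\<close> simultaneously.\<close>

definition Cat :: "bool \<Rightarrow> (('u, 'l) lps, ('u, 'l) lmor) category" where
  "Cat b = full_subcategory P_cat {X. b \<longrightarrow> hda_paradigm X}"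

lemma HDA_Cat: "HDA = Cat True"
  by (simp add: HDA_def Cat_def)

lemma P_cat_Cat: "P_cat = Cat False"
  by (auto simp: Cat_def full_subcategory_def P_cat_def)

lemma ob_object: "ob b X \<Longrightarrow> lps_object X"
  by (simp add: ob_def)

lemma ob_hda1: "ob True X \<Longrightarrow> hda1 X"
  by (simp add: ob_def)

lemma ob_small: "ob b X \<Longrightarrow> small TYPE('u) (cel (X :: ('u, 'l) lps) n)"
  by (simp add: ob_def)

lemma ob_weaken: "ob b X \<Longrightarrow> ob False X"
  by (simp add: ob_def)

lemma obj_Cat [simp]: "X \<in> obj (Cat b) \<longleftrightarrow> ob b X"
  by (auto simp: Cat_def full_subcategory_def P_cat_def ob_def hda_paradigm_iff)

lemma source_mk [simp]: "source (Cat b) (mk X \<phi> Y) = X"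
  and target_mk [simp]: "target (Cat b) (mk X \<phi> Y) = Y"
  by (auto simp: Cat_def full_subcategory_def P_cat_def mk_def)

lemma idm_Cat: "idm (Cat b) X = mk X (\<lambda>n x. x) X"
  by (auto simp: Cat_def full_subcategory_def P_cat_def mk_def)

lemma cmp_mk:
  assumes "lps_map X Y \<phi>"
  shows "cmp (Cat b) (mk Y \<psi> Z) (mk X \<phi> Y) = mk X (\<lambda>n x. \<psi> n (\<phi> n x)) Z"
proof -
  have "compose (cel X n) (restrict (\<psi> n) (cel Y n)) (restrict (\<phi> n) (cel X n)) =
      restrict (\<lambda>x. \<psi> n (\<phi> n x)) (cel X n)" for n
    using map_cel[OF assms] by (auto simp: compose_def restrict_def)
  then show ?thesis by (simp add: Cat_def full_subcategory_def P_cat_def mk_def)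
qed

lemma mk_eq_iff: "mk X \<phi> Y = mk X' \<phi>' Y' \<longleftrightarrow> X = X' \<and> Y = Y' \<and> (\<forall>n. \<forall>x\<in>cel X n. \<phi> n x = \<phi>' n x)"
proof -
  have "restrict (\<phi> n) (cel X n) = restrict (\<phi>' n) (cel X n) \<longleftrightarrow> (\<forall>x\<in>cel X n. \<phi> n x = \<phi>' n x)" for n
    by (metis restrict_apply' restrict_ext)
  then show ?thesis by (auto simp: mk_def fun_eq_iff[of "\<lambda>n. restrict (\<phi> n) (cel X n)"])
qed

lemma mor_Cat_triple: "(X, \<phi>, Y) \<in> mor (Cat b) \<longleftrightarrow>
    ob b X \<and> ob b Y \<and> lps_map X Y \<phi> \<and> (\<forall>n. \<phi> n \<in> extensional (cel X n))"
  by (auto simp: Cat_def full_subcategory_def P_cat_def ob_def hda_paradigm_iff)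

lemma mor_Cat: "f \<in> mor (Cat b) \<longleftrightarrow> (\<exists>X \<phi> Y. ob b X \<and> ob b Y \<and> lps_map X Y \<phi> \<and> f = mk X \<phi> Y)"
proof
  assume f: "f \<in> mor (Cat b)"
  obtain X \<phi> Y where F: "f = (X, \<phi>, Y)" by (cases f)
  then have *: "ob b X" "ob b Y" "lps_map X Y \<phi>" "\<And>n. \<phi> n \<in> extensional (cel X n)"
    using f mor_Cat_triple[of X \<phi> Y b] by simp_all
  have "f = mk X \<phi> Y" using F *(4) by (simp add: mk_def extensional_restrict)
  then show "\<exists>X \<phi> Y. ob b X \<and> ob b Y \<and> lps_map X Y \<phi> \<and> f = mk X \<phi> Y"
    by (intro exI[of _ X] exI[of _ \<phi>] exI[of _ Y] conjI *)
next
  assume "\<exists>X \<phi> Y. ob b X \<and> ob b Y \<and> lps_map X Y \<phi> \<and> f = mk X \<phi> Y"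
  then obtain X \<phi> Y where *: "ob b X" "ob b Y" "lps_map X Y \<phi>" "f = mk X \<phi> Y"
    by (elim exE conjE)
  have "lps_map X Y (\<lambda>n. \<lambda>x\<in>cel X n. \<phi> n x)"
    by (rule lps_map_cong[OF ob_object[OF *(1)] *(3)]) simp
  then show "f \<in> mor (Cat b)"
    unfolding *(4) mk_def mor_Cat_triple using *(1,2) restrict_extensional by (intro conjI allI)
qed

lemma hom_Cat: "f \<in> hom (Cat b) X Y \<longleftrightarrow> ob b X \<and> ob b Y \<and> (\<exists>\<phi>. lps_map X Y \<phi> \<and> f = mk X \<phi> Y)"
  unfolding hom_def mor_Cat by auto

lemma mk_mor [simp]: "ob b X \<Longrightarrow> ob b Y \<Longrightarrow> lps_map X Y \<phi> \<Longrightarrow> mk X \<phi> Y \<in> mor (Cat b)"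
  by (auto simp: mor_Cat)

lemma mk_hom [simp]: "ob b X \<Longrightarrow> ob b Y \<Longrightarrow> lps_map X Y \<phi> \<Longrightarrow> mk X \<phi> Y \<in> hom (Cat b) X Y"
  by (auto simp: hom_Cat)

lemma homE:
  assumes "f \<in> hom (Cat b) X Y"
  obtains \<phi> where "f = mk X \<phi> Y" "lps_map X Y \<phi>" "ob b X" "ob b Y"
  using assms by (auto simp: hom_Cat)

lemma mk_map_iff:
  assumes "ob b X" "ob b Y"
  shows "mk X \<phi> Y \<in> mor (Cat b) \<longleftrightarrow> lps_map X Y \<phi>"
  using assms lps_map_cong[of X Y] by (auto simp: mor_Cat mk_eq_iff ob_def)

lemma idm_hom: "ob b X \<Longrightarrow> idm (Cat b) X \<in> hom (Cat b) X X"
  by (simp add: idm_Cat lps_map_id)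

lemma cmp_hom: "f \<in> hom (Cat b) X Y \<Longrightarrow> g \<in> hom (Cat b) Y Z \<Longrightarrow> cmp (Cat b) g f \<in> hom (Cat b) X Z"
  by (auto elim!: homE simp: cmp_mk lps_map_comp)

lemma cmp_idm:
  assumes "f \<in> hom (Cat b) X Y"
  shows "cmp (Cat b) f (idm (Cat b) X) = f" "cmp (Cat b) (idm (Cat b) Y) f = f"
  using assms by (auto elim!: homE simp: idm_Cat cmp_mk lps_map_id)

lemma cmp_assoc:
  assumes "f \<in> hom (Cat b) W X" "g \<in> hom (Cat b) X Y" "h \<in> hom (Cat b) Y Z"
  shows "cmp (Cat b) h (cmp (Cat b) g f) = cmp (Cat b) (cmp (Cat b) h g) f"
  using assms by (auto elim!: homE simp: cmp_mk lps_map_comp)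

lemma is_category_Cat: "is_category (Cat b)"
  unfolding is_category_def
proof (intro conjI)
  show "\<forall>f\<in>mor (Cat b). source (Cat b) f \<in> obj (Cat b) \<and> target (Cat b) f \<in> obj (Cat b)"
    by (auto simp: mor_Cat)
  show "\<forall>X\<in>obj (Cat b). idm (Cat b) X \<in> hom (Cat b) X X"
    by (simp add: idm_hom)
  show "\<forall>X Y Z f g. f \<in> hom (Cat b) X Y \<and> g \<in> hom (Cat b) Y Z \<longrightarrow> cmp (Cat b) g f \<in> hom (Cat b) X Z"
    using cmp_hom[of _ b] by blast
  show "\<forall>X Y f. f \<in> hom (Cat b) X Y \<longrightarrow>
      cmp (Cat b) f (idm (Cat b) X) = f \<and> cmp (Cat b) (idm (Cat b) Y) f = f"
    using cmp_idm[of _ b] by blast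
  show "\<forall>W X Y Z f g h. f \<in> hom (Cat b) W X \<and> g \<in> hom (Cat b) X Y \<and> h \<in> hom (Cat b) Y Z \<longrightarrow>
      cmp (Cat b) h (cmp (Cat b) g f) = cmp (Cat b) (cmp (Cat b) h g) f"
    using cmp_assoc[of _ b] by blast
qed

text \<open>The lifting property on the level of cells. The types of cells are independent of each
  other, so the generating maps can be tested where they were defined, before being moved into
  \<open>'u\<close>.\<close>

definition lifts :: "('a, 'l) lps \<Rightarrow> ('b, 'l) lps \<Rightarrow> (nat \<Rightarrow> 'a \<Rightarrow> 'b) \<Rightarrow> ('x, 'l) lps \<Rightarrow> ('y, 'l) lps \<Rightarrow>
    (nat \<Rightarrow> 'x \<Rightarrow> 'y) \<Rightarrow> bool" where
  "lifts A B \<iota> X Y \<phi> \<longleftrightarrow> (\<forall>u v. lps_map A X u \<and> lps_map B Y v \<and>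
     (\<forall>n. \<forall>a\<in>cel A n. \<phi> n (u n a) = v n (\<iota> n a)) \<longrightarrow>
     (\<exists>h. lps_map B X h \<and> (\<forall>n. \<forall>a\<in>cel A n. h n (\<iota> n a) = u n a) \<and>
        (\<forall>n. \<forall>b\<in>cel B n. \<phi> n (h n b) = v n b)))"

lemma has_lifts_mk:
  assumes "ob b A" "ob b B" "ob b X" "ob b Y" "lps_map A B \<iota>" "lps_map X Y \<phi>"
  shows "has_lifts (Cat b) (mk A \<iota> B) (mk X \<phi> Y) \<longleftrightarrow> lifts A B \<iota> X Y \<phi>"
proof
  assume l: "has_lifts (Cat b) (mk A \<iota> B) (mk X \<phi> Y)"
  show "lifts A B \<iota> X Y \<phi>" unfolding lifts_def
  proof (intro allI impI; elim conjE)
    fix u v assume *: "lps_map A X u" "lps_map B Y v" "\<forall>n. \<forall>a\<in>cel A n. \<phi> n (u n a) = v n (\<iota> n a)"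
    then have "\<exists>h\<in>hom (Cat b) B X. cmp (Cat b) h (mk A \<iota> B) = mk A u X \<and>
        cmp (Cat b) (mk X \<phi> Y) h = mk B v Y"
      using l[unfolded has_lifts_def, rule_format, of "mk A u X" "mk B v Y"] assms
      by (simp add: cmp_mk mk_eq_iff)
    then show "\<exists>h. lps_map B X h \<and> (\<forall>n. \<forall>a\<in>cel A n. h n (\<iota> n a) = u n a) \<and>
        (\<forall>n. \<forall>b\<in>cel B n. \<phi> n (h n b) = v n b)"
      using assms by (auto elim!: homE simp: cmp_mk mk_eq_iff)
  qed
next
  assume l: "lifts A B \<iota> X Y \<phi>"
  show "has_lifts (Cat b) (mk A \<iota> B) (mk X \<phi> Y)" unfolding has_lifts_def
  proof (intro allI impI; elim conjE)
    fix u v assume *: "u \<in> hom (Cat b) (source (Cat b) (mk A \<iota> B)) (source (Cat b) (mk X \<phi> Y))"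
      "v \<in> hom (Cat b) (target (Cat b) (mk A \<iota> B)) (target (Cat b) (mk X \<phi> Y))"
      "cmp (Cat b) (mk X \<phi> Y) u = cmp (Cat b) v (mk A \<iota> B)"
    obtain u' v' where uv: "u = mk A u' X" "v = mk B v' Y" "lps_map A X u'" "lps_map B Y v'"
      using *(1,2) by (auto elim!: homE)
    then have "\<forall>n. \<forall>a\<in>cel A n. \<phi> n (u' n a) = v' n (\<iota> n a)"
      using *(3) assms by (simp add: cmp_mk mk_eq_iff)
    then obtain h where "lps_map B X h" "\<forall>n. \<forall>a\<in>cel A n. h n (\<iota> n a) = u' n a"
        "\<forall>n. \<forall>b\<in>cel B n. \<phi> n (h n b) = v' n b"
      using l uv unfolding lifts_def by blast
    then show "\<exists>h\<in>hom (Cat b) (target (Cat b) (mk A \<iota> B)) (source (Cat b) (mk X \<phi> Y)).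
        cmp (Cat b) h (mk A \<iota> B) = u \<and> cmp (Cat b) (mk X \<phi> Y) h = v"
      using assms uv by (intro bexI[of _ "mk B h X"]) (simp_all add: cmp_mk mk_eq_iff)
  qed
qed

lemma lifts_iso:
  assumes A: "lps_iso A A' e d" and B: "lps_iso B B' e' d'" and \<iota>: "lps_map A B \<iota>"
  shows "lifts A' B' (\<lambda>n x. e' n (\<iota> n (d n x))) X Y \<phi> \<longleftrightarrow> lifts A B \<iota> X Y \<phi>"
proof
  assume l: "lifts A' B' (\<lambda>n x. e' n (\<iota> n (d n x))) X Y \<phi>"
  show "lifts A B \<iota> X Y \<phi>" unfolding lifts_def
  proof (intro allI impI; elim conjE)
    fix u v assume *: "lps_map A X u" "lps_map B Y v" "\<forall>n. \<forall>a\<in>cel A n. \<phi> n (u n a) = v n (\<iota> n a)"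
    have "\<forall>n. \<forall>a\<in>cel A' n. \<phi> n (u n (d n a)) = v n (d' n (e' n (\<iota> n (d n a))))"
      using * map_cel[OF lps_isoD(2)[OF A]] map_cel[OF \<iota>] lps_isoD(3)[OF B] by simp
    then obtain h where h: "lps_map B' X h"
        "\<forall>n. \<forall>a\<in>cel A' n. h n (e' n (\<iota> n (d n a))) = u n (d n a)"
        "\<forall>n. \<forall>b\<in>cel B' n. \<phi> n (h n b) = v n (d' n b)"
      using l[unfolded lifts_def, rule_format, of "\<lambda>n x. u n (d n x)" "\<lambda>n x. v n (d' n x)"]
        lps_map_comp[OF lps_isoD(2)[OF A] *(1)] lps_map_comp[OF lps_isoD(2)[OF B] *(2)] by blast
    have "h n (e' n (\<iota> n a)) = u n a" if "a \<in> cel A n" for n a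
      using h(2)[rule_format, of "e n a" n] map_cel[OF lps_isoD(1)[OF A] that] lps_isoD(3)[OF A that]
      by simp
    moreover have "\<phi> n (h n (e' n b)) = v n b" if "b \<in> cel B n" for n b
      using h(3)[rule_format, of "e' n b" n] map_cel[OF lps_isoD(1)[OF B] that] lps_isoD(3)[OF B that]
      by simp
    ultimately show "\<exists>h. lps_map B X h \<and> (\<forall>n. \<forall>a\<in>cel A n. h n (\<iota> n a) = u n a) \<and>
        (\<forall>n. \<forall>b\<in>cel B n. \<phi> n (h n b) = v n b)"
      using lps_map_comp[OF lps_isoD(1)[OF B] h(1)] by (intro exI[of _ "\<lambda>n x. h n (e' n x)"]) simp
  qed
next
  assume l: "lifts A B \<iota> X Y \<phi>"
  show "lifts A' B' (\<lambda>n x. e' n (\<iota> n (d n x))) X Y \<phi>" unfolding lifts_def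
  proof (intro allI impI; elim conjE)
    fix u v assume *: "lps_map A' X u" "lps_map B' Y v"
      "\<forall>n. \<forall>a\<in>cel A' n. \<phi> n (u n a) = v n (e' n (\<iota> n (d n a)))"
    have "\<forall>n. \<forall>a\<in>cel A n. \<phi> n (u n (e n a)) = v n (e' n (\<iota> n a))"
      using * map_cel[OF lps_isoD(1)[OF A]] lps_isoD(3)[OF A] by simp
    then obtain h where h: "lps_map B X h"
        "\<forall>n. \<forall>a\<in>cel A n. h n (\<iota> n a) = u n (e n a)"
        "\<forall>n. \<forall>b\<in>cel B n. \<phi> n (h n b) = v n (e' n b)"
      using l[unfolded lifts_def, rule_format, of "\<lambda>n x. u n (e n x)" "\<lambda>n x. v n (e' n x)"]
        lps_map_comp[OF lps_isoD(1)[OF A] *(1)] lps_map_comp[OF lps_isoD(1)[OF B] *(2)] by blast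
    have "h n (d' n (e' n (\<iota> n (d n a)))) = u n a" if "a \<in> cel A' n" for n a
      using h(2) map_cel[OF lps_isoD(2)[OF A] that] lps_isoD(4)[OF A that] lps_isoD(3)[OF B]
        map_cel[OF \<iota>] by simp
    moreover have "\<phi> n (h n (d' n b)) = v n b" if "b \<in> cel B' n" for n b
      using h(3) map_cel[OF lps_isoD(2)[OF B] that] lps_isoD(4)[OF B that] by simp
    ultimately show "\<exists>h. lps_map B' X h \<and>
        (\<forall>n. \<forall>a\<in>cel A' n. h n (e' n (\<iota> n (d n a))) = u n a) \<and>
        (\<forall>n. \<forall>b\<in>cel B' n. \<phi> n (h n b) = v n b)"
      using lps_map_comp[OF lps_isoD(2)[OF B] h(1)] by (intro exI[of _ "\<lambda>n x. h n (d' n x)"]) simp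
  qed
qed

lemma place_map_mk:
  "place_map A B \<iota> = mk (place A) (\<lambda>n x. emb (\<iota> n (inv emb x))) (place B)"
  by (simp add: place_map_def mk_def place_def)

context small_labels
begin

lemma place_iso:
  assumes "small TYPE('u) (UNIV :: 'a set)" "lps_object (K :: ('a, 'l) lps)"
  shows "lps_iso K (place K :: ('u, 'l) lps) (\<lambda>_. emb) (\<lambda>_. inv emb)"
  unfolding place_transport using assms emb_inj[OF assms(1)] by (intro transport_iso) auto

lemma ob_place:
  assumes "small TYPE('u) (UNIV :: 'a set)" "lps_object (K :: ('a, 'l) lps)" "b \<longrightarrow> hda1 K"
  shows "ob b (place K :: ('u, 'l) lps)"
proof -
  have "lps_object (place K :: ('u, 'l) lps)"
    unfolding place_transport using assms emb_inj[OF assms(1)] by (intro transport_iso) auto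
  moreover have "small TYPE('u) (cel (place K :: ('u, 'l) lps) n)" for n
    unfolding place_transport using small_subset[OF assms(1)] by (auto intro: small_image)
  ultimately show ?thesis using lps_iso_hda1[OF place_iso[OF assms(1,2)]] assms(3)
    by (auto simp: ob_def)
qed

lemma place_map_hom:
  assumes "small TYPE('u) (UNIV :: 'a set)" "small TYPE('u) (UNIV :: 'b set)"
    and "lps_object (A :: ('a, 'l) lps)" "lps_object (B :: ('b, 'l) lps)" "b \<longrightarrow> hda1 A \<and> hda1 B"
    and "lps_map A B \<iota>"
  shows "(place_map A B \<iota> :: ('u, 'l) lmor) \<in> hom (Cat b) (place A) (place B)"
proof -
  have "lps_map (place A :: ('u, 'l) lps) (place B :: ('u, 'l) lps) (\<lambda>n x. emb (\<iota> n (inv emb x)))"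
    by (rule lps_map_comp[OF lps_map_comp[OF lps_isoD(2)[OF place_iso[OF assms(1,3)]] assms(6)]
          lps_isoD(1)[OF place_iso[OF assms(2,4)]]])
  then show ?thesis unfolding place_map_mk using assms by (simp add: ob_place)
qed

lemma has_lifts_place:
  assumes "small TYPE('u) (UNIV :: 'a set)" "small TYPE('u) (UNIV :: 'b set)"
    and "lps_object (A :: ('a, 'l) lps)" "lps_object (B :: ('b, 'l) lps)" "b \<longrightarrow> hda1 A \<and> hda1 B"
    and "lps_map A B \<iota>" and "ob b X" "ob b Y" "lps_map X Y \<phi>"
  shows "has_lifts (Cat b) (place_map A B \<iota>) (mk X \<phi> Y :: ('u, 'l) lmor) \<longleftrightarrow> lifts A B \<iota> X Y \<phi>"
proof -
  have "lps_map (place A :: ('u, 'l) lps) (place B :: ('u, 'l) lps) (\<lambda>n x. emb (\<iota> n (inv emb x)))"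
    by (rule lps_map_comp[OF lps_map_comp[OF lps_isoD(2)[OF place_iso[OF assms(1,3)]] assms(6)]
          lps_isoD(1)[OF place_iso[OF assms(2,4)]]])
  then have "has_lifts (Cat b) (place_map A B \<iota>) (mk X \<phi> Y) \<longleftrightarrow>
      lifts (place A :: ('u, 'l) lps) (place B :: ('u, 'l) lps) (\<lambda>n x. emb (\<iota> n (inv emb x))) X Y \<phi>"
    unfolding place_map_mk using assms by (intro has_lifts_mk) (simp_all add: ob_place)
  then show ?thesis using lifts_iso[OF place_iso[OF assms(1,3)] place_iso[OF assms(2,4)] assms(6)]
    by metis
qed

text \<open>Each set of cells is coded separately, whereas \<open>place\<close> needs the whole type
  of cells to be small. The middle objects, quotients and limits built below have small sets of
  cells in types that are not small.\<close>

lemma representative: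
  assumes K: "lps_object (K :: ('a, 'l) lps)" "b \<longrightarrow> hda1 K" and sm: "\<And>n. small TYPE('u) (cel K n)"
  shows "\<exists>(K' :: ('u, 'l) lps) e d. ob b K' \<and> lps_iso K K' e d"
proof -
  have "\<exists>e :: 'a \<Rightarrow> 'u. inj_on e (cel K n)" for n using small_code[OF sm] .
  then obtain e :: "nat \<Rightarrow> 'a \<Rightarrow> 'u" where e: "\<And>n. inj_on (e n) (cel K n)" by metis
  let ?d = "\<lambda>n. inv_into (cel K n) (e n)"
  have iso: "lps_object (transport e ?d K)" "lps_iso K (transport e ?d K) e ?d"
    using transport_iso[OF K(1), of ?d e] e by simp_all
  moreover have "ob b (transport e ?d K)"
    using iso sm K(2) lps_iso_hda1[OF iso(2)] by (auto simp: ob_def small_image)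
  ultimately show ?thesis by blast
qed

end

section \<open>Generating cofibrations\<close>

lemma liftsD:
  assumes "lifts A B \<iota> X Y \<phi>" "lps_map A X u" "lps_map B Y v"
    and "\<And>n a. a \<in> cel A n \<Longrightarrow> \<phi> n (u n a) = v n (\<iota> n a)"
  shows "\<exists>h. lps_map B X h \<and> (\<forall>n. \<forall>a\<in>cel A n. h n (\<iota> n a) = u n a) \<and>
    (\<forall>n. \<forall>b\<in>cel B n. \<phi> n (h n b) = v n b)"
  using assms unfolding lifts_def by blast

lemma ldiscrete_simps [simp]:
  "a \<in> cel (ldiscrete A) n \<longleftrightarrow> n = 0 \<and> a \<in> A" "res (ldiscrete A) m n f x = x"
  "lab (ldiscrete A) n x = []"
  by (auto simp: ldiscrete_def discrete_def)

lemma box_0_right: "box m 0 f \<longleftrightarrow> m = 0 \<and> f = idb 0"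
  using box_le[of m 0 f] box_00 by auto

lemma lps_object_ldiscrete: "lps_object (ldiscrete A)"
  by (rule lps_objectI) (auto simp: box_0_right word_act_def split: if_splits)

lemma hda1_ldiscrete: "hda1 (ldiscrete A)"
  by (auto simp: hda1_def)

lemma lps_map_ldiscrete:
  assumes X: "lps_object X" and g: "\<And>a. a \<in> A \<Longrightarrow> g a \<in> cel X 0"
  shows "lps_map (ldiscrete A) X (\<lambda>n. g)"
  using length_lab[OF X g] by (intro lps_mapI) (auto simp: box_0_right g res_id[OF X] split: if_splits)

lemma lps_map_boundary_cube: "lps_map (lboundary as) (lcube as) (\<lambda>n x. x)"
  by (rule lps_mapI) auto

text \<open>Lifting against \<open>R\<close> forces two vertices with the same image to be equal,
  lifting against \<open>C\<close> supplies preimages of vertices, and lifting against the boundary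
  of a cube fills shells by the Yoneda lemma.\<close>

lemma tfib_lifts:
  fixes X :: "('a, 'b) lps"
  assumes X: "lps_object X" and Y: "lps_object Y" and \<phi>: "lps_map X Y \<phi>"
    and cub: "\<And>as. length as \<ge> 1 \<Longrightarrow> lifts (lboundary as) (lcube as) (\<lambda>n x. x) X Y \<phi>"
    and C: "lifts (ldiscrete ({} :: nat set)) (ldiscrete {0 :: nat}) (\<lambda>n x. x) X Y \<phi>"
    and R: "lifts (ldiscrete {0, 1 :: nat}) (ldiscrete {0 :: nat}) (\<lambda>n x. 0) X Y \<phi>"
  shows "tfib X Y \<phi>"
  unfolding tfib_def
proof (intro conjI allI impI ballI)
  have "x = x'" if x: "x \<in> cel X 0" "x' \<in> cel X 0" "\<phi> 0 x = \<phi> 0 x'" for x x'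
  proof -
    let ?u = "\<lambda>k :: nat. if k = 0 then x else x'"
    have u: "lps_map (ldiscrete {0, 1 :: nat}) X (\<lambda>n. ?u)"
      by (rule lps_map_ldiscrete[OF X]) (use x in auto)
    have v: "lps_map (ldiscrete {0 :: nat}) Y (\<lambda>n _. \<phi> 0 x)"
      by (rule lps_map_ldiscrete[OF Y]) (use map_cel[OF \<phi> x(1)] in auto)
    have sq: "\<phi> n (?u a) = \<phi> 0 x" if "a \<in> cel (ldiscrete {0, 1 :: nat} :: (nat, 'b) lps) n" for n a
      using that x(3) by auto
    have "\<exists>h. lps_map (ldiscrete {0 :: nat}) X h \<and>
        (\<forall>n. \<forall>a\<in>cel (ldiscrete {0, 1 :: nat} :: (nat, 'b) lps) n. h n (0 :: nat) = ?u a) \<and>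
        (\<forall>n. \<forall>b\<in>cel (ldiscrete {0 :: nat} :: (nat, 'b) lps) n. \<phi> n (h n b) = \<phi> 0 x)"
      by (rule liftsD[OF R u v]) (rule sq)
    then obtain h where h: "\<forall>n. \<forall>a\<in>cel (ldiscrete {0, 1 :: nat} :: (nat, 'b) lps) n.
      h n (0 :: nat) = ?u a"
      by blast
    have "h 0 0 = x" "h 0 0 = x'"
      using bspec[OF spec[OF h, of 0], of 0] bspec[OF spec[OF h, of 0], of 1] by simp_all
    then show ?thesis by simp
  qed
  moreover have "\<exists>x\<in>cel X 0. \<phi> 0 x = y" if y: "y \<in> cel Y 0" for y
  proof -
    have u: "lps_map (ldiscrete ({} :: nat set)) X (\<lambda>n _. undefined)"
      by (rule lps_map_ldiscrete[OF X]) auto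
    have v: "lps_map (ldiscrete {0 :: nat}) Y (\<lambda>n _. y)"
      by (rule lps_map_ldiscrete[OF Y]) (use y in auto)
    obtain h where h: "lps_map (ldiscrete {0 :: nat}) X h"
        "\<forall>n. \<forall>b\<in>cel (ldiscrete {0 :: nat} :: (nat, 'b) lps) n. \<phi> n (h n b) = y"
      using liftsD[OF C u v] by auto
    then show ?thesis using map_cel[OF h(1), of 0 0] by (intro bexI[of _ "h 0 0"]) auto
  qed
  ultimately show "bij_betw (\<phi> 0) (cel X 0) (cel Y 0)"
    using map_cel[OF \<phi>] by (auto simp: bij_betw_def inj_on_def image_iff) metis
next
  fix n b y assume n: "Suc 0 \<le> n" and y: "y \<in> cel Y n" and b: "shell X n b \<and> over Y \<phi> n b y"
  \<comment> \<open>The letters of the cube are read off from \<open>y\<close>; a shell over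
    \<open>y\<close> then carries the labels of the labelled boundary.\<close>
  let ?as = "lab Y n y"
  have len: "length ?as = n" by (rule length_lab[OF Y y])
  have "lab X m (b m f) = word_act m n f ?as" if f: "box m n f" "m < n" for m f
    using b f map_lab[OF \<phi> shell_cel[of X n b m f]] lab_res[OF Y f(1) y] by (simp add: over_def)
  then have "lps_map (lboundary ?as) X b" using b by (simp add: lps_map_lboundary_iff len)
  moreover have "lps_map (lcube ?as) Y (\<lambda>m f. res Y m n f y)" by (rule yoneda[OF Y y refl])
  moreover have "\<forall>m. \<forall>f\<in>cel (lboundary ?as) m. \<phi> m (b m f) = res Y m n f y"
    using b by (auto simp: over_def len)
  ultimately obtain h where h: "lps_map (lcube ?as) X h"
      "\<forall>m. \<forall>f\<in>cel (lboundary ?as) m. h m f = b m f"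
      "\<forall>m. \<forall>f\<in>cel (lcube ?as) m. \<phi> m (h m f) = res Y m n f y"
    using liftsD[OF cub[of ?as], of b "\<lambda>m f. res Y m n f y"] n len by auto
  have i: "idb n \<in> cel (lcube ?as) n" by (simp add: len box_id)
  have "res X m n f (h n (idb n)) = b m f" if "box m n f" "m < n" for m f
    using yoneda_inverse[OF h(1), of m f] h(2) that by (simp add: len)
  then show "fills X Y \<phi> n b y"
    unfolding fills_def using h(3) i map_cel[OF h(1) i] res_id[OF Y y]
    by (intro bexI[of _ "h n (idb n)"]) auto
qed

lemma lifts_tfib:
  assumes "lps_object A" "lps_object B" "lps_object X" "hda1 X" "lps_object Y"
    and "lps_map A B \<iota>" "cofib A B \<iota>" "lps_map X Y \<phi>" "tfib X Y \<phi>"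
  shows "lifts A B \<iota> X Y \<phi>"
  unfolding lifts_def using lift_cofib_tfib[OF assms] by metis

context small_labels
begin

lemma place_map_cofib:
  assumes K: "small TYPE('u) (UNIV :: 'a set)" "lps_object (K :: ('a, 'l) lps)" "hda1 K"
    and M: "small TYPE('u) (UNIV :: 'b set)" "lps_object (M :: ('b, 'l) lps)" "hda1 M"
    and \<iota>: "lps_map K M \<iota>" "cofib K M \<iota>"
  shows "\<exists>A \<iota>' B. place_map K M \<iota> = (mk A \<iota>' B :: ('u, 'l) lmor) \<and> ob True A \<and> ob True B \<and>
      lps_map A B \<iota>' \<and> cofib A B \<iota>'"
proof -
  let ?\<iota> = "\<lambda>n x. emb (\<iota> n (inv emb x)) :: 'u"
  have obs: "ob True (place K :: ('u, 'l) lps)" "ob True (place M :: ('u, 'l) lps)"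
    using ob_place[OF K(1,2)] ob_place[OF M(1,2)] K(3) M(3) by blast+
  have "place_map K M \<iota> \<in> hom (Cat True) (place K :: ('u, 'l) lps) (place M :: ('u, 'l) lps)"
    using place_map_hom[OF K(1) M(1) K(2) M(2)] K(3) M(3) \<iota>(1) by blast
  then have "mk (place K) ?\<iota> (place M) \<in> mor (Cat True)" unfolding place_map_mk hom_def by blast
  then have "lps_map (place K :: ('u, 'l) lps) (place M :: ('u, 'l) lps) ?\<iota>"
    using mk_map_iff[OF obs] by blast
  moreover have "cofib (place K :: ('u, 'l) lps) (place M :: ('u, 'l) lps) ?\<iota>"
    using \<iota>(2) by (auto simp: cofib_def inj_on_def place_transport inv_f_f[OF emb_inj[OF K(1)]]
        inj_eq[OF emb_inj[OF M(1)]])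
  ultimately show ?thesis
    unfolding place_map_mk using obs by blast
qed

text \<open>The maps \<open>C\<close> and \<open>R\<close> involve no edges, so they satisfy
  \<open>cofib\<close> although \<open>R\<close> is not injective.\<close>

lemma gen_cofs_HDA:
  assumes "i \<in> gen_cofs"
  shows "\<exists>A \<iota> B. i = (mk A \<iota> B :: ('u, 'l) lmor) \<and> ob True A \<and> ob True B \<and> lps_map A B \<iota> \<and> cofib A B \<iota>"
proof -
  have c: "small TYPE('u) (UNIV :: (bool list \<Rightarrow> bool list) set)" by (rule small_box)
  have d: "small TYPE('u) (UNIV :: nat set)" by (rule small_nat)
  consider as where "i = place_map (lboundary as) (lcube as) (\<lambda>n x. x)"
    | "i = place_map (ldiscrete ({} :: nat set)) (ldiscrete {0 :: nat}) (\<lambda>n x. x)"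
    | "i = place_map (ldiscrete {0, 1 :: nat}) (ldiscrete {0 :: nat}) (\<lambda>n x. 0)"
    using assms unfolding gen_cofs_def by blast
  then show ?thesis
  proof cases
    case 1
    show ?thesis unfolding 1
      by (rule place_map_cofib[OF c lps_object_lboundary hda1_lboundary c lps_object_lcube hda1_lcube
            lps_map_boundary_cube]) (simp add: cofib_def)
  next
    case 2
    show ?thesis unfolding 2
      by (rule place_map_cofib[OF d lps_object_ldiscrete hda1_ldiscrete d lps_object_ldiscrete hda1_ldiscrete])
        (auto simp: cofib_def intro!: lps_mapI)
  next
    case 3
    show ?thesis unfolding 3
      by (rule place_map_cofib[OF d lps_object_ldiscrete hda1_ldiscrete d lps_object_ldiscrete hda1_ldiscrete])
        (auto simp: cofib_def inj_on_def intro!: lps_mapI)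
  qed
qed

lemma rlp_gen_cofs:
  assumes X: "ob True (X :: ('u, 'l) lps)" and Y: "ob True Y" and \<phi>: "lps_map X Y \<phi>"
  shows "mk X \<phi> Y \<in> rlp HDA gen_cofs \<longleftrightarrow> tfib X Y \<phi>"
proof
  assume t: "tfib X Y \<phi>"
  have "has_lifts (Cat True) i (mk X \<phi> Y)" if g: "i \<in> gen_cofs" for i
  proof -
    obtain A \<iota> B where i: "i = mk A \<iota> B" "ob True A" "ob True B" "lps_map A B \<iota>" "cofib A B \<iota>"
      using gen_cofs_HDA[OF g] by blast
    show ?thesis unfolding i(1) has_lifts_mk[OF i(2,3) X Y i(4) \<phi>]
      by (rule lifts_tfib) (use i X Y \<phi> t in \<open>simp_all add: ob_def\<close>)
  qed
  then show "mk X \<phi> Y \<in> rlp HDA gen_cofs" using assms by (simp add: rlp_def HDA_Cat)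
next
  assume r: "mk X \<phi> Y \<in> rlp HDA gen_cofs"
  have c: "small TYPE('u) (UNIV :: (bool list \<Rightarrow> bool list) set)" by (rule small_box)
  have d: "small TYPE('u) (UNIV :: nat set)" by (rule small_nat)
  show "tfib X Y \<phi>"
  proof (rule tfib_lifts[OF ob_object[OF X] ob_object[OF Y] \<phi>])
    fix as :: "'l list" assume "1 \<le> length as"
    then have "(place_map (lboundary as) (lcube as) (\<lambda>n x. x) :: ('u, 'l) lmor) \<in> gen_cofs"
      by (auto simp: gen_cofs_def)
    then have "has_lifts (Cat True) (place_map (lboundary as) (lcube as) (\<lambda>n x. x)) (mk X \<phi> Y)"
      using r by (auto simp: rlp_def HDA_Cat)
    then show "lifts (lboundary as) (lcube as) (\<lambda>n x. x) X Y \<phi>"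
      using has_lifts_place[OF c c lps_object_lboundary lps_object_lcube _ lps_map_boundary_cube X Y \<phi>]
        hda1_lboundary hda1_lcube by blast
  next
    have "has_lifts (Cat True) (place_map (ldiscrete ({} :: nat set)) (ldiscrete {0 :: nat}) (\<lambda>n x. x))
        (mk X \<phi> Y)" using r by (auto simp: rlp_def HDA_Cat gen_cofs_def)
    moreover have "lps_map (ldiscrete ({} :: nat set)) (ldiscrete {0 :: nat} :: (nat, 'l) lps) (\<lambda>n x. x)"
      by (rule lps_mapI) auto
    ultimately show "lifts (ldiscrete ({} :: nat set)) (ldiscrete {0 :: nat}) (\<lambda>n x. x) X Y \<phi>"
      using has_lifts_place[OF d d lps_object_ldiscrete lps_object_ldiscrete _ _ X Y \<phi>]
        hda1_ldiscrete by blast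
  next
    have "has_lifts (Cat True) (place_map (ldiscrete {0, 1 :: nat}) (ldiscrete {0 :: nat}) (\<lambda>n x. 0))
        (mk X \<phi> Y)" using r by (auto simp: rlp_def HDA_Cat gen_cofs_def)
    moreover have "lps_map (ldiscrete {0, 1 :: nat}) (ldiscrete {0 :: nat} :: (nat, 'l) lps) (\<lambda>n x. 0)"
      by (rule lps_mapI) auto
    ultimately show "lifts (ldiscrete {0, 1 :: nat}) (ldiscrete {0 :: nat}) (\<lambda>n x. 0) X Y \<phi>"
      using has_lifts_place[OF d d lps_object_ldiscrete lps_object_ldiscrete _ _ X Y \<phi>]
        hda1_ldiscrete by blast
  qed
qed

end

section \<open>Generating trivial cofibrations\<close>

text \<open>
  Two copies of a labelled cube glued along their vertices, and the subobject that lacks the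
  top cell of the second copy.  The cells of the second copy are marked by \<open>True\<close>.
\<close>

definition dcube :: "'l list \<Rightarrow> (bool \<times> (bool list \<Rightarrow> bool list), 'l) lps" where
  "dcube as = \<lparr>und = \<lparr>cells = (\<lambda>m. {(k, f). box m (length as) f \<and> (k \<longrightarrow> m \<noteq> 0)}),
     act = (\<lambda>l m g (k, f). (k \<and> l \<noteq> 0, cb l f g))\<rparr>,
     lab = (\<lambda>m (k, f). word_act m (length as) f as)\<rparr>"

definition dhorn :: "'l list \<Rightarrow> (bool \<times> (bool list \<Rightarrow> bool list), 'l) lps" where
  "dhorn as = (dcube as)\<lparr>und := (und (dcube as))\<lparr>cells := (\<lambda>m. {(k, f). box m (length as) f \<and>
     (k \<longrightarrow> m \<noteq> 0 \<and> m < length as)})\<rparr>\<rparr>"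

definition gen_tcofs :: "('u, 'l) lmor set" where
  "gen_tcofs = {place_map (dhorn as) (dcube as) (\<lambda>n x. x) | as. length as \<ge> 1}"

lemma dcube_simps [simp]:
  "(k, f) \<in> cel (dcube as) m \<longleftrightarrow> box m (length as) f \<and> (k \<longrightarrow> m \<noteq> 0)"
  "res (dcube as) l m g (k, f) = (k \<and> l \<noteq> 0, cb l f g)"
  "lab (dcube as) m (k, f) = word_act m (length as) f as"
  by (auto simp: dcube_def)

lemma dhorn_simps [simp]:
  "(k, f) \<in> cel (dhorn as) m \<longleftrightarrow> box m (length as) f \<and> (k \<longrightarrow> m \<noteq> 0 \<and> m < length as)"
  "res (dhorn as) l m g (k, f) = (k \<and> l \<noteq> 0, cb l f g)"
  "lab (dhorn as) m (k, f) = word_act m (length as) f as"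
  by (auto simp: dhorn_def dcube_def)

lemma length_word_act [simp]: "length (word_act m n f w) = m"
  by (simp add: word_act_def)

lemma lps_object_dcube: "lps_object (dcube as)"
proof (rule lps_objectI)
  fix m n f x assume "box m n f" "x \<in> cel (dcube as) n"
  then show "res (dcube as) m n f x \<in> cel (dcube as) m" "lab (dcube as) m (res (dcube as) m n f x) =
      word_act m n f (lab (dcube as) n x)"
    by (cases x; auto intro: box_comp simp: word_act_compose)+
next
  fix n x assume "x \<in> cel (dcube as) n"
  then show "res (dcube as) n n (idb n) x = x" "length (lab (dcube as) n x) = n"
    by (cases x; auto simp: cb_id_right)+
next
  fix l m n f g x assume *: "box l m f" "box m n g" "x \<in> cel (dcube as) n"
  then show "res (dcube as) l n (cb l g f) x = res (dcube as) l m f (res (dcube as) m n g x)"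
    using box_le[OF *(1)] by (cases x) (auto simp: cb_assoc)
qed

lemma lps_object_dhorn: "lps_object (dhorn as)"
proof (rule lps_objectI)
  fix m n f x assume *: "box m n f" "x \<in> cel (dhorn as) n"
  then show "res (dhorn as) m n f x \<in> cel (dhorn as) m" "lab (dhorn as) m (res (dhorn as) m n f x) =
      word_act m n f (lab (dhorn as) n x)"
    using box_le[OF *(1)] by (cases x; auto intro: box_comp simp: word_act_compose)+
next
  fix n x assume "x \<in> cel (dhorn as) n"
  then show "res (dhorn as) n n (idb n) x = x" "length (lab (dhorn as) n x) = n"
    by (cases x; auto simp: cb_id_right)+
next
  fix l m n f g x assume *: "box l m f" "box m n g" "x \<in> cel (dhorn as) n"
  then show "res (dhorn as) l n (cb l g f) x = res (dhorn as) l m f (res (dhorn as) m n g x)"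
    using box_le[OF *(1)] by (cases x) (auto simp: cb_assoc)
qed

lemma lps_map_dhorn: "lps_map (dhorn as) (dcube as) (\<lambda>n x. x)"
proof (rule lps_mapI)
  fix m n f x assume "x \<in> cel (dhorn as) n"
  then show "x \<in> cel (dcube as) n" "res (dhorn as) m n f x = res (dcube as) m n f x"
    "lab (dcube as) n x = lab (dhorn as) n x"
    by (cases x; auto)+
qed

lemma hda1_dcube: "hda1 (dcube as)"
  unfolding hda1_def
proof (intro allI ballI impI)
  fix n :: nat and x y
  assume n: "n \<ge> 2" and x: "x \<in> cel (dcube as) n" and y: "y \<in> cel (dcube as) n"
    and l: "lab (dcube as) n x = lab (dcube as) n y"
    and eq: "\<forall>m h. box m n h \<longrightarrow> m < n \<longrightarrow> res (dcube as) m n h x = res (dcube as) m n h y"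
  obtain k f k' f' where xy: "x = (k, f)" "y = (k', f')" by (cases x, cases y)
  \<comment> \<open>The marks are compared on an edge: it is a proper face because
    \<open>n \<ge> 2\<close>, and unlike a vertex it keeps the mark.\<close>
  obtain g where "box (Suc 0) n g" using box_edge[of n] n by auto
  then have "k = k'" using eq n xy by (auto dest!: spec[of _ "Suc 0"])
  moreover have "f = f'"
    using hda1D[OF hda1_lcube[of as] n, of f f'] x y eq l xy by auto
  ultimately show "x = y" using xy by simp
qed

lemma hda1_dhorn: "hda1 (dhorn as)"
  by (rule hda1_inj[OF lps_map_dhorn _ hda1_dcube]) simp

text \<open>The missing cell, like every marked cell, is parallel to its unmarked copy, because the
  two cubes share their vertices.\<close>

lemma weq_dhorn: "weq (dhorn as) (dcube as) (\<lambda>n x. x)"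
  unfolding weq_def
proof (intro conjI allI ballI)
  fix n y assume y: "y \<in> cel (dcube as) n"
  obtain k f where kf: "y = (k, f)" by (cases y)
  show "\<exists>x\<in>cel (dhorn as) n. par (dcube as) n x y"
    using y kf by (intro bexI[of _ "(False, f)"]) (auto simp: par_def)
qed auto

lemma lifts_fib:
  assumes "lps_object A" "lps_object B" "lps_object X" "hda1 X" "lps_object Y"
    and "lps_map A B \<iota>" "cofib A B \<iota>" "weq A B \<iota>" "lps_map X Y \<phi>" "fib X Y \<phi>"
  shows "lifts A B \<iota> X Y \<phi>"
  unfolding lifts_def using lift_weq_cofib_fib[OF assms] by metis

text \<open>The unmarked cube is mapped to \<open>x\<close> and the marked proper faces to the shell
  \<open>b\<close>. These fit together on vertices by the assumption on \<open>b\<close>, and the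
  image of the marked top cell under a lift is the filler.\<close>

lemma fib_lifts:
  assumes X: "lps_object X" and Y: "lps_object Y" and \<phi>: "lps_map X Y \<phi>"
    and l: "\<And>as. length as \<ge> 1 \<Longrightarrow> lifts (dhorn as) (dcube as) (\<lambda>n x. x) X Y \<phi>"
  shows "fib X Y \<phi>"
  unfolding fib_def
proof (intro allI impI ballI; elim conjE)
  fix n b x y
  assume n: "Suc 0 \<le> n" and x: "x \<in> cel X n" and y: "y \<in> cel Y n" and b: "shell X n b" "over Y \<phi> n b y"
    and lxy: "lab X n x = lab Y n y" and b0: "\<forall>f. box 0 n f \<longrightarrow> b 0 f = res X 0 n f x"
  let ?as = "lab Y n y"
  have len: "length ?as = n" by (rule length_lab[OF Y y])
  define u where "u m = (\<lambda>(k, f). if k then b m f else res X m n f x)" for m :: nat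
  define v where "v m = (\<lambda>(k, f). if k then res Y m n f y else res Y m n f (\<phi> n x))" for m :: nat
  \<comment> \<open>The map \<open>v\<close> sends the two cubes to \<open>\<phi> n x\<close> and to
    \<open>y\<close>, so these must share their vertices; they do, since both have the images of the
    vertices of the shell.\<close>
  have y0: "res Y 0 n f y = res Y 0 n f (\<phi> n x)" if f: "box 0 n f" for f
    using b(2)[unfolded over_def, rule_format, of 0 f] b0 f n map_res[OF \<phi> f x] by simp
  have bl: "lab X m (b m f) = word_act m n f ?as" if f: "box m n f" "m < n" for m f
    using b f map_lab[OF \<phi> shell_cel[OF b(1) f]] lab_res[OF Y f(1) y] by (simp add: over_def)
  have u: "lps_map (dhorn ?as) X u"
  proof (rule lps_mapI)
    fix m p assume p: "p \<in> cel (dhorn ?as) m"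
    obtain k f where kf: "p = (k, f)" by (cases p)
    show "u m p \<in> cel X m" "lab X m (u m p) = lab (dhorn ?as) m p"
      using p kf shell_cel[OF b(1)] bl x lxy
      by (auto simp: u_def len res_cel[OF X] lab_res[OF X])
    fix l g assume g: "box l m g"
    have f: "box m n f" using p kf len by simp
    have "b 0 (cb 0 f g) = res X 0 n (cb 0 f g) x" if "l = 0"
      using b0 box_comp[OF g f] that by blast
    then show "u l (res (dhorn ?as) l m g p) = res X l m g (u m p)"
      using p kf shell_res[OF b(1) f _ g] res_comp[OF X g f x] by (cases "l = 0") (auto simp: u_def len)
  qed
  have v: "lps_map (dcube ?as) Y v"
  proof (rule lps_mapI)
    fix m p assume p: "p \<in> cel (dcube ?as) m"
    obtain k f where kf: "p = (k, f)" by (cases p)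
    show "v m p \<in> cel Y m" "lab Y m (v m p) = lab (dcube ?as) m p"
      using p kf y lxy map_cel[OF \<phi> x] map_lab[OF \<phi> x]
      by (auto simp: v_def len res_cel[OF Y] lab_res[OF Y])
    fix l g assume g: "box l m g"
    have f: "box m n f" using p kf len by simp
    show "v l (res (dcube ?as) l m g p) = res Y l m g (v m p)"
      using kf res_comp[OF Y g f y] res_comp[OF Y g f map_cel[OF \<phi> x]] y0[of "cb 0 f g"]
        box_comp[OF g f]
      by (cases "l = 0") (auto simp: v_def)
  qed
  have sq: "\<forall>m. \<forall>p\<in>cel (dhorn ?as) m. \<phi> m (u m p) = v m p"
  proof (intro allI ballI)
    fix m p assume p: "p \<in> cel (dhorn ?as) m"
    obtain k f where kf: "p = (k, f)" by (cases p)
    show "\<phi> m (u m p) = v m p"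
      using p kf b(2) map_res[OF \<phi> _ x] by (auto simp: u_def v_def len over_def)
  qed
  obtain h where h: "lps_map (dcube ?as) X h" "\<forall>m. \<forall>p\<in>cel (dhorn ?as) m. h m p = u m p"
      "\<forall>m. \<forall>p\<in>cel (dcube ?as) m. \<phi> m (h m p) = v m p"
    using liftsD[OF l[of ?as] u v] sq n len by auto
  have i: "(True, idb n) \<in> cel (dcube ?as) n" using n by (simp add: len box_id)
  have "res X m n f (h n (True, idb n)) = b m f" if f: "box m n f" "m < n" for m f
  proof -
    have "res X m n f (h n (True, idb n)) = h m (m \<noteq> 0, f)"
      using map_res[OF h(1) f(1) i] cb_id_left[OF f(1)] by simp
    also have "\<dots> = u m (m \<noteq> 0, f)" using h(2) f by (simp add: len)
    also have "\<dots> = b m f" using b0 f by (auto simp: u_def)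
    finally show ?thesis .
  qed
  moreover have "\<phi> n (h n (True, idb n)) = y"
    using h(3) i res_id[OF Y y] by (simp add: v_def)
  ultimately show "fills X Y \<phi> n b y"
    unfolding fills_def using map_cel[OF h(1) i] by blast
qed

lemma (in small_labels) rlp_gen_tcofs:
  assumes X: "ob True (X :: ('u, 'l) lps)" and Y: "ob True Y" and \<phi>: "lps_map X Y \<phi>"
  shows "mk X \<phi> Y \<in> rlp HDA gen_tcofs \<longleftrightarrow> fib X Y \<phi>"
proof -
  have c: "small TYPE('u) (UNIV :: (bool \<times> (bool list \<Rightarrow> bool list)) set)"
    by (intro small_UNIV_prod small_box small_bool)
  have 1: "has_lifts (Cat True) (place_map (dhorn as) (dcube as) (\<lambda>n x. x)) (mk X \<phi> Y) \<longleftrightarrow>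
      lifts (dhorn as) (dcube as) (\<lambda>n x. x) X Y \<phi>" for as
    using has_lifts_place[OF c c lps_object_dhorn lps_object_dcube _ lps_map_dhorn X Y \<phi>]
      hda1_dhorn hda1_dcube by blast
  have "mk X \<phi> Y \<in> rlp HDA gen_tcofs \<longleftrightarrow> (\<forall>as. length as \<ge> 1 \<longrightarrow>
      has_lifts (Cat True) (place_map (dhorn as) (dcube as) (\<lambda>n x. x)) (mk X \<phi> Y))"
    unfolding rlp_def gen_tcofs_def HDA_Cat using mk_mor[OF X Y \<phi>] by blast
  then have "mk X \<phi> Y \<in> rlp HDA gen_tcofs \<longleftrightarrow>
      (\<forall>as. length as \<ge> 1 \<longrightarrow> lifts (dhorn as) (dcube as) (\<lambda>n x. x) X Y \<phi>)"
    by (simp only: 1)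
  moreover have "lifts (dhorn as) (dcube as) (\<lambda>n x. x) X Y \<phi>" if "fib X Y \<phi>" for as
    by (rule lifts_fib[OF lps_object_dhorn lps_object_dcube _ _ _ lps_map_dhorn _ weq_dhorn \<phi> that])
      (use X Y in \<open>simp_all add: ob_def cofib_def\<close>)
  ultimately show ?thesis using fib_lifts[OF ob_object[OF X] ob_object[OF Y] \<phi>] by blast
qed

section \<open>Factorizations\<close>

lemma shell_map:
  assumes X: "lps_map X Y \<phi>" and b: "shell X n b"
  shows "shell Y n (\<lambda>m f. \<phi> m (b m f))"
proof (rule shellI)
  fix l m f g assume *: "box m n f" "m < n" "box l m g"
  show "\<phi> l (b l (cb l f g)) = res Y l m g (\<phi> m (b m f))"
    using shell_res[OF b *] map_res[OF X *(3) shell_cel[OF b *(1,2)]] by simp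
qed (use shell_cel[OF b] map_cel[OF X] in blast)

lemma fillsI:
  assumes "z \<in> cel X n" "\<phi> n z = y" "\<And>m f. box m n f \<Longrightarrow> m < n \<Longrightarrow> res X m n f z = b m f"
  shows "fills X Y \<phi> n b y"
  using assms unfolding fills_def by blast

lemma fills_iso:
  assumes i: "lps_iso Z Z' e d" and b: "shell Z' n b" and f: "fills Z Y \<psi> n (\<lambda>m f. d m (b m f)) y"
  shows "fills Z' Y (\<lambda>n z. \<psi> n (d n z)) n b y"
proof -
  obtain z where z: "z \<in> cel Z n" "\<psi> n z = y" "\<And>m f. box m n f \<Longrightarrow> m < n \<Longrightarrow> res Z m n f z = d m (b m f)"
    using f by (auto simp: fills_def)
  have "res Z' m n f (e n z) = b m f" if "box m n f" "m < n" for m f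
    using map_res[OF lps_isoD(1)[OF i] that(1) z(1)] z(3)[OF that]
      lps_isoD(4)[OF i shell_cel[OF b that]]
    by simp
  then show ?thesis
    using z map_cel[OF lps_isoD(1)[OF i] z(1)] lps_isoD(3)[OF i z(1)] by (intro fillsI[of "e n z"]) auto
qed

lemma tfib_iso:
  assumes i: "lps_iso Z Z' e d" and t: "tfib Z Y \<psi>"
  shows "tfib Z' Y (\<lambda>n z. \<psi> n (d n z))"
  unfolding tfib_def
proof (intro conjI allI impI ballI; (elim conjE)?)
  have "bij_betw (d 0) (cel Z' 0) (cel Z 0)"
    using lps_isoD[OF i] map_cel[OF lps_isoD(1)[OF i]] map_cel[OF lps_isoD(2)[OF i]]
    by (intro bij_betwI[where g = "e 0"]) auto
  then show "bij_betw (\<lambda>z. \<psi> 0 (d 0 z)) (cel Z' 0) (cel Y 0)"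
    using bij_betw_trans[of "d 0" _ _ "\<psi> 0"] t by (simp add: tfib_def o_def)
next
  fix n b y assume *: "Suc 0 \<le> n" "y \<in> cel Y n" "shell Z' n b" "over Y (\<lambda>n z. \<psi> n (d n z)) n b y"
  have "fills Z Y \<psi> n (\<lambda>m f. d m (b m f)) y"
    using t * shell_map[OF lps_isoD(2)[OF i] *(3)] unfolding tfib_def over_def by blast
  then show "fills Z' Y (\<lambda>n z. \<psi> n (d n z)) n b y" by (rule fills_iso[OF i *(3)])
qed

lemma fib_iso:
  assumes i: "lps_iso Z Z' e d" and t: "fib Z Y \<psi>"
  shows "fib Z' Y (\<lambda>n z. \<psi> n (d n z))"
  unfolding fib_def
proof (intro conjI allI impI ballI; elim conjE)
  fix n b x y assume *: "Suc 0 \<le> n" "x \<in> cel Z' n" "y \<in> cel Y n" "shell Z' n b"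
    "over Y (\<lambda>n z. \<psi> n (d n z)) n b y" "lab Z' n x = lab Y n y"
    "\<forall>f. box 0 n f \<longrightarrow> b 0 f = res Z' 0 n f x"
  have "\<forall>f. box 0 n f \<longrightarrow> d 0 (b 0 f) = res Z 0 n f (d n x)"
    using *(7) map_res[OF lps_isoD(2)[OF i] _ *(2)] by simp
  moreover have "lab Z n (d n x) = lab Y n y" using map_lab[OF lps_isoD(2)[OF i] *(2)] *(6) by simp
  moreover have "over Y \<psi> n (\<lambda>m f. d m (b m f)) y" using *(5) by (simp add: over_def)
  ultimately have "fills Z Y \<psi> n (\<lambda>m f. d m (b m f)) y"
    using t[unfolded fib_def, rule_format, OF *(1) map_cel[OF lps_isoD(2)[OF i] *(2)] *(3)]
      shell_map[OF lps_isoD(2)[OF i] *(4)] by blast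
  then show "fills Z' Y (\<lambda>n z. \<psi> n (d n z)) n b y" by (rule fills_iso[OF i *(4)])
qed

subsection \<open>Weak equivalences\<close>

lemma weqD: "weq X Y \<phi> \<Longrightarrow> y \<in> cel Y n \<Longrightarrow> \<exists>x\<in>cel X n. par Y n (\<phi> n x) y"
  by (auto simp: weq_def)

lemma weq_iso:
  assumes "lps_iso X Y \<phi> \<psi>"
  shows "weq X Y \<phi>"
  unfolding weq_def
proof (intro conjI allI ballI)
  show "inj_on (\<phi> 0) (cel X 0)" using lps_isoD(3)[OF assms] by (metis inj_onI)
  fix n y assume y: "y \<in> cel Y n"
  show "\<exists>x\<in>cel X n. par Y n (\<phi> n x) y"
    using lps_isoD(4)[OF assms y] map_cel[OF lps_isoD(2)[OF assms] y] by (intro bexI[of _ "\<psi> n y"]) auto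
qed

lemma weq_comp:
  assumes \<phi>: "lps_map X Y \<phi>" and \<psi>: "lps_map Y Z \<psi>" and w: "weq X Y \<phi>" "weq Y Z \<psi>"
  shows "weq X Z (\<lambda>n x. \<psi> n (\<phi> n x))"
  unfolding weq_def
proof (intro conjI allI ballI)
  show "inj_on (\<lambda>x. \<psi> 0 (\<phi> 0 x)) (cel X 0)"
  proof (rule inj_onI)
    fix x x' assume *: "x \<in> cel X 0" "x' \<in> cel X 0" "\<psi> 0 (\<phi> 0 x) = \<psi> 0 (\<phi> 0 x')"
    have inj: "inj_on (\<phi> 0) (cel X 0)" "inj_on (\<psi> 0) (cel Y 0)" using w by (simp_all add: weq_def)
    show "x = x'"
      by (rule inj_onD[OF inj(1) inj_onD[OF inj(2) *(3) map_cel[OF \<phi> *(1)] map_cel[OF \<phi> *(2)]] *(1,2)])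
  qed
  fix n z assume "z \<in> cel Z n"
  then obtain y where y: "y \<in> cel Y n" "par Z n (\<psi> n y) z" using weqD[OF w(2)] by blast
  then obtain x where x: "x \<in> cel X n" "par Y n (\<phi> n x) y" using weqD[OF w(1)] by blast
  have "par Z n (\<psi> n (\<phi> n x)) (\<psi> n y)"
    using par_map[OF \<psi> map_cel[OF \<phi> x(1)] y(1) x(2)] .
  then show "\<exists>x\<in>cel X n. par Z n (\<psi> n (\<phi> n x)) z"
    by (intro bexI[OF par_trans[OF _ y(2)] x(1)])
qed

text \<open>Vertices of \<open>Y\<close> come from \<open>X\<close>, where injectivity of the
  composite applies.\<close>

lemma weq_cancel_left:
  assumes Y: "lps_object Y" and \<phi>: "lps_map X Y \<phi>" and \<psi>: "lps_map Y Z \<psi>"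
    and w: "weq X Y \<phi>" "weq X Z (\<lambda>n x. \<psi> n (\<phi> n x))"
  shows "weq Y Z \<psi>"
  unfolding weq_def
proof (intro conjI allI ballI)
  show "inj_on (\<psi> 0) (cel Y 0)"
  proof (rule inj_onI)
    fix y y' assume *: "y \<in> cel Y 0" "y' \<in> cel Y 0" "\<psi> 0 y = \<psi> 0 y'"
    have "y \<in> \<phi> 0 ` cel X 0" "y' \<in> \<phi> 0 ` cel X 0"
      using bij_betw_imp_surj_on[OF weq_bij[OF Y \<phi> w(1)]] *(1,2) by simp_all
    then obtain x x' where "x \<in> cel X 0" "y = \<phi> 0 x" "x' \<in> cel X 0" "y' = \<phi> 0 x'" by blast
    then show "y = y'" using w(2) *(3) by (auto simp: weq_def dest: inj_onD)
  qed
  fix n z assume "z \<in> cel Z n"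
  then obtain x where "x \<in> cel X n" "par Z n (\<psi> n (\<phi> n x)) z" using weqD[OF w(2)] by blast
  then show "\<exists>y\<in>cel Y n. par Z n (\<psi> n y) z" using map_cel[OF \<phi>] by blast
qed

text \<open>The map \<open>\<psi>\<close> is injective on vertices and so reflects to
  \<open>Y\<close> the parallelism found in \<open>Z\<close>.\<close>

lemma weq_cancel_right:
  assumes Y: "lps_object Y" and \<phi>: "lps_map X Y \<phi>" and \<psi>: "lps_map Y Z \<psi>"
    and w: "weq Y Z \<psi>" "weq X Z (\<lambda>n x. \<psi> n (\<phi> n x))"
  shows "weq X Y \<phi>"
  unfolding weq_def
proof (intro conjI allI ballI)
  show "inj_on (\<phi> 0) (cel X 0)"
    using w(2) by (auto simp: weq_def inj_on_def)
  fix n y assume y: "y \<in> cel Y n"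
  then obtain x where x: "x \<in> cel X n" "par Z n (\<psi> n (\<phi> n x)) (\<psi> n y)"
    using weqD[OF w(2) map_cel[OF \<psi> y]] by blast
  have "inj_on (\<psi> 0) (cel Y 0)" using w(1) by (simp add: weq_def)
  then have "par Y n (\<phi> n x) y" by (rule par_reflect[OF Y \<psi> _ map_cel[OF \<phi> x(1)] y x(2)])
  then show "\<exists>x\<in>cel X n. par Y n (\<phi> n x) y" using x(1) by blast
qed

lemma weq_cong: "lps_object X \<Longrightarrow> (\<And>n x. x \<in> cel X n \<Longrightarrow> \<phi> n x = \<psi> n x) \<Longrightarrow> weq X Y \<phi> = weq X Y \<psi>"
  unfolding weq_def by (metis (mono_tags, lifting) inj_on_cong)

text \<open>No shell is given to start from. The whole cube is lifted at once, along the inclusion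
  of the empty object, which is injective on edges for lack of edges.\<close>

lemma tfib_fills_all:
  assumes X: "lps_object X" "hda1 X" and Y: "lps_object Y" and \<phi>: "lps_map X Y \<phi>" "tfib X Y \<phi>"
    and y: "y \<in> cel Y n"
  shows "\<exists>x\<in>cel X n. \<phi> n x = y"
proof -
  let ?as = "lab Y n y" and ?E = "ldiscrete {} :: (nat, _) lps"
  have len: "length ?as = n" by (rule length_lab[OF Y y])
  have 1: "lps_map ?E X (\<lambda>n _. undefined)" by (rule lps_map_ldiscrete[OF X(1)]) simp
  have 2: "lps_map ?E (lcube ?as) (\<lambda>n _. undefined)"
    by (rule lps_map_ldiscrete[OF lps_object_lcube]) simp
  have 3: "cofib ?E (lcube ?as) (\<lambda>n _. undefined)" 
    unfolding cofib_def by (rule inj_onI) simp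
  obtain h where h: "lps_map (lcube ?as) X h"
      "\<forall>m. \<forall>f\<in>cel (lcube ?as) m. \<phi> m (h m f) = res Y m n f y"
    using lift_cofib_tfib[OF lps_object_ldiscrete lps_object_lcube X Y 2 3 \<phi> 1 yoneda[OF Y y refl]]
    by auto
  have i: "idb n \<in> cel (lcube ?as) n" by (simp add: len box_id)
  then show ?thesis using h(2) map_cel[OF h(1) i] res_id[OF Y y]
    by (intro bexI[of _ "h n (idb n)"]) auto
qed

lemma tfib_weq:
  assumes "lps_object X" "hda1 X" "lps_object Y" "lps_map X Y \<phi>" "tfib X Y \<phi>"
  shows "weq X Y \<phi>"
  using tfib_fills_all[OF assms] assms(5) unfolding weq_def tfib_def bij_betw_def by (metis par_refl)

lemma tfib_fib: "tfib X Y \<phi> \<Longrightarrow> fib X Y \<phi>"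
  by (auto simp: tfib_def fib_def)

text \<open>The weak equivalence supplies a cell \<open>x\<close> whose image is parallel to
  \<open>y\<close>, and injectivity on vertices puts the vertices of the shell at those of
  \<open>x\<close>. So the certificate demanded by \<open>fib\<close> always exists.\<close>

lemma fib_weq_tfib:
  assumes X: "lps_object X" and Y: "lps_object Y" and \<phi>: "lps_map X Y \<phi>" and f: "fib X Y \<phi>"
    and w: "weq X Y \<phi>"
  shows "tfib X Y \<phi>"
  unfolding tfib_def
proof (intro conjI allI impI ballI; (elim conjE)?)
  show "bij_betw (\<phi> 0) (cel X 0) (cel Y 0)" by (rule weq_bij[OF Y \<phi> w])
  fix n b y assume *: "Suc 0 \<le> n" "y \<in> cel Y n" "shell X n b" "over Y \<phi> n b y"
  obtain x where x: "x \<in> cel X n" "par Y n (\<phi> n x) y" using weqD[OF w *(2)] by blast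
  have "b 0 f = res X 0 n f x" if g: "box 0 n f" for f
  proof -
    have "\<phi> 0 (b 0 f) = \<phi> 0 (res X 0 n f x)"
      using *(1,4) x(2) g map_res[OF \<phi> g x(1)] by (auto simp: over_def par_def)
    then show ?thesis
      using w shell_cel[OF *(3) g] *(1) res_cel[OF X g x(1)] by (auto simp: weq_def dest: inj_onD)
  qed
  moreover have "lab X n x = lab Y n y" using x map_lab[OF \<phi> x(1)] by (simp add: par_def)
  ultimately show "fills X Y \<phi> n b y" using f * x(1) unfolding fib_def by blast
qed

subsection \<open>Cofibrations followed by trivial fibrations\<close>

text \<open>
  The edges of the middle object are those of \<open>X\<close> together with a free copy of those of \<open>Y\<close>, and
  its other cells are those of \<open>Y\<close> with all of their edges lifted.
\<close>

definition edge_lifts :: "('x, 'l) lps \<Rightarrow> ('y, 'l) lps \<Rightarrow> (nat \<Rightarrow> 'x \<Rightarrow> 'y) \<Rightarrow> 'y \<Rightarrow> 'x option set" where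
  "edge_lifts X Y \<phi> e = {None} \<union> Some ` {x \<in> cel X (Suc 0). \<phi> (Suc 0) x = e}"

text \<open>The second component is indexed by all maps from the 1-cube, so that restriction is
  precomposition. A vertex has no edges, which leaves the projection to \<open>Y\<close> bijective
  on vertices.\<close>

definition mid :: "('x, 'l) lps \<Rightarrow> ('y, 'l) lps \<Rightarrow> (nat \<Rightarrow> 'x \<Rightarrow> 'y) \<Rightarrow>
    ('y \<times> ((bool list \<Rightarrow> bool list) \<Rightarrow> 'x option), 'l) lps" where
  "mid X Y \<phi> = \<lparr>und = \<lparr>cells = (\<lambda>n. {(y, c). y \<in> cel Y n \<and>
       c \<in> (\<Pi>\<^sub>E g\<in>{g. box (Suc 0) n g}. edge_lifts X Y \<phi> (res Y (Suc 0) n g y))}),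
     act = (\<lambda>m n f (y, c). (res Y m n f y, \<lambda>g\<in>{g. box (Suc 0) m g}. c (cb (Suc 0) f g)))\<rparr>,
     lab = (\<lambda>n (y, c). lab Y n y)\<rparr>"

lemma mid_simps [simp]:
  "(y, c) \<in> cel (mid X Y \<phi>) n \<longleftrightarrow> y \<in> cel Y n \<and>
     c \<in> (\<Pi>\<^sub>E g\<in>{g. box (Suc 0) n g}. edge_lifts X Y \<phi> (res Y (Suc 0) n g y))"
  "res (mid X Y \<phi>) m n f (y, c) = (res Y m n f y, \<lambda>g\<in>{g. box (Suc 0) m g}. c (cb (Suc 0) f g))"
  "lab (mid X Y \<phi>) n (y, c) = lab Y n y"
  by (auto simp: mid_def)

definition mid_in :: "('x, 'l) lps \<Rightarrow> (nat \<Rightarrow> 'x \<Rightarrow> 'y) \<Rightarrow> nat \<Rightarrow> 'x \<Rightarrow>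
    'y \<times> ((bool list \<Rightarrow> bool list) \<Rightarrow> 'x option)" where
  "mid_in X \<phi> n x = (\<phi> n x, \<lambda>g\<in>{g. box (Suc 0) n g}. Some (res X (Suc 0) n g x))"

context
  fixes X :: "('x, 'l) lps" and Y :: "('y, 'l) lps" and \<phi>
  assumes X: "lps_object X" and Y: "lps_object Y" and \<phi>: "lps_map X Y \<phi>"
begin

lemma lps_object_mid: "lps_object (mid X Y \<phi>)"
proof (rule lps_objectI)
  fix m n f p assume f: "box m n f" and p: "p \<in> cel (mid X Y \<phi>) n"
  obtain y c where yc: "p = (y, c)" by (cases p)
  have y: "y \<in> cel Y n" using p yc by simp
  have "c (cb (Suc 0) f g) \<in> edge_lifts X Y \<phi> (res Y (Suc 0) m g (res Y m n f y))"
    if g: "box (Suc 0) m g" for g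
    using p yc box_comp[OF g f] res_comp[OF Y g f y] by (auto dest!: PiE_mem)
  then show "res (mid X Y \<phi>) m n f p \<in> cel (mid X Y \<phi>) m"
    using yc res_cel[OF Y f y] by simp
  show "lab (mid X Y \<phi>) m (res (mid X Y \<phi>) m n f p) = word_act m n f (lab (mid X Y \<phi>) n p)"
    using yc lab_res[OF Y f y] by simp
next
  fix n p assume p: "p \<in> cel (mid X Y \<phi>) n"
  obtain y c where yc: "p = (y, c)" by (cases p)
  have "(\<lambda>g\<in>{g. box (Suc 0) n g}. c (cb (Suc 0) (idb n) g)) = c"
    using p yc by (intro extensionalityI[of _ "{g. box (Suc 0) n g}"]) (auto simp: cb_id_left PiE_iff)
  then show "res (mid X Y \<phi>) n n (idb n) p = p" "length (lab (mid X Y \<phi>) n p) = n"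
    using p yc by (auto simp: res_id[OF Y] length_lab[OF Y])
next
  fix l m n f g p assume f: "box l m f" and g: "box m n g" and p: "p \<in> cel (mid X Y \<phi>) n"
  obtain y c where yc: "p = (y, c)" by (cases p)
  have "(\<lambda>h\<in>{h. box (Suc 0) l h}. c (cb (Suc 0) (cb l g f) h)) =
      (\<lambda>h\<in>{h. box (Suc 0) l h}. (\<lambda>h\<in>{h. box (Suc 0) m h}. c (cb (Suc 0) g h)) (cb (Suc 0) f h))"
    using f by (intro restrict_ext) (auto simp: cb_assoc box_comp)
  then show "res (mid X Y \<phi>) l n (cb l g f) p = res (mid X Y \<phi>) l m f (res (mid X Y \<phi>) m n g p)"
    using yc p res_comp[OF Y f g] by simp
qed

lemma lps_map_mid_out: "lps_map (mid X Y \<phi>) Y (\<lambda>n. fst)"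
  by (rule lps_mapI) auto

lemma lps_map_mid_in: "lps_map X (mid X Y \<phi>) (mid_in X \<phi>)"
proof (rule lps_mapI)
  fix n x assume x: "x \<in> cel X n"
  show "mid_in X \<phi> n x \<in> cel (mid X Y \<phi>) n"
    using map_cel[OF \<phi> x] res_cel[OF X _ x] map_res[OF \<phi> _ x] by (auto simp: mid_in_def edge_lifts_def)
  show "lab (mid X Y \<phi>) n (mid_in X \<phi> n x) = lab X n x"
    using map_lab[OF \<phi> x] by (simp add: mid_in_def)
  fix m f assume f: "box m n f"
  have "(\<lambda>g\<in>{g. box (Suc 0) m g}. Some (res X (Suc 0) m g (res X m n f x))) =
      (\<lambda>g\<in>{g. box (Suc 0) m g}. (\<lambda>g\<in>{g. box (Suc 0) n g}. Some (res X (Suc 0) n g x)) (cb (Suc 0) f g))"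
    using f by (intro restrict_ext) (auto simp: res_comp[OF X _ f x] box_comp)
  then show "mid_in X \<phi> m (res X m n f x) = res (mid X Y \<phi>) m n f (mid_in X \<phi> n x)"
    using map_res[OF \<phi> f x] by (simp add: mid_in_def)
qed

lemma cofib_mid_in: "cofib X (mid X Y \<phi>) (mid_in X \<phi>)"
  unfolding cofib_def
proof (rule inj_onI)
  fix x x' assume *: "x \<in> cel X (Suc 0)" "x' \<in> cel X (Suc 0)"
    "mid_in X \<phi> (Suc 0) x = mid_in X \<phi> (Suc 0) x'"
  have "snd (mid_in X \<phi> (Suc 0) x) (idb (Suc 0)) = snd (mid_in X \<phi> (Suc 0) x') (idb (Suc 0))"
    using *(3) by simp
  then show "x = x'" using *(1,2) by (simp add: mid_in_def box_11 res_id[OF X])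
qed

text \<open>The lift of an edge is recorded on that edge itself, which is a proper face from
  dimension 2 on.\<close>

lemma hda1_mid:
  assumes "hda1 Y"
  shows "hda1 (mid X Y \<phi>)"
  unfolding hda1_def
proof (intro allI ballI impI)
  fix n :: nat and p q
  assume n: "n \<ge> 2" and p: "p \<in> cel (mid X Y \<phi>) n" and q: "q \<in> cel (mid X Y \<phi>) n"
    and l: "lab (mid X Y \<phi>) n p = lab (mid X Y \<phi>) n q"
    and eq: "\<forall>m f. box m n f \<longrightarrow> m < n \<longrightarrow> res (mid X Y \<phi>) m n f p = res (mid X Y \<phi>) m n f q"
  obtain y c z d where pq: "p = (y, c)" "q = (z, d)" by (cases p, cases q)
  have "y = z" by (rule hda1D[OF assms n]) (use p q l eq pq in auto)
  moreover have "c = d"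
  proof (rule extensionalityI[of _ "{g. box (Suc 0) n g}"])
    fix g assume g: "g \<in> {g. box (Suc 0) n g}"
    then have "snd (res (mid X Y \<phi>) (Suc 0) n g p) (idb (Suc 0)) =
        snd (res (mid X Y \<phi>) (Suc 0) n g q) (idb (Suc 0))" using eq n by simp
    then show "c g = d g" using g pq by (simp add: box_11 cb_id_right)
  qed (use p q pq in \<open>auto simp: PiE_iff\<close>)
  ultimately show "p = q" using pq by simp
qed

lemma tfib_mid: "tfib (mid X Y \<phi>) Y (\<lambda>n. fst)"
  unfolding tfib_def
proof (intro conjI allI impI ballI; (elim conjE)?)
  have no: "{g. box (Suc 0) 0 g} = {}" using box_le by fastforce
  show "bij_betw fst (cel (mid X Y \<phi>) 0) (cel Y 0)"
    by (rule bij_betwI[where g = "\<lambda>y. (y, \<lambda>_. undefined)"]) (auto simp: no)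
next
  fix n b y assume n: "Suc 0 \<le> n" and y: "y \<in> cel Y n" and b: "shell (mid X Y \<phi>) n b"
    and o: "over Y (\<lambda>n. fst) n b y"
  \<comment> \<open>In dimension 1 the shell says nothing about the edge, and the free copy
    \<open>None\<close> is taken. From dimension 2 on all edges are proper faces, so their lifts are
    prescribed by the shell.\<close>
  define c where "c = (\<lambda>g\<in>{g. box (Suc 0) n g}. if n =
    Suc 0 then None else snd (b (Suc 0) g) (idb (Suc 0)))"
  have b1: "fst (b m f) = res Y m n f y" if "box m n f" "m < n" for m f
    using o that by (simp add: over_def)
  have b2: "snd (b m f) \<in> (\<Pi>\<^sub>E g\<in>{g. box (Suc 0) m g}.
    edge_lifts X Y \<phi> (res Y (Suc 0) m g (res Y m n f y)))"
    if f: "box m n f" "m < n" for m f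
    using shell_cel[OF b f] b1[OF f] by (cases "b m f") simp
  have "c g \<in> edge_lifts X Y \<phi> (res Y (Suc 0) n g y)" if g: "box (Suc 0) n g" for g
  proof (cases "n = Suc 0")
    case False
    then have "snd (b (Suc 0) g) (idb (Suc 0)) \<in>
        edge_lifts X Y \<phi> (res Y (Suc 0) (Suc 0) (idb (Suc 0)) (res Y (Suc 0) n g y))"
      using b2[OF g] n by (auto simp: box_11 dest!: PiE_mem[of _ _ _ "idb (Suc 0)"])
    then show ?thesis using False g res_id[OF Y res_cel[OF Y g y]] by (simp add: c_def)
  next
    case True
    then show ?thesis using g by (simp add: c_def edge_lifts_def)
  qed
  then have z: "(y, c) \<in> cel (mid X Y \<phi>) n" using y by (auto simp: c_def)
  have "res (mid X Y \<phi>) m n f (y, c) = b m f" if f: "box m n f" "m < n" for m f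
  proof -
    have "(\<lambda>g\<in>{g. box (Suc 0) m g}. c (cb (Suc 0) f g)) = snd (b m f)"
    proof (rule extensionalityI[of _ "{g. box (Suc 0) m g}"])
      fix g assume "g \<in> {g. box (Suc 0) m g}"
      then have g: "box (Suc 0) m g" by simp
      have n': "n \<noteq> Suc 0" "Suc 0 < n" using box_le[OF g] f by auto
      have fg: "box (Suc 0) n (cb (Suc 0) f g)" using box_comp[OF g f(1)] .
      obtain y' c' where bc: "b m f = (y', c')" by (cases "b m f")
      have "b (Suc 0) (cb (Suc 0) f g) = res (mid X Y \<phi>) (Suc 0) m g (b m f)"
        by (rule shell_res[OF b f g])
      then show "(\<lambda>g\<in>{g. box (Suc 0) m g}. c (cb (Suc 0) f g)) g = snd (b m f) g"
        using n' g fg bc by (simp add: c_def box_11 cb_id_right)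
    qed (use b2[OF f] in \<open>auto simp: PiE_iff\<close>)
    then show ?thesis using b1[OF f] by (cases "b m f") simp
  qed
  then show "fills (mid X Y \<phi>) Y (\<lambda>n. fst) n b y" by (intro fillsI[OF z]) auto
qed

end

subsection \<open>Weak equivalences followed by fibrations\<close>

text \<open>
  Replaces every cell of \<open>X\<close> by the pair of its label and its vertices, and pulls the result back
  to \<open>Y\<close>.
\<close>

definition loc :: "('x, 'l) lps \<Rightarrow> ('y, 'l) lps \<Rightarrow> (nat \<Rightarrow> 'x \<Rightarrow> 'y) \<Rightarrow>
    ('y \<times> ((bool list \<Rightarrow> bool list) \<Rightarrow> 'x), 'l) lps" where
  "loc X Y \<phi> = \<lparr>und = \<lparr>cells = (\<lambda>n. {(y, k). y \<in> cel Y n \<and>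
       (\<exists>x\<in>cel X n. par Y n (\<phi> n x) y \<and> k = (\<lambda>g\<in>{g. box 0 n g}. res X 0 n g x))}),
     act = (\<lambda>m n f (y, k). (res Y m n f y, \<lambda>g\<in>{g. box 0 m g}. k (cb 0 f g)))\<rparr>,
     lab = (\<lambda>n (y, k). lab Y n y)\<rparr>"

lemma loc_simps [simp]:
  "(y, k) \<in> cel (loc X Y \<phi>) n \<longleftrightarrow> y \<in> cel Y n \<and>
     (\<exists>x\<in>cel X n. par Y n (\<phi> n x) y \<and> k = (\<lambda>g\<in>{g. box 0 n g}. res X 0 n g x))"
  "res (loc X Y \<phi>) m n f (y, k) = (res Y m n f y, \<lambda>g\<in>{g. box 0 m g}. k (cb 0 f g))"
  "lab (loc X Y \<phi>) n (y, k) = lab Y n y"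
  by (auto simp: loc_def)

definition loc_in :: "('x, 'l) lps \<Rightarrow> (nat \<Rightarrow> 'x \<Rightarrow> 'y) \<Rightarrow> nat \<Rightarrow> 'x \<Rightarrow>
    'y \<times> ((bool list \<Rightarrow> bool list) \<Rightarrow> 'x)" where
  "loc_in X \<phi> n x = (\<phi> n x, \<lambda>g\<in>{g. box 0 n g}. res X 0 n g x)"

definition local :: "('a, 'l) lps \<Rightarrow> bool" where
  "local X \<longleftrightarrow> (\<forall>n. \<forall>x\<in>cel X n. \<forall>y\<in>cel X n. par X n x y \<longrightarrow> x = y)"

lemma localD: "local X \<Longrightarrow> x \<in> cel X n \<Longrightarrow> y \<in> cel X n \<Longrightarrow> par X n x y \<Longrightarrow> x = y"
  by (auto simp: local_def)

context
  fixes X :: "('x, 'l) lps" and Y :: "('y, 'l) lps" and \<phi>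
  assumes X: "lps_object X" and Y: "lps_object Y" and \<phi>: "lps_map X Y \<phi>"
begin

lemma vertices_res:
  assumes "box m n f" "x \<in> cel X n"
  shows "(\<lambda>g\<in>{g. box 0 m g}. (\<lambda>g\<in>{g. box 0 n g}. res X 0 n g x) (cb 0 f g)) =
    (\<lambda>g\<in>{g. box 0 m g}. res X 0 m g (res X m n f x))"
  using assms by (intro restrict_ext) (auto simp: res_comp[OF X] box_comp)

lemma lps_object_loc: "lps_object (loc X Y \<phi>)"
proof (rule lps_objectI)
  fix m n f p assume f: "box m n f" and p: "p \<in> cel (loc X Y \<phi>) n"
  obtain y k where yk: "p = (y, k)" by (cases p)
  obtain x where x: "y \<in> cel Y n" "x \<in> cel X n" "par Y n (\<phi> n x) y"
    "k = (\<lambda>g\<in>{g. box 0 n g}. res X 0 n g x)"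
    using p yk by auto
  have "par Y m (\<phi> m (res X m n f x)) (res Y m n f y)"
    using par_res[OF Y f map_cel[OF \<phi> x(2)] x(1,3)] map_res[OF \<phi> f x(2)] by simp
  then show "res (loc X Y \<phi>) m n f p \<in> cel (loc X Y \<phi>) m"
    using x yk res_cel[OF Y f x(1)] res_cel[OF X f x(2)] vertices_res[OF f x(2)] by auto
  show "lab (loc X Y \<phi>) m (res (loc X Y \<phi>) m n f p) = word_act m n f (lab (loc X Y \<phi>) n p)"
    using yk lab_res[OF Y f x(1)] by simp
next
  fix n p assume p: "p \<in> cel (loc X Y \<phi>) n"
  obtain y k where yk: "p = (y, k)" by (cases p)
  have "(\<lambda>g\<in>{g. box 0 n g}. k (cb 0 (idb n) g)) = k"
    using p yk by (intro extensionalityI[of _ "{g. box 0 n g}"]) (auto simp: cb_id_left)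
  then show "res (loc X Y \<phi>) n n (idb n) p = p" "length (lab (loc X Y \<phi>) n p) = n"
    using p yk by (auto simp: res_id[OF Y] length_lab[OF Y])
next
  fix l m n f g p assume f: "box l m f" and g: "box m n g" and p: "p \<in> cel (loc X Y \<phi>) n"
  obtain y k where yk: "p = (y, k)" by (cases p)
  have "(\<lambda>h\<in>{h. box 0 l h}. k (cb 0 (cb l g f) h)) =
      (\<lambda>h\<in>{h. box 0 l h}. (\<lambda>h\<in>{h. box 0 m h}. k (cb 0 g h)) (cb 0 f h))"
    using f by (intro restrict_ext) (auto simp: cb_assoc box_comp)
  then show "res (loc X Y \<phi>) l n (cb l g f) p = res (loc X Y \<phi>) l m f (res (loc X Y \<phi>) m n g p)"
    using yk p res_comp[OF Y f g] by simp
qed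

lemma lps_map_loc_out: "lps_map (loc X Y \<phi>) Y (\<lambda>n. fst)"
  by (rule lps_mapI) auto

lemma lps_map_loc_in: "lps_map X (loc X Y \<phi>) (loc_in X \<phi>)"
proof (rule lps_mapI)
  fix n x assume x: "x \<in> cel X n"
  show "loc_in X \<phi> n x \<in> cel (loc X Y \<phi>) n"
    unfolding loc_in_def loc_simps
    by (intro conjI bexI[of _ x] map_cel[OF \<phi> x] par_refl refl x)
  show "lab (loc X Y \<phi>) n (loc_in X \<phi> n x) = lab X n x"
    using map_lab[OF \<phi> x] by (simp add: loc_in_def)
  fix m f assume f: "box m n f"
  show "loc_in X \<phi> m (res X m n f x) = res (loc X Y \<phi>) m n f (loc_in X \<phi> n x)"
    using map_res[OF \<phi> f x] vertices_res[OF f x] by (simp add: loc_in_def)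
qed

lemma loc_vertex:
  assumes p: "p \<in> cel (loc X Y \<phi>) n" and g: "box 0 n g"
  shows "snd (res (loc X Y \<phi>) 0 n g p) (idb 0) = snd p g"
  using g by (cases p) (simp add: box_00 cb_id_right)

lemma loc_snd_eqI:
  assumes "p \<in> cel (loc X Y \<phi>) n" "q \<in> cel (loc X Y \<phi>) n"
    and "\<And>g. box 0 n g \<Longrightarrow> snd p g = snd q g"
  shows "snd p = snd q"
proof -
  obtain y k z j where pq: "p = (y, k)" "q = (z, j)" by (cases p, cases q)
  have "k = j"
    by (rule extensionalityI[of _ "{g. box 0 n g}"]) (use assms pq in auto)
  then show ?thesis using pq by simp
qed

text \<open>The second component remembers vertices, which gives injectivity there, and a cell
  belongs to \<open>loc\<close> only if some cell of \<open>X\<close> has its vertices and its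
  label.\<close>

lemma weq_loc_in: "weq X (loc X Y \<phi>) (loc_in X \<phi>)"
  unfolding weq_def
proof (intro conjI allI ballI)
  show "inj_on (loc_in X \<phi> 0) (cel X 0)"
  proof (rule inj_onI)
    fix x x' assume *: "x \<in> cel X 0" "x' \<in> cel X 0" "loc_in X \<phi> 0 x = loc_in X \<phi> 0 x'"
    have "snd (loc_in X \<phi> 0 x) (idb 0) = snd (loc_in X \<phi> 0 x') (idb 0)" using *(3) by simp
    then show "x = x'" using *(1,2) by (simp add: loc_in_def box_00 res_id[OF X])
  qed
  fix n p assume p: "p \<in> cel (loc X Y \<phi>) n"
  obtain y k where yk: "p = (y, k)" by (cases p)
  obtain x where x: "y \<in> cel Y n" "x \<in> cel X n" "par Y n (\<phi> n x) y"
    "k = (\<lambda>g\<in>{g. box 0 n g}. res X 0 n g x)"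
    using p yk by auto
  have "par (loc X Y \<phi>) n (loc_in X \<phi> n x) p"
    using x yk by (auto simp: par_def loc_in_def)
  then show "\<exists>x\<in>cel X n. par (loc X Y \<phi>) n (loc_in X \<phi> n x) p" using x(2) by blast
qed

lemma hda1_loc:
  assumes "hda1 Y"
  shows "hda1 (loc X Y \<phi>)"
  unfolding hda1_def
proof (intro allI ballI impI)
  fix n :: nat and p q
  assume n: "n \<ge> 2" and p: "p \<in> cel (loc X Y \<phi>) n" and q: "q \<in> cel (loc X Y \<phi>) n"
    and l: "lab (loc X Y \<phi>) n p = lab (loc X Y \<phi>) n q"
    and eq: "\<forall>m f. box m n f \<longrightarrow> m < n \<longrightarrow> res (loc X Y \<phi>) m n f p = res (loc X Y \<phi>) m n f q"
  obtain y k z j where pq: "p = (y, k)" "q = (z, j)" by (cases p, cases q)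
  have "y = z" by (rule hda1D[OF assms n]) (use p q l eq pq in auto)
  moreover have "snd p = snd q"
    by (rule loc_snd_eqI[OF p q]) (use loc_vertex[OF p] loc_vertex[OF q] eq n in simp)
  ultimately show "p = q" using pq by simp
qed

lemma fib_loc: "fib (loc X Y \<phi>) Y (\<lambda>n. fst)"
  unfolding fib_def
proof (intro allI impI ballI; elim conjE)
  fix n b p y assume n: "Suc 0 \<le> n" and p: "p \<in> cel (loc X Y \<phi>) n" and y: "y \<in> cel Y n"
    and b: "shell (loc X Y \<phi>) n b" "over Y (\<lambda>n. fst) n b y" and l: "lab (loc X Y \<phi>) n p = lab Y n y"
    and b0: "\<forall>f. box 0 n f \<longrightarrow> b 0 f = res (loc X Y \<phi>) 0 n f p"
  obtain z k where zk: "p = (z, k)" by (cases p)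
  obtain x where x: "z \<in> cel Y n" "x \<in> cel X n" "par Y n (\<phi> n x) z"
    "k = (\<lambda>g\<in>{g. box 0 n g}. res X 0 n g x)"
    using p zk by auto
  have b1: "fst (b m f) = res Y m n f y" if "box m n f" "m < n" for m f
    using b(2) that by (simp add: over_def)
  \<comment> \<open>The vertices of the shell lie over those of \<open>y\<close> and of
    \<open>z\<close> at once. As \<open>y\<close> is parallel to \<open>z\<close>, the tuple
    \<open>k\<close> of vertices is admissible over \<open>y\<close> too, and \<open>(y, k)\<close>
    is the filler.\<close>
  have "par Y n z y"
    using l zk b0 b1[of 0] n by (simp add: par_def)
  then have q: "(y, k) \<in> cel (loc X Y \<phi>) n" using x y par_trans by fastforce
  have "res (loc X Y \<phi>) m n f (y, k) = b m f" if f: "box m n f" "m < n" for m f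
  proof (rule prod_eqI)
    show "fst (res (loc X Y \<phi>) m n f (y, k)) = fst (b m f)" using b1[OF f] by simp
    have r: "res (loc X Y \<phi>) m n f (y, k) \<in> cel (loc X Y \<phi>) m"
      by (rule res_cel[OF lps_object_loc f(1) q])
    show "snd (res (loc X Y \<phi>) m n f (y, k)) = snd (b m f)"
    proof (rule loc_snd_eqI[OF r shell_cel[OF b(1) f]])
      fix g assume g: "box 0 m g"
      have fg: "box 0 n (cb 0 f g)" using box_comp[OF g f(1)] .
      have "snd (b m f) g = snd (res (loc X Y \<phi>) 0 m g (b m f)) (idb 0)"
        using loc_vertex[OF shell_cel[OF b(1) f] g] by simp
      also have "\<dots> = snd (res (loc X Y \<phi>) 0 n (cb 0 f g) p) (idb 0)"
        using shell_res[OF b(1) f g] b0 fg by simp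
      also have "\<dots> = k (cb 0 f g)" using loc_vertex[OF p fg] zk by simp
      finally show "snd (res (loc X Y \<phi>) m n f (y, k)) g = snd (b m f) g" using g by simp
    qed
  qed
  then show "fills (loc X Y \<phi>) Y (\<lambda>n. fst) n b y" by (intro fillsI[OF q]) auto
qed

end

text \<open>Over \<open>lwords\<close> the first component is the label, so a cell is nothing but
  its label and its tuple of vertices.\<close>

lemma local_loc:
  fixes X :: "('x, 'l) lps"
  assumes X: "lps_object X"
  shows "local (loc X lwords (lab X))"
  unfolding local_def
proof (intro allI ballI impI)
  fix n p q
  assume p: "p \<in> cel (loc X lwords (lab X)) n" and q: "q \<in> cel (loc X lwords (lab X)) n"
    and pq: "par (loc X lwords (lab X)) n p q"
  note * = X lps_object_lwords lps_map_lab[OF X]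
  have "fst p = fst q" using pq by (cases p, cases q) (simp add: par_def)
  moreover have "snd p = snd q"
    by (rule loc_snd_eqI[OF * p q]) (use loc_vertex[OF * p] loc_vertex[OF * q] pq
      in \<open>simp add: par_def\<close>)
  ultimately show "p = q" by (rule prod_eqI)
qed

text \<open>A cell of \<open>B\<close> is sent to the image of any cell of \<open>A\<close> that
  becomes parallel to it. Two candidates are parallel in \<open>A\<close>, since
  \<open>\<phi>\<close> reflects parallelism, and so have the same image in the local object
  \<open>S\<close>.\<close>

lemma weq_extend:
  assumes A: "lps_object A" and B: "lps_object B" and S: "lps_object S" "local S"
    and \<phi>: "lps_map A B \<phi>" "weq A B \<phi>" and u: "lps_map A S u"
  shows "\<exists>h. lps_map B S h \<and> (\<forall>n. \<forall>a\<in>cel A n. h n (\<phi> n a) = u n a)"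
proof -
  define h where "h n b = u n (SOME a. a \<in> cel A n \<and> par B n (\<phi> n a) b)" for n b
  have inj: "inj_on (\<phi> 0) (cel A 0)" using \<phi>(2) by (simp add: weq_def)
  have h: "h n b = u n a" if a: "a \<in> cel A n" "par B n (\<phi> n a) b" and b: "b \<in> cel B n" for n a b
  proof -
    let ?a = "SOME a. a \<in> cel A n \<and> par B n (\<phi> n a) b"
    have a': "?a \<in> cel A n \<and> par B n (\<phi> n ?a) b"
      by (rule someI[of "\<lambda>a. a \<in> cel A n \<and> par B n (\<phi> n a) b", OF conjI[OF a]])
    then have "par B n (\<phi> n ?a) (\<phi> n a)" using a(2) par_trans par_sym by metis
    then have "par A n ?a a" using par_reflect[OF A \<phi>(1) inj _ a(1)] a' by blast
    then have "par S n (u n ?a) (u n a)" using par_map[OF u _ a(1)] a' by blast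
    then show ?thesis unfolding h_def using localD[OF S(2)] map_cel[OF u] a' a(1) by blast
  qed
  have "lps_map B S h"
  proof (rule lps_mapI)
    fix n b assume b: "b \<in> cel B n"
    obtain a where a: "a \<in> cel A n" "par B n (\<phi> n a) b" using weqD[OF \<phi>(2) b] by blast
    show "h n b \<in> cel S n" "lab S n (h n b) = lab B n b"
      using h[OF a b] map_cel[OF u a(1)] map_lab[OF u a(1)] map_lab[OF \<phi>(1) a(1)] a(2)
        by (auto simp: par_def)
    fix m f assume f: "box m n f"
    have "par B m (\<phi> m (res A m n f a)) (res B m n f b)"
      using par_res[OF B f map_cel[OF \<phi>(1) a(1)] b a(2)] map_res[OF \<phi>(1) f a(1)] by simp
    then have "h m (res B m n f b) = u m (res A m n f a)"
      using h res_cel[OF A f a(1)] res_cel[OF B f b] by blast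
    then show "h m (res B m n f b) = res S m n f (h n b)"
      using h[OF a b] map_res[OF u f a(1)] by simp
  qed
  moreover have "h n (\<phi> n a) = u n a" if "a \<in> cel A n" for n a
    using h[OF that par_refl map_cel[OF \<phi>(1) that]] .
  ultimately show ?thesis by blast
qed

section \<open>Lifting properties in a category\<close>

locale cat =
  fixes C :: "('o, 'm) category"
  assumes cat: "is_category C"
begin

lemma hom_obj: "f \<in> hom C X Y \<Longrightarrow> X \<in> obj C \<and> Y \<in> obj C"
  using cat unfolding is_category_def hom_def by blast

lemma cat_comp: "f \<in> hom C X Y \<Longrightarrow> g \<in> hom C Y Z \<Longrightarrow> cmp C g f \<in> hom C X Z"
  using cat unfolding is_category_def by blast

lemma cat_id: "X \<in> obj C \<Longrightarrow> idm C X \<in> hom C X X"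
  using cat unfolding is_category_def by blast

lemma cat_id_right: "f \<in> hom C X Y \<Longrightarrow> cmp C f (idm C X) = f"
  using cat unfolding is_category_def by blast

lemma cat_id_left: "f \<in> hom C X Y \<Longrightarrow> cmp C (idm C Y) f = f"
  using cat unfolding is_category_def by blast

lemma cat_assoc: "f \<in> hom C W X \<Longrightarrow> g \<in> hom C X Y \<Longrightarrow> h \<in> hom C Y Z \<Longrightarrow>
    cmp C h (cmp C g f) = cmp C (cmp C h g) f"
  using cat unfolding is_category_def by blast

lemma mor_hom: "f \<in> mor C \<longleftrightarrow> f \<in> hom C (source C f) (target C f)"
  by (simp add: hom_def)

lemma homD: "f \<in> hom C X Y \<Longrightarrow> f \<in> mor C \<and> source C f = X \<and> target C f = Y"
  by (simp add: hom_def)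

lemma has_lifts_hom:
  assumes "i \<in> hom C A B" "p \<in> hom C X Y"
  shows "has_lifts C i p \<longleftrightarrow> (\<forall>u\<in>hom C A X. \<forall>v\<in>hom C B Y. cmp C p u = cmp C v i \<longrightarrow>
    (\<exists>h\<in>hom C B X. cmp C h i = u \<and> cmp C p h = v))"
  using homD[OF assms(1)] homD[OF assms(2)] unfolding has_lifts_def by blast

lemma has_liftsD:
  assumes "has_lifts C i p" "i \<in> hom C A B" "p \<in> hom C X Y" "u \<in> hom C A X" "v \<in> hom C B Y"
    and "cmp C p u = cmp C v i"
  shows "\<exists>h\<in>hom C B X. cmp C h i = u \<and> cmp C p h = v"
  using assms(1,4-6) unfolding has_lifts_hom[OF assms(2,3)] by blast

lemma retract_rlp:
  assumes S: "i \<in> mor C" and r: "retract_of C f g" and g: "has_lifts C i g"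
  shows "has_lifts C i f"
proof -
  obtain A B where i: "i \<in> hom C A B" using S mor_hom by blast
  obtain X Y X' Y' where f: "f \<in> hom C X Y" and g': "g \<in> hom C X' Y'"
    using r mor_hom unfolding retract_of_def by blast
  obtain a b a' b' where ab: "a \<in> hom C X X'" "b \<in> hom C X' X" "a' \<in> hom C Y Y'" "b' \<in> hom C Y' Y"
    "cmp C b a = idm C X" "cmp C b' a' = idm C Y" "cmp C g a = cmp C a' f" "cmp C f b = cmp C b' g"
    using r homD[OF f] homD[OF g'] unfolding retract_of_def by blast
  show ?thesis unfolding has_lifts_hom[OF i f]
  proof (intro ballI impI)
    fix u v assume uv: "u \<in> hom C A X" "v \<in> hom C B Y" "cmp C f u = cmp C v i"
    have "cmp C g (cmp C a u) = cmp C (cmp C a' v) i"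
      using cat_assoc[OF uv(1) ab(1) g'] cat_assoc[OF uv(1) f ab(3)] cat_assoc[OF i uv(2) ab(3)]
        ab(7) uv(3)
      by simp
    then obtain h where h: "h \<in> hom C B X'" "cmp C h i = cmp C a u" "cmp C g h = cmp C a' v"
      using has_liftsD[OF g i g' cat_comp[OF uv(1) ab(1)] cat_comp[OF uv(2) ab(3)]] by blast
    have "cmp C (cmp C b h) i = u"
      using cat_assoc[OF i h(1) ab(2)] h(2) cat_assoc[OF uv(1) ab(1) ab(2)] ab(5)
        cat_id_left[OF uv(1)] by simp
    moreover have "cmp C f (cmp C b h) = v"
      using cat_assoc[OF h(1) ab(2) f] ab(8) cat_assoc[OF h(1) g' ab(4)] h(3) cat_assoc[OF uv(2)
        ab(3) ab(4)]
        ab(6) cat_id_left[OF uv(2)] by simp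
    ultimately show "\<exists>h\<in>hom C B X. cmp C h i = u \<and> cmp C f h = v"
      using cat_comp[OF h(1) ab(2)] by blast
  qed
qed

lemma retract_llp:
  assumes S: "p \<in> mor C" and r: "retract_of C f g" and g: "has_lifts C g p"
  shows "has_lifts C f p"
proof -
  obtain E F where p: "p \<in> hom C E F" using S mor_hom by blast
  obtain X Y X' Y' where f: "f \<in> hom C X Y" and g': "g \<in> hom C X' Y'"
    using r mor_hom unfolding retract_of_def by blast
  obtain a b a' b' where ab: "a \<in> hom C X X'" "b \<in> hom C X' X" "a' \<in> hom C Y Y'" "b' \<in> hom C Y' Y"
    "cmp C b a = idm C X" "cmp C b' a' = idm C Y" "cmp C g a = cmp C a' f" "cmp C f b = cmp C b' g"
    using r homD[OF f] homD[OF g'] unfolding retract_of_def by blast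
  show ?thesis unfolding has_lifts_hom[OF f p]
  proof (intro ballI impI)
    fix u v assume uv: "u \<in> hom C X E" "v \<in> hom C Y F" "cmp C p u = cmp C v f"
    have "cmp C p (cmp C u b) = cmp C (cmp C v b') g"
      using cat_assoc[OF ab(2) uv(1) p] cat_assoc[OF ab(2) f uv(2)] cat_assoc[OF g' ab(4) uv(2)]
        ab(8) uv(3)
      by simp
    then obtain h where h: "h \<in> hom C Y' E" "cmp C h g = cmp C u b" "cmp C p h = cmp C v b'"
      using has_liftsD[OF g g' p cat_comp[OF ab(2) uv(1)] cat_comp[OF ab(4) uv(2)]] by blast
    have "cmp C (cmp C h a') f = u"
      using cat_assoc[OF f ab(3) h(1)] ab(7)[symmetric] cat_assoc[OF ab(1) g' h(1)] h(2)
        cat_assoc[OF ab(1) ab(2) uv(1)] ab(5) cat_id_right[OF uv(1)] by simp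
    moreover have "cmp C p (cmp C h a') = v"
      using cat_assoc[OF ab(3) h(1) p] h(3) cat_assoc[OF ab(3) ab(4) uv(2)] ab(6)
        cat_id_right[OF uv(2)] by simp
    ultimately show "\<exists>h\<in>hom C Y E. cmp C h f = u \<and> cmp C p h = v"
      using cat_comp[OF ab(3) h(1)] by blast
  qed
qed

lemma retract_closed_rlp: "S \<subseteq> mor C \<Longrightarrow> retract_closed C (rlp C S)"
  unfolding retract_closed_def rlp_def
proof (intro allI impI CollectI conjI ballI; elim conjE)
  fix f g assume "retract_of C f g"
  then show "f \<in> mor C" by (simp add: retract_of_def)
next
  fix f g i assume *: "S \<subseteq> mor C" "retract_of C f g" "g \<in> {p \<in> mor C. \<forall>i\<in>S. has_lifts C i p}" "i \<in> S"
  then show "has_lifts C i f" by (intro retract_rlp[OF _ *(2)]) auto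
qed

lemma retract_closed_llp: "S \<subseteq> mor C \<Longrightarrow> retract_closed C (llp C S)"
  unfolding retract_closed_def llp_def
proof (intro allI impI CollectI conjI ballI; elim conjE)
  fix f g assume "retract_of C f g"
  then show "f \<in> mor C" by (simp add: retract_of_def)
next
  fix f g i assume *: "S \<subseteq> mor C" "retract_of C f g" "g \<in> {i \<in> mor C. \<forall>p\<in>S. has_lifts C i p}" "i \<in> S"
  then show "has_lifts C f i" by (intro retract_llp[OF _ *(2)]) auto
qed

text \<open>The retract argument: a lift in the square with top \<open>i\<close> and bottom the
  identity of \<open>B\<close> exhibits the composite as a retract of \<open>i\<close>.\<close>

lemma retract_of_left:
  assumes i: "i \<in> hom C A Z" and p: "p \<in> hom C Z B" and l: "has_lifts C (cmp C p i) p"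
  shows "retract_of C (cmp C p i) i"
proof -
  note f = cat_comp[OF i p]
  have "cmp C p i = cmp C (idm C B) (cmp C p i)" using cat_id_left[OF f] by simp
  then obtain h where h: "h \<in> hom C B Z" "cmp C h (cmp C p i) = i" "cmp C p h = idm C B"
    using has_liftsD[OF l f p i cat_id] hom_obj[OF p] by blast
  have "retract_of C (cmp C p i) i \<longleftrightarrow> (\<exists>a\<in>hom C A A. \<exists>b\<in>hom C A A. \<exists>a'\<in>hom C B Z. \<exists>b'\<in>hom C Z B.
      cmp C b a = idm C A \<and> cmp C b' a' = idm C B \<and> cmp C i a = cmp C a' (cmp C p i) \<and>
      cmp C (cmp C p i) b = cmp C b' i)"
    unfolding retract_of_def using homD[OF f] homD[OF i] by simp
  then show ?thesis
    using h p cat_id[of A] hom_obj[OF i] cat_id_right[OF i] cat_id_right[OF f]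
      cat_id_left[OF cat_id] by metis
qed

text \<open>The dual retract argument, with the identity of \<open>A\<close> on top and
  \<open>p\<close> at the bottom.\<close>

lemma retract_of_right:
  assumes i: "i \<in> hom C A Z" and p: "p \<in> hom C Z B" and l: "has_lifts C i (cmp C p i)"
  shows "retract_of C (cmp C p i) p"
proof -
  note f = cat_comp[OF i p]
  have "cmp C (cmp C p i) (idm C A) = cmp C p i" using cat_id_right[OF f] by simp
  then obtain h where h: "h \<in> hom C Z A" "cmp C h i = idm C A" "cmp C (cmp C p i) h = p"
    using has_liftsD[OF l i f cat_id p] hom_obj[OF i] by blast
  have "retract_of C (cmp C p i) p \<longleftrightarrow> (\<exists>a\<in>hom C A Z. \<exists>b\<in>hom C Z A. \<exists>a'\<in>hom C B B. \<exists>b'\<in>hom C B B.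
      cmp C b a = idm C A \<and> cmp C b' a' = idm C B \<and> cmp C p a = cmp C a' (cmp C p i) \<and>
      cmp C (cmp C p i) b = cmp C b' p)"
    unfolding retract_of_def using homD[OF f] homD[OF p] by simp
  then show ?thesis
    using h i cat_id[of B] hom_obj[OF p] cat_id_left[OF p] cat_id_left[OF f] cat_id_left[OF cat_id]
      by metis
qed

lemma rlp_comp:
  assumes "p \<in> hom C X Y" "q \<in> hom C Y Z" "p \<in> rlp C S" "q \<in> rlp C S" "S \<subseteq> mor C"
  shows "cmp C q p \<in> rlp C S"
  unfolding rlp_def
proof (intro CollectI conjI ballI)
  note c = cat_comp[OF assms(1,2)]
  show "cmp C q p \<in> mor C" using homD[OF c] by blast
  fix i assume "i \<in> S"
  then obtain A B where i: "i \<in> hom C A B" and l: "has_lifts C i p" "has_lifts C i q"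
    using assms(3-5) mor_hom unfolding rlp_def by blast
  show "has_lifts C i (cmp C q p)" unfolding has_lifts_hom[OF i c]
  proof (intro ballI impI)
    fix u v assume uv: "u \<in> hom C A X" "v \<in> hom C B Z" "cmp C (cmp C q p) u = cmp C v i"
    have "cmp C q (cmp C p u) = cmp C v i" using uv(3) cat_assoc[OF uv(1) assms(1,2)] by simp
    then obtain k where k: "k \<in> hom C B Y" "cmp C k i = cmp C p u" "cmp C q k = v"
      using has_liftsD[OF l(2) i assms(2) cat_comp[OF uv(1) assms(1)] uv(2)] by blast
    obtain h where h: "h \<in> hom C B X" "cmp C h i = u" "cmp C p h = k"
      using has_liftsD[OF l(1) i assms(1) uv(1) k(1)] k(2) by metis
    have "cmp C (cmp C q p) h = v" using cat_assoc[OF h(1) assms(1,2)] h(3) k(3) by simp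
    then show "\<exists>h\<in>hom C B X. cmp C h i = u \<and> cmp C (cmp C q p) h = v" using h by blast
  qed
qed

end

section \<open>Consequences of the model axioms\<close>

locale model_cat = cat C for C :: "('o, 'm) category" +
  fixes M :: "'m model_data"
  assumes sub: "weqs M \<subseteq> mor C" "cofs M \<subseteq> mor C" "fibs M \<subseteq> mor C"
    and retr: "retract_closed C (weqs M)" "retract_closed C (cofs M)" "retract_closed C (fibs M)"
    and lift: "\<And>i p. i \<in> cofs M \<Longrightarrow> p \<in> fibs M \<Longrightarrow> i \<in> weqs M \<or> p \<in> weqs M \<Longrightarrow> has_lifts C i p"
    and fact1: "\<And>f. f \<in> mor C \<Longrightarrow>
      \<exists>i\<in>cofs M \<inter> weqs M. \<exists>p\<in>fibs M. target C i = source C p \<and> f = cmp C p i"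
    and fact2: "\<And>f. f \<in> mor C \<Longrightarrow>
      \<exists>i\<in>cofs M. \<exists>p\<in>fibs M \<inter> weqs M. target C i = source C p \<and> f = cmp C p i"
    and two_three: "\<And>X Y Z f g. f \<in> hom C X Y \<Longrightarrow> g \<in> hom C Y Z \<Longrightarrow>
        (f \<in> weqs M \<and> g \<in> weqs M \<longrightarrow> cmp C g f \<in> weqs M) \<and>
        (f \<in> weqs M \<and> cmp C g f \<in> weqs M \<longrightarrow> g \<in> weqs M) \<and>
        (g \<in> weqs M \<and> cmp C g f \<in> weqs M \<longrightarrow> f \<in> weqs M)"

lemma model_structure_model_cat:
  assumes "model_structure U C M"
  shows "model_cat C M"
proof -
  note m = assms[unfolded model_structure_def]
  have 1: "is_category C" using m by (elim conjE)
  have 2: "\<forall>i\<in>cofs M. \<forall>p\<in>fibs M. i \<in> weqs M \<or> p \<in> weqs M \<longrightarrow> has_lifts C i p"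
    using m by (elim conjE)
  have 3: "\<forall>X Y Z f g. f \<in> hom C X Y \<and> g \<in> hom C Y Z \<longrightarrow>
        (f \<in> weqs M \<and> g \<in> weqs M \<longrightarrow> cmp C g f \<in> weqs M) \<and>
        (f \<in> weqs M \<and> cmp C g f \<in> weqs M \<longrightarrow> g \<in> weqs M) \<and>
        (g \<in> weqs M \<and> cmp C g f \<in> weqs M \<longrightarrow> f \<in> weqs M)"
    using m by (elim conjE)
  have 4: "\<forall>f\<in>mor C. \<exists>i\<in>cofs M \<inter> weqs M. \<exists>p\<in>fibs M. target C i = source C p \<and> f = cmp C p i"
    using m by (elim conjE)
  have 5: "\<forall>f\<in>mor C. \<exists>i\<in>cofs M. \<exists>p\<in>fibs M \<inter> weqs M. target C i = source C p \<and> f = cmp C p i"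
    using m by (elim conjE)
  have 6: "weqs M \<subseteq> mor C" using m by (elim conjE)
  have 7: "cofs M \<subseteq> mor C" using m by (elim conjE)
  have 8: "fibs M \<subseteq> mor C" using m by (elim conjE)
  have 9: "retract_closed C (weqs M)" using m by (elim conjE)
  have 10: "retract_closed C (cofs M)" using m by (elim conjE)
  have 11: "retract_closed C (fibs M)" using m by (elim conjE)
  show ?thesis
  proof
    fix X Y Z f g assume "f \<in> hom C X Y" "g \<in> hom C Y Z"
    then show "(f \<in> weqs M \<and> g \<in> weqs M \<longrightarrow> cmp C g f \<in> weqs M) \<and>
        (f \<in> weqs M \<and> cmp C g f \<in> weqs M \<longrightarrow> g \<in> weqs M) \<and>
        (g \<in> weqs M \<and> cmp C g f \<in> weqs M \<longrightarrow> f \<in> weqs M)"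
      by (rule 3[THEN spec, THEN spec, THEN spec, THEN spec, THEN spec, THEN mp, OF conjI])
    next
    fix i p assume "i \<in> cofs M" "p \<in> fibs M" "i \<in> weqs M \<or> p \<in> weqs M"
    then show "has_lifts C i p" using 2 by blast
  qed (use 1 4 5 6 7 8 9 10 11 in \<open>simp_all\<close>)
qed

lemma model_cat_model_structure:
  assumes "model_cat C M" "complete U C" "cocomplete U C"
  shows "model_structure U C M"
proof -
  interpret model_cat C M by (rule assms(1))
  show ?thesis unfolding model_structure_def
  proof (intro conjI)
    show "\<forall>X Y Z f g. f \<in> hom C X Y \<and> g \<in> hom C Y Z \<longrightarrow>
        (f \<in> weqs M \<and> g \<in> weqs M \<longrightarrow> cmp C g f \<in> weqs M) \<and>
        (f \<in> weqs M \<and> cmp C g f \<in> weqs M \<longrightarrow> g \<in> weqs M) \<and>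
        (g \<in> weqs M \<and> cmp C g f \<in> weqs M \<longrightarrow> f \<in> weqs M)"
      by (intro allI impI, elim conjE, rule two_three)
    show "\<forall>i\<in>cofs M. \<forall>p\<in>fibs M. i \<in> weqs M \<or> p \<in> weqs M \<longrightarrow> has_lifts C i p"
      by (intro ballI impI lift)
    show "\<forall>f\<in>mor C. \<exists>i\<in>cofs M \<inter> weqs M. \<exists>p\<in>fibs M. target C i = source C p \<and> f = cmp C p i"
      by (intro ballI fact1)
    show "\<forall>f\<in>mor C. \<exists>i\<in>cofs M. \<exists>p\<in>fibs M \<inter> weqs M. target C i = source C p \<and> f = cmp C p i"
      by (intro ballI fact2)
  qed (rule cat assms(2,3) sub retr)+
qed

context model_cat
begin

lemma factor1:
  assumes "f \<in> hom C X Y"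
  obtains Z i p where "i \<in> hom C X Z" "p \<in> hom C Z Y" "i \<in> cofs M" "i \<in> weqs M" "p \<in> fibs M"
    "f = cmp C p i"
proof -
  obtain i p where ip: "i \<in> cofs M \<inter> weqs M" "p \<in> fibs M" "target C i = source C p" "f = cmp C p i"
    using fact1 homD[OF assms] by blast
  have ih: "i \<in> hom C (source C i) (source C p)" and ph: "p \<in> hom C (source C p) (target C p)"
    using ip sub mor_hom[of i] mor_hom[of p] by auto
  have "source C i = X" "target C p = Y" using homD[OF cat_comp[OF ih ph]] ip(4) homD[OF assms] by auto
  then show ?thesis using that ih ph ip by blast
qed

lemma factor2:
  assumes "f \<in> hom C X Y"
  obtains Z i p where "i \<in> hom C X Z" "p \<in> hom C Z Y" "i \<in> cofs M" "p \<in> weqs M" "p \<in> fibs M"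
    "f = cmp C p i"
proof -
  obtain i p where ip: "i \<in> cofs M" "p \<in> fibs M \<inter> weqs M" "target C i = source C p" "f = cmp C p i"
    using fact2 homD[OF assms] by blast
  have ih: "i \<in> hom C (source C i) (source C p)" and ph: "p \<in> hom C (source C p) (target C p)"
    using ip sub mor_hom[of i] mor_hom[of p] by auto
  have "source C i = X" "target C p = Y" using homD[OF cat_comp[OF ih ph]] ip(4) homD[OF assms] by auto
  then show ?thesis using that ih ph ip by blast
qed

lemma trivial_fibs: "fibs M \<inter> weqs M = rlp C (cofs M)"
proof
  show "fibs M \<inter> weqs M \<subseteq> rlp C (cofs M)" using lift sub by (auto simp: rlp_def)
  show "rlp C (cofs M) \<subseteq> fibs M \<inter> weqs M"
  proof
    fix p assume p: "p \<in> rlp C (cofs M)"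
    then have "p \<in> hom C (source C p) (target C p)" using mor_hom by (simp add: rlp_def)
    then obtain Z i q where *: "i \<in> hom C (source C p) Z" "q \<in> hom C Z (target C p)" "i \<in> cofs M"
        "q \<in> weqs M" "q \<in> fibs M" "p = cmp C q i" by (rule factor2)
    have "retract_of C p q" using retract_of_right[OF *(1,2)] p * by (auto simp: rlp_def)
    then show "p \<in> fibs M \<inter> weqs M" using retr *(4,5) unfolding retract_closed_def by blast
  qed
qed

lemma fibs_rlp: "fibs M = rlp C (cofs M \<inter> weqs M)"
proof
  show "fibs M \<subseteq> rlp C (cofs M \<inter> weqs M)" using lift sub by (auto simp: rlp_def)
  show "rlp C (cofs M \<inter> weqs M) \<subseteq> fibs M"
  proof
    fix p assume p: "p \<in> rlp C (cofs M \<inter> weqs M)"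
    then have "p \<in> hom C (source C p) (target C p)" using mor_hom by (simp add: rlp_def)
    then obtain Z i q where *: "i \<in> hom C (source C p) Z" "q \<in> hom C Z (target C p)" "i \<in> cofs M"
        "i \<in> weqs M" "q \<in> fibs M" "p = cmp C q i" by (rule factor1)
    have "retract_of C p q" using retract_of_right[OF *(1,2)] p * by (auto simp: rlp_def)
    then show "p \<in> fibs M" using retr *(5) unfolding retract_closed_def by blast
  qed
qed

text \<open>Serves to recognise pushouts of trivial cofibrations, through their lifting
  property.\<close>

lemma trivial_cofs: "llp C (fibs M) \<subseteq> cofs M \<inter> weqs M"
proof
  fix i assume i: "i \<in> llp C (fibs M)"
  then have "i \<in> hom C (source C i) (target C i)" using mor_hom by (simp add: llp_def)
  then obtain Z j q where *: "j \<in> hom C (source C i) Z" "q \<in> hom C Z (target C i)" "j \<in> cofs M"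
      "j \<in> weqs M" "q \<in> fibs M" "i = cmp C q j" by (rule factor1)
  have "retract_of C i j" using retract_of_left[OF *(1,2)] i * by (auto simp: llp_def)
  then show "i \<in> cofs M \<inter> weqs M" using retr *(3,4) unfolding retract_closed_def by blast
qed

text \<open>Identities are not mentioned in the axioms. An identity has the right lifting property
  with respect to every map, so it is a trivial fibration.\<close>

lemma idm_weqs: "X \<in> obj C \<Longrightarrow> idm C X \<in> weqs M"
proof -
  assume X: "X \<in> obj C"
  note id = cat_id[OF X]
  have "idm C X \<in> rlp C (cofs M)"
    unfolding rlp_def
  proof (intro CollectI conjI ballI)
    show "idm C X \<in> mor C" using homD[OF id] by blast
    fix i assume "i \<in> cofs M"
    then obtain A B where i: "i \<in> hom C A B" using sub mor_hom by blast
    show "has_lifts C i (idm C X)" unfolding has_lifts_hom[OF i id] using cat_id_left by metis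
  qed
  then show ?thesis using trivial_fibs by blast
qed

end

section \<open>The model structure\<close>

definition hda_model :: "('u, 'l) lmor model_data" where
  "hda_model = \<lparr>weqs = {mk X \<phi> Y | X \<phi> Y. ob True X \<and> ob True Y \<and> lps_map X Y \<phi> \<and> weq X Y \<phi>},
     cofs = llp HDA (rlp HDA gen_cofs), fibs = rlp HDA gen_tcofs\<rparr>"

context small_labels
begin

lemma small_Un: "small TYPE('u) A \<Longrightarrow> small TYPE('u) B \<Longrightarrow> small TYPE('u) (A \<union> B)"
  using small_UN[OF small_bool, of UNIV "\<lambda>b. if b then A else B"] by (auto simp: UNIV_bool Un_commute)

section \<open>Factorizations and the three classes of maps\<close>

lemma factor_cofib_tfib:
  assumes X: "ob True (X :: ('u, 'l) lps)" and Y: "ob True (Y :: ('u, 'l) lps)" and \<phi>: "lps_map X Y \<phi>"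
  obtains Z \<iota> \<psi> where "ob True (Z :: ('u, 'l) lps)" "lps_map X Z \<iota>" "lps_map Z Y \<psi>" "cofib X Z \<iota>"
    "tfib Z Y \<psi>"
    "\<forall>n. \<forall>x\<in>cel X n. \<psi> n (\<iota> n x) = \<phi> n x"
proof -
  note * = ob_object[OF X] ob_object[OF Y] \<phi>
  have "small TYPE('u) (cel (mid X Y \<phi>) n)" for n
  proof (rule small_subset)
    have "small TYPE('u) ({None} \<union> Some ` cel X (Suc 0))"
      by (intro small_Un small_image ob_small[OF X] small_finite[of "{None}"]) simp
    then show "small TYPE('u) (cel Y n \<times> ({g. box (Suc 0) n g} \<rightarrow>\<^sub>E ({None} \<union> Some ` cel X (Suc 0))))"
      by (intro small_Sigma small_PiE small_box ob_small[OF Y])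
    show "cel (mid X Y \<phi>) n \<subseteq> cel Y n \<times> ({g. box (Suc 0) n g} \<rightarrow>\<^sub>E ({None} \<union> Some ` cel X (Suc 0)))"
    proof
      fix p assume p: "p \<in> cel (mid X Y \<phi>) n"
      obtain y c where yc: "p = (y, c)" by (cases p)
      have "y \<in> cel Y n" and
        c: "c \<in> (\<Pi>\<^sub>E g\<in>{g. box (Suc 0) n g}. edge_lifts X Y \<phi> (res Y (Suc 0) n g y))"
        using p yc by simp_all
      moreover have "c \<in> {g. box (Suc 0) n g} \<rightarrow>\<^sub>E ({None} \<union> Some ` cel X (Suc 0))"
        by (rule subsetD[OF PiE_mono c]) (auto simp: edge_lifts_def)
      ultimately show "p \<in> cel Y n \<times> ({g. box (Suc 0) n g} \<rightarrow>\<^sub>E ({None} \<union> Some ` cel X (Suc 0)))"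
        using yc by blast
    qed
  qed
  then obtain Z e d where Z: "ob True (Z :: ('u, 'l) lps)" and i: "lps_iso (mid X Y \<phi>) Z e d"
    using representative[OF lps_object_mid[OF *], of True] hda1_mid[OF * ob_hda1[OF Y]] by blast
  show ?thesis
  proof (rule that[OF Z])
    show "lps_map X Z (\<lambda>n x. e n (mid_in X \<phi> n x))"
      by (rule lps_map_comp[OF lps_map_mid_in[OF *] lps_isoD(1)[OF i]])
    show "lps_map Z Y (\<lambda>n z. fst (d n z))"
      by (rule lps_map_comp[OF lps_isoD(2)[OF i] lps_map_mid_out[OF *]])
    show "cofib X Z (\<lambda>n x. e n (mid_in X \<phi> n x))"
      unfolding cofib_def
    proof (rule inj_onI)
      fix x x' assume a: "x \<in> cel X (Suc 0)" "x' \<in> cel X (Suc 0)"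
        "e (Suc 0) (mid_in X \<phi> (Suc 0) x) = e (Suc 0) (mid_in X \<phi> (Suc 0) x')"
      have "mid_in X \<phi> (Suc 0) x = d (Suc 0) (e (Suc 0) (mid_in X \<phi> (Suc 0) x))"
        by (rule lps_isoD(3)[OF i map_cel[OF lps_map_mid_in[OF *] a(1)], symmetric])
      also have "\<dots> = d (Suc 0) (e (Suc 0) (mid_in X \<phi> (Suc 0) x'))" by (simp only: a(3))
      also have "\<dots> = mid_in X \<phi> (Suc 0) x'"
        by (rule lps_isoD(3)[OF i map_cel[OF lps_map_mid_in[OF *] a(2)]])
      finally show "x = x'" using inj_onD[OF cofib_mid_in[OF *, unfolded cofib_def] _ a(1,2)] by blast
    qed
    show "tfib Z Y (\<lambda>n z. fst (d n z))" by (rule tfib_iso[OF i tfib_mid[OF *]])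
    show "\<forall>n. \<forall>x\<in>cel X n. fst (d n (e n (mid_in X \<phi> n x))) = \<phi> n x"
      using lps_isoD(3)[OF i map_cel[OF lps_map_mid_in[OF *]]] by (simp add: mid_in_def)
  qed
qed

lemma loc_representative:
  assumes X: "ob b (X :: ('u, 'l) lps)" and Y: "lps_object Y" "\<And>n. small TYPE('u) (cel Y n)" "hda1 Y"
    and \<phi>: "lps_map X Y \<phi>"
  obtains Z e d where "ob True (Z :: ('u, 'l) lps)" "lps_iso (loc X Y \<phi>) Z e d"
proof -
  note * = ob_object[OF X] Y(1) \<phi>
  have "small TYPE('u) (cel (loc X Y \<phi>) n)" for n
  proof (rule small_subset)
    show "small TYPE('u) (cel Y n \<times> ({g. box 0 n g} \<rightarrow>\<^sub>E cel X 0))"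
      by (intro small_Sigma small_PiE small_box ob_small[OF X] Y(2))
    show "cel (loc X Y \<phi>) n \<subseteq> cel Y n \<times> ({g. box 0 n g} \<rightarrow>\<^sub>E cel X 0)"
    proof
      fix p assume p: "p \<in> cel (loc X Y \<phi>) n"
      obtain y k where yk: "p = (y, k)" by (cases p)
      obtain x where x: "y \<in> cel Y n" "x \<in> cel X n" "k = (\<lambda>g\<in>{g. box 0 n g}. res X 0 n g x)"
        using p yk by auto
      have "k \<in> {g. box 0 n g} \<rightarrow>\<^sub>E cel X 0"
        unfolding x(3) restrict_PiE_iff using res_cel[OF *(1) _ x(2)] by blast
      then show "p \<in> cel Y n \<times> ({g. box 0 n g} \<rightarrow>\<^sub>E cel X 0)" using yk x(1) by blast
    qed
  qed
  then show ?thesis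
    using representative[OF lps_object_loc[OF *], of True] hda1_loc[OF * Y(3)] that by blast
qed

lemma factor_weq_fib:
  assumes X: "ob True (X :: ('u, 'l) lps)" and Y: "ob True (Y :: ('u, 'l) lps)" and \<phi>: "lps_map X Y \<phi>"
  obtains Z \<iota> \<psi> where "ob True (Z :: ('u, 'l) lps)" "lps_map X Z \<iota>" "lps_map Z Y \<psi>" "weq X Z \<iota>"
    "fib Z Y \<psi>"
    "\<forall>n. \<forall>x\<in>cel X n. \<psi> n (\<iota> n x) = \<phi> n x"
proof -
  note * = ob_object[OF X] ob_object[OF Y] \<phi>
  obtain Z e d where Z: "ob True (Z :: ('u, 'l) lps)" and i: "lps_iso (loc X Y \<phi>) Z e d"
    using loc_representative[OF X ob_object[OF Y] ob_small[OF Y] ob_hda1[OF Y] \<phi>] by blast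
  show ?thesis
  proof (rule that[OF Z])
    show "lps_map X Z (\<lambda>n x. e n (loc_in X \<phi> n x))"
      by (rule lps_map_comp[OF lps_map_loc_in[OF *] lps_isoD(1)[OF i]])
    show "lps_map Z Y (\<lambda>n z. fst (d n z))"
      by (rule lps_map_comp[OF lps_isoD(2)[OF i] lps_map_loc_out[OF *]])
    show "weq X Z (\<lambda>n x. e n (loc_in X \<phi> n x))"
      by (rule weq_comp[OF lps_map_loc_in[OF *] lps_isoD(1)[OF i] weq_loc_in[OF *] weq_iso[OF i]])
    show "fib Z Y (\<lambda>n z. fst (d n z))" by (rule fib_iso[OF i fib_loc[OF *]])
    show "\<forall>n. \<forall>x\<in>cel X n. fst (d n (e n (loc_in X \<phi> n x))) = \<phi> n x"
      using lps_isoD(3)[OF i map_cel[OF lps_map_loc_in[OF *]]] by (simp add: loc_in_def)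
  qed
qed

text \<open>Applies to all objects of \<open>P_cat\<close>, since \<open>loc\<close> takes the HDA
  paradigm from its base, here the object of all words.\<close>

lemma localization:
  assumes X: "ob b (X :: ('u, 'l) lps)"
  obtains S \<eta> where "ob True (S :: ('u, 'l) lps)" "local S" "lps_map X S \<eta>" "weq X S \<eta>"
proof -
  note * = ob_object[OF X] lps_object_lwords lps_map_lab[OF ob_object[OF X]]
  have sm: "small TYPE('u) (cel (lwords :: ('l list, 'l) lps) n)" for n
    by (simp add: small_words)
  obtain S e d where S: "ob True (S :: ('u, 'l) lps)" and i: "lps_iso (loc X lwords (lab X)) S e d"
    using loc_representative[OF X lps_object_lwords sm hda1_lwords *(3)] by blast
  show ?thesis
  proof (rule that[OF S])
    show "local S" unfolding local_def
    proof (intro allI ballI impI)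
      fix n x y assume x: "x \<in> cel S n" "y \<in> cel S n" and p: "par S n x y"
      have "d n x = d n y"
        by (rule localD[OF local_loc[OF *(1)] _ _ par_map[OF lps_isoD(2)[OF i] x p]])
          (use x map_cel[OF lps_isoD(2)[OF i]] in auto)
      then show "x = y" using lps_isoD(4)[OF i] x by metis
    qed
    show "lps_map X S (\<lambda>n x. e n (loc_in X (lab X) n x))"
      by (rule lps_map_comp[OF lps_map_loc_in[OF *] lps_isoD(1)[OF i]])
    show "weq X S (\<lambda>n x. e n (loc_in X (lab X) n x))"
      by (rule weq_comp[OF lps_map_loc_in[OF *] lps_isoD(1)[OF i] weq_loc_in[OF *] weq_iso[OF i]])
  qed
qed

lemma mk_weqs:
  assumes "ob True (X :: ('u, 'l) lps)" "ob True Y" "lps_map X Y \<phi>"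
  shows "mk X \<phi> Y \<in> weqs hda_model \<longleftrightarrow> weq X Y \<phi>"
proof
  assume "mk X \<phi> Y \<in> weqs hda_model"
  then obtain \<psi> where "weq X Y \<psi>" "\<forall>n. \<forall>x\<in>cel X n. \<phi> n x = \<psi> n x"
    by (auto simp: hda_model_def mk_eq_iff)
  then show "weq X Y \<phi>" using weq_cong[OF ob_object[OF assms(1)], of \<phi> \<psi> Y] by blast
qed (use assms in \<open>auto simp: hda_model_def\<close>)

lemma mk_fibs:
  assumes "ob True (X :: ('u, 'l) lps)" "ob True Y" "lps_map X Y \<phi>"
  shows "mk X \<phi> Y \<in> fibs hda_model \<longleftrightarrow> fib X Y \<phi>"
  using rlp_gen_tcofs[OF assms] by (simp add: hda_model_def)

text \<open>For the converse direction, the factorization through \<open>mid\<close> gives a square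
  with a lift: a map that is injective on edges then factors through \<open>\<phi>\<close>, which
  makes \<open>\<phi>\<close> injective on edges.\<close>

lemma llp_rlp_gen_cofs:
  assumes X: "ob True (X :: ('u, 'l) lps)" and Y: "ob True Y" and \<phi>: "lps_map X Y \<phi>"
  shows "mk X \<phi> Y \<in> llp HDA (rlp HDA gen_cofs) \<longleftrightarrow> cofib X Y \<phi>"
proof
  assume c: "cofib X Y \<phi>"
  have "has_lifts (Cat True) (mk X \<phi> Y) p" if p: "p \<in> rlp HDA gen_cofs" for p
  proof -
    obtain E q B where q: "p = mk E q B" "ob True E" "ob True B" "lps_map E B q"
      using p mor_Cat[of p True] by (auto simp: rlp_def HDA_Cat)
    then have "tfib E B q" using rlp_gen_cofs[OF q(2-4)] p by simp
    then show ?thesis unfolding q(1) has_lifts_mk[OF X Y q(2,3) \<phi> q(4)]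
      by (intro lifts_tfib) (use X Y q \<phi> c in \<open>simp_all add: ob_def\<close>)
  qed
  then show "mk X \<phi> Y \<in> llp HDA (rlp HDA gen_cofs)" using assms by (simp add: llp_def HDA_Cat)
next
  assume l: "mk X \<phi> Y \<in> llp HDA (rlp HDA gen_cofs)"
  obtain Z \<iota> \<psi> where Z: "ob True (Z :: ('u, 'l) lps)" "lps_map X Z \<iota>" "lps_map Z Y \<psi>" "cofib X Z \<iota>"
    "tfib Z Y \<psi>"
    "\<forall>n. \<forall>x\<in>cel X n. \<psi> n (\<iota> n x) = \<phi> n x" using factor_cofib_tfib[OF assms] by blast
  have "mk Z \<psi> Y \<in> rlp HDA gen_cofs" using rlp_gen_cofs[OF Z(1) Y Z(3)] Z(5) by simp
  then have "has_lifts (Cat True) (mk X \<phi> Y) (mk Z \<psi> Y)" using l by (simp add: llp_def HDA_Cat)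
  then have "lifts X Y \<phi> Z Y \<psi>" using has_lifts_mk[OF X Y Z(1) Y \<phi> Z(3)] by simp
  then obtain h where h: "\<forall>n. \<forall>a\<in>cel X n. h n (\<phi> n a) = \<iota> n a"
    using liftsD[of X Y \<phi> Z Y \<psi> \<iota> "\<lambda>n x. x"] Z(2,6) lps_map_id by blast
  show "cofib X Y \<phi>" unfolding cofib_def
  proof (rule inj_onI)
    fix x y assume xy: "x \<in> cel X (Suc 0)" "y \<in> cel X (Suc 0)" "\<phi> (Suc 0) x = \<phi> (Suc 0) y"
    then have "\<iota> (Suc 0) x = \<iota> (Suc 0) y" using h by metis
    then show "x = y" using Z(4) xy by (auto simp: cofib_def dest: inj_onD)
  qed
qed

lemma mk_cofs:
  assumes "ob True (X :: ('u, 'l) lps)" "ob True Y" "lps_map X Y \<phi>"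
  shows "mk X \<phi> Y \<in> cofs hda_model \<longleftrightarrow> cofib X Y \<phi>"
  using llp_rlp_gen_cofs[OF assms] by (simp add: hda_model_def)

lemma gen_cofs_mor: "(gen_cofs :: ('u, 'l) lmor set) \<subseteq> mor HDA"
  unfolding HDA_Cat using gen_cofs_HDA mor_Cat[of _ True] by blast

lemma gen_tcofs_mor: "(gen_tcofs :: ('u, 'l) lmor set) \<subseteq> mor HDA"
proof
  fix f assume "f \<in> (gen_tcofs :: ('u, 'l) lmor set)"
  then obtain as where f: "f = place_map (dhorn as) (dcube as) (\<lambda>n x. x)" by (auto simp: gen_tcofs_def)
  have c: "small TYPE('u) (UNIV :: (bool \<times> (bool list \<Rightarrow> bool list)) set)"
    by (intro small_UNIV_prod small_box small_bool)
  have "place_map (dhorn as) (dcube as) (\<lambda>n x. x) \<in>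
      hom (Cat True) (place (dhorn as) :: ('u, 'l) lps) (place (dcube as) :: ('u, 'l) lps)"
    using place_map_hom[OF c c lps_object_dhorn lps_object_dcube _ lps_map_dhorn]
      hda1_dhorn hda1_dcube by blast
  then show "f \<in> mor HDA" unfolding f HDA_Cat hom_def by blast
qed

lemma small_gen_cofs: "small TYPE('u) (gen_cofs :: ('u, 'l) lmor set)"
proof -
  have "(gen_cofs :: ('u, 'l) lmor set) \<subseteq>
      (\<lambda>as. place_map (lboundary as) (lcube as) (\<lambda>n x. x)) ` UNIV \<union>
      {place_map (ldiscrete ({} :: nat set)) (ldiscrete {0 :: nat}) (\<lambda>n x. x),
       place_map (ldiscrete {0, 1 :: nat}) (ldiscrete {0 :: nat}) (\<lambda>n x. 0)}"
    unfolding gen_cofs_def by blast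
  moreover have "small TYPE('u) \<dots>"
    by (intro small_Un small_image small_UNIV_list small_labels small_finite) simp
  ultimately show ?thesis using small_subset by blast
qed

lemma small_gen_tcofs: "small TYPE('u) (gen_tcofs :: ('u, 'l) lmor set)"
proof -
  have "(gen_tcofs :: ('u, 'l) lmor set) \<subseteq> (\<lambda>as. place_map (dhorn as) (dcube as) (\<lambda>n x. x)) ` UNIV"
    unfolding gen_tcofs_def by blast
  moreover have "small TYPE('u) \<dots>"
    by (intro small_image small_UNIV_list small_labels)
  ultimately show ?thesis using small_subset by blast
qed

lemma trivial_fibs_hda_model:
  "fibs hda_model \<inter> weqs hda_model = rlp HDA (gen_cofs :: ('u, 'l) lmor set)"
proof (intro set_eqI iffI)
  fix p :: "('u, 'l) lmor" assume p: "p \<in> fibs hda_model \<inter> weqs hda_model"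
  then obtain X \<phi> Y where *: "p = mk X \<phi> Y" "ob True X" "ob True Y" "lps_map X Y \<phi>"
    by (auto simp: hda_model_def)
  then have "tfib X Y \<phi>"
    using p mk_weqs[OF *(2-4)] mk_fibs[OF *(2-4)] fib_weq_tfib[of X Y \<phi>] by (simp add: ob_def)
  then show "p \<in> rlp HDA gen_cofs" using rlp_gen_cofs[OF *(2-4)] *(1) by simp
next
  fix p :: "('u, 'l) lmor" assume p: "p \<in> rlp HDA gen_cofs"
  then obtain X \<phi> Y where *: "p = mk X \<phi> Y" "ob True X" "ob True Y" "lps_map X Y \<phi>"
    using mor_Cat[of p True] by (auto simp: rlp_def HDA_Cat)
  then have "tfib X Y \<phi>" using rlp_gen_cofs[OF *(2-4)] p by simp
  then show "p \<in> fibs hda_model \<inter> weqs hda_model"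
    using mk_weqs[OF *(2-4)] mk_fibs[OF *(2-4)] tfib_fib tfib_weq[of X Y \<phi>] *(1-4) by (simp add: ob_def)
qed

section \<open>The model axioms\<close>

lemma weq_retract:
  assumes X: "lps_object X" and Y: "lps_object Y" "lps_object Y'" and g: "lps_map X' Y' \<gamma>" "weq X' Y' \<gamma>"
    and f: "lps_map X Y \<phi>" and a: "lps_map X X' a" and b: "lps_map X' X b"
    and a': "lps_map Y Y' a'" and b': "lps_map Y' Y b'"
    and ba: "\<And>n x. x \<in> cel X n \<Longrightarrow> b n (a n x) = x" and ba': "\<And>n y. y \<in> cel Y n \<Longrightarrow> b' n (a' n y) = y"
    and ga: "\<And>n x. x \<in> cel X n \<Longrightarrow> \<gamma> n (a n x) = a' n (\<phi> n x)"
    and fb: "\<And>n x. x \<in> cel X' n \<Longrightarrow> \<phi> n (b n x) = b' n (\<gamma> n x)"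
  shows "weq X Y \<phi>"
  unfolding weq_def
proof (intro conjI allI ballI)
  show "inj_on (\<phi> 0) (cel X 0)"
  proof (rule inj_onI)
    fix x y assume xy: "x \<in> cel X 0" "y \<in> cel X 0" "\<phi> 0 x = \<phi> 0 y"
    then have "\<gamma> 0 (a 0 x) = \<gamma> 0 (a 0 y)" using ga by simp
    moreover have "inj_on (\<gamma> 0) (cel X' 0)" using g(2) by (simp add: weq_def)
    ultimately have "a 0 x = a 0 y" using xy map_cel[OF a] by (auto dest: inj_onD)
    then show "x = y" using ba xy by metis
  qed
  fix n y assume y: "y \<in> cel Y n"
  obtain x where x: "x \<in> cel X' n" "par Y' n (\<gamma> n x) (a' n y)" using weqD[OF g(2) map_cel[OF a' y]]
    by blast
  have "par Y n (b' n (\<gamma> n x)) (b' n (a' n y))"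
    by (rule par_map[OF b' map_cel[OF g(1) x(1)] map_cel[OF a' y] x(2)])
  then have "par Y n (\<phi> n (b n x)) y" using fb[OF x(1)] ba'[OF y] by simp
  then show "\<exists>x\<in>cel X n. par Y n (\<phi> n x) y" using map_cel[OF b x(1)] by blast
qed

lemma retract_closed_weqs: "retract_closed HDA (weqs (hda_model :: ('u, 'l) lmor model_data))"
  unfolding retract_closed_def
proof (intro allI impI; elim conjE)
  fix f g :: "('u, 'l) lmor" assume r: "retract_of HDA f g" and g: "g \<in> weqs hda_model"
  obtain X' \<gamma> Y' where gg: "g = mk X' \<gamma> Y'" "ob True X'" "ob True Y'" "lps_map X' Y' \<gamma>" "weq X' Y' \<gamma>"
    using g by (auto simp: hda_model_def)
  obtain X \<phi> Y where ff: "f = mk X \<phi> Y" "ob True X" "ob True Y" "lps_map X Y \<phi>"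
    using r mor_Cat[of f True] by (auto simp: retract_of_def HDA_Cat)
  obtain A B A' B' where *: "A \<in> hom (Cat True) X X'" "B \<in> hom (Cat True) X' X"
      "A' \<in> hom (Cat True) Y Y'" "B' \<in> hom (Cat True) Y' Y"
      "cmp (Cat True) B A = idm (Cat True) X" "cmp (Cat True) B' A' = idm (Cat True) Y"
      "cmp (Cat True) g A = cmp (Cat True) A' f" "cmp (Cat True) f B = cmp (Cat True) B' g"
    using r unfolding retract_of_def HDA_Cat gg(1) ff(1) source_mk target_mk by blast
  obtain a where a: "A = mk X a X'" "lps_map X X' a" using homE[OF *(1)] by blast
  obtain b where b: "B = mk X' b X" "lps_map X' X b" using homE[OF *(2)] by blast
  obtain a' where a': "A' = mk Y a' Y'" "lps_map Y Y' a'" using homE[OF *(3)] by blast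
  obtain b' where b': "B' = mk Y' b' Y" "lps_map Y' Y b'" using homE[OF *(4)] by blast
  have "weq X Y \<phi>"
    by (rule weq_retract[OF ob_object[OF ff(2)] ob_object[OF ff(3)] ob_object[OF gg(3)] gg(4,5) ff(4)
          a(2) b(2) a'(2) b'(2)])
      (use *(5-8) in \<open>simp_all add: gg(1,4) ff(1,4) a b a' b' cmp_mk idm_Cat mk_eq_iff\<close>)
  then show "f \<in> weqs hda_model" using mk_weqs[OF ff(2-4)] ff(1) by simp
qed

lemma model_cat_hda_model: "model_cat HDA (hda_model :: ('u, 'l) lmor model_data)"
proof -
  interpret cat "HDA :: (('u, 'l) lps, ('u, 'l) lmor) category"
    by unfold_locales (simp add: HDA_Cat is_category_Cat)
  show ?thesis
  proof
    show "weqs hda_model \<subseteq> mor (HDA :: (('u, 'l) lps, ('u, 'l) lmor) category)"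
      by (auto simp: hda_model_def HDA_Cat)
    show "cofs hda_model \<subseteq> mor (HDA :: (('u, 'l) lps, ('u, 'l) lmor) category)"
      by (auto simp: hda_model_def llp_def)
    show "fibs hda_model \<subseteq> mor (HDA :: (('u, 'l) lps, ('u, 'l) lmor) category)"
      by (auto simp: hda_model_def rlp_def)
    show "retract_closed HDA (weqs (hda_model :: ('u, 'l) lmor model_data))"
      by (rule retract_closed_weqs)
    have "rlp HDA gen_cofs \<subseteq> mor (HDA :: (('u, 'l) lps, ('u, 'l) lmor) category)"
      by (auto simp: rlp_def)
    then show "retract_closed HDA (cofs (hda_model :: ('u, 'l) lmor model_data))"
      using retract_closed_llp by (simp add: hda_model_def)
    show "retract_closed HDA (fibs (hda_model :: ('u, 'l) lmor model_data))"
      using retract_closed_rlp[OF gen_tcofs_mor] by (simp add: hda_model_def)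
  next
    fix i p :: "('u, 'l) lmor"
    assume i: "i \<in> cofs hda_model" and p: "p \<in> fibs hda_model"
      and w: "i \<in> weqs hda_model \<or> p \<in> weqs hda_model"
    show "has_lifts HDA i p"
    proof (cases "p \<in> weqs hda_model")
      case True
      then have "p \<in> rlp HDA gen_cofs" using p trivial_fibs_hda_model by blast
      then show ?thesis using i by (simp add: hda_model_def llp_def)
    next
      case False
      then have w: "i \<in> weqs hda_model" using w by simp
      then obtain A \<iota> B where a: "i = mk A \<iota> B" "ob True A" "ob True B" "lps_map A B \<iota>" "weq A B \<iota>"
        by (auto simp: hda_model_def)
      obtain X \<phi> Y where x: "p = mk X \<phi> Y" "ob True X" "ob True Y" "lps_map X Y \<phi>"
        using p mor_Cat[of p True] by (auto simp: hda_model_def rlp_def HDA_Cat)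
      have "cofib A B \<iota>" using i mk_cofs[OF a(2-4)] a(1) by simp
      moreover have "fib X Y \<phi>" using p mk_fibs[OF x(2-4)] x(1) by simp
      ultimately show ?thesis unfolding a(1) x(1) HDA_Cat has_lifts_mk[OF a(2,3) x(2,3) a(4) x(4)]
        by (intro lifts_fib) (use a x in \<open>simp_all add: ob_def\<close>)
    qed
  next
    fix f :: "('u, 'l) lmor" assume "f \<in> mor HDA"
    then obtain X \<phi> Y where x: "f = mk X \<phi> Y" "ob True X" "ob True Y" "lps_map X Y \<phi>"
      using mor_Cat[of f True] by (auto simp: HDA_Cat)
    obtain Z \<iota> \<psi> where Z: "ob True (Z :: ('u, 'l) lps)" "lps_map X Z \<iota>" "lps_map Z Y \<psi>"
      "cofib X Z \<iota>" "tfib Z Y \<psi>"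
      "\<forall>n. \<forall>x\<in>cel X n. \<psi> n (\<iota> n x) = \<phi> n x" using factor_cofib_tfib[OF x(2-4)] by blast
    have "mk X \<iota> Z \<in> cofs hda_model" using mk_cofs[OF x(2) Z(1,2)] Z(4) by simp
    moreover have "mk Z \<psi> Y \<in> fibs hda_model \<inter> weqs hda_model"
      using rlp_gen_cofs[OF Z(1) x(3) Z(3)] Z(5) trivial_fibs_hda_model by blast
    moreover have "f = cmp HDA (mk Z \<psi> Y) (mk X \<iota> Z)"
      using Z(6) by (simp add: HDA_Cat cmp_mk[OF Z(2)] x(1) mk_eq_iff)
    ultimately show "\<exists>i\<in>cofs hda_model. \<exists>p\<in>fibs hda_model \<inter> weqs hda_model.
        target HDA i = source HDA p \<and> f = cmp HDA p i"
      by (intro bexI[of _ "mk X \<iota> Z"] bexI[of _ "mk Z \<psi> Y"]) (simp_all add: HDA_Cat)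
    \<comment> \<open>The map is factored into a weak equivalence and a fibration, and the weak
      equivalence is split further into a cofibration and a trivial fibration. Two-out-of-three
      makes that cofibration trivial.\<close>
    obtain P \<eta> \<rho> where P: "ob True (P :: ('u, 'l) lps)" "lps_map X P \<eta>" "lps_map P Y \<rho>" "weq X P \<eta>"
      "fib P Y \<rho>"
      "\<forall>n. \<forall>x\<in>cel X n. \<rho> n (\<eta> n x) = \<phi> n x" using factor_weq_fib[OF x(2-4)] by blast
    obtain Z \<iota> \<psi> where Z: "ob True (Z :: ('u, 'l) lps)" "lps_map X Z \<iota>" "lps_map Z P \<psi>"
      "cofib X Z \<iota>" "tfib Z P \<psi>"
      "\<forall>n. \<forall>x\<in>cel X n. \<psi> n (\<iota> n x) = \<eta> n x" using factor_cofib_tfib[OF x(2) P(1,2)] by blast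
    have "weq X P (\<lambda>n x. \<psi> n (\<iota> n x))"
      using weq_cong[OF ob_object[OF x(2)], of "\<lambda>n x. \<psi> n (\<iota> n x)" \<eta> P] Z(6) P(4) by simp
    moreover have "weq Z P \<psi>" using tfib_weq[OF _ _ _ Z(3,5)] Z(1) P(1) by (simp add: ob_def)
    ultimately have "weq X Z \<iota>" using weq_cancel_right[OF ob_object[OF Z(1)] Z(2,3)] by blast
    then have "mk X \<iota> Z \<in> cofs hda_model \<inter> weqs hda_model"
      using mk_cofs[OF x(2) Z(1,2)] mk_weqs[OF x(2) Z(1,2)] Z(4) by simp
    moreover have "cmp HDA (mk P \<rho> Y) (mk Z \<psi> P) \<in> fibs hda_model"
    proof -
      have "mk Z \<psi> P \<in> rlp HDA gen_tcofs" "mk P \<rho> Y \<in> rlp HDA gen_tcofs"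
        using rlp_gen_tcofs[OF Z(1) P(1) Z(3)] rlp_gen_tcofs[OF P(1) x(3) P(3)] tfib_fib[OF Z(5)] P(5)
        by blast+
      then show ?thesis
        using rlp_comp[OF _ _ _ _ gen_tcofs_mor, of "mk Z \<psi> P" Z P "mk P \<rho> Y" Y] Z P x
        by (simp add: hda_model_def HDA_Cat)
    qed
    moreover have "f = cmp HDA (cmp HDA (mk P \<rho> Y) (mk Z \<psi> P)) (mk X \<iota> Z)"
      using Z(6) P(6) by (simp add: HDA_Cat cmp_mk[OF Z(3)] cmp_mk[OF Z(2)] x(1) mk_eq_iff)
    moreover have "cmp HDA (mk P \<rho> Y) (mk Z \<psi> P) = mk Z (\<lambda>n x. \<rho> n (\<psi> n x)) Y"
      by (simp add: HDA_Cat cmp_mk[OF Z(3)])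
    ultimately show "\<exists>i\<in>cofs hda_model \<inter> weqs hda_model. \<exists>p\<in>fibs hda_model.
        target HDA i = source HDA p \<and> f = cmp HDA p i"
      by (intro bexI[of _ "mk X \<iota> Z"] bexI[of _ "cmp HDA (mk P \<rho> Y) (mk Z \<psi> P)"])
        (simp_all add: HDA_Cat)
  next
    fix X Y Z :: "('u, 'l) lps" and f g assume f: "f \<in> hom HDA X Y" and g: "g \<in> hom HDA Y Z"
    obtain \<phi> where ff: "f = mk X \<phi> Y" "lps_map X Y \<phi>" "ob True X" "ob True Y"
      using f unfolding HDA_Cat by (rule homE)
    obtain \<psi> where gg: "g = mk Y \<psi> Z" "lps_map Y Z \<psi>" "ob True Z"
      using g unfolding HDA_Cat by (auto elim: homE)
    note c = lps_map_comp[OF ff(2) gg(2)]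
    note w = mk_weqs[OF ff(3,4,2)] mk_weqs[OF ff(4) gg(3,2)] mk_weqs[OF ff(3) gg(3) c]
    have e: "cmp HDA g f = mk X (\<lambda>n x. \<psi> n (\<phi> n x)) Z" by (simp add: ff gg HDA_Cat cmp_mk)
    show "(f \<in> weqs hda_model \<and> g \<in> weqs hda_model \<longrightarrow> cmp HDA g f \<in> weqs hda_model) \<and>
        (f \<in> weqs hda_model \<and> cmp HDA g f \<in> weqs hda_model \<longrightarrow> g \<in> weqs hda_model) \<and>
        (g \<in> weqs hda_model \<and> cmp HDA g f \<in> weqs hda_model \<longrightarrow> f \<in> weqs hda_model)"
      unfolding e unfolding ff(1) gg(1) w
      using weq_comp[OF ff(2) gg(2)] weq_cancel_left[OF ob_object[OF ff(4)] ff(2) gg(2)]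
        weq_cancel_right[OF ob_object[OF ff(4)] ff(2) gg(2)] by blast
  qed
qed

end

section \<open>Colimits\<close>

definition restr :: "('a, 'l) lps \<Rightarrow> (nat \<Rightarrow> 'a set) \<Rightarrow> ('a, 'l) lps" where
  "restr X P = X\<lparr>und := (und X)\<lparr>cells := P\<rparr>\<rparr>"

lemma restr_simps [simp]: "cel (restr X P) = P" "res (restr X P) = res X" "lab (restr X P) = lab X"
  by (simp_all add: restr_def)

lemma lps_object_restr:
  assumes X: "lps_object X" and P: "\<And>x n. x \<in> P n \<Longrightarrow> x \<in> cel X n"
    and c: "\<And>m n f x. box m n f \<Longrightarrow> x \<in> P n \<Longrightarrow> res X m n f x \<in> P m"
  shows "lps_object (restr X P)"
proof (rule lps_objectI, unfold restr_simps)
  fix m n f x assume f: "box m n f" and x: "x \<in> P n"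
  show "res X m n f x \<in> P m" by (rule c[OF f x])
  show "lab X m (res X m n f x) = word_act m n f (lab X n x)" by (rule lab_res[OF X f P[OF x]])
next
  fix n x assume x: "x \<in> P n"
  show "res X n n (idb n) x = x" by (rule res_id[OF X P[OF x]])
  show "length (lab X n x) = n" by (rule length_lab[OF X P[OF x]])
next
  fix l m n f g x assume f: "box l m f" and g: "box m n g" and x: "x \<in> P n"
  show "res X l n (cb l g f) x = res X l m f (res X m n g x)" by (rule res_comp[OF X f g P[OF x]])
qed

lemma lps_map_restr: "(\<And>x n. x \<in> P n \<Longrightarrow> x \<in> cel X n) \<Longrightarrow> lps_map (restr X P) X (\<lambda>n x. x)"
  by (rule lps_mapI) simp_all

section \<open>Congruences and quotients\<close>

definition congr :: "bool \<Rightarrow> ('a, 'l) lps \<Rightarrow> (nat \<Rightarrow> ('a \<times> 'a) set) \<Rightarrow> bool" where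
  "congr b K r \<longleftrightarrow> (\<forall>n. equiv (cel K n) (r n)) \<and>
     (\<forall>m n f x y. box m n f \<longrightarrow> (x, y) \<in> r n \<longrightarrow> (res K m n f x, res K m n f y) \<in> r m) \<and>
     (\<forall>n x y. (x, y) \<in> r n \<longrightarrow> lab K n x = lab K n y) \<and>
     (b \<longrightarrow> (\<forall>n\<ge>2. \<forall>x\<in>cel K n. \<forall>y\<in>cel K n. lab K n x = lab K n y \<longrightarrow>
        (\<forall>m f. box m n f \<longrightarrow> m < n \<longrightarrow> (res K m n f x, res K m n f y) \<in> r m) \<longrightarrow> (x, y) \<in> r n))"

lemma congrI:
  assumes "\<And>n. equiv (cel K n) (r n)"
    and "\<And>m n f x y. box m n f \<Longrightarrow> (x, y) \<in> r n \<Longrightarrow> (res K m n f x, res K m n f y) \<in> r m"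
    and "\<And>n x y. (x, y) \<in> r n \<Longrightarrow> lab K n x = lab K n y"
    and "\<And>n x y. b \<Longrightarrow> n \<ge> 2 \<Longrightarrow> x \<in> cel K n \<Longrightarrow> y \<in> cel K n \<Longrightarrow> lab K n x = lab K n y \<Longrightarrow>
      (\<And>m f. box m n f \<Longrightarrow> m < n \<Longrightarrow> (res K m n f x, res K m n f y) \<in> r m) \<Longrightarrow> (x, y) \<in> r n"
  shows "congr b K r"
  unfolding congr_def using assms by (intro conjI allI impI ballI) blast+

lemma congrD:
  assumes "congr b K r"
  shows "equiv (cel K n) (r n)"
    and "box m n f \<Longrightarrow> (x, y) \<in> r n \<Longrightarrow> (res K m n f x, res K m n f y) \<in> r m"
    and "(x, y) \<in> r n \<Longrightarrow> lab K n x = lab K n y"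
  using assms unfolding congr_def by blast+

lemma congr_hda:
  assumes "congr b K r" b "n \<ge> 2" "x \<in> cel K n" "y \<in> cel K n" "lab K n x = lab K n y"
    and "\<And>m f. box m n f \<Longrightarrow> m < n \<Longrightarrow> (res K m n f x, res K m n f y) \<in> r m"
  shows "(x, y) \<in> r n"
proof -
  have "\<forall>n\<ge>2. \<forall>x\<in>cel K n. \<forall>y\<in>cel K n. lab K n x = lab K n y \<longrightarrow>
        (\<forall>m f. box m n f \<longrightarrow> m < n \<longrightarrow> (res K m n f x, res K m n f y) \<in> r m) \<longrightarrow> (x, y) \<in> r n"
    using assms(1,2) unfolding congr_def by blast
  then show ?thesis using assms(3-7) by blast
qed

lemma equivI':
  assumes "r \<subseteq> A \<times> A" "\<And>x. x \<in> A \<Longrightarrow> (x, x) \<in> r" "\<And>x y. (x, y) \<in> r \<Longrightarrow> (y, x) \<in> r"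
    and "\<And>x y z. (x, y) \<in> r \<Longrightarrow> (y, z) \<in> r \<Longrightarrow> (x, z) \<in> r"
  shows "equiv A r"
  using assms(1)
proof (rule equivI)
  show "refl_on A r" unfolding refl_on_def using assms(2) by blast
  show "sym r" by (rule symI) (rule assms(3))
  show "trans r" by (rule transI) (rule assms(4))
qed

lemma equivD:
  assumes "equiv A r"
  shows "(x, y) \<in> r \<Longrightarrow> x \<in> A" "(x, y) \<in> r \<Longrightarrow> y \<in> A" "x \<in> A \<Longrightarrow> (x, x) \<in> r" "(x, y) \<in> r \<Longrightarrow> (y, x) \<in> r"
    "(x, y) \<in> r \<Longrightarrow> (y, z) \<in> r \<Longrightarrow> (x, z) \<in> r"
  using assms by (auto simp: equiv_class_eq_iff[OF assms] equiv_def refl_on_def dest: symD transD)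

definition quot :: "('a, 'l) lps \<Rightarrow> (nat \<Rightarrow> ('a \<times> 'a) set) \<Rightarrow> ('a set, 'l) lps" where
  "quot K r = \<lparr>und = \<lparr>cells = (\<lambda>n. cel K n // r n),
     act = (\<lambda>m n f c. r m `` {res K m n f (SOME x. x \<in> c)})\<rparr>,
     lab = (\<lambda>n c. lab K n (SOME x. x \<in> c))\<rparr>"

context
  fixes b and K :: "('a, 'l) lps" and r
  assumes K: "lps_object K" and r: "congr b K r"
begin

lemma cel_quot: "cel (quot K r) n = (\<lambda>x. r n `` {x}) ` cel K n"
  by (auto simp: quot_def quotient_def)

lemma class_eq: "x \<in> cel K n \<Longrightarrow> y \<in> cel K n \<Longrightarrow> r n `` {x} = r n `` {y} \<longleftrightarrow> (x, y) \<in> r n"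
  by (rule eq_equiv_class_iff[OF congrD(1)[OF r]])

lemma some_class:
  assumes "x \<in> cel K n"
  shows "(x, SOME z. z \<in> r n `` {x}) \<in> r n"
proof -
  have "x \<in> r n `` {x}" using equiv_class_self[OF congrD(1)[OF r] assms] .
  then have "(SOME z. z \<in> r n `` {x}) \<in> r n `` {x}" by (rule someI)
  then show ?thesis by simp
qed

lemma lab_quot:
  assumes "x \<in> cel K n"
  shows "lab (quot K r) n (r n `` {x}) = lab K n x"
  using congrD(3)[OF r some_class[OF assms]] by (simp add: quot_def)

lemma res_quot:
  assumes x: "x \<in> cel K n" and f: "box m n f"
  shows "res (quot K r) m n f (r n `` {x}) = r m `` {res K m n f x}"
proof -
  have "(res K m n f x, res K m n f (SOME z. z \<in> r n `` {x})) \<in> r m"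
    by (rule congrD(2)[OF r f some_class[OF x]])
  then have "r m `` {res K m n f x} = r m `` {res K m n f (SOME z. z \<in> r n `` {x})}"
    by (rule equiv_class_eq[OF congrD(1)[OF r]])
  then show ?thesis by (simp add: quot_def)
qed

lemma lps_object_quot: "lps_object (quot K r)"
proof (rule lps_objectI)
  fix m n f c assume f: "box m n f" and "c \<in> cel (quot K r) n"
  then obtain x where x: "x \<in> cel K n" "c = r n `` {x}" by (auto simp: cel_quot)
  note rx = res_cel[OF K f x(1)]
  show "res (quot K r) m n f c \<in> cel (quot K r) m"
    unfolding x(2) res_quot[OF x(1) f] cel_quot using rx by blast
  show "lab (quot K r) m (res (quot K r) m n f c) = word_act m n f (lab (quot K r) n c)"
    unfolding x(2) res_quot[OF x(1) f] lab_quot[OF x(1)] lab_quot[OF rx] by (rule lab_res[OF K f x(1)])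
next
  fix n c assume "c \<in> cel (quot K r) n"
  then obtain x where x: "x \<in> cel K n" "c = r n `` {x}" by (auto simp: cel_quot)
  show "res (quot K r) n n (idb n) c = c"
    unfolding x(2) res_quot[OF x(1) box_id] res_id[OF K x(1)] ..
  show "length (lab (quot K r) n c) = n" unfolding x(2) lab_quot[OF x(1)]
    by (rule length_lab[OF K x(1)])
next
  fix l m n f g c assume f: "box l m f" and g: "box m n g" and "c \<in> cel (quot K r) n"
  then obtain x where x: "x \<in> cel K n" "c = r n `` {x}" by (auto simp: cel_quot)
  show "res (quot K r) l n (cb l g f) c = res (quot K r) l m f (res (quot K r) m n g c)"
    unfolding x(2) res_quot[OF x(1) g] res_quot[OF x(1) box_comp[OF f g]]
      res_quot[OF res_cel[OF K g x(1)] f] res_comp[OF K f g x(1)] ..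
qed

lemma lps_map_quot: "lps_map K (quot K r) (\<lambda>n x. r n `` {x})"
  by (rule lps_mapI) (auto simp: cel_quot lab_quot res_quot)

text \<open>The last clause of \<open>congr\<close> is designed for this: when \<open>b\<close>
  holds, quotients by congruences satisfy the HDA paradigm, so colimits in \<open>HDA\<close> arise
  in one stage, without a reflection afterwards.\<close>

lemma hda1_quot:
  assumes b
  shows "hda1 (quot K r)"
  unfolding hda1_def
proof (intro allI ballI impI)
  fix n :: nat and c d
  assume n: "n \<ge> 2" and c: "c \<in> cel (quot K r) n" and d: "d \<in> cel (quot K r) n"
    and l: "lab (quot K r) n c = lab (quot K r) n d"
    and eq: "\<forall>m f. box m n f \<longrightarrow> m < n \<longrightarrow> res (quot K r) m n f c = res (quot K r) m n f d"
  obtain x y where x: "x \<in> cel K n" "c = r n `` {x}" and y: "y \<in> cel K n" "d = r n `` {y}"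
    using c d by (auto simp: cel_quot)
  have "(x, y) \<in> r n"
  proof (rule congr_hda[OF r assms n x(1) y(1)])
    show "lab K n x = lab K n y" using l unfolding x(2) y(2) lab_quot[OF x(1)] lab_quot[OF y(1)] .
    fix m f assume f: "box m n f" "m < n"
    have "r m `` {res K m n f x} = r m `` {res K m n f y}"
      using eq f unfolding x(2) y(2) by (simp add: res_quot x(1) y(1))
    then show "(res K m n f x, res K m n f y) \<in> r m"
      using class_eq[OF res_cel[OF K f(1) x(1)] res_cel[OF K f(1) y(1)]] by blast
  qed
  then show "c = d" unfolding x(2) y(2) by (rule equiv_class_eq[OF congrD(1)[OF r]])
qed

end

text \<open>Equality of labels is built in: if no congruence contains \<open>R\<close>, the
  intersection over such congruences imposes no condition at all, and the result is still to be a
  congruence.\<close>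

definition gen_congr :: "bool \<Rightarrow> ('a, 'l) lps \<Rightarrow> (nat \<Rightarrow> ('a \<times> 'a) set) \<Rightarrow> nat \<Rightarrow> ('a \<times> 'a) set" where
  "gen_congr b K R n = {(x, y). x \<in> cel K n \<and> y \<in> cel K n \<and> lab K n x = lab K n y \<and>
     (\<forall>r. congr b K r \<longrightarrow> (\<forall>k. R k \<subseteq> r k) \<longrightarrow> (x, y) \<in> r n)}"

lemma gen_congrD:
  "(x, y) \<in> gen_congr b K R n \<Longrightarrow> congr b K r \<Longrightarrow> (\<And>k. R k \<subseteq> r k) \<Longrightarrow> (x, y) \<in> r n"
  unfolding gen_congr_def by blast

lemma gen_congrI:
  assumes "x \<in> cel K n" "y \<in> cel K n" "lab K n x = lab K n y"
    and "\<And>r. congr b K r \<Longrightarrow> (\<And>k. R k \<subseteq> r k) \<Longrightarrow> (x, y) \<in> r n"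
  shows "(x, y) \<in> gen_congr b K R n"
  using assms unfolding gen_congr_def by blast

lemma gen_congrE:
  assumes "(x, y) \<in> gen_congr b K R n"
  shows "x \<in> cel K n" "y \<in> cel K n" "lab K n x = lab K n y"
  using assms unfolding gen_congr_def by blast+

lemma congr_gen_congr:
  assumes K: "lps_object K"
  shows "congr b K (gen_congr b K R)"
proof (rule congrI)
  fix n
  show "equiv (cel K n) (gen_congr b K R n)"
  proof (rule equivI')
    show "gen_congr b K R n \<subseteq> cel K n \<times> cel K n"
      unfolding gen_congr_def by blast
    show "(x, x) \<in> gen_congr b K R n" if "x \<in> cel K n" for x
    proof (rule gen_congrI[OF that that refl])
      fix r assume r: "congr b K r"
      show "(x, x) \<in> r n" by (rule equivD(3)[OF congrD(1)[OF r] that])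
    qed
    show "(y, x) \<in> gen_congr b K R n" if xy: "(x, y) \<in> gen_congr b K R n" for x y
    proof (rule gen_congrI[OF gen_congrE(2,1)[OF xy] gen_congrE(3)[OF xy, symmetric]])
      fix r assume r: "congr b K r" "\<And>k. R k \<subseteq> r k"
      show "(y, x) \<in> r n" by (rule equivD(4)[OF congrD(1)[OF r(1)] gen_congrD[OF xy r]])
    qed
    show "(x, z) \<in> gen_congr b K R n" if xy: "(x, y) \<in> gen_congr b K R n"
      and yz: "(y, z) \<in> gen_congr b K R n"
      for x y z
    proof (rule gen_congrI)
      fix r assume r: "congr b K r" "\<And>k. R k \<subseteq> r k"
      show "(x, z) \<in> r n"
        by (rule equivD(5)[OF congrD(1)[OF r(1)] gen_congrD[OF xy r] gen_congrD[OF yz r]])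
    qed (use gen_congrE[OF xy] gen_congrE[OF yz] in simp_all)
  qed
next
  fix m n f x y assume f: "box m n f" and xy: "(x, y) \<in> gen_congr b K R n"
  note * = gen_congrE[OF xy]
  show "(res K m n f x, res K m n f y) \<in> gen_congr b K R m"
  proof (rule gen_congrI)
    show "lab K m (res K m n f x) = lab K m (res K m n f y)"
      using lab_res[OF K f] * by simp
    fix r assume r: "congr b K r" "\<And>k. R k \<subseteq> r k"
    show "(res K m n f x, res K m n f y) \<in> r m"
      by (rule congrD(2)[OF r(1) f gen_congrD[OF xy r]])
  qed (use res_cel[OF K f] * in simp_all)
next
  fix n x y assume "(x, y) \<in> gen_congr b K R n"
  then show "lab K n x = lab K n y" by (rule gen_congrE)
next
  fix n x y
  assume *: b "n \<ge> 2" "x \<in> cel K n" "y \<in> cel K n" "lab K n x = lab K n y"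
    and eq: "\<And>m f. box m n f \<Longrightarrow> m < n \<Longrightarrow> (res K m n f x, res K m n f y) \<in> gen_congr b K R m"
  show "(x, y) \<in> gen_congr b K R n"
  proof (rule gen_congrI[OF *(3-5)])
    fix r assume r: "congr b K r" "\<And>k. R k \<subseteq> r k"
    show "(x, y) \<in> r n"
      by (rule congr_hda[OF r(1) *]) (rule gen_congrD[OF eq r])
  qed
qed

text \<open>When the target satisfies the HDA paradigm, the kernel of a map is closed under the last
  clause of \<open>congr\<close>. The universal property of quotients by generated congruences rests
  on this.\<close>

lemma congr_kernel:
  assumes K: "lps_object K" and \<mu>: "lps_map K M \<mu>" and M: "b \<Longrightarrow> hda1 M"
  shows "congr b K (\<lambda>n. {(x, y). x \<in> cel K n \<and> y \<in> cel K n \<and> \<mu> n x = \<mu> n y})"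
proof (rule congrI)
  fix n
  show "equiv (cel K n) {(x, y). x \<in> cel K n \<and> y \<in> cel K n \<and> \<mu> n x = \<mu> n y}"
    by (rule equivI') auto
next
  fix m n f x y assume f: "box m n f" and "(x, y) \<in> {(x, y). x \<in> cel K n \<and> y \<in> cel K n \<and> \<mu> n x = \<mu> n y}"
  then show "(res K m n f x, res K m n f y) \<in> {(x, y). x \<in> cel K m \<and> y \<in> cel K m \<and> \<mu> m x = \<mu> m y}"
    using res_cel[OF K f] map_res[OF \<mu> f] by simp
next
  fix n x y assume "(x, y) \<in> {(x, y). x \<in> cel K n \<and> y \<in> cel K n \<and> \<mu> n x = \<mu> n y}"
  then show "lab K n x = lab K n y" using map_lab[OF \<mu>, of x n] map_lab[OF \<mu>, of y n] by simp
next
  fix n x y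
  assume *: b "n \<ge> 2" "x \<in> cel K n" "y \<in> cel K n" "lab K n x = lab K n y"
    and eq: "\<And>m f. box m n f \<Longrightarrow> m < n \<Longrightarrow> (res K m n f x, res K m n f y) \<in>
      {(x, y). x \<in> cel K m \<and> y \<in> cel K m \<and> \<mu> m x = \<mu> m y}"
  have "\<mu> n x = \<mu> n y"
    by (rule hda1D[OF M[OF *(1)] *(2)])
      (use *(3-5) eq map_cel[OF \<mu>] map_lab[OF \<mu>] map_res[OF \<mu>, symmetric] in simp_all)
  then show "(x, y) \<in> {(x, y). x \<in> cel K n \<and> y \<in> cel K n \<and> \<mu> n x = \<mu> n y}" using * by simp
qed

section \<open>Sums, and colimits described by their cells\<close>

definition sum_lps :: "'i set \<Rightarrow> ('i \<Rightarrow> ('a, 'l) lps) \<Rightarrow> ('i \<times> 'a, 'l) lps" where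
  "sum_lps I X = \<lparr>und = \<lparr>cells = (\<lambda>n. {(i, x). i \<in> I \<and> x \<in> cel (X i) n}),
     act = (\<lambda>m n f (i, x). (i, res (X i) m n f x))\<rparr>, lab = (\<lambda>n (i, x). lab (X i) n x)\<rparr>"

lemma sum_lps_simps [simp]:
  "(i, x) \<in> cel (sum_lps I X) n \<longleftrightarrow> i \<in> I \<and> x \<in> cel (X i) n"
  "res (sum_lps I X) m n f (i, x) = (i, res (X i) m n f x)"
  "lab (sum_lps I X) n (i, x) = lab (X i) n x"
  by (auto simp: sum_lps_def)

lemma lps_object_sum:
  assumes "\<And>i. i \<in> I \<Longrightarrow> lps_object (X i)"
  shows "lps_object (sum_lps I X)"
proof (rule lps_objectI)
  fix m n f p assume f: "box m n f" and p: "p \<in> cel (sum_lps I X) n"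
  obtain i x where "p = (i, x)" "i \<in> I" "x \<in> cel (X i) n" using p by (cases p) simp
  then show "res (sum_lps I X) m n f p \<in> cel (sum_lps I X) m"
    "lab (sum_lps I X) m (res (sum_lps I X) m n f p) = word_act m n f (lab (sum_lps I X) n p)"
    using res_cel[OF assms f] lab_res[OF assms f] by simp_all
next
  fix n p assume p: "p \<in> cel (sum_lps I X) n"
  obtain i x where "p = (i, x)" "i \<in> I" "x \<in> cel (X i) n" using p by (cases p) simp
  then show "res (sum_lps I X) n n (idb n) p = p" "length (lab (sum_lps I X) n p) = n"
    using res_id[OF assms] length_lab[OF assms] by simp_all
next
  fix l m n f g p assume f: "box l m f" and g: "box m n g" and p: "p \<in> cel (sum_lps I X) n"
  obtain i x where "p = (i, x)" "i \<in> I" "x \<in> cel (X i) n" using p by (cases p) simp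
  then show "res (sum_lps I X) l n (cb l g f) p = res (sum_lps I X) l m f (res (sum_lps I X) m n g p)"
    using res_comp[OF assms f g] by simp
qed

text \<open>The legs are jointly surjective and identify only what the generated congruence
  identifies. The universal property follows from this description, and it allows cells of colimits
  to be computed.\<close>

definition colim :: "bool \<Rightarrow> 'i set \<Rightarrow> ('i \<Rightarrow> ('u, 'l) lps) \<Rightarrow> (nat \<Rightarrow> (('i \<times> 'u) \<times> ('i \<times> 'u)) set) \<Rightarrow>
    ('u, 'l) lps \<Rightarrow> ('i \<Rightarrow> nat \<Rightarrow> 'u \<Rightarrow> 'u) \<Rightarrow> bool" where
  "colim b I X R L \<iota> \<longleftrightarrow> ob b L \<and> (\<forall>i\<in>I. lps_map (X i) L (\<iota> i)) \<and>
     (\<forall>n i x j y. ((i, x), (j, y)) \<in> R n \<longrightarrow> \<iota> i n x = \<iota> j n y) \<and>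
     (\<forall>n. \<forall>z\<in>cel L n. \<exists>i\<in>I. \<exists>x\<in>cel (X i) n. z = \<iota> i n x) \<and>
     (\<forall>n. \<forall>i\<in>I. \<forall>x\<in>cel (X i) n. \<forall>j\<in>I. \<forall>y\<in>cel (X j) n. \<iota> i n x = \<iota> j n y \<longrightarrow>
        ((i, x), (j, y)) \<in> gen_congr b (sum_lps I X) R n)"

lemma colimD:
  assumes "colim b I X R L \<iota>"
  shows "ob b L" "i \<in> I \<Longrightarrow> lps_map (X i) L (\<iota> i)" "((i, x), (j, y)) \<in> R n \<Longrightarrow> \<iota> i n x = \<iota> j n y"
    "z \<in> cel L n \<Longrightarrow> \<exists>i\<in>I. \<exists>x\<in>cel (X i) n. z = \<iota> i n x"
    "i \<in> I \<Longrightarrow> x \<in> cel (X i) n \<Longrightarrow> j \<in> I \<Longrightarrow> y \<in> cel (X j) n \<Longrightarrow> \<iota> i n x = \<iota> j n y \<Longrightarrow>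
        ((i, x), (j, y)) \<in> gen_congr b (sum_lps I X) R n"
  using assms unfolding colim_def by (elim conjE; blast)+

lemma (in small_labels) colim_exists:
  fixes X :: "'i \<Rightarrow> ('u, 'l) lps"
  assumes I: "small TYPE('u) I" and X: "\<And>i. i \<in> I \<Longrightarrow> ob b (X i)"
    and R: "\<And>n p q. (p, q) \<in> R n \<Longrightarrow>
      p \<in> cel (sum_lps I X) n \<and> q \<in> cel (sum_lps I X) n \<and> lab (sum_lps I X) n p = lab (sum_lps I X) n q"
  shows "\<exists>L \<iota>. colim b I X R L \<iota>"
proof -
  let ?K = "sum_lps I X" and ?r = "gen_congr b (sum_lps I X) R"
  have K: "lps_object ?K" by (rule lps_object_sum) (rule ob_object[OF X])
  note r = congr_gen_congr[OF K, of b R]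
  have "small TYPE('u) (cel ?K n)" for n
  proof (rule small_subset)
    show "small TYPE('u) (Sigma I (\<lambda>i. cel (X i) n))" by (intro small_Sigma I ob_small[OF X])
    show "cel ?K n \<subseteq> Sigma I (\<lambda>i. cel (X i) n)" by (auto simp: sum_lps_def)
  qed
  then have sm: "small TYPE('u) (cel (quot ?K ?r) n)" for n
    unfolding cel_quot[OF K r] by (rule small_image)
  obtain L e d where L: "ob b (L :: ('u, 'l) lps)" and i: "lps_iso (quot ?K ?r) L e d"
    using representative[OF lps_object_quot[OF K r] _ sm, of b] hda1_quot[OF K r] by blast
  let ?\<iota> = "\<lambda>i n x. e n (?r n `` {(i, x)})"
  have "colim b I X R L ?\<iota>"
    unfolding colim_def
  proof (intro conjI allI ballI impI)
    show "ob b L" by (rule L)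
    fix i assume ii: "i \<in> I"
    have "lps_map (X i) ?K (\<lambda>n x. (i, x))" by (rule lps_mapI) (simp_all add: ii)
    from lps_map_comp[OF lps_map_comp[OF this lps_map_quot[OF K r]] lps_isoD(1)[OF i]]
    show "lps_map (X i) L (?\<iota> i)" .
  next
    fix n i x j y assume *: "((i, x), (j, y)) \<in> R n"
    have "((i, x), (j, y)) \<in> ?r n"
      using R[OF *] * by (intro gen_congrI) blast+
    then have "?r n `` {(i, x)} = ?r n `` {(j, y)}" by (rule equiv_class_eq[OF congrD(1)[OF r]])
    then show "?\<iota> i n x = ?\<iota> j n y" by simp
  next
    fix n z assume z: "z \<in> cel L n"
    have "d n z \<in> cel (quot ?K ?r) n" by (rule map_cel[OF lps_isoD(2)[OF i] z])
    then obtain p where p: "p \<in> cel ?K n" "d n z = ?r n `` {p}" unfolding cel_quot[OF K r] by blast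
    then have "z = e n (?r n `` {p})" using lps_isoD(4)[OF i z] by simp
    then show "\<exists>i\<in>I. \<exists>x\<in>cel (X i) n. z = ?\<iota> i n x" using p(1) by (cases p) auto
  next
    fix n i x j y assume *: "i \<in> I" "x \<in> cel (X i) n" "j \<in> I" "y \<in> cel (X j) n" "?\<iota> i n x = ?\<iota> j n y"
    have c: "(i, x) \<in> cel ?K n" "(j, y) \<in> cel ?K n" using * by simp_all
    have "?r n `` {(i, x)} \<in> cel (quot ?K ?r) n" "?r n `` {(j, y)} \<in> cel (quot ?K ?r) n"
      unfolding cel_quot[OF K r] using c by blast+
    then have "?r n `` {(i, x)} = ?r n `` {(j, y)}" using *(5) lps_isoD(3)[OF i] by metis
    then show "((i, x), (j, y)) \<in> ?r n" using class_eq[OF K r c] by blast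
  qed
  then show ?thesis by blast
qed

lemma colim_desc:
  assumes X: "\<And>i. i \<in> I \<Longrightarrow> lps_object (X i)" and L: "colim b I X R L \<iota>" and M: "b \<Longrightarrow> hda1 M"
    and \<mu>: "\<And>i. i \<in> I \<Longrightarrow> lps_map (X i) M (\<mu> i)"
    and R: "\<And>n i x j y. ((i, x), (j, y)) \<in> R n \<Longrightarrow> i \<in> I \<and> j \<in> I \<and> x \<in> cel (X i) n \<and> y \<in> cel (X j) n \<and>
      \<mu> i n x = \<mu> j n y"
  shows "\<exists>h. lps_map L M h \<and> (\<forall>i\<in>I. \<forall>n. \<forall>x\<in>cel (X i) n. h n (\<iota> i n x) = \<mu> i n x)"
proof -
  let ?K = "sum_lps I X"
  have K: "lps_object ?K" by (rule lps_object_sum[OF X])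
  define \<nu> where "\<nu> n = (\<lambda>(i, x). \<mu> i n x)" for n
  have \<nu>: "lps_map ?K M \<nu>"
  proof (rule lps_mapI)
    fix n p assume "p \<in> cel ?K n"
    then obtain i x where p: "p = (i, x)" "i \<in> I" "x \<in> cel (X i) n" by (cases p) simp
    then show "\<nu> n p \<in> cel M n" "lab M n (\<nu> n p) = lab ?K n p"
      using map_cel[OF \<mu>] map_lab[OF \<mu>] by (simp_all add: \<nu>_def)
    fix m f assume "box m n f"
    then show "\<nu> m (res ?K m n f p) = res M m n f (\<nu> n p)"
      using map_res[OF \<mu>] p by (simp add: \<nu>_def)
  qed
  have ker: "\<mu> i n x = \<mu> j n y"
    if *: "i \<in> I" "x \<in> cel (X i) n" "j \<in> I" "y \<in> cel (X j) n" "\<iota> i n x = \<iota> j n y" for i x j y n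
  proof -
    have "((i, x), (j, y)) \<in> {(x, y). x \<in> cel ?K n \<and> y \<in> cel ?K n \<and> \<nu> n x = \<nu> n y}"
    proof (rule gen_congrD[OF colimD(5)[OF L *] congr_kernel[OF K \<nu> M]])
      show "R k \<subseteq> {(x, y). x \<in> cel ?K k \<and> y \<in> cel ?K k \<and> \<nu> k x = \<nu> k y}" for k
        using R by (auto simp: \<nu>_def) 
    qed
    then show ?thesis by (simp add: \<nu>_def)
  qed
  define h where "h n z = (let p = SOME p. p \<in> cel ?K n \<and> z = \<iota> (fst p) n (snd p) in \<nu> n p)" for n z
  have h: "h n (\<iota> i n x) = \<mu> i n x" if *: "i \<in> I" "x \<in> cel (X i) n" for i n x
  proof -
    let ?P = "\<lambda>p. p \<in> cel ?K n \<and> \<iota> i n x = \<iota> (fst p) n (snd p)"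
    have P: "?P (SOME p. ?P p)" by (rule someI[of ?P "(i, x)"]) (simp add: *)
    obtain j y where jy: "(SOME p. ?P p) = (j, y)" by (cases "SOME p. ?P p")
    have "\<mu> i n x = \<mu> j n y" using P jy by (intro ker *) simp_all
    then show ?thesis by (simp add: h_def jy \<nu>_def)
  qed
  have "lps_map L M h"
  proof (rule lps_mapI)
    fix n z assume z: "z \<in> cel L n"
    obtain i x where ix: "i \<in> I" "x \<in> cel (X i) n" "z = \<iota> i n x" using colimD(4)[OF L z] by blast
    show "h n z \<in> cel M n" "lab M n (h n z) = lab L n z"
      unfolding ix(3) h[OF ix(1,2)] map_lab[OF colimD(2)[OF L ix(1)] ix(2)] map_lab[OF \<mu>[OF ix(1)]
        ix(2)]
      by (rule map_cel[OF \<mu>[OF ix(1)] ix(2)] refl)+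
    fix m f assume f: "box m n f"
    show "h m (res L m n f z) = res M m n f (h n z)"
      unfolding ix(3) h[OF ix(1,2)] map_res[OF colimD(2)[OF L ix(1)] f ix(2), symmetric]
        h[OF ix(1) res_cel[OF X[OF ix(1)] f ix(2)]] by (rule map_res[OF \<mu>[OF ix(1)] f ix(2)])
  qed
  then show ?thesis using h by blast
qed

lemma colim_unique:
  assumes L: "colim b I X R L \<iota>" and "\<And>i n x. i \<in> I \<Longrightarrow> x \<in> cel (X i) n \<Longrightarrow> h n (\<iota> i n x) = k n (\<iota> i n x)"
    and "z \<in> cel L n"
  shows "h n z = k n z"
  using colimD(4)[OF L assms(3)] assms(2) by blast

section \<open>Morphisms as functions on cells, and colimits of diagrams\<close>

definition fn :: "('u, 'l) lmor \<Rightarrow> nat \<Rightarrow> 'u \<Rightarrow> 'u" where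
  "fn f = fst (snd f)"

lemma hom_fn:
  assumes "f \<in> hom (Cat b) X Y"
  shows "f = mk X (fn f) Y" "lps_map X Y (fn f)" "ob b X" "ob b Y"
proof -
  obtain \<phi> where f: "f = mk X \<phi> Y" "lps_map X Y \<phi>" "ob b X" "ob b Y" using assms by (rule homE)
  have eq: "fn f n x = \<phi> n x" if "x \<in> cel X n" for n x using that by (simp add: f(1) fn_def mk_def)
  show "f = mk X (fn f) Y" unfolding f(1) mk_eq_iff using eq f(1) by simp
  show "lps_map X Y (fn f)" by (rule lps_map_cong[OF ob_object[OF f(3)] f(2) eq])
  show "ob b X" "ob b Y" by (rule f)+
qed

lemma mk_fn: "f \<in> hom (Cat b) X Y \<Longrightarrow> mk X (fn f) Y = f"
  by (rule hom_fn(1)[symmetric])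

lemma fn_mk: "x \<in> cel X n \<Longrightarrow> fn (mk X \<phi> Y) n x = \<phi> n x"
  by (simp add: fn_def mk_def)

lemma cmp_fn:
  assumes "f \<in> hom (Cat b) X Y" "g \<in> hom (Cat b) Y Z"
  shows "cmp (Cat b) g f = mk X (\<lambda>n x. fn g n (fn f n x)) Z"
  using cmp_mk[OF hom_fn(2)[OF assms(1)], of b "fn g" Z]
    unfolding mk_fn[OF assms(1)] mk_fn[OF assms(2)] .

lemma fn_cmp:
  assumes "f \<in> hom (Cat b) X Y" "g \<in> hom (Cat b) Y Z" "x \<in> cel X n"
  shows "fn (cmp (Cat b) g f) n x = fn g n (fn f n x)"
  unfolding cmp_fn[OF assms(1,2)] by (rule fn_mk[OF assms(3)])

lemma hom_eqI:
  assumes "f \<in> hom (Cat b) X Y" "g \<in> hom (Cat b) X Y" "\<And>n x. x \<in> cel X n \<Longrightarrow> fn f n x = fn g n x"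
  shows "f = g"
proof -
  have "mk X (fn f) Y = mk X (fn g) Y" unfolding mk_eq_iff using assms(3) by simp
  then show ?thesis using mk_fn[OF assms(1)] mk_fn[OF assms(2)] by simp
qed

lemma hom_op_cat [simp]: "hom (op_cat C) X Y = hom C Y X"
  by (auto simp: hom_def op_cat_def)

lemma op_cat_simps [simp]:
  "obj (op_cat C) = obj C" "mor (op_cat C) = mor C" "cmp (op_cat C) g f = cmp C f g"
  "source (op_cat C) = target C" "target (op_cat C) = source C" "idm (op_cat C) = idm C"
  by (simp_all add: op_cat_def)

definition is_cocone where
  "is_cocone J C Fo Fm M \<mu> \<longleftrightarrow> M \<in> obj C \<and> (\<forall>j\<in>obj J. \<mu> j \<in> hom C (Fo j) M) \<and>
     (\<forall>i j u. u \<in> hom J i j \<longrightarrow> cmp C (\<mu> j) (Fm u) = \<mu> i)"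

lemma is_colimit_iff:
  "is_colimit J C Fo Fm L \<iota> \<longleftrightarrow> is_cocone J C Fo Fm L \<iota> \<and>
    (\<forall>M \<mu>. is_cocone J C Fo Fm M \<mu> \<longrightarrow>
      (\<exists>!h. h \<in> hom C L M \<and> (\<forall>j\<in>obj J. cmp C h (\<iota> j) = \<mu> j)))"
proof -
  have "is_cone (op_cat J) (op_cat C) Fo Fm M \<mu> \<longleftrightarrow> is_cocone J C Fo Fm M \<mu>" for M \<mu>
    unfolding is_cone_def is_cocone_def by auto
  then show ?thesis unfolding is_colimit_def is_limit_def by simp
qed

definition diagram_rel where
  "diagram_rel J Fo Fm n = {((i, x), (j, y)) | i x j y. \<exists>u. u \<in> hom J i j \<and> x \<in> cel (Fo i) n \<and> y =
    fn (Fm u) n x}"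

lemma hom_is_obj: "is_category J \<Longrightarrow> u \<in> hom J i j \<Longrightarrow> i \<in> obj J \<and> j \<in> obj J"
  unfolding is_category_def hom_def by blast

lemma functorD:
  assumes "is_functor J C Fo Fm"
  shows "j \<in> obj J \<Longrightarrow> Fo j \<in> obj C" "u \<in> hom J i j \<Longrightarrow> Fm u \<in> hom C (Fo i) (Fo j)"
    "j \<in> obj J \<Longrightarrow> Fm (idm J j) = idm C (Fo j)"
    "u \<in> hom J i j \<Longrightarrow> v \<in> hom J j k \<Longrightarrow> Fm (cmp J v u) = cmp C (Fm v) (Fm u)"
  using assms unfolding is_functor_def by blast+

lemma is_colimit_colim:
  fixes Fo :: "'j \<Rightarrow> ('u, 'l) lps"
  assumes J: "is_category J" and F: "is_functor J (Cat b) Fo Fm"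
    and L: "colim b (obj J) Fo (diagram_rel J Fo Fm) L \<iota>"
  shows "is_colimit J (Cat b) Fo Fm L (\<lambda>j. mk (Fo j) (\<iota> j) L)"
  unfolding is_colimit_iff
proof (intro conjI allI impI)
  have o: "ob b (Fo j)" if "j \<in> obj J" for j using functorD(1)[OF F that] by simp
  show "is_cocone J (Cat b) Fo Fm L (\<lambda>j. mk (Fo j) (\<iota> j) L)"
    unfolding is_cocone_def
  proof (intro conjI ballI allI impI)
    show "L \<in> obj (Cat b)" using colimD(1)[OF L] by simp
    show "mk (Fo j) (\<iota> j) L \<in> hom (Cat b) (Fo j) L" if "j \<in> obj J" for j
      using o[OF that] colimD(1)[OF L] colimD(2)[OF L that] by simp
    fix i j u assume u: "u \<in> hom J i j"
    note f = hom_fn[OF functorD(2)[OF F u]]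
    have "\<iota> j n (fn (Fm u) n x) = \<iota> i n x" if "x \<in> cel (Fo i) n" for n x
      by (rule colimD(3)[OF L, symmetric]) (use that u in \<open>auto simp: diagram_rel_def\<close>)
    then have "cmp (Cat b) (mk (Fo j) (\<iota> j) L) (mk (Fo i) (fn (Fm u)) (Fo j)) = mk (Fo i) (\<iota> i) L"
      by (simp add: cmp_mk[OF f(2)] mk_eq_iff)
    then show "cmp (Cat b) (mk (Fo j) (\<iota> j) L) (Fm u) = mk (Fo i) (\<iota> i) L"
      unfolding mk_fn[OF functorD(2)[OF F u]] .
  qed
  fix M \<mu> assume M: "is_cocone J (Cat b) Fo Fm M \<mu>"
  have Mo: "ob b M" and \<mu>: "\<And>j. j \<in> obj J \<Longrightarrow> \<mu> j \<in> hom (Cat b) (Fo j) M"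
    and c: "\<And>i j u. u \<in> hom J i j \<Longrightarrow> cmp (Cat b) (\<mu> j) (Fm u) = \<mu> i"
    using M unfolding is_cocone_def by simp_all
  have R: "i \<in> obj J \<and> j \<in> obj J \<and> x \<in> cel (Fo i) n \<and> y \<in> cel (Fo j) n \<and> fn (\<mu> i) n x = fn (\<mu> j) n y"
    if xy: "((i, x), (j, y)) \<in> diagram_rel J Fo Fm n" for n i x j y
  proof -
    obtain u where u: "u \<in> hom J i j" "x \<in> cel (Fo i) n" "y = fn (Fm u) n x"
      using xy unfolding diagram_rel_def by blast
    have "fn (\<mu> i) n x = fn (cmp (Cat b) (\<mu> j) (Fm u)) n x" using c[OF u(1)] by simp
    also have "\<dots> = fn (\<mu> j) n y"
      unfolding u(3) by (rule fn_cmp[OF functorD(2)[OF F u(1)] \<mu> u(2)]) (use hom_is_obj[OF J u(1)]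
        in simp)
    finally show ?thesis
      using hom_is_obj[OF J u(1)] u(2,3) map_cel[OF hom_fn(2)[OF functorD(2)[OF F u(1)]] u(2)] by simp
  qed
  obtain h where h: "lps_map L M h"
      "\<forall>i\<in>obj J. \<forall>n. \<forall>x\<in>cel (Fo i) n. h n (\<iota> i n x) = fn (\<mu> i) n x"
    using colim_desc[OF _ L _ hom_fn(2)[OF \<mu>] R] ob_object[OF o] Mo by (auto simp: ob_def)
  show "\<exists>!h. h \<in> hom (Cat b) L M \<and> (\<forall>j\<in>obj J. cmp (Cat b) h (mk (Fo j) (\<iota> j) L) = \<mu> j)"
  proof (rule ex1I[of _ "mk L h M"])
    have "cmp (Cat b) (mk L h M) (mk (Fo j) (\<iota> j) L) = \<mu> j" if j: "j \<in> obj J" for j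
    proof -
      have "cmp (Cat b) (mk L h M) (mk (Fo j) (\<iota> j) L) = mk (Fo j) (fn (\<mu> j)) M"
        unfolding cmp_mk[OF colimD(2)[OF L j]] mk_eq_iff using h(2) j by simp
      then show ?thesis using mk_fn[OF \<mu>[OF j]] by simp
    qed
    then show "mk L h M \<in> hom (Cat b) L M \<and> (\<forall>j\<in>obj J. cmp (Cat b) (mk L h M) (mk (Fo j) (\<iota> j) L) =
      \<mu> j)"
      using Mo h(1) colimD(1)[OF L] by simp
    fix k assume k: "k \<in> hom (Cat b) L M \<and> (\<forall>j\<in>obj J. cmp (Cat b) k (mk (Fo j) (\<iota> j) L) = \<mu> j)"
    then have kh: "k \<in> hom (Cat b) L M" by simp
    show "k = mk L h M"
    proof (rule hom_eqI[OF kh])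
      show "mk L h M \<in> hom (Cat b) L M" using Mo h(1) colimD(1)[OF L] by simp
      fix n z assume z: "z \<in> cel L n"
      have "fn k n z = h n z"
      proof (rule colim_unique[OF L _ z])
        fix j n x assume jx: "j \<in> obj J" "x \<in> cel (Fo j) n"
        have m: "mk (Fo j) (\<iota> j) L \<in> hom (Cat b) (Fo j) L"
          using o[OF jx(1)] colimD(1)[OF L] colimD(2)[OF L jx(1)] by simp
        have "fn k n (\<iota> j n x) = fn (cmp (Cat b) k (mk (Fo j) (\<iota> j) L)) n x"
          unfolding fn_cmp[OF m kh jx(2)] fn_mk[OF jx(2)] ..
        also have "\<dots> = fn (\<mu> j) n x" using k jx(1) by simp
        finally show "fn k n (\<iota> j n x) = h n (\<iota> j n x)" using h(2) jx by simp
      qed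
      then show "fn k n z = fn (mk L h M) n z" using fn_mk[OF z] by simp
    qed
  qed
qed

context small_labels
begin

lemma diagram_colim:
  fixes Fo :: "'j \<Rightarrow> ('u, 'l) lps"
  assumes J: "is_category J" and sm: "small TYPE('u) (obj J)" and F: "is_functor J (Cat b) Fo Fm"
  shows "\<exists>L \<iota>. colim b (obj J) Fo (diagram_rel J Fo Fm) L \<iota>"
proof (rule colim_exists[OF sm])
  show "ob b (Fo i)" if "i \<in> obj J" for i using functorD(1)[OF F that] by simp
  fix n p q assume "(p, q) \<in> diagram_rel J Fo Fm n"
  then obtain i x j u where *: "p = (i, x)" "q = (j, fn (Fm u) n x)" "u \<in> hom J i j" "x \<in> cel (Fo i) n"
    unfolding diagram_rel_def by blast
  note m = hom_fn(2)[OF functorD(2)[OF F *(3)]]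
  show "p \<in> cel (sum_lps (obj J) Fo) n \<and> q \<in> cel (sum_lps (obj J) Fo) n \<and>
      lab (sum_lps (obj J) Fo) n p = lab (sum_lps (obj J) Fo) n q"
    using * hom_is_obj[OF J *(3)] map_cel[OF m *(4)] map_lab[OF m *(4)] by simp
qed

lemma cocomplete_Cat: "cocomplete TYPE('u) (Cat b :: (('u, 'l) lps, ('u, 'l) lmor) category)"
  unfolding cocomplete_def using diagram_colim is_colimit_colim by blast

section \<open>Pushouts, and the cells of arbitrary colimits\<close>

lemma pushout_exists:
  assumes f: "f \<in> hom (Cat b) A B" and g: "g \<in> hom (Cat b) A (C :: ('u, 'l) lps)"
  shows "\<exists>t. is_pushout (Cat b) f g t"
proof -
  let ?X = "\<lambda>i. if i then C else B"
  let ?R = "\<lambda>n. {((False, fn f n a), (True, fn g n a)) | a. a \<in> cel A n}"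
  have o: "ob b (?X i)" for i using hom_fn(4)[OF f] hom_fn(4)[OF g] by simp
  have Rc: "fn f n a \<in> cel B n" "fn g n a \<in> cel C n" "lab B n (fn f n a) = lab A n a"
    "lab C n (fn g n a) = lab A n a" if "a \<in> cel A n" for n a
    using map_cel[OF hom_fn(2)[OF f] that] map_cel[OF hom_fn(2)[OF g] that]
      map_lab[OF hom_fn(2)[OF f] that] map_lab[OF hom_fn(2)[OF g] that] by simp_all
  have "\<exists>L \<iota>. colim b UNIV ?X ?R L \<iota>"
    by (rule colim_exists[OF small_bool o]) (use Rc in auto)
  then obtain Q \<iota> where Q: "colim b UNIV ?X ?R Q \<iota>" by blast
  have m: "lps_map B Q (\<iota> False)" "lps_map C Q (\<iota> True)"
    using colimD(2)[OF Q, of False] colimD(2)[OF Q, of True] by simp_all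
  note Qo = colimD(1)[OF Q]
  let ?i = "mk B (\<iota> False) Q" and ?j = "mk C (\<iota> True) Q"
  have ij: "?i \<in> hom (Cat b) B Q" "?j \<in> hom (Cat b) C Q"
    using m Qo hom_fn(4)[OF f] hom_fn(4)[OF g] by simp_all
  have "is_pushout (Cat b) f g (Q, ?i, ?j)"
    unfolding is_pushout_def prod.case
  proof (intro conjI allI impI; (elim conjE)?)
    have tf: "target (Cat b) f = B" "target (Cat b) g = C" using f g by (simp_all add: hom_def)
    show "Q \<in> obj (Cat b)" using Qo by simp
    show "?i \<in> hom (Cat b) (target (Cat b) f) Q" "?j \<in> hom (Cat b) (target (Cat b) g) Q"
      unfolding tf by (rule ij)+
    show "cmp (Cat b) ?i f = cmp (Cat b) ?j g"
    proof (rule hom_eqI[OF cmp_hom[OF f ij(1)] cmp_hom[OF g ij(2)]])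
      fix n a assume a: "a \<in> cel A n"
      show "fn (cmp (Cat b) ?i f) n a = fn (cmp (Cat b) ?j g) n a"
        unfolding fn_cmp[OF f ij(1) a] fn_cmp[OF g ij(2) a] fn_mk[OF Rc(1)[OF a]] fn_mk[OF Rc(2)[OF a]]
        by (rule colimD(3)[OF Q]) (use a in blast)
    qed
    fix Z p q assume "p \<in> hom (Cat b) (target (Cat b) f) Z" "q \<in> hom (Cat b) (target (Cat b) g) Z"
      and eq: "cmp (Cat b) p f = cmp (Cat b) q g"
    then have p: "p \<in> hom (Cat b) B Z" and q: "q \<in> hom (Cat b) C Z" by (simp_all add: tf)
    have pq: "fn p n (fn f n a) = fn q n (fn g n a)" if a: "a \<in> cel A n" for n a
      using fn_cmp[OF f p a] fn_cmp[OF g q a] eq by simp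
    have \<mu>: "lps_map (?X i) Z (if i then fn q else fn p)" for i
      using hom_fn(2)[OF p] hom_fn(2)[OF q] by simp
    have M: "b \<Longrightarrow> hda1 Z" using hom_fn(4)[OF p] by (simp add: ob_def)
    have "\<exists>h. lps_map Q Z h \<and> (\<forall>i\<in>UNIV. \<forall>n. \<forall>x\<in>cel (?X i) n. h n (\<iota> i n x) =
      (if i then fn q else fn p) n x)"
      by (rule colim_desc[OF ob_object[OF o] Q M \<mu>]) (use Rc pq in auto)
    then obtain h where h: "lps_map Q Z h"
        "\<forall>i\<in>UNIV. \<forall>n. \<forall>x\<in>cel (?X i) n. h n (\<iota> i n x) = (if i then fn q else fn p) n x" by blast
    have hp: "h n (\<iota> False n x) = fn p n x" if "x \<in> cel B n" for n x
      using h(2)[rule_format, of False x n] that by simp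
    have hq: "h n (\<iota> True n x) = fn q n x" if "x \<in> cel C n" for n x
      using h(2)[rule_format, of True x n] that by simp
    have hh: "mk Q h Z \<in> hom (Cat b) Q Z" using Qo hom_fn(4)[OF p] h(1) by simp
    show "\<exists>!h. h \<in> hom (Cat b) Q Z \<and> cmp (Cat b) h ?i = p \<and> cmp (Cat b) h ?j = q"
    proof (rule ex1I[of _ "mk Q h Z"])
      have "cmp (Cat b) (mk Q h Z) ?i = mk B (fn p) Z" "cmp (Cat b) (mk Q h Z) ?j = mk C (fn q) Z"
        unfolding cmp_mk[OF m(1)] cmp_mk[OF m(2)] mk_eq_iff using hp hq by simp_all
      then show "mk Q h Z \<in> hom (Cat b) Q Z \<and> cmp (Cat b) (mk Q h Z) ?i = p \<and>
        cmp (Cat b) (mk Q h Z) ?j = q"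
        using mk_fn[OF p] mk_fn[OF q] hh by simp
      fix k assume k: "k \<in> hom (Cat b) Q Z \<and> cmp (Cat b) k ?i = p \<and> cmp (Cat b) k ?j = q"
      then have kh: "k \<in> hom (Cat b) Q Z" by simp
      show "k = mk Q h Z"
      proof (rule hom_eqI[OF kh hh])
        fix n z assume z: "z \<in> cel Q n"
        have "fn k n z = h n z"
        proof (rule colim_unique[OF Q _ z])
          fix i n x assume x: "x \<in> cel (?X i) n"
          show "fn k n (\<iota> i n x) = h n (\<iota> i n x)"
          proof (cases i)
            case True
            then have x: "x \<in> cel C n" using x by simp
            show ?thesis
              using fn_cmp[OF ij(2) kh x] k hq[OF x] True by (simp add: fn_mk[OF x])
          next
            case False
            then have x: "x \<in> cel B n" using x by simp
            show ?thesis
              using fn_cmp[OF ij(1) kh x] k hp[OF x] False by (simp add: fn_mk[OF x])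
          qed
        qed
        then show "fn k n z = fn (mk Q h Z) n z" using fn_mk[OF z] by simp
      qed
    qed
  qed
  then show ?thesis by blast
qed

text \<open>The images of \<open>B\<close> and \<open>C\<close> form a subobject of
  \<open>Q\<close>, which receives a map from \<open>Q\<close> by the universal property. Followed
  by the inclusion it must be the identity, so the subobject is all of \<open>Q\<close>. This covers
  pushouts that are merely chosen.\<close>

lemma pushout_surj:
  assumes f: "f \<in> hom (Cat b) A B" and g: "g \<in> hom (Cat b) A (C :: ('u, 'l) lps)"
    and Q: "is_pushout (Cat b) f g (Q, i, j)" and z: "z \<in> cel Q n"
  shows "(\<exists>x\<in>cel B n. z = fn i n x) \<or> (\<exists>x\<in>cel C n. z = fn j n x)"
proof -
  have tf: "target (Cat b) f = B" "target (Cat b) g = C" using f g by (simp_all add: hom_def)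
  have i: "i \<in> hom (Cat b) B Q" and j: "j \<in> hom (Cat b) C Q" and sq: "cmp (Cat b) i f = cmp (Cat b) j g"
    and un: "\<And>Z p q. p \<in> hom (Cat b) B Z \<Longrightarrow> q \<in> hom (Cat b) C Z \<Longrightarrow> cmp (Cat b) p f = cmp (Cat b) q g \<Longrightarrow>
      \<exists>!h. h \<in> hom (Cat b) Q Z \<and> cmp (Cat b) h i = p \<and> cmp (Cat b) h j = q"
    using Q unfolding is_pushout_def prod.case tf by blast+
  define P where "P n = fn i n ` cel B n \<union> fn j n ` cel C n" for n
  define T where "T = restr Q P"
  have T: "cel T n = P n" "res T = res Q" "lab T = lab Q" for n by (simp_all add: T_def)
  note im = hom_fn(2)[OF i] and jm = hom_fn(2)[OF j]
  have PQ: "x \<in> P n \<Longrightarrow> x \<in> cel Q n" for x n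
    using map_cel[OF im] map_cel[OF jm] by (auto simp: P_def)
  note Qo = ob_object[OF hom_fn(4)[OF i]] and Bo = ob_object[OF hom_fn(3)[OF i]]
    and Co = ob_object[OF hom_fn(3)[OF j]]
  have Pres: "res Q m n g x \<in> P m" if "box m n g" "x \<in> P n" for m n g x
    using that(2) map_res[OF im that(1), symmetric] map_res[OF jm that(1), symmetric]
      res_cel[OF Bo that(1)] res_cel[OF Co that(1)]
    unfolding P_def by auto
  have To: "lps_object T" unfolding T_def by (rule lps_object_restr[OF Qo PQ Pres])
  have TQ: "lps_map T Q (\<lambda>n x. x)" unfolding T_def by (rule lps_map_restr[OF PQ])
  have obT: "ob b T"
    using hom_fn(4)[OF i] To hda1_inj[OF TQ] small_subset[of "cel Q n" "P n" for n] PQ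
    by (auto simp: ob_def T subset_iff)
  have iTm: "lps_map B T (fn i)" "lps_map C T (fn j)"
    by (auto intro!: lps_mapI simp: T P_def map_res[OF im] map_res[OF jm] map_lab[OF im] map_lab[OF jm])
  have iT: "mk B (fn i) T \<in> hom (Cat b) B T" "mk C (fn j) T \<in> hom (Cat b) C T"
    using obT hom_fn(3)[OF i] hom_fn(3)[OF j] iTm by simp_all
  have inc: "mk T (\<lambda>n x. x) Q \<in> hom (Cat b) T Q" using obT hom_fn(4)[OF i] TQ by simp
  have fm: "f = mk A (fn f) B" "g = mk A (fn g) C" "lps_map A B (fn f)" "lps_map A C (fn g)"
    using hom_fn[OF f] hom_fn[OF g] by simp_all
  have "cmp (Cat b) (mk B (fn i) T) f = cmp (Cat b) (mk C (fn j) T) g"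
  proof (rule hom_eqI[OF cmp_hom[OF f iT(1)] cmp_hom[OF g iT(2)]])
    fix n a assume a: "a \<in> cel A n"
    show "fn (cmp (Cat b) (mk B (fn i) T) f) n a = fn (cmp (Cat b) (mk C (fn j) T) g) n a"
      unfolding fn_cmp[OF f iT(1) a] fn_cmp[OF g iT(2) a] fn_mk[OF map_cel[OF fm(3) a]]
        fn_mk[OF map_cel[OF fm(4) a]]
      using sq fn_cmp[OF f i a] fn_cmp[OF g j a] by simp
  qed
  then obtain h where h: "h \<in> hom (Cat b) Q T" "cmp (Cat b) h i = mk B (fn i) T"
    "cmp (Cat b) h j = mk C (fn j) T"
    using un[OF iT] by blast
  let ?k = "cmp (Cat b) (mk T (\<lambda>n x. x) Q) h"
  have iT': "cmp (Cat b) (mk T (\<lambda>n x. x) Q) (mk B (fn i) T) = i"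
    "cmp (Cat b) (mk T (\<lambda>n x. x) Q) (mk C (fn j) T) = j"
    unfolding cmp_mk[OF iTm(1)] cmp_mk[OF iTm(2)] by (rule mk_fn[OF i] mk_fn[OF j])+
  have k: "?k \<in> hom (Cat b) Q Q" "cmp (Cat b) ?k i = i" "cmp (Cat b) ?k j = j"
    using cmp_hom[OF h(1) inc] cmp_assoc[OF i h(1) inc] cmp_assoc[OF j h(1) inc] h(2,3) iT' by simp_all
  moreover have "idm (Cat b) Q \<in> hom (Cat b) Q Q \<and> cmp (Cat b) (idm (Cat b) Q) i = i \<and>
    cmp (Cat b) (idm (Cat b) Q) j = j"
    using idm_hom[OF hom_fn(4)[OF i]] cmp_idm(2)[OF i] cmp_idm(2)[OF j] by simp
  ultimately have "?k = idm (Cat b) Q" using un[OF i j sq] by blast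
  then have "fn ?k n z = z" using fn_mk[OF z] by (simp add: idm_Cat)
  moreover have "fn ?k n z = fn h n z"
    unfolding fn_cmp[OF h(1) inc z] by (rule fn_mk[OF map_cel[OF hom_fn(2)[OF h(1)] z]])
  moreover have "fn h n z \<in> P n" using map_cel[OF hom_fn(2)[OF h(1)] z] by (simp add: T)
  ultimately have "z \<in> P n" by simp
  then show ?thesis by (auto simp: P_def)
qed

text \<open>Mapping to the constructed colimit and back is the identity of \<open>D\<close>, so the
  description of cells and identifications carries over to an arbitrary colimit.\<close>

lemma is_colimit_cells:
  fixes Fo :: "'j \<Rightarrow> ('u, 'l) lps"
  assumes J: "is_category J" and sm: "small TYPE('u) (obj J)" and F: "is_functor J (Cat b) Fo Fm"
    and D: "is_colimit J (Cat b) Fo Fm D \<iota>"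
  shows "z \<in> cel D n \<Longrightarrow> \<exists>j\<in>obj J. \<exists>x\<in>cel (Fo j) n. z = fn (\<iota> j) n x"
    and "i \<in> obj J \<Longrightarrow> x \<in> cel (Fo i) n \<Longrightarrow> j \<in> obj J \<Longrightarrow> y \<in> cel (Fo j) n \<Longrightarrow>
      fn (\<iota> i) n x = fn (\<iota> j) n y \<Longrightarrow>
      ((i, x), (j, y)) \<in> gen_congr b (sum_lps (obj J) Fo) (diagram_rel J Fo Fm) n"
proof -
  obtain E \<kappa> where E: "colim b (obj J) Fo (diagram_rel J Fo Fm) E \<kappa>"
    using diagram_colim[OF J sm F] by blast
  let ?\<kappa> = "\<lambda>j. mk (Fo j) (\<kappa> j) E"
  have Ec: "is_cocone J (Cat b) Fo Fm E ?\<kappa>"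
    using is_colimit_colim[OF J F E] unfolding is_colimit_iff by blast
  have Dc: "is_cocone J (Cat b) Fo Fm D \<iota>" and
    Du: "\<And>M \<mu>. is_cocone J (Cat b) Fo Fm M \<mu> \<Longrightarrow>
      \<exists>!h. h \<in> hom (Cat b) D M \<and> (\<forall>j\<in>obj J. cmp (Cat b) h (\<iota> j) = \<mu> j)"
    using D unfolding is_colimit_iff by blast+
  have \<iota>: "\<iota> j \<in> hom (Cat b) (Fo j) D" if "j \<in> obj J" for j
    using Dc that unfolding is_cocone_def by blast
  obtain k where k: "k \<in> hom (Cat b) D E" "\<And>j. j \<in> obj J \<Longrightarrow> cmp (Cat b) k (\<iota> j) = ?\<kappa> j"
    using Du[OF Ec] by blast
  have k\<iota>: "fn k n (fn (\<iota> j) n x) = \<kappa> j n x" if "j \<in> obj J" "x \<in> cel (Fo j) n" for j n x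
    using fn_cmp[OF \<iota>[OF that(1)] k(1) that(2)] unfolding k(2)[OF that(1)] fn_mk[OF that(2)] by simp
  have "\<exists>!h. h \<in> hom (Cat b) E D \<and> (\<forall>j\<in>obj J. cmp (Cat b) h (?\<kappa> j) = \<iota> j)"
    using is_colimit_colim[OF J F E] Dc unfolding is_colimit_iff by blast
  then obtain h where h: "h \<in> hom (Cat b) E D" "\<And>j. j \<in> obj J \<Longrightarrow> cmp (Cat b) h (?\<kappa> j) = \<iota> j"
    by blast
  note hk = cmp_hom[OF k(1) h(1)]
  have "cmp (Cat b) (cmp (Cat b) h k) (\<iota> j) = \<iota> j" if "j \<in> obj J" for j
    using cmp_assoc[OF \<iota>[OF that] k(1) h(1)] k(2)[OF that] h(2)[OF that] by simp
  moreover have "cmp (Cat b) (idm (Cat b) D) (\<iota> j) = \<iota> j" if "j \<in> obj J" for j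
    using cmp_idm(2)[OF \<iota>[OF that]] .
  ultimately have hk1: "cmp (Cat b) h k = idm (Cat b) D"
    using Du[OF Dc] hk idm_hom[OF hom_fn(3)[OF k(1)]] by blast
  show "\<exists>j\<in>obj J. \<exists>x\<in>cel (Fo j) n. z = fn (\<iota> j) n x" if z: "z \<in> cel D n"
  proof -
    obtain j x where jx: "j \<in> obj J" "x \<in> cel (Fo j) n" "fn k n z = \<kappa> j n x"
      using colimD(4)[OF E map_cel[OF hom_fn(2)[OF k(1)] z]] by blast
    have m: "?\<kappa> j \<in> hom (Cat b) (Fo j) E"
      using Ec jx(1) unfolding is_cocone_def by blast
    have "z = fn (cmp (Cat b) h k) n z" unfolding hk1 idm_Cat fn_mk[OF z] ..
    also have "\<dots> = fn h n (fn (?\<kappa> j) n x)" unfolding fn_cmp[OF k(1) h(1) z] jx(3) fn_mk[OF jx(2)] ..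
    also have "\<dots> = fn (\<iota> j) n x" unfolding fn_cmp[OF m h(1) jx(2), symmetric] h(2)[OF jx(1)] ..
    finally show ?thesis using jx by blast
  qed
  show "((i, x), (j, y)) \<in> gen_congr b (sum_lps (obj J) Fo) (diagram_rel J Fo Fm) n"
    if *: "i \<in> obj J" "x \<in> cel (Fo i) n" "j \<in> obj J" "y \<in> cel (Fo j) n" "fn (\<iota> i) n x = fn (\<iota> j) n y"
  proof -
    have "\<kappa> i n x = \<kappa> j n y" using k\<iota>[OF *(1,2)] k\<iota>[OF *(3,4)] *(5) by simp
    then show ?thesis by (rule colimD(5)[OF E *(1-4)])
  qed
qed

end

section \<open>Limits\<close>

text \<open>The label is stored separately for the sake of the empty diagram, whose limit is the
  object of all words and not a point.\<close>

definition lim_lps :: "'i set \<Rightarrow> ('i \<Rightarrow> ('a, 'l) lps) \<Rightarrow> ('i \<times> 'i \<times> (nat \<Rightarrow> 'a \<Rightarrow> 'a)) set \<Rightarrow>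
    ('l list \<times> ('i \<Rightarrow> 'a), 'l) lps" where
  "lim_lps I X T = \<lparr>und = \<lparr>cells = (\<lambda>n. {(w, s). length w = n \<and> s \<in> (\<Pi>\<^sub>E i\<in>I. cel (X i) n) \<and>
       (\<forall>i\<in>I. lab (X i) n (s i) = w) \<and> (\<forall>(i, j, \<phi>)\<in>T. \<phi> n (s i) = s j)}),
     act = (\<lambda>m n f (w, s). (word_act m n f w, \<lambda>i\<in>I. res (X i) m n f (s i)))\<rparr>,
     lab = (\<lambda>n (w, s). w)\<rparr>"

lemma lim_lps_simps [simp]:
  "(w, s) \<in> cel (lim_lps I X T) n \<longleftrightarrow> length w = n \<and> s \<in> (\<Pi>\<^sub>E i\<in>I. cel (X i) n) \<and>
       (\<forall>i\<in>I. lab (X i) n (s i) = w) \<and> (\<forall>(i, j, \<phi>)\<in>T. \<phi> n (s i) = s j)"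
  "res (lim_lps I X T) m n f (w, s) = (word_act m n f w, \<lambda>i\<in>I. res (X i) m n f (s i))"
  "lab (lim_lps I X T) n (w, s) = w"
  by (simp_all add: lim_lps_def)

definition lim :: "bool \<Rightarrow> 'i set \<Rightarrow> ('i \<Rightarrow> ('u, 'l) lps) \<Rightarrow> ('i \<times> 'i \<times> (nat \<Rightarrow> 'u \<Rightarrow> 'u)) set \<Rightarrow>
    ('u, 'l) lps \<Rightarrow> ('i \<Rightarrow> nat \<Rightarrow> 'u \<Rightarrow> 'u) \<Rightarrow> bool" where
  "lim b I X T E \<pi> \<longleftrightarrow> ob b E \<and> (\<forall>i\<in>I. lps_map E (X i) (\<pi> i)) \<and>
     (\<forall>i j \<phi> n z. (i, j, \<phi>) \<in> T \<longrightarrow> z \<in> cel E n \<longrightarrow> \<phi> n (\<pi> i n z) = \<pi> j n z) \<and>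
     (\<forall>n w s. length w = n \<longrightarrow> (\<forall>i\<in>I. s i \<in> cel (X i) n \<and> lab (X i) n (s i) = w) \<longrightarrow>
        (\<forall>i j \<phi>. (i, j, \<phi>) \<in> T \<longrightarrow> \<phi> n (s i) = s j) \<longrightarrow>
        (\<exists>z\<in>cel E n. lab E n z = w \<and> (\<forall>i\<in>I. \<pi> i n z = s i))) \<and>
     (\<forall>n. \<forall>z\<in>cel E n. \<forall>z'\<in>cel E n. lab E n z = lab E n z' \<longrightarrow> (\<forall>i\<in>I. \<pi> i n z = \<pi> i n z') \<longrightarrow> z = z')"

lemma limD:
  assumes "lim b I X T E \<pi>"
  shows "ob b E" "i \<in> I \<Longrightarrow> lps_map E (X i) (\<pi> i)"
    "(i, j, \<phi>) \<in> T \<Longrightarrow> z \<in> cel E n \<Longrightarrow> \<phi> n (\<pi> i n z) = \<pi> j n z"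
    "length w = n \<Longrightarrow> (\<And>i. i \<in> I \<Longrightarrow> s i \<in> cel (X i) n \<and> lab (X i) n (s i) = w) \<Longrightarrow>
      (\<And>i j \<phi>. (i, j, \<phi>) \<in> T \<Longrightarrow> \<phi> n (s i) = s j) \<Longrightarrow> \<exists>z\<in>cel E n. lab E n z = w \<and> (\<forall>i\<in>I. \<pi> i n z = s i)"
    "z \<in> cel E n \<Longrightarrow> z' \<in> cel E n \<Longrightarrow> lab E n z = lab E n z' \<Longrightarrow> (\<And>i. i \<in> I \<Longrightarrow> \<pi> i n z = \<pi> i n z') \<Longrightarrow> z = z'"
proof -
  note * = assms[unfolded lim_def]
  show "ob b E" using * by (elim conjE)
  have 1: "\<forall>i\<in>I. lps_map E (X i) (\<pi> i)" using * by (elim conjE)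
  then show "i \<in> I \<Longrightarrow> lps_map E (X i) (\<pi> i)" by (rule bspec)
  have 2: "\<forall>i j \<phi> n z. (i, j, \<phi>) \<in> T \<longrightarrow> z \<in> cel E n \<longrightarrow> \<phi> n (\<pi> i n z) = \<pi> j n z"
    using * by (elim conjE)
  show "(i, j, \<phi>) \<in> T \<Longrightarrow> z \<in> cel E n \<Longrightarrow> \<phi> n (\<pi> i n z) = \<pi> j n z"
    by (rule 2[THEN spec[of _ i], THEN spec[of _ j], THEN spec[of _ \<phi>], THEN spec[of _ n],
          THEN spec[of _ z], THEN mp, THEN mp])
  have 3: "\<forall>n w s. length w = n \<longrightarrow> (\<forall>i\<in>I. s i \<in> cel (X i) n \<and> lab (X i) n (s i) = w) \<longrightarrow>
        (\<forall>i j \<phi>. (i, j, \<phi>) \<in> T \<longrightarrow> \<phi> n (s i) = s j) \<longrightarrow>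
        (\<exists>z\<in>cel E n. lab E n z = w \<and> (\<forall>i\<in>I. \<pi> i n z = s i))" using * by (elim conjE)
  assume a: "length w = n" "\<And>i. i \<in> I \<Longrightarrow> s i \<in> cel (X i) n \<and> lab (X i) n (s i) = w"
    "\<And>i j \<phi>. (i, j, \<phi>) \<in> T \<Longrightarrow> \<phi> n (s i) = s j"
  show "\<exists>z\<in>cel E n. lab E n z = w \<and> (\<forall>i\<in>I. \<pi> i n z = s i)"
    by (rule 3[THEN spec[of _ n], THEN spec[of _ w], THEN spec[of _ s], THEN mp, THEN mp, THEN mp])
      (use a in blast)+
next
  assume a: "z \<in> cel E n" "z' \<in> cel E n" "lab E n z = lab E n z'" "\<And>i. i \<in> I \<Longrightarrow> \<pi> i n z = \<pi> i n z'"
  have "\<forall>n. \<forall>z\<in>cel E n. \<forall>z'\<in>cel E n. lab E n z = lab E n z' \<longrightarrow> (\<forall>i\<in>I. \<pi> i n z = \<pi> i n z') \<longrightarrow> z = z'"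
    using assms[unfolded lim_def] by (elim conjE)
  then show "z = z'" using a by blast
qed

lemma lps_object_lim:
  assumes X: "\<And>i. i \<in> I \<Longrightarrow> lps_object (X i)"
    and T: "\<And>i j \<phi>. (i, j, \<phi>) \<in> T \<Longrightarrow> i \<in> I \<and> j \<in> I \<and> lps_map (X i) (X j) \<phi>"
  shows "lps_object (lim_lps I X T)"
proof (rule lps_objectI)
  fix m n f p assume f: "box m n f" and p: "p \<in> cel (lim_lps I X T) n"
  obtain w s where ws: "p = (w, s)" by (cases p)
  have s: "s i \<in> cel (X i) n" "lab (X i) n (s i) = w" if "i \<in> I" for i
    using p ws that by (auto dest: PiE_mem)
  have "\<phi> m (res (X i) m n f (s i)) = res (X j) m n f (s j)" if t: "(i, j, \<phi>) \<in> T" for i j \<phi>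
    using T[OF t] map_res[of "X i" "X j" \<phi> m n f "s i"] s f p ws t by auto
  then show "res (lim_lps I X T) m n f p \<in> cel (lim_lps I X T) m"
    using s T res_cel[OF X f] lab_res[OF X f] by (fastforce simp: ws)
  show "lab (lim_lps I X T) m (res (lim_lps I X T) m n f p) = word_act m n f (lab (lim_lps I X T) n p)"
    by (simp add: ws)
next
  fix n p assume p: "p \<in> cel (lim_lps I X T) n"
  obtain w s where ws: "p = (w, s)" by (cases p)
  have "(\<lambda>i\<in>I. res (X i) n n (idb n) (s i)) = s"
  proof (rule extensionalityI[of _ I])
    fix i assume i: "i \<in> I"
    have "s i \<in> cel (X i) n" using p ws i by (auto dest: PiE_mem)
    then show "(\<lambda>i\<in>I. res (X i) n n (idb n) (s i)) i = s i" using i by (simp add: res_id[OF X[OF i]])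
  qed (use p ws in \<open>auto simp: PiE_iff\<close>)
  then show "res (lim_lps I X T) n n (idb n) p = p" "length (lab (lim_lps I X T) n p) = n"
    using p by (simp_all add: ws word_act_id)
next
  fix l m n f g p assume f: "box l m f" and g: "box m n g" and p: "p \<in> cel (lim_lps I X T) n"
  obtain w s where ws: "p = (w, s)" by (cases p)
  have "(\<lambda>i\<in>I. res (X i) l n (cb l g f) (s i)) =
      (\<lambda>i\<in>I. res (X i) l m f ((\<lambda>i\<in>I. res (X i) m n g (s i)) i))"
  proof (rule restrict_ext)
    fix i assume i: "i \<in> I"
    have "s i \<in> cel (X i) n" using p ws i by (auto dest: PiE_mem)
    then show "res (X i) l n (cb l g f) (s i) = res (X i) l m f ((\<lambda>i\<in>I. res (X i) m n g (s i)) i)"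
      using i by (simp add: res_comp[OF X[OF i] f g])
  qed
  then show "res (lim_lps I X T) l n (cb l g f) p =
    res (lim_lps I X T) l m f (res (lim_lps I X T) m n g p)"
    by (simp add: ws word_act_compose[OF f g])
qed

lemma hda1_lim:
  assumes X: "\<And>i. i \<in> I \<Longrightarrow> hda1 (X i)"
  shows "hda1 (lim_lps I X T)"
  unfolding hda1_def
proof (intro allI ballI impI)
  fix n :: nat and p q
  assume n: "n \<ge> 2" and p: "p \<in> cel (lim_lps I X T) n" and q: "q \<in> cel (lim_lps I X T) n"
    and l: "lab (lim_lps I X T) n p = lab (lim_lps I X T) n q"
    and eq: "\<forall>m f. box m n f \<longrightarrow> m < n \<longrightarrow> res (lim_lps I X T) m n f p = res (lim_lps I X T) m n f q"
  obtain w s w' s' where pq: "p = (w, s)" "q = (w', s')" by (cases p, cases q)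
  have sp: "s \<in> (\<Pi>\<^sub>E i\<in>I. cel (X i) n)" "s' \<in> (\<Pi>\<^sub>E i\<in>I. cel (X i) n)"
    using p q pq by simp_all
  have "s = s'"
  proof (rule PiE_ext[OF sp])
    fix i assume i: "i \<in> I"
    show "s i = s' i"
    proof (rule hda1D[OF X[OF i] n PiE_mem[OF sp(1) i] PiE_mem[OF sp(2) i]])
      have "lab (X i) n (s i) = w" "lab (X i) n (s' i) = w'" using p q i pq by simp_all
      then show "lab (X i) n (s i) = lab (X i) n (s' i)" using l pq by simp
      fix m f assume f: "box m n f" "m < n"
      have "res (lim_lps I X T) m n f (w, s) = res (lim_lps I X T) m n f (w', s')"
        using eq f unfolding pq by blast
      then have "(\<lambda>i\<in>I. res (X i) m n f (s i)) = (\<lambda>i\<in>I. res (X i) m n f (s' i))"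
        unfolding lim_lps_simps by (rule conjunct2[OF iffD1[OF prod.inject]])
      from fun_cong[OF this, of i] show "res (X i) m n f (s i) = res (X i) m n f (s' i)" using i by simp
    qed
  qed
  then show "p = q" using l pq by simp
qed

lemma (in small_labels) lim_exists:
  fixes X :: "'i \<Rightarrow> ('u, 'l) lps"
  assumes I: "small TYPE('u) I" and X: "\<And>i. i \<in> I \<Longrightarrow> ob b (X i)"
    and T: "\<And>i j \<phi>. (i, j, \<phi>) \<in> T \<Longrightarrow> i \<in> I \<and> j \<in> I \<and> lps_map (X i) (X j) \<phi>"
  shows "\<exists>E \<pi>. lim b I X T E \<pi>"
proof -
  let ?K = "lim_lps I X T"
  have K: "lps_object ?K" by (rule lps_object_lim[OF ob_object[OF X] T])
  have sm: "small TYPE('u) (cel ?K n)" for n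
  proof (rule small_subset)
    show "small TYPE('u) ((UNIV :: 'l list set) \<times> (\<Pi>\<^sub>E i\<in>I. cel (X i) n))"
      by (intro small_Sigma small_PiE small_UNIV_list small_labels I ob_small[OF X])
    show "cel ?K n \<subseteq> UNIV \<times> (\<Pi>\<^sub>E i\<in>I. cel (X i) n)" by (auto simp: lim_lps_def)
  qed
  have h: "b \<longrightarrow> hda1 ?K" using X by (auto simp: ob_def intro!: hda1_lim)
  obtain E e d where E: "ob b (E :: ('u, 'l) lps)" and iso: "lps_iso ?K E e d"
    using representative[OF K h sm] by blast
  let ?\<pi> = "\<lambda>i n z. snd (d n z) i"
  have dK: "d n z \<in> cel ?K n" if "z \<in> cel E n" for n z by (rule map_cel[OF lps_isoD(2)[OF iso] that])
  have proj: "lps_map ?K (X i) (\<lambda>n p. snd p i)" if i: "i \<in> I" for i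
  proof (rule lps_mapI)
    fix n p assume p: "p \<in> cel ?K n"
    obtain w s where ws: "p = (w, s)" by (cases p)
    show "snd p i \<in> cel (X i) n" "lab (X i) n (snd p i) = lab ?K n p"
      using p i ws by (auto dest: PiE_mem)
    fix m f show "snd (res ?K m n f p) i = res (X i) m n f (snd p i)" using i ws by simp
  qed
  have "lim b I X T E ?\<pi>"
    unfolding lim_def
  proof (intro conjI allI ballI impI)
    show "ob b E" by (rule E)
    show "lps_map E (X i) (?\<pi> i)" if "i \<in> I" for i
      by (rule lps_map_comp[OF lps_isoD(2)[OF iso] proj[OF that]])
    show "\<phi> n (?\<pi> i n z) = ?\<pi> j n z" if "(i, j, \<phi>) \<in> T" "z \<in> cel E n" for i j \<phi> n z
      using dK[OF that(2)] that(1) by (cases "d n z") auto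
  next
    fix n w s assume w: "length w = n" and s: "\<forall>i\<in>I. s i \<in> cel (X i) n \<and> lab (X i) n (s i) = w"
      and t: "\<forall>i j \<phi>. (i, j, \<phi>) \<in> T \<longrightarrow> \<phi> n (s i) = s j"
    let ?p = "(w, restrict s I)"
    have p: "?p \<in> cel ?K n" using w s t T by fastforce
    show "\<exists>z\<in>cel E n. lab E n z = w \<and> (\<forall>i\<in>I. ?\<pi> i n z = s i)"
    proof (rule bexI)
      show "e n ?p \<in> cel E n" by (rule map_cel[OF lps_isoD(1)[OF iso] p])
      show "lab E n (e n ?p) = w \<and> (\<forall>i\<in>I. ?\<pi> i n (e n ?p) = s i)"
        using lps_isoD(3)[OF iso p] map_lab[OF lps_isoD(1)[OF iso] p] by simp
    qed
  next
    fix n z z' assume z: "z \<in> cel E n" "z' \<in> cel E n" "lab E n z = lab E n z'"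
      and eq: "\<forall>i\<in>I. ?\<pi> i n z = ?\<pi> i n z'"
    obtain w s w' s' where ws: "d n z = (w, s)" "d n z' = (w', s')" by (cases "d n z", cases "d n z'")
    have "w = w'" using z(3) ws map_lab[OF lps_isoD(2)[OF iso] z(1)] map_lab[OF lps_isoD(2)[OF iso]
      z(2)] by simp
    moreover have "s = s'"
      by (rule extensionalityI[of _ I]) (use eq ws dK[OF z(1)] dK[OF z(2)] in \<open>auto simp: PiE_iff\<close>)
    ultimately have "d n z = d n z'" using ws by simp
    then show "z = z'" using lps_isoD(4)[OF iso] z(1,2) by metis
  qed
  then show ?thesis by blast
qed

lemma lim_desc:
  assumes X: "\<And>i. i \<in> I \<Longrightarrow> lps_object (X i)" and E: "lim b I X T E \<pi>" and M: "lps_object M"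
    and \<mu>: "\<And>i. i \<in> I \<Longrightarrow> lps_map M (X i) (\<mu> i)"
    and T: "\<And>i j \<phi> n m. (i, j, \<phi>) \<in> T \<Longrightarrow> m \<in> cel M n \<Longrightarrow> \<phi> n (\<mu> i n m) = \<mu> j n m"
  shows "\<exists>h. lps_map M E h \<and> (\<forall>i\<in>I. \<forall>n. \<forall>m\<in>cel M n. \<pi> i n (h n m) = \<mu> i n m)"
proof -
  define h where "h n m = (SOME z. z \<in> cel E n \<and> lab E n z = lab M n m \<and> (\<forall>i\<in>I. \<pi> i n z = \<mu> i n m))"
    for n m
  have h: "h n m \<in> cel E n \<and> lab E n (h n m) = lab M n m \<and> (\<forall>i\<in>I. \<pi> i n (h n m) = \<mu> i n m)"
    if m: "m \<in> cel M n" for n m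
  proof -
    have "\<exists>z\<in>cel E n. lab E n z = lab M n m \<and> (\<forall>i\<in>I. \<pi> i n z = \<mu> i n m)"
      by (rule limD(4)[OF E length_lab[OF M m]]) (use map_cel[OF \<mu> m] map_lab[OF \<mu> m] T[OF _ m]
        in blast)+
    then have "\<exists>z. z \<in> cel E n \<and> lab E n z = lab M n m \<and> (\<forall>i\<in>I. \<pi> i n z = \<mu> i n m)" by blast
    then show ?thesis unfolding h_def by (rule someI_ex)
  qed
  have "lps_map M E h"
  proof (rule lps_mapI)
    fix m n f x assume f: "box m n f" and x: "x \<in> cel M n"
    note Eo = ob_object[OF limD(1)[OF E]]
    note hx = h[OF x] and hr = h[OF res_cel[OF M f x]]
    show "h m (res M m n f x) = res E m n f (h n x)"
    proof (rule limD(5)[OF E])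
      show "h m (res M m n f x) \<in> cel E m" using hr by blast
      show "res E m n f (h n x) \<in> cel E m" using res_cel[OF Eo f] hx by blast
      show "lab E m (h m (res M m n f x)) = lab E m (res E m n f (h n x))"
        using hr hx lab_res[OF Eo f, of "h n x"] lab_res[OF M f x] by simp
      show "\<pi> i m (h m (res M m n f x)) = \<pi> i m (res E m n f (h n x))" if i: "i \<in> I" for i
        using hr hx i map_res[OF limD(2)[OF E i] f, of "h n x"] map_res[OF \<mu>[OF i] f x] by simp
    qed
  qed (use h in blast)+
  then show ?thesis using h by blast
qed

lemma is_limit_lim:
  fixes Fo :: "'j \<Rightarrow> ('u, 'l) lps"
  assumes J: "is_category J" and F: "is_functor J (Cat b) Fo Fm"
    and E: "lim b (obj J) Fo {(i, j, fn (Fm u)) | i j u. u \<in> hom J i j} E \<pi>"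
  shows "is_limit J (Cat b) Fo Fm E (\<lambda>j. mk E (\<pi> j) (Fo j))"
  unfolding is_limit_def
proof (intro conjI allI impI)
  let ?T = "{(i, j, fn (Fm u)) | i j u. u \<in> hom J i j}"
  have o: "ob b (Fo j)" if "j \<in> obj J" for j using functorD(1)[OF F that] by simp
  note Eo = limD(1)[OF E]
  have p: "mk E (\<pi> j) (Fo j) \<in> hom (Cat b) E (Fo j)" if "j \<in> obj J" for j
    using o[OF that] Eo limD(2)[OF E that] by simp
  show "is_cone J (Cat b) Fo Fm E (\<lambda>j. mk E (\<pi> j) (Fo j))"
    unfolding is_cone_def
  proof (intro conjI ballI allI impI)
    show "E \<in> obj (Cat b)" using Eo by simp
    show "mk E (\<pi> j) (Fo j) \<in> hom (Cat b) E (Fo j)" if "j \<in> obj J" for j by (rule p[OF that])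
    fix i j u assume u: "u \<in> hom J i j"
    have ij: "i \<in> obj J" "j \<in> obj J" using hom_is_obj[OF J u] by simp_all
    note Fu = functorD(2)[OF F u]
    show "cmp (Cat b) (Fm u) (mk E (\<pi> i) (Fo i)) = mk E (\<pi> j) (Fo j)"
    proof (rule hom_eqI[OF cmp_hom[OF p[OF ij(1)] Fu] p[OF ij(2)]])
      fix n z assume z: "z \<in> cel E n"
      have "(i, j, fn (Fm u)) \<in> ?T" using u by blast
      from limD(3)[OF E this z]
      show "fn (cmp (Cat b) (Fm u) (mk E (\<pi> i) (Fo i))) n z = fn (mk E (\<pi> j) (Fo j)) n z"
        unfolding fn_cmp[OF p[OF ij(1)] Fu z] fn_mk[OF z] .
    qed
  qed
  fix M \<mu> assume M: "is_cone J (Cat b) Fo Fm M \<mu>"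
  have Mo: "ob b M" and \<mu>: "\<And>j. j \<in> obj J \<Longrightarrow> \<mu> j \<in> hom (Cat b) M (Fo j)"
    and c: "\<And>i j u. u \<in> hom J i j \<Longrightarrow> cmp (Cat b) (Fm u) (\<mu> i) = \<mu> j"
    using M unfolding is_cone_def by simp_all
  have t: "\<phi> n (fn (\<mu> i) n m) = fn (\<mu> j) n m" if ij: "(i, j, \<phi>) \<in> ?T" and m: "m \<in> cel M n" for i j \<phi> n m
  proof -
    obtain u where u: "u \<in> hom J i j" "\<phi> = fn (Fm u)" using ij by blast
    have i: "i \<in> obj J" using hom_is_obj[OF J u(1)] by simp
    show ?thesis using fn_cmp[OF \<mu>[OF i] functorD(2)[OF F u(1)] m] unfolding c[OF u(1)] u(2) by simp
  qed
  have "\<exists>h. lps_map M E h \<and> (\<forall>i\<in>obj J. \<forall>n. \<forall>m\<in>cel M n. \<pi> i n (h n m) = fn (\<mu> i) n m)"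
    by (rule lim_desc[where \<mu> = "\<lambda>i. fn (\<mu> i)", OF ob_object[OF o] E ob_object[OF Mo] hom_fn(2)[OF \<mu>]])
      (assumption | erule (1) t)+
  then obtain h where h: "lps_map M E h" "\<forall>i\<in>obj J. \<forall>n. \<forall>m\<in>cel M n. \<pi> i n (h n m) = fn (\<mu> i) n m"
    by blast
  have hh: "mk M h E \<in> hom (Cat b) M E" using Mo Eo h(1) by simp
  show "\<exists>!h. h \<in> hom (Cat b) M E \<and> (\<forall>j\<in>obj J. cmp (Cat b) (mk E (\<pi> j) (Fo j)) h = \<mu> j)"
  proof (rule ex1I[of _ "mk M h E"])
    have "cmp (Cat b) (mk E (\<pi> j) (Fo j)) (mk M h E) = \<mu> j" if j: "j \<in> obj J" for j
    proof -
      have "cmp (Cat b) (mk E (\<pi> j) (Fo j)) (mk M h E) = mk M (fn (\<mu> j)) (Fo j)"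
        unfolding cmp_mk[OF h(1)] mk_eq_iff using h(2) j by simp
      then show ?thesis unfolding mk_fn[OF \<mu>[OF j]] .
    qed
    then show "mk M h E \<in> hom (Cat b) M E \<and> (\<forall>j\<in>obj J. cmp (Cat b) (mk E (\<pi> j) (Fo j)) (mk M h E) =
      \<mu> j)"
      using hh by blast
    fix k assume k: "k \<in> hom (Cat b) M E \<and> (\<forall>j\<in>obj J. cmp (Cat b) (mk E (\<pi> j) (Fo j)) k = \<mu> j)"
    then have kh: "k \<in> hom (Cat b) M E" by simp
    show "k = mk M h E"
    proof (rule hom_eqI[OF kh hh])
      fix n m assume m: "m \<in> cel M n"
      note km = map_cel[OF hom_fn(2)[OF kh] m] and hm = map_cel[OF h(1) m]
      have "fn k n m = h n m"
      proof (rule limD(5)[OF E km hm])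
        show "lab E n (fn k n m) = lab E n (h n m)"
          using map_lab[OF hom_fn(2)[OF kh] m] map_lab[OF h(1) m] by simp
        fix j assume j: "j \<in> obj J"
        have "\<pi> j n (fn k n m) = fn (\<mu> j) n m"
          using fn_cmp[OF kh p[OF j] m] k j by (simp add: fn_mk[OF km])
        then show "\<pi> j n (fn k n m) = \<pi> j n (h n m)" using h(2) j m by simp
      qed
      then show "fn k n m = fn (mk M h E) n m" by (simp add: fn_mk[OF m])
    qed
  qed
qed

context small_labels
begin

lemma complete_Cat: "complete TYPE('u) (Cat b :: (('u, 'l) lps, ('u, 'l) lmor) category)"
  unfolding complete_def
proof (intro allI impI; elim conjE)
  fix J :: "('u, 'u) category" and Fo :: "'u \<Rightarrow> ('u, 'l) lps" and Fm
  assume J: "is_category J" and sm: "small TYPE('u) (obj J)" and F: "is_functor J (Cat b) Fo Fm"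
  have "\<exists>E \<pi>. lim b (obj J) Fo {(i, j, fn (Fm u)) | i j u. u \<in> hom J i j} E \<pi>"
  proof (rule lim_exists[OF sm])
    show "ob b (Fo i)" if "i \<in> obj J" for i using functorD(1)[OF F that] by simp
    fix i j \<phi> assume "(i, j, \<phi>) \<in> {(i, j, fn (Fm u)) | i j u. u \<in> hom J i j}"
    then obtain u where u: "u \<in> hom J i j" "\<phi> = fn (Fm u)" by blast
    show "i \<in> obj J \<and> j \<in> obj J \<and> lps_map (Fo i) (Fo j) \<phi>"
      using hom_is_obj[OF J u(1)] hom_fn(2)[OF functorD(2)[OF F u(1)]] u(2) by simp
  qed
  then show "\<exists>L \<pi>. is_limit J (Cat b) Fo Fm L \<pi>" using is_limit_lim[OF J F] by blast
qed

section \<open>Binary products\<close>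

lemma product_exists:
  assumes X: "ob b X" and Y: "ob b (Y :: ('u, 'l) lps)"
  shows "\<exists>t. is_product (Cat b) X Y t"
proof -
  let ?X = "\<lambda>i. if i then Y else X"
  have o: "ob b (?X i)" for i using X Y by simp
  have "\<exists>E \<pi>. lim b UNIV ?X {} E \<pi>" by (rule lim_exists[OF small_bool o]) simp
  then obtain E \<pi> where E: "lim b UNIV ?X {} E \<pi>" by blast
  note Eo = limD(1)[OF E]
  have pm: "lps_map E X (\<pi> False)" "lps_map E Y (\<pi> True)"
    using limD(2)[OF E, of False] limD(2)[OF E, of True] by simp_all
  let ?p = "mk E (\<pi> False) X" and ?q = "mk E (\<pi> True) Y"
  have pq: "?p \<in> hom (Cat b) E X" "?q \<in> hom (Cat b) E Y" using pm Eo X Y by simp_all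
  have "is_product (Cat b) X Y (E, ?p, ?q)"
    unfolding is_product_def prod.case
  proof (intro conjI allI impI pq; (elim conjE)?)
    show "E \<in> obj (Cat b)" using Eo by simp
    fix Z f g assume f: "f \<in> hom (Cat b) Z X" and g: "g \<in> hom (Cat b) Z Y"
    have \<mu>: "lps_map Z (?X i) (if i then fn g else fn f)" for i
      using hom_fn(2)[OF f] hom_fn(2)[OF g] by simp
    have "\<exists>h. lps_map Z E h \<and> (\<forall>i\<in>UNIV. \<forall>n. \<forall>m\<in>cel Z n. \<pi> i n (h n m) = (if i then fn g else fn f) n m)"
      by (rule lim_desc[OF ob_object[OF o] E ob_object[OF hom_fn(3)[OF f]] \<mu>]) simp
    then obtain h where h: "lps_map Z E h"
      "\<forall>i\<in>UNIV. \<forall>n. \<forall>m\<in>cel Z n. \<pi> i n (h n m) = (if i then fn g else fn f) n m" by blast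
    have hf: "\<pi> False n (h n m) = fn f n m" "\<pi> True n (h n m) = fn g n m" if "m \<in> cel Z n" for n m
      using h(2)[THEN bspec[of _ _ False]] h(2)[THEN bspec[of _ _ True]] that by simp_all
    have hh: "mk Z h E \<in> hom (Cat b) Z E" using Eo hom_fn(3)[OF f] h(1) by simp
    show "\<exists>!h. h \<in> hom (Cat b) Z E \<and> cmp (Cat b) ?p h = f \<and> cmp (Cat b) ?q h = g"
    proof (rule ex1I[of _ "mk Z h E"])
      have "cmp (Cat b) ?p (mk Z h E) = mk Z (fn f) X" "cmp (Cat b) ?q (mk Z h E) = mk Z (fn g) Y"
        unfolding cmp_mk[OF h(1)] mk_eq_iff using hf by simp_all
      then show "mk Z h E \<in> hom (Cat b) Z E \<and> cmp (Cat b) ?p (mk Z h E) = f \<and>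
        cmp (Cat b) ?q (mk Z h E) = g"
        unfolding mk_fn[OF f] mk_fn[OF g] using hh by blast
      fix k assume k: "k \<in> hom (Cat b) Z E \<and> cmp (Cat b) ?p k = f \<and> cmp (Cat b) ?q k = g"
      then have kh: "k \<in> hom (Cat b) Z E" by simp
      show "k = mk Z h E"
      proof (rule hom_eqI[OF kh hh])
        fix n m assume m: "m \<in> cel Z n"
        note km = map_cel[OF hom_fn(2)[OF kh] m] and hm = map_cel[OF h(1) m]
        have "fn k n m = h n m"
        proof (rule limD(5)[OF E km hm])
          show "lab E n (fn k n m) = lab E n (h n m)"
            using map_lab[OF hom_fn(2)[OF kh] m] map_lab[OF h(1) m] by simp
          have "\<pi> False n (fn k n m) = fn f n m" "\<pi> True n (fn k n m) = fn g n m"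
            using fn_cmp[OF kh pq(1) m] fn_cmp[OF kh pq(2) m] k by (simp_all add: fn_mk[OF km])
          then show "\<pi> j n (fn k n m) = \<pi> j n (h n m)" for j using hf[OF m] by (cases j) simp_all
        qed
        then show "fn k n m = fn (mk Z h E) n m" by (simp add: fn_mk[OF m])
      qed
    qed
  qed
  then show ?thesis by blast
qed

end

section \<open>Local presentability\<close>

definition fin_lps :: "('a, 'l) lps \<Rightarrow> bool" where
  "fin_lps X \<longleftrightarrow> finite {(n, x). x \<in> cel X n}"

lemma poset_hom: "hom (poset_cat P R) i j = {(i, j)} \<inter> R"
  by (auto simp: hom_def poset_cat_def)

lemma poset_simps [simp]: "obj (poset_cat P R) = P" "idm (poset_cat P R) x = (x, x)"
  "cmp (poset_cat P R) (j', k) (i, j) = (i, k)"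
  by (simp_all add: poset_cat_def)

lemma is_category_poset:
  assumes "R \<subseteq> P \<times> P" "refl_on P R" "trans R"
  shows "is_category (poset_cat P R)"
  unfolding is_category_def poset_hom
proof (intro conjI)
  show "\<forall>f\<in>mor (poset_cat P R). source (poset_cat P R) f \<in> obj (poset_cat P R) \<and>
      target (poset_cat P R) f \<in> obj (poset_cat P R)"
    using assms(1) by (auto simp: poset_cat_def)
  show "\<forall>X\<in>obj (poset_cat P R). idm (poset_cat P R) X \<in> {(X, X)} \<inter> R"
    using assms(2) by (auto simp: refl_on_def)
  show "\<forall>X Y Z f g. f \<in> {(X, Y)} \<inter> R \<and> g \<in> {(Y, Z)} \<inter> R \<longrightarrow> cmp (poset_cat P R) g f \<in> {(X, Z)} \<inter> R"
    using assms(3) by (auto dest: transD)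
qed auto

context small_labels
begin

text \<open>Cardinals are relations on \<open>'u\<close> here, so the first infinite cardinal is
  represented on a countable subset of \<open>'u\<close>.\<close>

lemma countable_cardinal:
  obtains \<kappa> :: "'u rel" where "regular_cardinal TYPE('u) \<kappa>" "\<And>S :: 'u set. |S| <o \<kappa> \<longleftrightarrow> finite S"
proof -
  obtain e :: "nat \<Rightarrow> 'u" where e: "inj e" using small_code[OF small_nat[of UNIV]] by blast
  let ?N = "range e"
  have "bij_betw e UNIV ?N" using e by (simp add: bij_betw_def)
  then have "|UNIV :: nat set| =o |?N|" using card_of_ordIsoI by blast
  then have iso: "natLeq =o |?N|"
    by (rule ordIso_transitive[OF ordIso_symmetric[OF card_of_nat]])
  have inf: "infinite ?N" using e finite_imageD[of e UNIV] by auto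
  have 1: "regular_cardinal TYPE('u) |?N|"
    unfolding regular_cardinal_def
  proof (intro conjI)
    show "Card_order |?N|" by (rule card_of_Card_order)
    show "infinite (Field |?N| )" unfolding Field_card_of by (rule inf)
    show "regularCard |?N|" by (rule regularCard_ordIso[OF iso natLeq_Cinfinite regularCard_natLeq])
    show "|?N| <o |UNIV :: 'u set|"
      using small_image[OF small_nat[of UNIV], of e] by (simp add: small_def)
  qed
  have "|S| <o |?N| \<longleftrightarrow> finite S" for S :: "'u set"
  proof -
    have "|S| <o |?N| \<longleftrightarrow> |S| <o natLeq"
      using ordLess_ordIso_trans[OF _ iso] ordLess_ordIso_trans[OF _ ordIso_symmetric[OF iso]] by metis
    then show ?thesis using finite_iff_ordLess_natLeq by metis
  qed
  then show ?thesis using that 1 by blast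
qed

text \<open>In a directed colimit two cells are identified only if they agree at some later stage:
  the relation \<open>ev\<close> expressing this is a congruence containing the relation of the
  diagram. The finitely many cells of \<open>A\<close> and the finitely many equations between their
  faces are then realised at one stage.\<close>

lemma finite_presentable:
  assumes A: "ob True (A :: ('u, 'l) lps)" and fin: "fin_lps A"
    and \<kappa>: "\<And>S :: 'u set. |S| <o \<kappa> \<longleftrightarrow> finite S"
  shows "presentable TYPE('u) \<kappa> HDA A"
  unfolding presentable_def HDA_Cat
proof (intro conjI allI impI; (elim conjE)?)
  show "A \<in> obj (Cat True)" using A by simp
next
  fix P :: "'u set" and R and Fo :: "'u \<Rightarrow> ('u, 'l) lps" and Fm D \<iota>
  assume dir: "directed_poset TYPE('u) \<kappa> P R" and F: "is_functor (poset_cat P R) (Cat True) Fo Fm"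
    and D: "is_colimit (poset_cat P R) (Cat True) Fo Fm D \<iota>"
  have sm: "small TYPE('u) P" and RP: "R \<subseteq> P \<times> P" and refl: "refl_on P R" and tr: "trans R"
    and ub0: "\<And>S. S \<subseteq> P \<Longrightarrow> finite S \<Longrightarrow> \<exists>u\<in>P. \<forall>s\<in>S. (s, u) \<in> R"
    using dir \<kappa> unfolding directed_poset_def by blast+
  have ub: "\<exists>u\<in>P. \<forall>t\<in>T. (g t, u) \<in> R" if "finite T" "\<And>t. t \<in> T \<Longrightarrow> g t \<in> P" for T :: "'t set" and g
    using ub0[of "g ` T"] that by auto
  have J: "is_category (poset_cat P R)" by (rule is_category_poset[OF RP refl tr])
  have RD: "i \<in> P" "j \<in> P" if "(i, j) \<in> R" for i j using RP that by blast+
  have hm: "(i, j) \<in> hom (poset_cat P R) i j" if "(i, j) \<in> R" for i j using that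
    by (simp add: poset_hom)
  have Fh: "Fm (i, j) \<in> hom (Cat True) (Fo i) (Fo j)" if "(i, j) \<in> R" for i j
    by (rule functorD(2)[OF F hm[OF that]])
  have o: "ob True (Fo i)" if "i \<in> P" for i using functorD(1)[OF F, of i] that by simp
  define tm where "tm i j = fn (Fm (i, j))" for i j
  have tm: "lps_map (Fo i) (Fo j) (tm i j)" if "(i, j) \<in> R" for i j
    unfolding tm_def by (rule hom_fn(2)[OF Fh[OF that]])
  have tm_id: "tm i i n x = x" if "i \<in> P" "x \<in> cel (Fo i) n" for i n x
    using functorD(3)[OF F, of i] that by (simp add: tm_def idm_Cat fn_mk)
  have tm_comp: "tm j k n (tm i j n x) = tm i k n x" if "(i, j) \<in> R" "(j, k) \<in> R" "x \<in> cel (Fo i) n"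
    for i j k n x
  proof -
    have "Fm (i, k) = cmp (Cat True) (Fm (j, k)) (Fm (i, j))"
      using functorD(4)[OF F hm[OF that(1)] hm[OF that(2)]] by simp
    then show ?thesis unfolding tm_def using fn_cmp[OF Fh[OF that(1)] Fh[OF that(2)] that(3)] by simp
  qed
  have Dc: "is_cocone (poset_cat P R) (Cat True) Fo Fm D \<iota>" using D unfolding is_colimit_iff by blast
  have \<iota>: "\<iota> j \<in> hom (Cat True) (Fo j) D" if "j \<in> P" for j
    using Dc that unfolding is_cocone_def by simp
  have \<iota>tm: "fn (\<iota> j) n (tm i j n x) = fn (\<iota> i) n x" if "(i, j) \<in> R" "x \<in> cel (Fo i) n" for i j n x
  proof -
    have "cmp (Cat True) (\<iota> j) (Fm (i, j)) = \<iota> i" using Dc hm[OF that(1)] unfolding is_cocone_def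
      by blast
    then show ?thesis unfolding tm_def
      using fn_cmp[OF Fh[OF that(1)] \<iota>[OF RD(2)[OF that(1)]] that(2)] by simp
  qed
  let ?K = "sum_lps P Fo"
  have K: "lps_object ?K" by (rule lps_object_sum[OF ob_object[OF o]])
  define ev where "ev n = {((i, x), (j, y)) | i x j y. i \<in> P \<and> j \<in> P \<and> x \<in> cel (Fo i) n \<and>
    y \<in> cel (Fo j) n \<and>
    (\<exists>k. (i, k) \<in> R \<and> (j, k) \<in> R \<and> tm i k n x = tm j k n y)}" for n
  have evD: "i \<in> P \<and> j \<in> P \<and> x \<in> cel (Fo i) n \<and> y \<in> cel (Fo j) n \<and>
      (\<exists>k. (i, k) \<in> R \<and> (j, k) \<in> R \<and> tm i k n x = tm j k n y)" if "((i, x), (j, y))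
        \<in> ev n" for i x j y n
    using that unfolding ev_def by blast
  have evI: "((i, x), (j, y)) \<in> ev n" if "x \<in> cel (Fo i) n" "y \<in> cel (Fo j) n" "(i, k) \<in> R" "(j, k) \<in> R"
    "tm i k n x = tm j k n y" for i x j y n k
    using that RD unfolding ev_def by blast
  have "congr True ?K ev"
  proof (rule congrI)
    fix n show "equiv (cel ?K n) (ev n)"
    proof (rule equivI')
      show "ev n \<subseteq> cel ?K n \<times> cel ?K n" using evD by fastforce
      show "(p, p) \<in> ev n" if pK: "p \<in> cel ?K n" for p
      proof -
        obtain i x where p: "p = (i, x)" "i \<in> P" "x \<in> cel (Fo i) n" using pK by (cases p) simp
        have "(i, i) \<in> R" using refl p(2) by (auto simp: refl_on_def)
        then show ?thesis unfolding p(1) using evI[OF p(3) p(3)] by blast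
      qed
      show "(q, p) \<in> ev n" if pq: "(p, q) \<in> ev n" for p q
      proof -
        obtain i x j y where *: "p = (i, x)" "q = (j, y)" by (cases p, cases q)
        show ?thesis using evD[OF pq[unfolded *]] evI unfolding * by metis
      qed
      show "(p, r) \<in> ev n" if pq: "(p, q) \<in> ev n" and qr: "(q, r) \<in> ev n" for p q r
      proof -
        obtain i x j y l z where *: "p = (i, x)" "q = (j, y)" "r = (l, z)"
          by (cases p, cases q, cases r)
        have c: "x \<in> cel (Fo i) n" "y \<in> cel (Fo j) n" "z \<in> cel (Fo l) n"
          using evD[OF pq[unfolded *]] evD[OF qr[unfolded *]] by blast+
        obtain k where k: "(i, k) \<in> R" "(j, k) \<in> R" "tm i k n x = tm j k n y"
          using evD[OF pq[unfolded *]] by blast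
        obtain k' where k': "(j, k') \<in> R" "(l, k') \<in> R" "tm j k' n y = tm l k' n z"
          using evD[OF qr[unfolded *]] by blast
        obtain m where m: "(k, m) \<in> R" "(k', m) \<in> R" using ub0[of "{k, k'}"] RD k k' by auto
        have "tm i m n x = tm l m n z"
          using tm_comp[OF k(1) m(1) c(1)] tm_comp[OF k(2) m(1) c(2)] tm_comp[OF k'(1) m(2) c(2)]
            tm_comp[OF k'(2) m(2) c(3)] k(3) k'(3) by simp
        then show ?thesis unfolding *
          using evI[OF c(1,3) transD[OF tr k(1) m(1)] transD[OF tr k'(2) m(2)]] by blast
      qed
    qed
  next
    fix m n f p q assume f: "box m n f" and pq: "(p, q) \<in> ev n"
    obtain i x j y where *: "p = (i, x)" "q = (j, y)" by (cases p, cases q)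
    obtain k where k: "i \<in> P" "j \<in> P" "x \<in> cel (Fo i) n" "y \<in> cel (Fo j) n" "(i, k) \<in> R" "(j, k) \<in> R"
        "tm i k n x = tm j k n y" using evD[OF pq[unfolded *]] by blast
    have "tm i k m (res (Fo i) m n f x) = tm j k m (res (Fo j) m n f y)"
      using map_res[OF tm[OF k(5)] f k(3)] map_res[OF tm[OF k(6)] f k(4)] k(7) by simp
    then show "(res ?K m n f p, res ?K m n f q) \<in> ev m"
      using evI[OF res_cel[OF ob_object[OF o[OF k(1)]] f k(3)] res_cel[OF ob_object[OF o[OF k(2)]]
        f k(4)] k(5,6)]
      by (simp add: *)
  next
    fix n p q assume pq: "(p, q) \<in> ev n"
    obtain i x j y where *: "p = (i, x)" "q = (j, y)" by (cases p, cases q)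
    obtain k where k: "x \<in> cel (Fo i) n" "y \<in> cel (Fo j) n" "(i, k) \<in> R" "(j, k) \<in> R"
        "tm i k n x = tm j k n y" using evD[OF pq[unfolded *]] by blast
    show "lab ?K n p = lab ?K n q"
      using map_lab[OF tm[OF k(3)] k(1)] map_lab[OF tm[OF k(4)] k(2)] k(5) by (simp add: *)
  next
    fix n p q assume n: "n \<ge> 2" and p: "p \<in> cel ?K n" and q: "q \<in> cel ?K n"
      and l: "lab ?K n p = lab ?K n q"
      and eq: "\<And>m f. box m n f \<Longrightarrow> m < n \<Longrightarrow> (res ?K m n f p, res ?K m n f q) \<in> ev m"
    obtain i x j y where *: "p = (i, x)" "q = (j, y)" by (cases p, cases q)
    have c: "i \<in> P" "j \<in> P" "x \<in> cel (Fo i) n" "y \<in> cel (Fo j) n" using p q * by simp_all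
    \<comment> \<open>The clause of the HDA paradigm: a cell has only finitely many proper faces, so
      there is one stage at which those of both cells agree, and there the two cells themselves
      agree.\<close>
    let ?T = "Sigma {..<n} (\<lambda>m. {f. box m n f})"
    have "\<exists>k. (i, k) \<in> R \<and> (j, k) \<in> R \<and> tm i k (fst t) (res (Fo i) (fst t) n (snd t) x) =
        tm j k (fst t) (res (Fo j) (fst t) n (snd t) y)" if t: "t \<in> ?T" for t
    proof -
      obtain m f where mf: "t = (m, f)" "m < n" "box m n f" using t by auto
      show ?thesis using evD[of i "res (Fo i) m n f x" j "res (Fo j) m n f y" m] eq[OF mf(3,2)]
        by (simp add: * mf(1))
    qed
    then obtain g where g: "\<And>t. t \<in> ?T \<Longrightarrow> (i, g t) \<in> R \<and> (j, g t) \<in> R \<and>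
        tm i (g t) (fst t) (res (Fo i) (fst t) n (snd t) x) = tm j (g t) (fst t) (res (Fo j) (fst t)
          n (snd t) y)"
      by metis
    have "finite ?T" using finite_box by blast
    then obtain k0 where k0: "k0 \<in> P" "\<forall>t\<in>?T. (g t, k0) \<in> R" using ub[of ?T g] g RD(2) by blast
    obtain k where k: "k \<in> P" "(i, k) \<in> R" "(j, k) \<in> R" "(k0, k) \<in> R"
      using ub0[of "{i, j, k0}"] c k0(1) by auto
    have "tm i k n x = tm j k n y"
    proof (rule hda1D[OF ob_hda1[OF o[OF k(1)]] n])
      show "tm i k n x \<in> cel (Fo k) n" "tm j k n y \<in> cel (Fo k) n"
        using map_cel[OF tm[OF k(2)] c(3)] map_cel[OF tm[OF k(3)] c(4)] .
      show "lab (Fo k) n (tm i k n x) = lab (Fo k) n (tm j k n y)"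
        using map_lab[OF tm[OF k(2)] c(3)] map_lab[OF tm[OF k(3)] c(4)] l by (simp add: *)
      fix m f assume f: "box m n f" "m < n"
      then have t: "(m, f) \<in> ?T" by simp
      have gk: "(g (m, f), k) \<in> R" using transD[OF tr bspec[OF k0(2) t] k(4)] .
      note rx = res_cel[OF ob_object[OF o[OF c(1)]] f(1) c(3)]
        and ry = res_cel[OF ob_object[OF o[OF c(2)]] f(1) c(4)]
      have "tm i k m (res (Fo i) m n f x) = tm j k m (res (Fo j) m n f y)"
        using g[OF t] tm_comp[OF _ gk rx] tm_comp[OF _ gk ry] by (metis fst_conv snd_conv)
      then show "res (Fo k) m n f (tm i k n x) = res (Fo k) m n f (tm j k n y)"
        using map_res[OF tm[OF k(2)] f(1) c(3)] map_res[OF tm[OF k(3)] f(1) c(4)] by simp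
    qed
    then show "(p, q) \<in> ev n" unfolding * by (rule evI[OF c(3,4) k(2,3)])
  qed
  note evc = this
  have Rev: "diagram_rel (poset_cat P R) Fo Fm n \<subseteq> ev n" for n
  proof (rule subsetI)
    fix p assume "p \<in> diagram_rel (poset_cat P R) Fo Fm n"
    then obtain i j x where p: "p = ((i, x), (j, tm i j n x))" "(i, j) \<in> R" "x \<in> cel (Fo i) n"
      unfolding diagram_rel_def poset_hom tm_def by blast
    have jj: "(j, j) \<in> R" using refl RD(2)[OF p(2)] by (auto simp: refl_on_def)
    note c = map_cel[OF tm[OF p(2)] p(3)]
    show "p \<in> ev n" unfolding p(1)
      by (rule evI[OF p(3) c p(2) jj]) (simp add: tm_id[OF RD(2)[OF p(2)] c])
  qed
  have cover: "\<exists>j\<in>P. \<exists>x\<in>cel (Fo j) n. z = fn (\<iota> j) n x" if "z \<in> cel D n" for z n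
    using is_colimit_cells(1)[OF J _ F D that] sm by simp
  have kernel: "\<exists>k. (i, k) \<in> R \<and> (j, k) \<in> R \<and> tm i k n x = tm j k n y"
    if "i \<in> P" "x \<in> cel (Fo i) n" "j \<in> P" "y \<in> cel (Fo j) n" "fn (\<iota> i) n x = fn (\<iota> j) n y" for i x j y n
  proof -
    have "((i, x), (j, y)) \<in> gen_congr True ?K (diagram_rel (poset_cat P R) Fo Fm) n"
      using is_colimit_cells(2)[OF J _ F D, of i x n j y] that sm by simp
    then have "((i, x), (j, y)) \<in> ev n" by (rule gen_congrD[OF _ evc Rev])
    then show ?thesis using evD by blast
  qed
  let ?A = "{(n, a). a \<in> cel A n}"
  have finA: "finite ?A" using fin by (simp add: fin_lps_def)
  have Ao: "lps_object A" by (rule ob_object[OF A])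
  have fact: "\<exists>j\<in>P. \<exists>g\<in>hom (Cat True) A (Fo j). f = cmp (Cat True) (\<iota> j) g"
    if f: "f \<in> hom (Cat True) A D" for f
  proof -
    note fm = hom_fn(2)[OF f]
    have "\<exists>jx. fst jx \<in> P \<and> snd jx \<in> cel (Fo (fst jx)) (fst t) \<and> fn f (fst t) (snd t) =
      fn (\<iota> (fst jx)) (fst t) (snd jx)"
      if t: "t \<in> ?A" for t
    proof -
      obtain n a where na: "t = (n, a)" "a \<in> cel A n" using t by blast
      show ?thesis using cover[OF map_cel[OF fm na(2)]] na(1) by auto
    qed
    then obtain s where s: "\<And>t. t \<in> ?A \<Longrightarrow> fst (s t) \<in> P \<and> snd (s t) \<in> cel (Fo (fst (s t))) (fst t) \<and>
        fn f (fst t) (snd t) = fn (\<iota> (fst (s t))) (fst t) (snd (s t))" by metis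
    obtain j where j: "j \<in> P" "\<forall>t\<in>?A. (fst (s t), j) \<in> R" using ub[OF finA, of "\<lambda>t. fst (s t)"] s
      by blast
    \<comment> \<open>The lifts of the cells of \<open>A\<close>, chosen one by one, are brought to
      a common stage \<open>j\<close>; they need not commute with restrictions yet.\<close>
    define x where "x n a = tm (fst (s (n, a))) j n (snd (s (n, a)))" for n a
    have x: "x n a \<in> cel (Fo j) n \<and> fn (\<iota> j) n (x n a) = fn f n a" if a: "a \<in> cel A n" for n a
    proof -
      have t: "(n, a) \<in> ?A" using a by simp
      have r: "(fst (s (n, a)), j) \<in> R" using j(2) t by blast
      have c: "snd (s (n, a)) \<in> cel (Fo (fst (s (n, a)))) n"
        "fn f n a = fn (\<iota> (fst (s (n, a)))) n (snd (s (n, a)))"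
        using s[OF t] by simp_all
      show ?thesis unfolding x_def c(2) using map_cel[OF tm[OF r] c(1)] \<iota>tm[OF r c(1)] by blast
    qed
    \<comment> \<open>Compatibility with restrictions holds in the colimit. It amounts to finitely
      many equations, each valid from some stage on, so all of them hold at a later stage.\<close>
    let ?T = "Sigma ?A (\<lambda>t. Sigma {..fst t} (\<lambda>m. {g. box m (fst t) g}))"
    have finT: "finite ?T" by (intro finite_SigmaI finA finite_atMost finite_box)
    have "\<exists>k. (j, k) \<in> R \<and> tm j k m (res (Fo j) m n g (x n a)) = tm j k m (x m (res A m n g a))"
      if "a \<in> cel A n" "box m n g" for n a m g
    proof -
      have "fn (\<iota> j) m (res (Fo j) m n g (x n a)) = fn (\<iota> j) m (x m (res A m n g a))"
        using map_res[OF hom_fn(2)[OF \<iota>[OF j(1)]] that(2), of "x n a"] x[OF that(1)]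
          x[OF res_cel[OF Ao that(2,1)]]
          map_res[OF fm that(2,1)] by simp
      moreover have "res (Fo j) m n g (x n a) \<in> cel (Fo j) m" "x m (res A m n g a) \<in> cel (Fo j) m"
        using res_cel[OF ob_object[OF o[OF j(1)]] that(2)] x[OF that(1)]
          x[OF res_cel[OF Ao that(2,1)]] by blast+
      ultimately show ?thesis using kernel[OF j(1) _ j(1)] by blast
    qed
    note qex = this
    define q where "q n a m g = (SOME k. (j, k) \<in> R \<and>
      tm j k m (res (Fo j) m n g (x n a)) = tm j k m (x m (res A m n g a)))" for n a m g
    have q: "(j, q n a m g) \<in> R \<and> tm j (q n a m g) m (res (Fo j) m n g (x n a)) =
      tm j (q n a m g) m (x m (res A m n g a))"
      if "a \<in> cel A n" "box m n g" for n a m g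
      unfolding q_def by (rule someI_ex[OF qex[OF that]])
    have "\<exists>u\<in>P. \<forall>t\<in>?T. ((\<lambda>((n, a), m, g). q n a m g) t, u) \<in> R"
      by (rule ub[OF finT]) (use q RD(2) in fastforce)
    then obtain k0 where k0: "k0 \<in> P" "\<And>n a m g. a \<in> cel A n \<Longrightarrow> box m n g \<Longrightarrow> (q n a m g, k0) \<in> R"
      using box_le by fastforce
    obtain k where k: "k \<in> P" "(j, k) \<in> R" "(k0, k) \<in> R" using ub0[of "{j, k0}"] j(1) k0(1) by auto
    define g where "g n a = tm j k n (x n a)" for n a
    have g\<iota>: "fn (\<iota> k) n (g n a) = fn f n a" if "a \<in> cel A n" for n a
      unfolding g_def using \<iota>tm[OF k(2)] x[OF that] by simp
    have gm: "lps_map A (Fo k) g"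
    proof (rule lps_mapI)
      fix n a assume a: "a \<in> cel A n"
      show c: "g n a \<in> cel (Fo k) n" unfolding g_def using map_cel[OF tm[OF k(2)]] x[OF a] by blast
      show "lab (Fo k) n (g n a) = lab A n a"
        using map_lab[OF hom_fn(2)[OF \<iota>[OF k(1)]] c] g\<iota>[OF a] map_lab[OF fm a] by simp
      fix m h assume h: "box m n h"
      have qk: "(q n a m h, k) \<in> R" by (rule transD[OF tr k0(2)[OF a h] k(3)])
      have xc: "res (Fo j) m n h (x n a) \<in> cel (Fo j) m" "x m (res A m n h a) \<in> cel (Fo j) m"
        using res_cel[OF ob_object[OF o[OF j(1)]] h] x[OF a] x[OF res_cel[OF Ao h a]] by blast+
      have jq: "(j, q n a m h) \<in> R" using q[OF a h] by blast
      have "tm j k m (res (Fo j) m n h (x n a)) = tm j k m (x m (res A m n h a))"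
        using q[OF a h] tm_comp[OF jq qk xc(1)] tm_comp[OF jq qk xc(2)] by simp
      then show "g m (res A m n h a) = res (Fo k) m n h (g n a)"
        unfolding g_def using map_res[OF tm[OF k(2)] h] x[OF a] by simp
    qed
    have gh: "mk A g (Fo k) \<in> hom (Cat True) A (Fo k)" using A o[OF k(1)] gm by simp
    have "f = cmp (Cat True) (\<iota> k) (mk A g (Fo k))"
    proof (rule hom_eqI[OF f cmp_hom[OF gh \<iota>[OF k(1)]]])
      fix n a assume a: "a \<in> cel A n"
      show "fn f n a = fn (cmp (Cat True) (\<iota> k) (mk A g (Fo k))) n a"
        unfolding fn_cmp[OF gh \<iota>[OF k(1)] a] fn_mk[OF a] using g\<iota>[OF a] by simp
    qed
    then show ?thesis using k(1) gh by blast
  qed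
  then show "\<forall>f\<in>hom (Cat True) A D. \<exists>j\<in>P. \<exists>g\<in>hom (Cat True) A (Fo j). f = cmp (Cat True) (\<iota> j) g"
    by (intro ballI)
  show "\<forall>i\<in>P. \<forall>j\<in>P. \<forall>g\<in>hom (Cat True) A (Fo i). \<forall>h\<in>hom (Cat True) A (Fo j).
      cmp (Cat True) (\<iota> i) g = cmp (Cat True) (\<iota> j) h \<longrightarrow>
      (\<exists>k. (i, k) \<in> R \<and> (j, k) \<in> R \<and> cmp (Cat True) (Fm (i, k)) g = cmp (Cat True) (Fm (j, k)) h)"
  proof (intro ballI impI)
    fix i j g h assume i: "i \<in> P" and j: "j \<in> P" and g: "g \<in> hom (Cat True) A (Fo i)"
      and h: "h \<in> hom (Cat True) A (Fo j)" and eq: "cmp (Cat True) (\<iota> i) g = cmp (Cat True) (\<iota> j) h"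
    have qex: "\<exists>k. (i, k) \<in> R \<and> (j, k) \<in> R \<and> tm i k n (fn g n a) = tm j k n (fn h n a)"
      if a: "a \<in> cel A n" for n a
      using kernel[OF i map_cel[OF hom_fn(2)[OF g] a] j map_cel[OF hom_fn(2)[OF h] a]]
        fn_cmp[OF g \<iota>[OF i] a] fn_cmp[OF h \<iota>[OF j] a] eq by simp
    define q where "q n a = (SOME k. (i, k) \<in> R \<and> (j, k) \<in> R \<and> tm i k n (fn g n a) =
      tm j k n (fn h n a))" for n a
    have q: "(i, q n a) \<in> R \<and> (j, q n a) \<in> R \<and> tm i (q n a) n (fn g n a) = tm j (q n a) n (fn h n a)"
      if "a \<in> cel A n" for n a
      unfolding q_def by (rule someI_ex[OF qex[OF that]])
    have "\<exists>u\<in>P. \<forall>t\<in>?A. ((\<lambda>(n, a). q n a) t, u) \<in> R"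
      by (rule ub[OF finA]) (use q RD(2) in fastforce)
    then obtain k0 where k0: "k0 \<in> P" "\<And>n a. a \<in> cel A n \<Longrightarrow> (q n a, k0) \<in> R" by fastforce
    obtain k where k: "(i, k) \<in> R" "(j, k) \<in> R" "(k0, k) \<in> R" using ub0[of "{i, j, k0}"] i j k0(1)
      by auto
    have "cmp (Cat True) (Fm (i, k)) g = cmp (Cat True) (Fm (j, k)) h"
    proof (rule hom_eqI[OF cmp_hom[OF g Fh[OF k(1)]] cmp_hom[OF h Fh[OF k(2)]]])
      fix n a assume a: "a \<in> cel A n"
      note qk = transD[OF tr k0(2)[OF a] k(3)]
      have qa: "(i, q n a) \<in> R" "(j, q n a) \<in> R" "tm i (q n a) n (fn g n a) = tm j (q n a) n (fn h n a)"
        using q[OF a] by blast+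
      have "tm i k n (fn g n a) = tm j k n (fn h n a)"
        using tm_comp[OF qa(1) qk map_cel[OF hom_fn(2)[OF g] a]] tm_comp[OF qa(2)
          qk map_cel[OF hom_fn(2)[OF h] a]] qa(3)
        by simp
      then show "fn (cmp (Cat True) (Fm (i, k)) g) n a = fn (cmp (Cat True) (Fm (j, k)) h) n a"
        unfolding fn_cmp[OF g Fh[OF k(1)] a] fn_cmp[OF h Fh[OF k(2)] a] tm_def .
    qed
    then show "\<exists>k. (i, k) \<in> R \<and> (j, k) \<in> R \<and> cmp (Cat True) (Fm (i, k)) g =
      cmp (Cat True) (Fm (j, k)) h"
      using k(1,2) by blast
  qed
qed

end

section \<open>Every object as a directed colimit of finite ones\<close>

lemma lps_iso_comp:
  assumes "lps_iso X Y \<phi> \<psi>" "lps_iso Y Z \<phi>' \<psi>'"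
  shows "lps_iso X Z (\<lambda>n x. \<phi>' n (\<phi> n x)) (\<lambda>n z. \<psi> n (\<psi>' n z))"
  unfolding lps_iso_def
  using lps_map_comp[OF lps_isoD(1)[OF assms(1)] lps_isoD(1)[OF assms(2)]]
    lps_map_comp[OF lps_isoD(2)[OF assms(2)] lps_isoD(2)[OF assms(1)]]
    lps_isoD(3,4)[OF assms(1)] lps_isoD(3,4)[OF assms(2)]
    map_cel[OF lps_isoD(1)[OF assms(1)]] map_cel[OF lps_isoD(2)[OF assms(2)]] by simp

lemma fin_lps_iso:
  assumes i: "lps_iso X Y \<phi> \<psi>" and fin: "fin_lps X"
  shows "fin_lps Y"
proof -
  have "{(n, y). y \<in> cel Y n} \<subseteq> (\<lambda>(n, x). (n, \<phi> n x)) ` {(n, x). x \<in> cel X n}"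
  proof
    fix t assume "t \<in> {(n, y). y \<in> cel Y n}"
    then obtain n y where t: "t = (n, y)" "y \<in> cel Y n" by blast
    have "t = (\<lambda>(n, x). (n, \<phi> n x)) (n, \<psi> n y)" using lps_isoD(4)[OF i t(2)] t(1) by simp
    then show "t \<in> (\<lambda>(n, x). (n, \<phi> n x)) ` {(n, x). x \<in> cel X n}"
      using map_cel[OF lps_isoD(2)[OF i] t(2)] by blast
  qed
  then show ?thesis using fin unfolding fin_lps_def by (meson finite_imageI finite_subset)
qed

text \<open>Starting from cells in \<open>nat\<close> keeps this set small, and up to isomorphism
  every finite object is obtained.\<close>

definition fin_objects :: "('u, 'l) lps set" where
  "fin_objects = place ` {K :: (nat, 'l) lps. lps_object K \<and> hda1 K \<and> fin_lps K}"

definition gen :: "('a, 'l) lps \<Rightarrow> nat \<Rightarrow> 'a \<Rightarrow> (nat \<times> 'a) set" where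
  "gen X n x = {(m, res X m n f x) | m f. box m n f}"

text \<open>Finite subobjects, coded as sets of cells paired with their dimensions.\<close>

definition fin_subs :: "('a, 'l) lps \<Rightarrow> (nat \<times> 'a) set set" where
  "fin_subs X = {D. finite D \<and> (\<forall>n x. (n, x) \<in> D \<longrightarrow> x \<in> cel X n \<and> gen X n x \<subseteq> D)}"

lemma fin_subsD:
  assumes "D \<in> fin_subs X"
  shows "finite D" "(n, x) \<in> D \<Longrightarrow> x \<in> cel X n" "(n, x) \<in> D \<Longrightarrow> gen X n x \<subseteq> D"
    "(n, x) \<in> D \<Longrightarrow> box m n f \<Longrightarrow> (m, res X m n f x) \<in> D"
  using assms unfolding fin_subs_def gen_def by blast+

lemma gen_fin_subs:
  assumes X: "lps_object X" and x: "x \<in> cel X n"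
  shows "gen X n x \<in> fin_subs X" "(n, x) \<in> gen X n x"
proof -
  have "gen X n x \<subseteq> (\<lambda>(m, f). (m, res X m n f x)) ` Sigma {..n} (\<lambda>m. {f. box m n f})"
    unfolding gen_def using box_le by fastforce
  moreover have "finite (Sigma {..n} (\<lambda>m. {f. box m n f}))"
    by (intro finite_SigmaI finite_atMost finite_box)
  ultimately have "finite (gen X n x)" using finite_surj by blast
  moreover have "y \<in> cel X m \<and> gen X m y \<subseteq> gen X n x" if my: "(m, y) \<in> gen X n x" for m y
  proof -
    obtain f where f: "box m n f" "y = res X m n f x" using my unfolding gen_def by blast
    have "res X l m g y = res X l n (cb l f g) x" "box l n (cb l f g)" if "box l m g" for l g
      using res_comp[OF X that f(1) x] f(2) box_comp[OF that f(1)] by simp_all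
    then have "gen X m y \<subseteq> gen X n x" unfolding gen_def by blast
    then show ?thesis using res_cel[OF X f(1) x] f(2) by blast
  qed
  ultimately show "gen X n x \<in> fin_subs X" unfolding fin_subs_def by blast
  have "(n, res X n n (idb n) x) \<in> gen X n x" unfolding gen_def using box_id[of n] by blast
  then show "(n, x) \<in> gen X n x" by (simp add: res_id[OF X x])
qed

context small_labels
begin

lemma small_UNIV_lps: "small TYPE('u) (UNIV :: (nat, 'l) lps set)"
proof (rule small_inj)
  let ?f = "\<lambda>K :: (nat, 'l) lps. (cells (und K), act (und K), lab K)"
  have b: "small TYPE('u) (UNIV :: (bool list \<Rightarrow> bool list) set)" by (rule small_box)
  have n: "small TYPE('u) (UNIV :: nat set)" by (rule small_nat)
  show "small TYPE('u) (UNIV :: ((nat \<Rightarrow> nat set) \<times> (nat \<Rightarrow> nat \<Rightarrow> (bool list \<Rightarrow> bool list) \<Rightarrow> nat \<Rightarrow> nat) \<times>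
      (nat \<Rightarrow> nat \<Rightarrow> 'l list)) set)"
    by (intro small_UNIV_prod small_UNIV_fun small_UNIV_set small_UNIV_list small_labels b n)
  show "inj ?f" by (rule injI) (auto intro!: lps.equality presheaf_data.equality)
qed simp

lemma small_fin_objects: "small TYPE('u) (fin_objects :: ('u, 'l) lps set)"
  unfolding fin_objects_def by (intro small_image small_subset[OF small_UNIV_lps]) simp

lemma fin_objects_finite:
  assumes "A \<in> (fin_objects :: ('u, 'l) lps set)"
  shows "ob True A" "fin_lps A"
proof -
  obtain K :: "(nat, 'l) lps" where K: "A = place K" "lps_object K" "hda1 K" "fin_lps K"
    using assms unfolding fin_objects_def by blast
  show "ob True A" unfolding K(1) using ob_place[OF small_nat K(2)] K(3) by blast
  show "fin_lps A" unfolding K(1) by (rule fin_lps_iso[OF place_iso[OF small_nat K(2)] K(4)])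
qed

lemma fin_object_exists:
  assumes X: "lps_object (X :: ('u, 'l) lps)" "hda1 X" "fin_lps X"
  shows "\<exists>Z\<in>fin_objects. \<exists>\<alpha> \<beta>. lps_iso X (Z :: ('u, 'l) lps) \<alpha> \<beta>"
proof -
  let ?C = "snd ` {(n, x). x \<in> cel X n}"
  have "finite ?C" using X(3) unfolding fin_lps_def by (rule finite_imageI)
  from finite_imp_inj_to_nat_seg[OF this] obtain e :: "'u \<Rightarrow> nat" where e: "inj_on e ?C"
    by (elim exE conjE)
  have d: "inv_into ?C e (e x) = x" if "x \<in> cel X n" for n x
    by (rule inv_into_f_f[OF e image_eqI[of _ _ "(n, x)"]]) (simp_all add: that)
  let ?K = "transport (\<lambda>_. e) (\<lambda>_. inv_into ?C e) X"
  have K1: "lps_object ?K" by (rule transport_iso(1)[OF X(1)]) (rule d)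
  have K2: "lps_iso X ?K (\<lambda>_. e) (\<lambda>_. inv_into ?C e)" by (rule transport_iso(2)[OF X(1)]) (rule d)
  have "place ?K \<in> (fin_objects :: ('u, 'l) lps set)"
    unfolding fin_objects_def
    by (intro imageI CollectI conjI K1 lps_iso_hda1[OF K2 X(2)] fin_lps_iso[OF K2 X(3)])
  moreover have "lps_iso X (place ?K :: ('u, 'l) lps) (\<lambda>n x. emb (e x)) (\<lambda>n z.
    inv_into ?C e (inv emb z))"
    by (rule lps_iso_comp[OF K2 place_iso[OF small_nat K1]])
  ultimately show ?thesis by blast
qed

text \<open>The finite subobjects form a directed system, since finite unions of them are finite
  subobjects, and they exhaust \<open>X\<close>, since each cell generates a finite one. Both the
  index set and the subobjects have to be recoded: the former as a subset of \<open>'u\<close>, the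
  latter as members of \<open>fin_objects\<close>.\<close>

lemma finite_generation:
  assumes X: "ob True (X :: ('u, 'l) lps)" and \<kappa>: "\<And>S :: 'u set. |S| <o \<kappa> \<longleftrightarrow> finite S"
  shows "\<exists>(P :: 'u set) R Fo Fm \<iota>. directed_poset TYPE('u) \<kappa> P R \<and>
    is_functor (poset_cat P R) HDA Fo Fm \<and> (\<forall>j\<in>P. Fo j \<in> fin_objects) \<and>
    is_colimit (poset_cat P R) HDA Fo Fm X \<iota>"
proof -
  note Xo = ob_object[OF X]
  let ?F = "fin_subs X"
  have "small TYPE('u) ?F"
  proof (rule small_subset)
    show "small TYPE('u) (Pow (Sigma (UNIV :: nat set) (\<lambda>n. cel X n)))"
      by (intro small_Pow small_Sigma small_nat ob_small[OF X])
    show "?F \<subseteq> Pow (Sigma UNIV (\<lambda>n. cel X n))" using fin_subsD(2) by fast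
  qed
  then obtain c :: "(nat \<times> 'u) set \<Rightarrow> 'u" where c: "inj_on c ?F" using small_code by blast
  define P where "P = c ` ?F"
  define dec where "dec = inv_into ?F c"
  define R where "R = {(u, v). u \<in> P \<and> v \<in> P \<and> dec u \<subseteq> dec v}"
  have dec: "dec u \<in> ?F" if "u \<in> P" for u using that unfolding dec_def P_def by (rule inv_into_into)
  have dec_c: "dec (c D) = D" "c D \<in> P" if "D \<in> ?F" for D
    using inv_into_f_f[OF c that] that unfolding dec_def P_def by simp_all
  have c_dec: "c (dec u) = u" if "u \<in> P" for u using that f_inv_into_f unfolding dec_def P_def by metis
  have smP: "small TYPE('u) P" unfolding P_def by (rule small_image) fact
  have dir: "directed_poset TYPE('u) \<kappa> P R"
    unfolding directed_poset_def
  proof (intro conjI allI impI)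
    show "small TYPE('u) P" by (rule smP)
    show "R \<subseteq> P \<times> P" "refl_on P R" "trans R" unfolding R_def refl_on_def trans_def by auto
    show "antisym R"
    proof (rule antisymI)
      fix u v assume "(u, v) \<in> R" "(v, u) \<in> R"
      then have "dec u = dec v" "u \<in> P" "v \<in> P" unfolding R_def by auto
      then show "u = v" using c_dec by metis
    qed
    fix S assume S: "S \<subseteq> P" "|S| <o \<kappa>"
    let ?D = "\<Union>s\<in>S. dec s"
    have D: "?D \<in> ?F"
      unfolding fin_subs_def
    proof (intro CollectI conjI allI impI)
      show "finite ?D" using S \<kappa> fin_subsD(1)[OF dec] by blast
      fix n x assume "(n, x) \<in> ?D"
      then obtain s where s: "s \<in> S" "(n, x) \<in> dec s" by blast
      show "x \<in> cel X n" "gen X n x \<subseteq> ?D"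
        using fin_subsD(2,3)[OF dec s(2)] s(1) S(1) by blast+
    qed
    have "(s, c ?D) \<in> R" if "s \<in> S" for s
      using that S(1) dec_c[OF D] unfolding R_def by auto
    then show "\<exists>u\<in>P. \<forall>s\<in>S. (s, u) \<in> R" using dec_c(2)[OF D] by blast
  qed
  define sub where "sub D = restr X (\<lambda>n. {x. (n, x) \<in> D})" for D
  have sub: "lps_object (sub D)" "lps_map (sub D) X (\<lambda>n x. x)" "hda1 (sub D)" "fin_lps (sub D)"
    if D: "D \<in> ?F" for D
  proof -
    show "lps_object (sub D)" unfolding sub_def
      by (rule lps_object_restr[OF Xo]) (use fin_subsD[OF D] in blast)+
    show m: "lps_map (sub D) X (\<lambda>n x. x)" unfolding sub_def
      by (rule lps_map_restr) (use fin_subsD[OF D] in blast)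
    show "hda1 (sub D)" by (rule hda1_inj[OF m _ ob_hda1[OF X]]) simp
    show "fin_lps (sub D)" unfolding fin_lps_def sub_def using fin_subsD(1)[OF D] by simp
  qed
  have "\<exists>t. fst t \<in> fin_objects \<and> lps_iso (sub D) (fst t :: ('u, 'l) lps) (fst (snd t)) (snd (snd t))" if "D \<in> ?F" for D
    using fin_object_exists[OF sub(1,3,4)[OF that]] by auto
  then obtain t where t: "\<And>D. D \<in> ?F \<Longrightarrow> fst (t D) \<in> fin_objects \<and>
      lps_iso (sub D) (fst (t D) :: ('u, 'l) lps) (fst (snd (t D))) (snd (snd (t D)))" by metis
  define Z where "Z D = fst (t D)" for D
  define \<alpha> where "\<alpha> D = fst (snd (t D))" for D
  define \<beta> where "\<beta> D = snd (snd (t D))" for D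
  have Z: "Z D \<in> fin_objects" and iso: "lps_iso (sub D) (Z D) (\<alpha> D) (\<beta> D)" if "D \<in> ?F" for D
    using t[OF that] unfolding Z_def \<alpha>_def \<beta>_def by blast+
  have Zo: "ob True (Z D)" if "D \<in> ?F" for D by (rule fin_objects_finite(1)[OF Z[OF that]])
  have cs: "x \<in> cel (sub D) n \<longleftrightarrow> (n, x) \<in> D" for D n x by (simp add: sub_def)
  have \<beta>c: "(n, \<beta> D n z) \<in> D" if "D \<in> ?F" "z \<in> cel (Z D) n" for D n z
    using map_cel[OF lps_isoD(2)[OF iso[OF that(1)]] that(2)] cs by blast
  have \<alpha>c: "\<alpha> D n x \<in> cel (Z D) n" if "D \<in> ?F" "(n, x) \<in> D" for D n x
    using map_cel[OF lps_isoD(1)[OF iso[OF that(1)]]] that(2) cs by blast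
  have \<beta>\<alpha>: "\<beta> D n (\<alpha> D n x) = x" if "D \<in> ?F" "(n, x) \<in> D" for D n x
    using lps_isoD(3)[OF iso[OF that(1)]] that(2) cs by blast
  have \<alpha>\<beta>: "\<alpha> D n (\<beta> D n z) = z" if "D \<in> ?F" "z \<in> cel (Z D) n" for D n z
    by (rule lps_isoD(4)[OF iso[OF that(1)] that(2)])
  \<comment> \<open>The inclusions of subobjects, conjugated by the isomorphisms to their
    representatives.\<close>
  define tm where "tm D E n z = \<alpha> E n (\<beta> D n z)" for D E n z
  have tm: "lps_map (Z D) (Z E) (tm D E)" if "D \<in> ?F" "E \<in> ?F" "D \<subseteq> E" for D E
  proof -
    have "lps_map (sub D) (sub E) (\<lambda>n x. x)" by (rule lps_mapI) (use that(3) in \<open>auto simp: sub_def\<close>)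
    from lps_map_comp[OF lps_map_comp[OF lps_isoD(2)[OF iso[OF that(1)]] this]
      lps_isoD(1)[OF iso[OF that(2)]]]
    show ?thesis unfolding tm_def .
  qed
  let ?J = "poset_cat P R"
  define Fo where "Fo u = Z (dec u)" for u
  define Fm where "Fm t = mk (Fo (fst t)) (tm (dec (fst t)) (dec (snd t))) (Fo (snd t))" for t
  define \<iota> where "\<iota> u = mk (Fo u) (\<beta> (dec u)) X" for u
  have Fo: "ob True (Fo u)" "Fo u \<in> fin_objects" if "u \<in> P" for u unfolding Fo_def
    using Zo[OF dec[OF that]] Z[OF dec[OF that]] .
  have Rd: "u \<in> P" "v \<in> P" "dec u \<subseteq> dec v" if "(u, v) \<in> R" for u v using that unfolding R_def by blast+
  have Fh: "Fm (u, v) \<in> hom (Cat True) (Fo u) (Fo v)" if "(u, v) \<in> R" for u v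
    unfolding Fm_def fst_conv snd_conv using Rd[OF that] Fo tm[OF dec dec] by (simp add: Fo_def)
  have funct: "is_functor ?J (Cat True) Fo Fm"
    unfolding is_functor_def
  proof (intro conjI ballI allI impI; (elim conjE)?)
    show "Fo j \<in> obj (Cat True)" if "j \<in> obj ?J" for j using that Fo(1) by simp
    show "Fm u \<in> hom (Cat True) (Fo i) (Fo j)" if "u \<in> hom ?J i j" for i j u
      using that Fh unfolding poset_hom by blast
    show "Fm (idm ?J j) = idm (Cat True) (Fo j)" if "j \<in> obj ?J" for j
      using that \<alpha>\<beta>[OF dec] by (simp add: Fm_def idm_Cat mk_eq_iff tm_def Fo_def)
    fix i j k u v assume "u \<in> hom ?J i j" "v \<in> hom ?J j k"
    then have uv: "u = (i, j)" "v = (j, k)" "(i, j) \<in> R" "(j, k) \<in> R" unfolding poset_hom by blast+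
    have "(i, k) \<in> R" using Rd[OF uv(3)] Rd[OF uv(4)] unfolding R_def by blast
    note ik = this
    show "Fm (cmp ?J v u) = cmp (Cat True) (Fm v) (Fm u)"
    proof (rule hom_eqI)
      show "Fm (cmp ?J v u) \<in> hom (Cat True) (Fo i) (Fo k)" using Fh[OF ik] uv by simp
      show "cmp (Cat True) (Fm v) (Fm u) \<in> hom (Cat True) (Fo i) (Fo k)"
        using cmp_hom[OF Fh[OF uv(3)] Fh[OF uv(4)]] uv by simp
      fix n z assume z: "z \<in> cel (Fo i) n"
      have i: "dec i \<in> ?F" "dec j \<in> ?F" "dec i \<subseteq> dec j" using Rd[OF uv(3)] dec by blast+
      have b: "(n, \<beta> (dec i) n z) \<in> dec i" using \<beta>c[OF i(1)] z unfolding Fo_def by blast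
      have z': "tm (dec i) (dec j) n z \<in> cel (Fo j) n"
        using map_cel[OF tm[OF i]] z unfolding Fo_def by blast
      have "fn (Fm (cmp ?J v u)) n z = tm (dec i) (dec k) n z" using z by (simp add: uv Fm_def fn_mk)
      also have "\<dots> = tm (dec j) (dec k) n (tm (dec i) (dec j) n z)"
        unfolding tm_def using \<beta>\<alpha>[OF i(2)] b i(3) by (simp add: subset_iff)
      also have "\<dots> = fn (cmp (Cat True) (Fm v) (Fm u)) n z"
        unfolding uv fn_cmp[OF Fh[OF uv(3)] Fh[OF uv(4)] z] by (simp add: Fm_def fn_mk z z')
      finally show "fn (Fm (cmp ?J v u)) n z = fn (cmp (Cat True) (Fm v) (Fm u)) n z" .
    qed
  qed
  have \<iota>: "\<iota> u \<in> hom (Cat True) (Fo u) X" if "u \<in> P" for u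
    unfolding \<iota>_def using Fo(1)[OF that] X lps_map_comp[OF lps_isoD(2)[OF iso[OF dec[OF that]]]
      sub(2)[OF dec[OF that]]]
    by (simp add: Fo_def)
  have fn\<iota>: "fn (\<iota> u) n z = \<beta> (dec u) n z" if "z \<in> cel (Fo u) n" for u n z
    unfolding \<iota>_def by (rule fn_mk[OF that])
  have "is_colimit ?J (Cat True) Fo Fm X \<iota>"
    unfolding is_colimit_iff
  proof (intro conjI allI impI)
    show "is_cocone ?J (Cat True) Fo Fm X \<iota>"
      unfolding is_cocone_def
    proof (intro conjI ballI allI impI)
      show "X \<in> obj (Cat True)" using X by simp
      show "\<iota> j \<in> hom (Cat True) (Fo j) X" if "j \<in> obj ?J" for j using \<iota> that by simp
      fix i j u assume "u \<in> hom ?J i j"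
      then have u: "u = (i, j)" "(i, j) \<in> R" unfolding poset_hom by blast+
      note ij = Rd[OF u(2)]
      show "cmp (Cat True) (\<iota> j) (Fm u) = \<iota> i" unfolding u(1)
      proof (rule hom_eqI[OF cmp_hom[OF Fh[OF u(2)] \<iota>[OF ij(2)]] \<iota>[OF ij(1)]])
        fix n z assume z: "z \<in> cel (Fo i) n"
        have b: "(n, \<beta> (dec i) n z) \<in> dec j" using \<beta>c[OF dec[OF ij(1)]] z ij(3) unfolding Fo_def
          by blast
        have z': "tm (dec i) (dec j) n z \<in> cel (Fo j) n"
          unfolding tm_def Fo_def by (rule \<alpha>c[OF dec[OF ij(2)] b])
        have "fn (Fm (i, j)) n z = tm (dec i) (dec j) n z" using z by (simp add: Fm_def fn_mk)
        then show "fn (cmp (Cat True) (\<iota> j) (Fm (i, j))) n z = fn (\<iota> i) n z"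
          unfolding fn_cmp[OF Fh[OF u(2)] \<iota>[OF ij(2)] z] fn\<iota>[OF z]
            using fn\<iota>[OF z'] \<beta>\<alpha>[OF dec[OF ij(2)] b]
          by (simp add: tm_def)
      qed
    qed
    fix M \<mu> assume M: "is_cocone ?J (Cat True) Fo Fm M \<mu>"
    have Mo: "ob True M" and \<mu>: "\<And>j. j \<in> P \<Longrightarrow> \<mu> j \<in> hom (Cat True) (Fo j) M"
      and cc: "\<And>i j. (i, j) \<in> R \<Longrightarrow> cmp (Cat True) (\<mu> j) (Fm (i, j)) = \<mu> i"
      using M unfolding is_cocone_def by (simp_all add: poset_hom)
    \<comment> \<open>A cell is evaluated on the subobject that it generates. This is contained in
      every finite subobject having the cell, so compatibility of \<open>\<mu>\<close> gives the
      same value on all of them.\<close>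
    define h where "h n x = fn (\<mu> (c (gen X n x))) n (\<alpha> (gen X n x) n x)" for n x
    have h: "h n x = fn (\<mu> (c D)) n (\<alpha> D n x)" if D: "D \<in> ?F" and x: "(n, x) \<in> D" for D n x
    proof -
      have xX: "x \<in> cel X n" using fin_subsD(2)[OF D x] .
      let ?G = "gen X n x"
      note G = gen_fin_subs[OF Xo xX]
      have r: "(c ?G, c D) \<in> R" unfolding R_def
        using dec_c[OF G(1)] dec_c[OF D] fin_subsD(3)[OF D x] by simp
      have z: "\<alpha> ?G n x \<in> cel (Fo (c ?G)) n" unfolding Fo_def dec_c(1)[OF G(1)] by (rule \<alpha>c[OF G])
      have "fn (\<mu> (c ?G)) n (\<alpha> ?G n x) = fn (\<mu> (c D)) n (fn (Fm (c ?G, c D)) n (\<alpha> ?G n x))"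
        using fn_cmp[OF Fh[OF r] \<mu>[OF Rd(2)[OF r]] z] unfolding cc[OF r] .
      also have "fn (Fm (c ?G, c D)) n (\<alpha> ?G n x) = \<alpha> D n x"
        using z by (simp add: Fm_def fn_mk tm_def dec_c[OF G(1)] dec_c[OF D] \<beta>\<alpha>[OF G])
      finally show ?thesis unfolding h_def .
    qed
    have hm: "lps_map X M h"
    proof (rule lps_mapI)
      fix n x assume x: "x \<in> cel X n"
      let ?G = "gen X n x"
      note G = gen_fin_subs[OF Xo x]
      note \<mu>G = hom_fn(2)[OF \<mu>[OF dec_c(2)[OF G(1)]], unfolded Fo_def dec_c(1)[OF G(1)]]
      have a: "\<alpha> ?G n x \<in> cel (Z ?G) n" by (rule \<alpha>c[OF G])
      show "h n x \<in> cel M n" unfolding h_def by (rule map_cel[OF \<mu>G a])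
      show "lab M n (h n x) = lab X n x"
        unfolding h_def map_lab[OF \<mu>G a] using map_lab[OF lps_isoD(1)[OF iso[OF G(1)]], of x n] G(2) cs
        by (simp add: sub_def)
      fix m f assume f: "box m n f"
      have fx: "(m, res X m n f x) \<in> ?G" using fin_subsD(4)[OF G f] .
      have "\<alpha> ?G m (res X m n f x) = res (Z ?G) m n f (\<alpha> ?G n x)"
        using map_res[OF lps_isoD(1)[OF iso[OF G(1)]] f, of x] G(2) cs by (simp add: sub_def)
      then show "h m (res X m n f x) = res M m n f (h n x)"
        unfolding h[OF G(1) fx] h[OF G] using map_res[OF \<mu>G f a] by simp
    qed
    have hh: "mk X h M \<in> hom (Cat True) X M" using X Mo hm by simp
    show "\<exists>!h. h \<in> hom (Cat True) X M \<and> (\<forall>j\<in>obj ?J. cmp (Cat True) h (\<iota> j) = \<mu> j)"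
    proof (rule ex1I[of _ "mk X h M"])
      have "cmp (Cat True) (mk X h M) (\<iota> j) = \<mu> j" if j: "j \<in> P" for j
      proof (rule hom_eqI[OF cmp_hom[OF \<iota>[OF j] hh] \<mu>[OF j]])
        fix n z assume z: "z \<in> cel (Fo j) n"
        note zZ = z[unfolded Fo_def]
        have b: "(n, \<beta> (dec j) n z) \<in> dec j" by (rule \<beta>c[OF dec[OF j] zZ])
        have "fn (mk X h M) n (\<beta> (dec j) n z) = h n (\<beta> (dec j) n z)"
          by (rule fn_mk[OF fin_subsD(2)[OF dec[OF j] b]])
        also have "\<dots> = fn (\<mu> j) n z" using h[OF dec[OF j] b] \<alpha>\<beta>[OF dec[OF j] zZ] c_dec[OF j] by simp
        finally show "fn (cmp (Cat True) (mk X h M) (\<iota> j)) n z = fn (\<mu> j) n z"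
          unfolding fn_cmp[OF \<iota>[OF j] hh z] fn\<iota>[OF z] .
      qed
      then show "mk X h M \<in> hom (Cat True) X M \<and> (\<forall>j\<in>obj ?J. cmp (Cat True) (mk X h M) (\<iota> j) = \<mu> j)"
        using hh by simp
      fix k assume k: "k \<in> hom (Cat True) X M \<and> (\<forall>j\<in>obj ?J. cmp (Cat True) k (\<iota> j) = \<mu> j)"
      then have kh: "k \<in> hom (Cat True) X M" by blast
      show "k = mk X h M"
      proof (rule hom_eqI[OF kh hh])
        fix n x assume x: "x \<in> cel X n"
        let ?G = "gen X n x"
        note G = gen_fin_subs[OF Xo x]
        note p = dec_c(2)[OF G(1)]
        have a: "\<alpha> ?G n x \<in> cel (Fo (c ?G)) n" unfolding Fo_def dec_c(1)[OF G(1)] by (rule \<alpha>c[OF G])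
        have "fn k n x = fn k n (fn (\<iota> (c ?G)) n (\<alpha> ?G n x))"
          unfolding fn\<iota>[OF a] dec_c(1)[OF G(1)] \<beta>\<alpha>[OF G] ..
        also have "\<dots> = fn (\<mu> (c ?G)) n (\<alpha> ?G n x)"
          using fn_cmp[OF \<iota>[OF p] kh a] k p by simp
        finally show "fn k n x = fn (mk X h M) n x" unfolding fn_mk[OF x] h_def .
      qed
    qed
  qed
  then show ?thesis unfolding HDA_Cat using dir funct Fo(2) by blast
qed

lemma small_hom:
  assumes "ob b X" "ob b (Y :: ('u, 'l) lps)"
  shows "small TYPE('u) (hom (Cat b) X Y)"
proof (rule small_inj)
  let ?c = "\<lambda>f. {(n, x, fn f n x) | n x. x \<in> cel X n}"
  show "small TYPE('u) (Pow (Sigma (UNIV :: nat set) (\<lambda>n. cel X n \<times> cel Y n)))"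
    by (intro small_Pow small_Sigma small_nat ob_small[OF assms(1)] ob_small[OF assms(2)])
  show "?c ` hom (Cat b) X Y \<subseteq> Pow (Sigma UNIV (\<lambda>n. cel X n \<times> cel Y n))"
    using map_cel[OF hom_fn(2)] by fastforce
  show "inj_on ?c (hom (Cat b) X Y)"
  proof (rule inj_onI)
    fix f g assume f: "f \<in> hom (Cat b) X Y" and g: "g \<in> hom (Cat b) X Y" and eq: "?c f = ?c g"
    show "f = g"
    proof (rule hom_eqI[OF f g])
      fix n x assume "x \<in> cel X n"
      then have "(n, x, fn f n x) \<in> ?c g" unfolding eq[symmetric] by blast
      then show "fn f n x = fn g n x" by blast
    qed
  qed
qed

lemma locally_presentable_HDA: "locally_presentable TYPE('u) (HDA :: (('u, 'l) lps, ('u, 'l) lmor) category)"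
proof -
  obtain \<kappa> :: "'u rel" where \<kappa>: "regular_cardinal TYPE('u) \<kappa>" "\<And>S :: 'u set. |S| <o \<kappa> \<longleftrightarrow> finite S"
    using countable_cardinal by blast
  have "\<forall>A\<in>(fin_objects :: ('u, 'l) lps set). presentable TYPE('u) \<kappa> HDA A"
    using finite_presentable[OF fin_objects_finite \<kappa>(2)] by blast
  moreover have "\<forall>X\<in>obj (HDA :: (('u, 'l) lps, ('u, 'l) lmor) category).
      \<exists>P R Fo Fm \<iota>. directed_poset TYPE('u) \<kappa> P R \<and> is_functor (poset_cat P R) HDA Fo Fm \<and>
        (\<forall>j\<in>P. Fo j \<in> fin_objects) \<and> is_colimit (poset_cat P R) HDA Fo Fm X \<iota>"
  proof
    fix X assume "X \<in> obj (HDA :: (('u, 'l) lps, ('u, 'l) lmor) category)"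
    then have "ob True X" by (simp add: HDA_Cat)
    from finite_generation[OF this \<kappa>(2)]
    show "\<exists>P R Fo Fm \<iota>. directed_poset TYPE('u) \<kappa> P R \<and> is_functor (poset_cat P R) HDA Fo Fm \<and>
        (\<forall>j\<in>P. Fo j \<in> fin_objects) \<and> is_colimit (poset_cat P R) HDA Fo Fm X \<iota>" .
  qed
  moreover have "\<forall>X\<in>obj (HDA :: (('u, 'l) lps, ('u, 'l) lmor) category). \<forall>Y\<in>obj HDA.
      small TYPE('u) (hom HDA X Y)"
    unfolding HDA_Cat using small_hom by simp
  ultimately show ?thesis
    unfolding locally_presentable_def
    using \<kappa>(1) small_fin_objects cocomplete_Cat[of True] is_category_Cat[of True] unfolding HDA_Cat
      by blast
qed

lemma combinatorial_hda_model:
  "combinatorial_model_structure TYPE('u) HDA (hda_model :: ('u, 'l) lmor model_data)"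
proof -
  have "model_structure TYPE('u) HDA (hda_model :: ('u, 'l) lmor model_data)"
    by (rule model_cat_model_structure[OF model_cat_hda_model])
      (simp_all add: HDA_Cat complete_Cat cocomplete_Cat)
  moreover have "fibs hda_model = rlp HDA (gen_tcofs :: ('u, 'l) lmor set)" by (simp add: hda_model_def)
  ultimately show ?thesis
    unfolding combinatorial_model_structure_def
    using locally_presentable_HDA gen_cofs_mor gen_tcofs_mor small_gen_cofs small_gen_tcofs trivial_fibs_hda_model
    by blast
qed

end

section \<open>Fibrant objects\<close>

text \<open>The object \<open>lwords\<close> is terminal up to the type of its cells.\<close>

abbreviation fibr :: "('a, 'l) lps \<Rightarrow> bool" where
  "fibr X \<equiv> fib X lwords (lab X)"

text \<open>In \<open>Z\<close> a cell is determined by its label, so lying over a cell of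
  \<open>Z\<close> only means having the right label. This relates fibrancy, defined with a terminal
  object of the category, to \<open>lwords\<close>.\<close>

lemma fib_thin:
  assumes X: "lps_object X" and Z: "lps_object Z" and \<phi>: "lps_map X Z \<phi>"
    and thin: "\<And>n x y. x \<in> cel Z n \<Longrightarrow> y \<in> cel Z n \<Longrightarrow> lab Z n x = lab Z n y \<Longrightarrow> x = y"
  shows "fib X Z \<phi> \<longleftrightarrow> fibr X"
proof
  assume f: "fib X Z \<phi>"
  show "fibr X" unfolding fib_def
  proof (intro allI impI ballI; elim conjE)
    fix n b x w
    assume n: "Suc 0 \<le> n" and x: "x \<in> cel X n" and w: "w \<in> cel lwords n" and b: "shell X n b"
      "over lwords (lab X) n b w" and l: "lab X n x = lab lwords n w"
      and b0: "\<forall>f. box 0 n f \<longrightarrow> b 0 f = res X 0 n f x"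
    have "over Z \<phi> n b (\<phi> n x)" unfolding over_def
    proof (intro allI impI)
      fix m f assume f: "box m n f" "m < n"
      show "\<phi> m (b m f) = res Z m n f (\<phi> n x)"
      proof (rule thin)
        show "\<phi> m (b m f) \<in> cel Z m" by (rule map_cel[OF \<phi> shell_cel[OF b(1) f]])
        show "res Z m n f (\<phi> n x) \<in> cel Z m" by (rule res_cel[OF Z f(1) map_cel[OF \<phi> x]])
        show "lab Z m (\<phi> m (b m f)) = lab Z m (res Z m n f (\<phi> n x))"
          using b(2) f l by (simp add: map_lab[OF \<phi> shell_cel[OF b(1) f]] lab_res[OF Z f(1)
            map_cel[OF \<phi> x]]
              map_lab[OF \<phi> x] over_def)
      qed
    qed
    moreover have "lab X n x = lab Z n (\<phi> n x)" using map_lab[OF \<phi> x] by simp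
    ultimately have "fills X Z \<phi> n b (\<phi> n x)"
      using f n x map_cel[OF \<phi> x] b(1) b0 unfolding fib_def by blast
    then obtain z where z: "z \<in> cel X n" "\<phi> n z = \<phi> n x"
      "\<forall>m f. box m n f \<longrightarrow> m < n \<longrightarrow> res X m n f z = b m f"
      unfolding fills_def by blast
    have "lab X n z = w" using map_lab[OF \<phi> z(1)] map_lab[OF \<phi> x] z(2) l by simp
    then show "fills X lwords (lab X) n b w" using z by (intro fillsI[of z]) auto
  qed
next
  assume f: "fibr X"
  show "fib X Z \<phi>" unfolding fib_def
  proof (intro allI impI ballI; elim conjE)
    fix n b x y
    assume n: "Suc 0 \<le> n" and x: "x \<in> cel X n" and y: "y \<in> cel Z n"
      and b: "shell X n b" "over Z \<phi> n b y"
      and l: "lab X n x = lab Z n y" and b0: "\<forall>f. box 0 n f \<longrightarrow> b 0 f = res X 0 n f x"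
    have "over lwords (lab X) n b (lab X n x)" unfolding over_def
    proof (intro allI impI)
      fix m f assume f: "box m n f" "m < n"
      show "lab X m (b m f) = res lwords m n f (lab X n x)"
        using map_lab[OF \<phi> shell_cel[OF b(1) f]] b(2) f lab_res[OF Z f(1) y] l by (simp add: over_def)
    qed
    moreover have "lab X n x \<in> cel lwords n" using length_lab[OF X x] by simp
    ultimately have "fills X lwords (lab X) n b (lab X n x)"
      using f[unfolded fib_def, THEN spec[of _ n], THEN mp, OF n, THEN spec[of _ b], THEN bspec, OF x,
          THEN bspec, of "lab X n x"] b(1) b0 by simp
    then obtain z where z: "z \<in> cel X n" "lab X n z = lab X n x"
        "\<forall>m f. box m n f \<longrightarrow> m < n \<longrightarrow> res X m n f z = b m f"
      unfolding fills_def by blast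
    have "\<phi> n z = y" by (rule thin[OF map_cel[OF \<phi> z(1)] y]) (simp add: map_lab[OF \<phi> z(1)] z(2) l)
    then show "fills X Z \<phi> n b y" using z by (intro fillsI[of z]) auto
  qed
qed

text \<open>The certificate \<open>x\<close> is itself the filler: its proper faces are parallel to
  those of the shell, hence equal to them.\<close>

lemma local_fibr:
  assumes S: "lps_object S" "local S"
  shows "fibr S"
  unfolding fib_def
proof (intro allI impI ballI; elim conjE)
  fix n b x w
  assume n: "Suc 0 \<le> n" and x: "x \<in> cel S n" and w: "w \<in> cel lwords n" and b: "shell S n b"
    "over lwords (lab S) n b w" and l: "lab S n x = lab lwords n w"
    and b0: "\<forall>f. box 0 n f \<longrightarrow> b 0 f = res S 0 n f x"
  have "res S m n f x = b m f" if f: "box m n f" "m < n" for m f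
  proof (rule localD[OF S(2) res_cel[OF S(1) f(1) x] shell_cel[OF b(1) f]])
    show "par S m (res S m n f x) (b m f)" unfolding par_def
    proof (intro conjI allI impI)
      show "lab S m (res S m n f x) = lab S m (b m f)"
        using lab_res[OF S(1) f(1) x] l b(2) f by (simp add: over_def)
      fix g assume g: "box 0 m g"
      have "res S 0 m g (b m f) = b 0 (cb 0 f g)" using shell_res[OF b(1) f g] by simp
      then show "res S 0 m g (res S m n f x) = res S 0 m g (b m f)"
        using b0 box_comp[OF g f(1)] res_comp[OF S(1) g f(1) x] by simp
    qed
  qed
  then show "fills S lwords (lab S) n b w" using x l by (intro fillsI[of x]) auto
qed

text \<open>A filler obtained from fibrancy is sent by \<open>s\<close> to a cell with the vertices
  and the label of \<open>y\<close>, and this cell is \<open>y\<close> itself because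
  \<open>S\<close> is local.\<close>

lemma fibr_weq_local:
  assumes E: "lps_object E" "fibr E" and S: "lps_object S" "local S" and s: "lps_map E S s" "weq E S s"
  shows "tfib E S s"
  unfolding tfib_def
proof (intro conjI allI impI ballI; (elim conjE)?)
  show "bij_betw (s 0) (cel E 0) (cel S 0)" by (rule weq_bij[OF S(1) s])
  fix n b y assume n: "Suc 0 \<le> n" and y: "y \<in> cel S n" and b: "shell E n b" "over S s n b y"
  obtain x where x: "x \<in> cel E n" "par S n (s n x) y" using weqD[OF s(2) y] by blast
  have sx: "s n x = y" by (rule localD[OF S(2) map_cel[OF s(1) x(1)] y x(2)])
  have b0: "\<forall>f. box 0 n f \<longrightarrow> b 0 f = res E 0 n f x"
  proof (intro allI impI)
    fix f assume f: "box 0 n f"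
    have "s 0 (b 0 f) = s 0 (res E 0 n f x)"
      using b(2) f n map_res[OF s(1) f x(1)] sx by (simp add: over_def)
    then show "b 0 f = res E 0 n f x"
      using s(2) shell_cel[OF b(1) f] n res_cel[OF E(1) f x(1)] by (auto simp: weq_def dest: inj_onD)
  qed
  have "over lwords (lab E) n b (lab E n x)" unfolding over_def
  proof (intro allI impI)
    fix m f assume f: "box m n f" "m < n"
    show "lab E m (b m f) = res lwords m n f (lab E n x)"
      using map_lab[OF s(1) shell_cel[OF b(1) f]] b(2) f lab_res[OF S(1) f(1) y] map_lab[OF s(1)
        x(1)] sx
      by (simp add: over_def)
  qed
  then have "fills E lwords (lab E) n b (lab E n x)"
    using E(2)[unfolded fib_def, THEN spec[of _ n], THEN mp, OF n, THEN spec[of _ b], THEN bspec, OF x(1),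
        THEN bspec, of "lab E n x"] length_lab[OF E(1) x(1)] b(1) b0 by simp
  then obtain z where z: "z \<in> cel E n" "lab E n z = lab E n x"
      "\<forall>m f. box m n f \<longrightarrow> m < n \<longrightarrow> res E m n f z = b m f" unfolding fills_def by blast
  have "s n z = y"
  proof (rule localD[OF S(2) map_cel[OF s(1) z(1)] y])
    have "s 0 (b 0 f) = res S 0 n f y" if "box 0 n f" for f using b(2) that n by (simp add: over_def)
    then show "par S n (s n z) y"
      using z n sx map_lab[OF s(1) z(1)] map_lab[OF s(1) x(1)] map_res[OF s(1) _ z(1)]
      by (auto simp: par_def map_res[OF s(1) _ z(1), symmetric])
  qed
  then show "fills E S s n b y" using z by (intro fillsI[of z]) auto
qed

lemma terminal_hom: "is_terminal C Z \<Longrightarrow> X \<in> obj C \<Longrightarrow> \<exists>f. f \<in> hom C X Z"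
  unfolding is_terminal_def by blast

lemma terminal_eq: "is_terminal C Z \<Longrightarrow> X \<in> obj C \<Longrightarrow> f \<in> hom C X Z \<Longrightarrow> g \<in> hom C X Z \<Longrightarrow> f = g"
  unfolding is_terminal_def by blast

section \<open>Cells as maps from cubes, terminal objects and fibrancy\<close>

context small_labels
begin

text \<open>The map from a cube that corresponds to the cell \<open>x\<close> by the Yoneda lemma.
  It turns universal properties, stated for morphisms, into statements about cells.\<close>

definition pt :: "('u, 'l) lps \<Rightarrow> nat \<Rightarrow> 'u \<Rightarrow> ('u, 'l) lmor" where
  "pt X n x = mk (place (lcube (lab X n x))) (\<lambda>m f. res X m n (inv emb f) x) X"

abbreviation top_cell :: "nat \<Rightarrow> 'u" where
  "top_cell n \<equiv> emb (idb n)"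

lemma emb_box: "inj (emb :: (bool list \<Rightarrow> bool list) \<Rightarrow> 'u)"
  by (rule emb_inj[OF small_box])

lemma emb_inv_box [simp]: "inv emb (emb f :: 'u) = (f :: bool list \<Rightarrow> bool list)"
  by (rule inv_f_f[OF emb_box])

lemma ob_place_lcube: "ob b (place (lcube as) :: ('u, 'l) lps)"
  by (rule ob_place[OF small_box lps_object_lcube]) (simp add: hda1_lcube)

lemma ob_place_lboundary: "ob b (place (lboundary as) :: ('u, 'l) lps)"
  by (rule ob_place[OF small_box lps_object_lboundary]) (simp add: hda1_lboundary)

lemma pt:
  assumes X: "ob b X" and x: "x \<in> cel X n"
  shows "pt X n x \<in> hom (Cat b) (place (lcube (lab X n x))) X" "fn (pt X n x) n (top_cell n) = x"
    "top_cell n \<in> cel (place (lcube (lab X n x)) :: ('u, 'l) lps) n"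
proof -
  note Xo = ob_object[OF X]
  have "lps_map (place (lcube (lab X n x)) :: ('u, 'l) lps) X (\<lambda>m f. res X m n (inv emb f) x)"
    using lps_map_comp[OF lps_isoD(2)[OF place_iso[OF small_box lps_object_lcube]]
      yoneda[OF Xo x refl]] .
  then show "pt X n x \<in> hom (Cat b) (place (lcube (lab X n x))) X"
    unfolding pt_def by (intro mk_hom ob_place_lcube X)
  show c: "top_cell n \<in> cel (place (lcube (lab X n x)) :: ('u, 'l) lps) n"
    using length_lab[OF Xo x] by (auto simp: place_transport box_id)
  show "fn (pt X n x) n (top_cell n) = x"
    unfolding pt_def fn_mk[OF c] using res_id[OF Xo x] by simp
qed

lemma pt_comp:
  assumes f: "f \<in> hom (Cat b) X Y" and x: "x \<in> cel X n"
  shows "cmp (Cat b) f (pt X n x) = pt Y n (fn f n x)"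
proof -
  note l = map_lab[OF hom_fn(2)[OF f] x]
  note y = map_cel[OF hom_fn(2)[OF f] x]
  note p = pt(1)[OF hom_fn(3)[OF f] x]
  show ?thesis
  proof (rule hom_eqI[OF cmp_hom[OF p f]])
    show "pt Y n (fn f n x) \<in> hom (Cat b) (place (lcube (lab X n x))) Y"
      using pt(1)[OF hom_fn(4)[OF f] y] unfolding l .
    fix m g assume g: "g \<in> cel (place (lcube (lab X n x)) :: ('u, 'l) lps) m"
    then obtain h where h: "g = emb h" "box m n h"
      using length_lab[OF ob_object[OF hom_fn(3)[OF f]] x] by (auto simp: place_transport)
    have "fn (pt X n x) m g = res X m n h x" unfolding pt_def fn_mk[OF g] by (simp add: h(1))
    moreover have "fn (pt Y n (fn f n x)) m g = res Y m n h (fn f n x)"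
      unfolding pt_def l fn_mk[OF g] by (simp add: h(1))
    ultimately show "fn (cmp (Cat b) f (pt X n x)) m g = fn (pt Y n (fn f n x)) m g"
      unfolding fn_cmp[OF p f g] using map_res[OF hom_fn(2)[OF f] h(2) x] by simp
  qed
qed

text \<open>Two cells with the same label correspond to two maps from the same cube, and these
  agree.\<close>

lemma terminal_thin:
  assumes Z: "is_terminal (Cat b) (Z :: ('u, 'l) lps)" and x: "x \<in> cel Z n" and y: "y \<in> cel Z n"
    and l: "lab Z n x = lab Z n y"
  shows "x = y"
proof -
  have Zo: "ob b Z" using Z by (simp add: is_terminal_def)
  have o: "(place (lcube (lab Z n x)) :: ('u, 'l) lps) \<in> obj (Cat b)" using ob_place_lcube by simp
  have 1: "pt Z n x \<in> hom (Cat b) (place (lcube (lab Z n x))) Z" by (rule pt(1)[OF Zo x])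
  have 2: "pt Z n y \<in> hom (Cat b) (place (lcube (lab Z n x))) Z" using pt(1)[OF Zo y] unfolding l .
  have "pt Z n x = pt Z n y" by (rule terminal_eq[OF Z o 1 2])
  then have "x = fn (pt Z n y) n (top_cell n)" using pt(2)[OF Zo x] by simp
  then show "x = y" unfolding pt(2)[OF Zo y] .
qed

lemma emb_words: "inv emb (emb w :: 'u) = (w :: 'l list)"
  by (rule inv_f_f[OF emb_inj[OF small_UNIV_list[OF small_labels]]])

lemma one_P: "ob b (one_P :: ('u, 'l) lps)"
  "cel (one_P :: ('u, 'l) lps) n = emb ` {w :: 'l list. length w = n}"
  "lab (one_P :: ('u, 'l) lps) n (emb w) = w"
proof -
  show "ob b (one_P :: ('u, 'l) lps)" unfolding one_P_def
    by (rule ob_place[OF small_UNIV_list[OF small_labels] lps_object_lwords]) (simp add: hda1_lwords)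
qed (simp_all add: one_P_def place_transport emb_words)

lemma to_one:
  assumes X: "ob b (X :: ('u, 'l) lps)"
  shows "mk X (\<lambda>n x. emb (lab X n x)) one_P \<in> hom (Cat b) X one_P"
    "f \<in> hom (Cat b) X one_P \<Longrightarrow> f = mk X (\<lambda>n x. emb (lab X n x)) one_P"
proof -
  have "lps_map X (one_P :: ('u, 'l) lps) (\<lambda>n x. emb (lab X n x))"
    unfolding one_P_def
    by (rule lps_map_comp[OF lps_map_lab[OF ob_object[OF X]]
          lps_isoD(1)[OF place_iso[OF small_UNIV_list[OF small_labels] lps_object_lwords]]])
  then show h: "mk X (\<lambda>n x. emb (lab X n x)) one_P \<in> hom (Cat b) X one_P"
    by (intro mk_hom X one_P(1))
  assume f: "f \<in> hom (Cat b) X one_P"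
  show "f = mk X (\<lambda>n x. emb (lab X n x)) one_P"
  proof (rule hom_eqI[OF f h])
    fix n x assume x: "x \<in> cel X n"
    obtain w :: "'l list" where w: "fn f n x = emb w" using map_cel[OF hom_fn(2)[OF f] x]
      unfolding one_P(2) by blast
    have "w = lab X n x" using map_lab[OF hom_fn(2)[OF f] x] one_P(3) unfolding w by simp
    then show "fn f n x = fn (mk X (\<lambda>n x. emb (lab X n x)) one_P) n x" unfolding fn_mk[OF x] w by simp
  qed
qed

lemma terminal_one: "is_terminal (Cat b) (one_P :: ('u, 'l) lps)"
  unfolding is_terminal_def
proof (intro conjI ballI)
  show "(one_P :: ('u, 'l) lps) \<in> obj (Cat b)" by (simp add: one_P(1))
  fix X :: "('u, 'l) lps" assume "X \<in> obj (Cat b)"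
  then have X: "ob b X" by simp
  show "\<exists>!f. f \<in> hom (Cat b) X (one_P :: ('u, 'l) lps)"
    by (rule ex1I[of _ "mk X (\<lambda>n x. emb (lab X n x)) one_P"]) (rule to_one[OF X])+
qed

lemma fibrant_hda_model:
  assumes X: "ob True (X :: ('u, 'l) lps)"
  shows "fibrant HDA hda_model X \<longleftrightarrow> fibr X"
proof -
  have 1: "mk X \<phi> Z \<in> fibs hda_model \<longleftrightarrow> fibr X"
    if Z: "is_terminal (Cat True) Z" and \<phi>: "lps_map X Z \<phi>" for Z \<phi>
  proof -
    have Zo: "ob True Z" using Z by (simp add: is_terminal_def)
    show ?thesis unfolding mk_fibs[OF X Zo \<phi>]
      by (rule fib_thin[OF ob_object[OF X] ob_object[OF Zo] \<phi> terminal_thin[OF Z]])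
  qed
  show ?thesis
  proof
    assume "fibrant HDA hda_model X"
    then obtain Z f where Z: "is_terminal (Cat True) Z" "f \<in> hom (Cat True) X Z" "f \<in> fibs hda_model"
      unfolding fibrant_def HDA_Cat by blast
    have "mk X (fn f) Z \<in> fibs hda_model" using Z(3) unfolding mk_fn[OF Z(2)] .
    then show "fibr X" using 1[OF Z(1) hom_fn(2)[OF Z(2)]] by simp
  next
    assume f: "fibr X"
    note h = to_one(1)[OF X]
    have "lps_map X (one_P :: ('u, 'l) lps) (\<lambda>n x. emb (lab X n x))"
      using mk_map_iff[OF X one_P(1)] h unfolding hom_def by blast
    then have "mk X (\<lambda>n x. emb (lab X n x)) one_P \<in> fibs hda_model"
      using 1[OF terminal_one] f by simp
    then show "fibrant HDA hda_model X"
      unfolding fibrant_def HDA_Cat using terminal_one h by blast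
  qed
qed

text \<open>The initial object has no cells, so injectivity on edges is automatic for maps out of
  it.\<close>

lemma cofibrant_all:
  assumes X: "ob True (X :: ('u, 'l) lps)" and M: "cofs M = llp HDA (rlp HDA gen_cofs)"
  shows "cofibrant HDA M X"
proof -
  define Z :: "('u, 'l) lps" where "Z = place (ldiscrete ({} :: nat set))"
  have c: "cel Z n = {}" for n unfolding Z_def place_transport by (auto simp: )
  have Z: "ob True Z" unfolding Z_def
    by (rule ob_place[OF small_nat lps_object_ldiscrete]) (simp add: hda1_ldiscrete)
  have m: "lps_map Z Y (\<lambda>n x. x)" for Y :: "('u, 'l) lps" by (rule lps_mapI) (simp_all add: c)
  have "is_initial HDA Z"
    unfolding is_initial_def HDA_Cat
  proof (intro conjI ballI)
    show "Z \<in> obj (Cat True)" using Z by simp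
    fix Y :: "('u, 'l) lps" assume "Y \<in> obj (Cat True)"
    then have Y: "ob True Y" by simp
    note h = mk_hom[OF Z Y m]
    show "\<exists>!f. f \<in> hom (Cat True) Z Y"
      by (rule ex1I[of _ "mk Z (\<lambda>n x. x) Y"], rule h, rule hom_eqI[OF _ h]) (simp_all add: c)
  qed
  moreover have "mk Z (\<lambda>n x. x) X \<in> cofs M"
    unfolding M llp_rlp_gen_cofs[OF Z X m] cofib_def by (simp add: c)
  ultimately show ?thesis unfolding cofibrant_def using mk_hom[OF Z X m] unfolding HDA_Cat by blast
qed

end

section \<open>Uniqueness of the model structure\<close>

text \<open>A structure as in the theorem, with injectivity with respect to \<open>Lambda\<close>
  already replaced by \<open>fibr\<close>; that the two agree is established at the end.\<close>

locale hda_model_cat = small_labels U L + model_cat HDA M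
  for U :: "'u itself" and L :: "'l itself" and M :: "('u, 'l) lmor model_data" +
  assumes cofs: "cofs M = llp HDA (rlp HDA gen_cofs)"
    and fibrants: "\<And>X. ob True X \<Longrightarrow> fibrant HDA M X \<longleftrightarrow> fibr X"
begin

lemma cofs_eq: "cofs M = cofs hda_model"
  by (simp add: cofs hda_model_def)

lemma trivial_fibs_eq: "fibs M \<inter> weqs M = rlp HDA gen_cofs"
  using trivial_fibs model_cat.trivial_fibs[OF model_cat_hda_model] cofs_eq trivial_fibs_hda_model
    by simp

lemma mk_trivial_fibs:
  assumes "ob True X" "ob True Y" "lps_map X Y \<phi>"
  shows "mk X \<phi> Y \<in> fibs M \<inter> weqs M \<longleftrightarrow> tfib X Y \<phi>"
  unfolding trivial_fibs_eq by (rule rlp_gen_cofs[OF assms])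

lemma fibrantD:
  assumes X: "ob True X" and f: "fibr X"
  obtains Z t where "is_terminal (Cat True) Z" "t \<in> hom (Cat True) X Z" "t \<in> fibs M"
  using fibrants[OF X] f unfolding fibrant_def HDA_Cat by blast

lemma tcof_extend:
  assumes i: "i \<in> hom (Cat True) A B" "i \<in> cofs M" "i \<in> weqs M" and T: "ob True T" "fibr T"
    and a: "a \<in> hom (Cat True) A T"
  shows "\<exists>h\<in>hom (Cat True) B T. cmp (Cat True) h i = a"
proof -
  obtain Z t where Z: "is_terminal (Cat True) Z" "t \<in> hom (Cat True) T Z" "t \<in> fibs M"
    by (rule fibrantD[OF T])
  obtain v where v: "v \<in> hom (Cat True) B Z"
    using terminal_hom[OF Z(1), of B] hom_fn(4)[OF i(1)] unfolding obj_Cat by blast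
  have "cmp (Cat True) t a = cmp (Cat True) v i"
    by (rule terminal_eq[OF Z(1) _ cmp_hom[OF a Z(2)] cmp_hom[OF i(1) v]])
      (simp add: hom_fn(3)[OF i(1)])
  moreover have "has_lifts HDA i t" using lift[OF i(2) Z(3)] i(3) by blast
  ultimately show ?thesis
    using has_liftsD[of i t A B T Z a v] i(1) Z(2) a v unfolding HDA_Cat by blast
qed

text \<open>Lifts of \<open>i\<close> glue to lifts of its pushout by the universal property, and
  \<open>trivial_cofs\<close> turns the lifting property into membership.\<close>

lemma pushout_tcof:
  assumes i: "i \<in> hom (Cat True) A B" "i \<in> cofs M" "i \<in> weqs M" and g: "g \<in> hom (Cat True) A D"
    and Q: "is_pushout (Cat True) i g (Q, j0, j1)"
  shows "j1 \<in> cofs M \<inter> weqs M"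
proof -
  have tf: "target (Cat True) i = B" "target (Cat True) g = D" using i(1) g by (simp_all add: hom_def)
  have j0: "j0 \<in> hom (Cat True) B Q" and j1: "j1 \<in> hom (Cat True) D Q"
    and sq: "cmp (Cat True) j0 i = cmp (Cat True) j1 g"
    and un: "\<And>Z p q. p \<in> hom (Cat True) B Z \<Longrightarrow> q \<in> hom (Cat True) D Z \<Longrightarrow>
      cmp (Cat True) p i = cmp (Cat True) q g \<Longrightarrow>
      \<exists>!h. h \<in> hom (Cat True) Q Z \<and> cmp (Cat True) h j0 = p \<and> cmp (Cat True) h j1 = q"
    using Q unfolding is_pushout_def prod.case tf by blast+
  have "j1 \<in> llp HDA (fibs M)"
    unfolding llp_def
  proof (intro CollectI conjI ballI)
    show "j1 \<in> mor HDA" using j1 by (simp add: hom_def HDA_Cat)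
    fix p assume pf: "p \<in> fibs M"
    then obtain E F where p: "p \<in> hom (Cat True) E F"
      using sub(3) mor_hom[of p] unfolding HDA_Cat by blast
    note j1' = j1[folded HDA_Cat] and p' = p[folded HDA_Cat]
    show "has_lifts HDA j1 p" unfolding has_lifts_hom[OF j1' p']
    proof (intro ballI impI)
      fix u v assume u: "u \<in> hom HDA D E" and v: "v \<in> hom HDA Q F" and e: "cmp HDA p u = cmp HDA v j1"
      note u' = u[unfolded HDA_Cat] and v' = v[unfolded HDA_Cat] and e' = e[unfolded HDA_Cat]
      note ug = cmp_hom[OF g u'] and vj = cmp_hom[OF j0 v']
      have "cmp (Cat True) p (cmp (Cat True) u g) = cmp (Cat True) (cmp (Cat True) v j0) i"
        unfolding cmp_assoc[OF g u' p] e' cmp_assoc[OF g j1 v', symmetric] sq[symmetric]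
        by (rule cmp_assoc[OF i(1) j0 v'])
      moreover have "has_lifts HDA i p" using lift[OF i(2) pf] i(3) by blast
      ultimately obtain k where k: "k \<in> hom (Cat True) B E" "cmp (Cat True) k i = cmp (Cat True) u g"
          "cmp (Cat True) p k = cmp (Cat True) v j0"
        using has_liftsD[of i p A B E F] i(1) p ug vj unfolding HDA_Cat by blast
      obtain h where h: "h \<in> hom (Cat True) Q E" "cmp (Cat True) h j0 = k" "cmp (Cat True) h j1 = u"
        using un[OF k(1) u' k(2)] by blast
      note ph = cmp_hom[OF h(1) p]
      have "cmp (Cat True) (cmp (Cat True) p h) j0 = cmp (Cat True) v j0"
        using cmp_assoc[OF j0 h(1) p] h(2) k(3) by simp
      moreover have "cmp (Cat True) (cmp (Cat True) p h) j1 = cmp (Cat True) v j1"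
        using cmp_assoc[OF j1 h(1) p] h(3) e' by simp
      moreover have "cmp (Cat True) (cmp (Cat True) v j0) i = cmp (Cat True) (cmp (Cat True) v j1) g"
        using cmp_assoc[OF i(1) j0 v'] cmp_assoc[OF g j1 v'] sq by simp
      ultimately have "cmp (Cat True) p h = v"
        using un[OF vj cmp_hom[OF j1 v']] ph v' by blast
      then show "\<exists>h\<in>hom HDA Q E. cmp HDA h j1 = u \<and> cmp HDA p h = v"
        using h unfolding HDA_Cat by blast
    qed
  qed
  then show ?thesis using trivial_cofs by blast
qed

text \<open>
  Two extensions along a trivial cofibration \<open>A \<rightarrow> B\<close> to a local object are glued to a map on
  the pushout, extended to a cylinder of \<open>B\<close> relative to \<open>A\<close>, and compared there: the projection
  of the cylinder is a weak equivalence, to which local objects are orthogonal.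
\<close>

lemma tcof_unique:
  assumes i: "i \<in> hom (Cat True) A B" "i \<in> cofs M" "i \<in> weqs M" and T: "ob True T" "local T"
    and u: "u \<in> hom (Cat True) B T" and v: "v \<in> hom (Cat True) B T"
    and uv: "cmp (Cat True) u i = cmp (Cat True) v i"
  shows "u = v"
proof -
  have tf: "target (Cat True) i = B" using i(1) by (simp add: hom_def)
  obtain Q j0 j1 where Q: "is_pushout (Cat True) i i (Q, j0, j1)"
    using pushout_exists[OF i(1) i(1)] by (metis prod_cases3)
  have j: "j0 \<in> hom (Cat True) B Q" "j1 \<in> hom (Cat True) B Q"
    and sq: "cmp (Cat True) j0 i = cmp (Cat True) j1 i"
    and un: "\<And>Z p q. p \<in> hom (Cat True) B Z \<Longrightarrow> q \<in> hom (Cat True) B Z \<Longrightarrow>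
      cmp (Cat True) p i = cmp (Cat True) q i \<Longrightarrow>
      \<exists>!h. h \<in> hom (Cat True) Q Z \<and> cmp (Cat True) h j0 = p \<and> cmp (Cat True) h j1 = q"
    using Q unfolding is_pushout_def prod.case tf by blast+
  have B: "ob True B" by (rule hom_fn(4)[OF i(1)])
  note idB = idm_hom[OF B]
  obtain fold where fold: "fold \<in> hom (Cat True) Q B" "cmp (Cat True) fold j0 = idm (Cat True) B"
      "cmp (Cat True) fold j1 = idm (Cat True) B"
    using un[OF idB idB] by blast
  obtain D c p where cp': "c \<in> hom HDA Q D" "p \<in> hom HDA D B" "c \<in> cofs M" "p \<in> weqs M" "p \<in> fibs M"
      "fold = cmp HDA p c"
    by (rule factor2[OF fold(1)[folded HDA_Cat]])
  have c: "c \<in> hom (Cat True) Q D" "c \<in> cofs M"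
    and p: "p \<in> hom (Cat True) D B" "p \<in> weqs M" "p \<in> fibs M"
    and cp: "fold = cmp (Cat True) p c"
    using cp' unfolding HDA_Cat by blast+
  obtain w where w: "w \<in> hom (Cat True) Q T" "cmp (Cat True) w j0 = u" "cmp (Cat True) w j1 = v"
    using un[OF u v uv] by blast
  \<comment> \<open>The map \<open>j1\<close> is a weak equivalence as a pushout of
    \<open>i\<close>, and so is \<open>c j1\<close> as a section of \<open>p\<close>. Hence
    \<open>c\<close> is a trivial cofibration, and maps to fibrant objects extend along it.\<close>
  have j1: "j1 \<in> weqs M" using pushout_tcof[OF i i(1) Q] by blast
  note cj = cmp_hom[OF j(2) c(1)]
  have pcj: "cmp (Cat True) p (cmp (Cat True) c j1) = idm (Cat True) B"
    "cmp (Cat True) p (cmp (Cat True) c j0) = idm (Cat True) B"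
    using cmp_assoc[OF j(2) c(1) p(1)] cmp_assoc[OF j(1) c(1) p(1)] fold(2,3) cp by simp_all
  have "idm (Cat True) B \<in> weqs M" using idm_weqs[of B] B unfolding HDA_Cat by simp
  then have "cmp (Cat True) c j1 \<in> weqs M"
    using two_three[of "cmp (Cat True) c j1" B D p B] cj p(1,2) pcj(1) unfolding HDA_Cat by simp
  then have cw: "c \<in> weqs M"
    using two_three[of j1 B Q c D] j(2) c(1) j1 unfolding HDA_Cat by blast
  obtain w' where w': "w' \<in> hom (Cat True) D T" "cmp (Cat True) w' c = w"
    using tcof_extend[OF c cw T(1) local_fibr[OF ob_object[OF T(1)] T(2)] w(1)] by blast
  have D: "ob True D" by (rule hom_fn(3)[OF p(1)])
  have "tfib D B (fn p)"
    using mk_trivial_fibs[OF D B hom_fn(2)[OF p(1)]] p(2,3) unfolding mk_fn[OF p(1)] by blast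
  then have pw: "weq D B (fn p)"
    by (rule tfib_weq[OF ob_object[OF D] ob_hda1[OF D] ob_object[OF B] hom_fn(2)[OF p(1)]])
  \<comment> \<open>The extension \<open>w'\<close> factors through \<open>p\<close>, so its
    restrictions along the two sections \<open>c j0\<close> and \<open>c j1\<close> of
    \<open>p\<close> coincide. These restrictions are \<open>u\<close> and \<open>v\<close>.\<close>
  obtain k where k: "lps_map B T k" "\<forall>n. \<forall>x\<in>cel D n. k n (fn p n x) = fn w' n x"
    using weq_extend[OF ob_object[OF D] ob_object[OF B] ob_object[OF T(1)] T(2) hom_fn(2)[OF p(1)] pw
        hom_fn(2)[OF w'(1)]] by blast
  have key: "fn (cmp (Cat True) w j') n y = k n y"
    if j': "j' \<in> hom (Cat True) B Q" "cmp (Cat True) p (cmp (Cat True) c j') = idm (Cat True) B"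
      and y: "y \<in> cel B n" for j' n y
  proof -
    note yc = map_cel[OF hom_fn(2)[OF j'(1)] y]
    note yd = map_cel[OF hom_fn(2)[OF c(1)] yc]
    have "fn p n (fn c n (fn j' n y)) = y"
      using fn_cmp[OF cmp_hom[OF j'(1) c(1)] p(1) y] fn_cmp[OF j'(1) c(1) y] j'(2)
      by (simp add: idm_Cat fn_mk[OF y])
    then have "k n y = fn w' n (fn c n (fn j' n y))" using k(2) yd by metis
    also have "\<dots> = fn w n (fn j' n y)" using fn_cmp[OF c(1) w'(1) yc] w'(2) by simp
    also have "\<dots> = fn (cmp (Cat True) w j') n y" using fn_cmp[OF j'(1) w(1) y] by simp
    finally show ?thesis by simp
  qed
  show "u = v"
    by (rule hom_eqI[OF u v]) (use key[OF j(1) pcj(2)] key[OF j(2) pcj(1)] w(2,3) in simp)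
qed

text \<open>Extension along the trivial cofibration gives a map \<open>G\<close> from
  \<open>B\<close> to the local reflection of \<open>A\<close>, and uniqueness of extensions
  identifies its composite with \<open>l\<close> as the reflection of \<open>B\<close>. Parallel
  cells are then found in the reflection of \<open>A\<close> and pulled back along the reflection of
  \<open>B\<close>.\<close>

lemma tcof_weq:
  assumes i: "mk A \<iota> B \<in> cofs M" "mk A \<iota> B \<in> weqs M" and A: "ob True A" and B: "ob True B"
    and \<iota>: "lps_map A B \<iota>"
  shows "weq A B \<iota>"
proof -
  note ih = mk_hom[OF A B \<iota>]
  obtain S :: "('u, 'l) lps" and \<eta> where S: "ob True S" "local S" "lps_map A S \<eta>" "weq A S \<eta>"
    using localization[OF A] by blast
  obtain S' :: "('u, 'l) lps" and \<eta>'
    where S': "ob True S'" "local S'" "lps_map B S' \<eta>'" "weq B S' \<eta>'" using localization[OF B] by blast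
  obtain G where G: "G \<in> hom (Cat True) B S" "cmp (Cat True) G (mk A \<iota> B) = mk A \<eta> S"
    using tcof_extend[OF ih i S(1) local_fibr[OF ob_object[OF S(1)] S(2)] mk_hom[OF A S(1,3)]] by blast
  obtain l where l: "lps_map S S' l" "\<forall>n. \<forall>a\<in>cel A n. l n (\<eta> n a) = \<eta>' n (\<iota> n a)"
    using weq_extend[OF ob_object[OF A] ob_object[OF S(1)] ob_object[OF S'(1)] S'(2) S(3,4)
        lps_map_comp[OF \<iota> S'(3)]] by blast
  have g: "fn G n (\<iota> n a) = \<eta> n a" if "a \<in> cel A n" for n a
    using fn_cmp[OF ih G(1) that] unfolding G(2) by (simp add: fn_mk[OF that])
  note lh = mk_hom[OF S(1) S'(1) l(1)] and eh = mk_hom[OF B S'(1) S'(3)]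
  have "cmp (Cat True) (mk S l S') G = mk B \<eta>' S'"
  proof (rule tcof_unique[OF ih i S'(1,2) cmp_hom[OF G(1) lh] eh])
    show "cmp (Cat True) (cmp (Cat True) (mk S l S') G) (mk A \<iota> B) =
      cmp (Cat True) (mk B \<eta>' S') (mk A \<iota> B)"
      unfolding cmp_assoc[OF ih G(1) lh, symmetric] G(2) cmp_mk[OF S(3)] cmp_mk[OF \<iota>] mk_eq_iff
      using l(2) by simp
  qed
  then have lg: "l n (fn G n y) = \<eta>' n y" if "y \<in> cel B n" for n y
    using fn_cmp[OF G(1) lh that] fn_mk[OF map_cel[OF hom_fn(2)[OF G(1)] that]] fn_mk[OF that] by metis
  show "weq A B \<iota>" unfolding weq_def
  proof (intro conjI allI ballI)
    have inj: "inj_on (\<eta> 0) (cel A 0)" using S(4) by (simp add: weq_def)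
    show "inj_on (\<iota> 0) (cel A 0)"
    proof (rule inj_onI)
      fix x y assume xy: "x \<in> cel A 0" "y \<in> cel A 0" "\<iota> 0 x = \<iota> 0 y"
      have "\<eta> 0 x = \<eta> 0 y" using g[OF xy(1)] g[OF xy(2)] xy(3) by simp
      then show "x = y" by (rule inj_onD[OF inj _ xy(1,2)])
    qed
    fix n y assume y: "y \<in> cel B n"
    note Gy = map_cel[OF hom_fn(2)[OF G(1)] y]
    obtain x where x: "x \<in> cel A n" "par S n (\<eta> n x) (fn G n y)" using weqD[OF S(4) Gy] by blast
    have "par S' n (\<eta>' n (\<iota> n x)) (\<eta>' n y)"
      using par_map[OF l(1) map_cel[OF S(3) x(1)] Gy x(2)] lg[OF y] l(2) x(1) by simp
    then have "par B n (\<iota> n x) y"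
      using S'(4) by (intro par_reflect[OF ob_object[OF B] S'(3) _ map_cel[OF \<iota> x(1)] y])
        (simp_all add: weq_def)
    then show "\<exists>x\<in>cel A n. par B n (\<iota> n x) y" using x(1) by blast
  qed
qed

text \<open>A weak equivalence is a trivial cofibration followed by a trivial fibration. The former
  is covered by \<open>tcof_weq\<close>, and trivial fibrations are common to both
  structures.\<close>

lemma weqs_sub: "weqs M \<subseteq> weqs hda_model"
proof
  fix f assume f: "f \<in> weqs M"
  then obtain X Y where fh: "f \<in> hom HDA X Y" using sub(1) mor_hom by blast
  obtain Z i p where *: "i \<in> hom HDA X Z" "p \<in> hom HDA Z Y" "i \<in> cofs M" "p \<in> weqs M" "p \<in> fibs M"
    "f = cmp HDA p i"
    by (rule factor2[OF fh])
  have "i \<in> weqs M" using two_three[OF *(1,2)] f *(4,6) by blast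
  note ih = *(1)[unfolded HDA_Cat] and ph = *(2)[unfolded HDA_Cat]
  have "weq X Z (fn i)"
    by (rule tcof_weq[OF _ _ hom_fn(3,4)[OF ih] hom_fn(2)[OF ih]], unfold mk_fn[OF ih]) fact+
  then have "i \<in> weqs hda_model"
    using mk_weqs[OF hom_fn(3,4)[OF ih] hom_fn(2)[OF ih]] unfolding mk_fn[OF ih] by simp
  moreover have "p \<in> weqs hda_model"
    using *(4,5) trivial_fibs_eq trivial_fibs_hda_model by blast
  ultimately show "f \<in> weqs hda_model"
    using model_cat.two_three[OF model_cat_hda_model *(1,2)] *(6) by blast
qed

lemma weqs_eq: "weqs M = weqs hda_model"
proof (rule equalityI[OF weqs_sub subsetI])
  fix f :: "('u, 'l) lmor" assume f: "f \<in> weqs hda_model"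
  interpret H: model_cat HDA "hda_model :: ('u, 'l) lmor model_data" by (rule model_cat_hda_model)
  obtain X Y where fh: "f \<in> hom HDA X Y" using f H.sub(1) mor_hom by blast
  note fh' = fh[unfolded HDA_Cat]
  have Y: "ob True Y" by (rule hom_fn(4)[OF fh'])
  have one: "mk Y (\<lambda>n x. emb (lab Y n x)) one_P \<in> hom HDA Y one_P" unfolding HDA_Cat
    by (rule to_one(1)[OF Y])
  obtain E r q where rq: "r \<in> hom HDA Y E" "q \<in> hom HDA E one_P" "r \<in> cofs M" "r \<in> weqs M" "q \<in> fibs M"
      "mk Y (\<lambda>n x. emb (lab Y n x)) one_P = cmp HDA q r"
    by (rule factor1[OF one])
  note r = rq(1,3,4) and q = rq(2,5)
  \<comment> \<open>The object \<open>E\<close> is a fibrant replacement of \<open>Y\<close> in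
    \<open>M\<close>. Factoring the map to \<open>E\<close> with a fibration as second factor makes
    \<open>Z\<close> fibrant as well, and it remains to treat \<open>p\<close>.\<close>
  obtain Z j p where jp: "j \<in> hom HDA X Z" "p \<in> hom HDA Z E" "j \<in> cofs M" "j \<in> weqs M" "p \<in> fibs M"
      "cmp HDA r f = cmp HDA p j"
    by (rule factor1[OF cat_comp[OF fh r(1)]])
  note j = jp(1,3,4) and p = jp(2,5) and fact = jp(6)
  have pw: "p \<in> weqs hda_model"
  proof -
    have "cmp HDA r f \<in> weqs hda_model" using H.two_three[OF fh r(1)] f subsetD[OF weqs_sub r(3)]
      by simp
    then have "cmp HDA p j \<in> weqs hda_model" unfolding fact .
    then show ?thesis using H.two_three[OF j(1) p(1)] subsetD[OF weqs_sub j(3)] by simp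
  qed
  note ph = p(1)[unfolded HDA_Cat] and qh = q(1)[unfolded HDA_Cat]
  have E: "ob True E" and Z: "ob True Z" by (rule hom_fn(4)[OF ph], rule hom_fn(3)[OF ph])
  have "fibrant HDA M E" unfolding fibrant_def HDA_Cat using terminal_one qh q(2) by blast
  then have Ef: "fibr E" using fibrants[OF E] by simp
  have "cmp HDA q p \<in> fibs M"
    unfolding fibs_rlp by (rule rlp_comp[OF p(1) q(1)]) (use p(2) q(2) fibs_rlp sub in auto)
  then have "fibrant HDA M Z" unfolding fibrant_def HDA_Cat using terminal_one cmp_hom[OF ph qh]
    by blast
  then have Zf: "fibr Z" using fibrants[OF Z] by simp
  obtain S :: "('u, 'l) lps" and \<eta> where S: "ob True S" "local S" "lps_map E S \<eta>" "weq E S \<eta>"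
    using localization[OF E] by blast
  \<comment> \<open>Both \<open>E\<close> and \<open>Z\<close> are fibrant, so their maps to the
    local object \<open>S\<close> satisfy \<open>tfib\<close>, a condition that describes the
    trivial fibrations of \<open>M\<close> too. Hence both maps are weak equivalences of
    \<open>M\<close>.\<close>
  have t: "tfib E S \<eta>" by (rule fibr_weq_local[OF ob_object[OF E] Ef ob_object[OF S(1)] S(2-4)])
  note pm = hom_fn(2)[OF ph]
  have pw': "weq Z E (fn p)" using mk_weqs[OF Z E pm] pw unfolding mk_fn[OF ph] by simp
  note sm = lps_map_comp[OF pm S(3)]
  have s: "tfib Z S (\<lambda>n x. \<eta> n (fn p n x))"
    by (rule fibr_weq_local[OF ob_object[OF Z] Zf ob_object[OF S(1)] S(2) sm weq_comp[OF pm S(3)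
      pw' S(4)]])
  have w: "mk E \<eta> S \<in> weqs M" "mk Z (\<lambda>n x. \<eta> n (fn p n x)) S \<in> weqs M"
    using mk_trivial_fibs[OF E S(1,3)] mk_trivial_fibs[OF Z S(1) sm] s t by blast+
  have "mk Z (\<lambda>n x. \<eta> n (fn p n x)) S = cmp HDA (mk E \<eta> S) p"
    using cmp_mk[OF pm, of True \<eta> S] unfolding mk_fn[OF ph] HDA_Cat by simp
  then have "cmp HDA (mk E \<eta> S) p \<in> weqs M" using w(2) by (rule subst)
  moreover have "mk E \<eta> S \<in> hom HDA E S" unfolding HDA_Cat by (rule mk_hom[OF E S(1,3)])
  ultimately have "p \<in> weqs M" using two_three[OF p(1), of "mk E \<eta> S" S] w(1) by blast
  then have "cmp HDA r f \<in> weqs M" unfolding fact using two_three[OF j(1) p(1)] j(3) by blast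
  then show "f \<in> weqs M" using two_three[OF fh r(1)] r(3) by blast
qed

lemma model_unique: "M = hda_model"
proof (rule model_data.equality)
  show "weqs M = weqs hda_model" by (rule weqs_eq)
  show "cofs M = cofs hda_model" by (rule cofs_eq)
  show "fibs M = fibs hda_model"
    using fibs_rlp model_cat.fibs_rlp[OF model_cat_hda_model] weqs_eq cofs_eq by simp
qed simp

end

section \<open>The chosen products, coproducts and pushouts\<close>

lemma product_spec:
  assumes "\<exists>t. is_product C X Y t" "product C X Y = t"
  shows "is_product C X Y t"
  using someI_ex[OF assms(1)] assms(2) unfolding product_def by simp

lemma is_product_eq:
  assumes "is_product C X Y (P, p, q)" "h \<in> hom C Z P" "h' \<in> hom C Z P"
    and "cmp C p h' \<in> hom C Z X" "cmp C q h' \<in> hom C Z Y" "cmp C p h = cmp C p h'"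
      "cmp C q h = cmp C q h'"
  shows "h = h'"
  using assms unfolding is_product_def prod.case by blast

lemma pairing:
  assumes P: "is_product C X Y (P, p, q)" "product C X Y = (P, p, q)" and f: "f \<in> hom C Z X"
    and g: "g \<in> hom C Z Y"
  shows "pairing C f g \<in> hom C Z P \<and> cmp C p (pairing C f g) = f \<and> cmp C q (pairing C f g) = g"
proof -
  have s: "target C f = X" "target C g = Y" "source C f = Z" using f g by (simp_all add: hom_def)
  have "\<exists>!h. h \<in> hom C Z P \<and> cmp C p h = f \<and> cmp C q h = g"
    using P(1) f g unfolding is_product_def prod.case by blast
  from theI'[OF this] show ?thesis unfolding pairing_def s P(2) prod.case .
qed

lemma prod_map:
  assumes P: "product C A B = (P, p, q)"
    and Q: "is_product C X Y (Q, p', q')" "product C X Y = (Q, p', q')"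
    and "source C f = A" "source C g = B" "cmp C f p \<in> hom C P X" "cmp C g q \<in> hom C P Y"
  shows "prod_map C f g \<in> hom C P Q \<and> cmp C p' (prod_map C f g) = cmp C f p \<and>
    cmp C q' (prod_map C f g) = cmp C g q"
  using pairing[OF Q assms(6,7)] unfolding prod_map_def assms(4,5) P prod.case .

lemma pushout_spec:
  assumes "\<exists>t. is_pushout C f g t" "pushout C f g = t"
  shows "is_pushout C f g t"
  using someI_ex[OF assms(1)] assms(2) unfolding pushout_def by simp

lemma is_pushoutD:
  assumes "is_pushout C f g (Q, i, j)" "f \<in> hom C A B" "g \<in> hom C A D"
  shows "i \<in> hom C B Q" "j \<in> hom C D Q" "cmp C i f = cmp C j g"
    and "a \<in> hom C B Z \<Longrightarrow> b \<in> hom C D Z \<Longrightarrow> cmp C a f = cmp C b g \<Longrightarrow>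
      \<exists>!h. h \<in> hom C Q Z \<and> cmp C h i = a \<and> cmp C h j = b"
proof -
  have t: "target C f = B" "target C g = D" using assms(2,3) by (simp_all add: hom_def)
  note P = assms(1)[unfolded is_pushout_def prod.case t]
  show "i \<in> hom C B Q" "j \<in> hom C D Q" "cmp C i f = cmp C j g" using P by blast+
  show "a \<in> hom C B Z \<Longrightarrow> b \<in> hom C D Z \<Longrightarrow> cmp C a f = cmp C b g \<Longrightarrow>
      \<exists>!h. h \<in> hom C Q Z \<and> cmp C h i = a \<and> cmp C h j = b" using P by blast
qed

lemma corner:
  assumes P: "is_pushout C f g (Q, i, j)" "pushout C f g = (Q, i, j)" and f: "f \<in> hom C A B"
    and g: "g \<in> hom C A D"
    and h: "h \<in> hom C B E" and v: "v \<in> hom C D E" and sq: "cmp C h f = cmp C v g"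
  shows "corner C f g h v \<in> hom C Q E \<and> cmp C (corner C f g h v) i = h \<and> cmp C (corner C f g h v) j = v"
proof -
  have s: "target C h = E" using h by (simp add: hom_def)
  show ?thesis using theI'[OF is_pushoutD(4)[OF P(1) f g h v sq]]
    unfolding corner_def P(2) prod.case s .
qed

section \<open>Cylinders\<close>

lemma word_act_map:
  assumes "box m n f" "length w = n"
  shows "word_act m n f (map g w) = map g (word_act m n f w)"
proof -
  obtain p where p: "copies m n f p" using box_copies[OF assms(1)] by blast
  then have "p i < n" if "i < m" for i using that by (auto simp: copies_def)
  then show ?thesis using assms(2) by (simp add: word_act_copies[OF p])
qed

lemma V_lps_simps [simp]: "cel V_lps n = {w. length w = n}" "res V_lps = word_act"
  "lab V_lps n w = map fst w"
  by (auto simp: V_lps_def words_def)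

lemma lps_object_V: "lps_object (V_lps :: (('l \<times> bool) list, 'l) lps)"
  by (intro lps_objectI) (simp_all add: word_act_id word_act_compose word_act_map)

lemma lps_map_gamma: "lps_map lwords V_lps (\<lambda>n. map (\<lambda>a. (a, k)))"
  by (intro lps_mapI) (auto simp: word_act_map comp_def)

context small_labels
begin

lemma small_V: "small TYPE('u) (UNIV :: ('l \<times> bool) list set)"
  by (intro small_UNIV_list small_UNIV_prod small_labels small_bool)

lemma inv_emb_V [simp]: "inv emb (emb w :: 'u) = (w :: ('l \<times> bool) list)"
  by (rule inv_f_f[OF emb_inj[OF small_V]])

lemma emb_V_eq: "(emb v :: 'u) = emb w \<longleftrightarrow> v = w" for v w :: "('l \<times> bool) list"
  using inj_eq[OF emb_inj[OF small_V]] .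

lemma V_P: "ob False (V_P :: ('u, 'l) lps)"
    "cel (V_P :: ('u, 'l) lps) n = emb ` {w :: ('l \<times> bool) list. length w = n}"
    "lab (V_P :: ('u, 'l) lps) n (emb w) = map fst (w :: ('l \<times> bool) list)"
proof -
  show "ob False (V_P :: ('u, 'l) lps)" unfolding V_P_def
    by (rule ob_place[OF small_V lps_object_V]) simp
qed (simp_all add: V_P_def place_transport)

lemma gamma: "(gamma k :: ('u, 'l) lmor) \<in> hom (Cat False) one_P V_P"
    "length w = n \<Longrightarrow> fn (gamma k :: ('u, 'l) lmor) n (emb w) = emb (map (\<lambda>a. (a, k)) w)"
      for w :: "'l list"
proof -
  show "(gamma k :: ('u, 'l) lmor) \<in> hom (Cat False) one_P V_P" unfolding gamma_def one_P_def V_P_def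
    by (rule place_map_hom[OF small_UNIV_list[OF small_labels]
      small_V lps_object_lwords lps_object_V _ lps_map_gamma]) simp
  assume "length w = n"
  then have "emb w \<in> cel (place (lwords :: ('l list, 'l) lps) :: ('u, 'l) lps) n"
    by (simp add: place_transport)
  from fn_mk[OF this] show "fn (gamma k :: ('u, 'l) lmor) n (emb w) = emb (map (\<lambda>a. (a, k)) w)"
    unfolding gamma_def place_map_mk by (simp add: emb_words)
qed

definition cyl :: "('u, 'l) lps \<Rightarrow> ('u, 'l) lps" where
  "cyl X = fst (product (Cat False) V_P X)"

definition to_V :: "('u, 'l) lps \<Rightarrow> ('u, 'l) lmor" where
  "to_V X = fst (snd (product (Cat False) V_P X))"

definition proj :: "('u, 'l) lps \<Rightarrow> ('u, 'l) lmor" where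
  "proj X = snd (snd (product (Cat False) V_P X))"

lemma product_cyl: "product (Cat False) V_P X = (cyl X, to_V X, proj X)"
  by (simp add: cyl_def to_V_def proj_def)

lemma cyl:
  assumes X: "ob False X"
  shows "is_product (Cat False) V_P X (cyl X, to_V X, proj X)" "ob False (cyl X)"
    "to_V X \<in> hom (Cat False) (cyl X) V_P" "proj X \<in> hom (Cat False) (cyl X) X"
proof -
  show P: "is_product (Cat False) V_P X (cyl X, to_V X, proj X)"
    by (rule product_spec[OF product_exists[OF V_P(1) X] product_cyl])
  show "ob False (cyl X)" "to_V X \<in> hom (Cat False) (cyl X) V_P" "proj X \<in> hom (Cat False) (cyl X) X"
    using P unfolding is_product_def prod.case obj_Cat by blast+
qed

text \<open>The chosen product is known only through its universal property, which is applied to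
  maps from a cube. Both cells give maps from the same cube, since their labels are preserved by
  \<open>proj X\<close> and therefore agree.\<close>

lemma cyl_eqI:
  assumes X: "ob False X" and w: "w \<in> cel (cyl X) n" "w' \<in> cel (cyl X) n"
    and p: "fn (to_V X) n w = fn (to_V X) n w'" and q: "fn (proj X) n w = fn (proj X) n w'"
  shows "w = w'"
proof -
  note c = cyl[OF X]
  have "lab (cyl X) n w = lab X n (fn (proj X) n w)" using map_lab[OF hom_fn(2)[OF c(4)] w(1)] by simp
  also have "\<dots> = lab (cyl X) n w'" unfolding q using map_lab[OF hom_fn(2)[OF c(4)] w(2)] by simp
  finally have l: "lab (cyl X) n w = lab (cyl X) n w'" .
  have h: "pt (cyl X) n w \<in> hom (Cat False) (place (lcube (lab (cyl X) n w'))) (cyl X)"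
    using pt(1)[OF c(2) w(1)] unfolding l .
  have h': "pt (cyl X) n w' \<in> hom (Cat False) (place (lcube (lab (cyl X) n w'))) (cyl X)"
    by (rule pt(1)[OF c(2) w(2)])
  have eq: "pt (cyl X) n w = pt (cyl X) n w'"
    by (rule is_product_eq[OF c(1) h h' cmp_hom[OF h' c(3)] cmp_hom[OF h' c(4)]])
      (simp_all only: pt_comp[OF c(3)] pt_comp[OF c(4)] w p q)
  have "w = fn (pt (cyl X) n w') n (top_cell n)" using pt(2)[OF c(2) w(1)] unfolding eq by simp
  then show ?thesis unfolding pt(2)[OF c(2) w(2)] .
qed

lemma gamma_at:
  assumes X: "ob False X"
  shows "gamma_at k X \<in> hom (Cat False) X (cyl X)"
    and "x \<in> cel X n \<Longrightarrow> fn (to_V X) n (fn (gamma_at k X) n x) = emb (map (\<lambda>a. (a, k)) (lab X n x))"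
    and "x \<in> cel X n \<Longrightarrow> fn (proj X) n (fn (gamma_at k X) n x) = x"
proof -
  note t = to_one[OF X]
  have T: "(THE t. t \<in> hom (Cat False) X (one_P :: ('u, 'l) lps)) = mk X (\<lambda>n x. emb (lab X n x)) one_P"
    by (rule the_equality, rule t(1), rule t(2))
  have g: "gamma_at k X \<in> hom (Cat False) X (cyl X) \<and>
      cmp (Cat False) (to_V X) (gamma_at k X) = cmp (Cat False) (gamma k :: ('u, 'l) lmor)
        (mk X (\<lambda>n x. emb (lab X n x)) one_P) \<and>
      cmp (Cat False) (proj X) (gamma_at k X) = idm (Cat False) X"
    using pairing[OF cyl(1)[OF X] product_cyl cmp_hom[OF t(1) gamma(1)] idm_hom[OF X]]
    unfolding gamma_at_def P_cat_Cat T .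
  then show h: "gamma_at k X \<in> hom (Cat False) X (cyl X)" by (elim conjE)
  assume x: "x \<in> cel X n"
  have "fn (cmp (Cat False) (to_V X) (gamma_at k X)) n x =
      fn (cmp (Cat False) (gamma k :: ('u, 'l) lmor) (mk X (\<lambda>n x. emb (lab X n x)) one_P)) n x"
    using g by (elim conjE) (rule arg_cong[where f = "\<lambda>h. fn h n x"])
  then have "fn (to_V X) n (fn (gamma_at k X) n x) = fn (gamma k :: ('u, 'l) lmor) n (emb (lab X n x))"
    unfolding fn_cmp[OF h cyl(3)[OF X] x] fn_cmp[OF t(1) gamma(1) x] fn_mk[OF x] .
  then show "fn (to_V X) n (fn (gamma_at k X) n x) = emb (map (\<lambda>a. (a, k)) (lab X n x))"
    using gamma(2)[OF length_lab[OF ob_object[OF X] x]] by simp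
  have "fn (idm (Cat False) X) n x = x" unfolding idm_Cat by (rule fn_mk[OF x])
  then show "fn (proj X) n (fn (gamma_at k X) n x) = x"
    using fn_cmp[OF h cyl(4)[OF X] x] g by metis
qed

lemma to_V_cell:
  assumes X: "ob False X" and w: "w \<in> cel (cyl X) n"
  obtains v :: "('l \<times> bool) list" where "fn (to_V X) n w = emb v" "length v = n"
    "map fst v = lab X n (fn (proj X) n w)"
proof -
  note c = cyl[OF X]
  have "fn (to_V X) n w \<in> emb ` {v :: ('l \<times> bool) list. length v = n}"
    using map_cel[OF hom_fn(2)[OF c(3)] w] unfolding V_P(2) .
  then obtain v :: "('l \<times> bool) list" where v: "fn (to_V X) n w = emb v" "length v = n" by blast
  have "map fst v = lab (cyl X) n w" using map_lab[OF hom_fn(2)[OF c(3)] w] unfolding v(1) V_P(3) .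
  then show ?thesis using that v map_lab[OF hom_fn(2)[OF c(4)] w] by simp
qed

text \<open>The component of a vertex in \<open>V_P\<close> is the empty word, so the vertex lies at
  both ends of the cylinder.\<close>

lemma cyl_vertex:
  assumes X: "ob False X" and w: "w \<in> cel (cyl X) 0"
  shows "fn (gamma_at k X) 0 (fn (proj X) 0 w) = w"
proof -
  note q = map_cel[OF hom_fn(2)[OF cyl(4)[OF X]] w]
  note g = map_cel[OF hom_fn(2)[OF gamma_at(1)[OF X]] q]
  obtain v :: "('l \<times> bool) list" where v: "fn (to_V X) 0 w = emb v" "length v = 0"
    by (rule to_V_cell[OF X w])
  have "lab X 0 (fn (proj X) 0 w) = []" using length_lab[OF ob_object[OF X] q] by simp
  then show ?thesis
    by (intro cyl_eqI[OF X g w]) (use v gamma_at(2,3)[OF X q] in simp_all)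
qed

text \<open>The component of an edge in \<open>V_P\<close> is a single letter, and its bit tells at
  which end the edge lies. Cells of dimension at least 2 may have mixed bits and lie at neither
  end.\<close>

lemma cyl_edge:
  assumes X: "ob False X" and w: "w \<in> cel (cyl X) (Suc 0)"
  obtains k where "fn (gamma_at k X) (Suc 0) (fn (proj X) (Suc 0) w) = w"
proof -
  note q = map_cel[OF hom_fn(2)[OF cyl(4)[OF X]] w]
  note g = map_cel[OF hom_fn(2)[OF gamma_at(1)[OF X]] q]
  obtain v :: "('l \<times> bool) list" where v: "fn (to_V X) (Suc 0) w = emb v" "length v = Suc 0"
      "map fst v = lab X (Suc 0) (fn (proj X) (Suc 0) w)" by (rule to_V_cell[OF X w])
  obtain p where p: "v = [p]" using v(2) by (auto simp: length_Suc_conv)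
  have "fn (gamma_at (snd p) X) (Suc 0) (fn (proj X) (Suc 0) w) = w"
    by (rule cyl_eqI[OF X g w]) (use gamma_at(2,3)[OF X q] v(1) v(3)[symmetric] p in simp_all)
  then show ?thesis by (rule that)
qed

text \<open>Vertices lie at both ends, so moving a cell to an end over its projection changes
  neither its vertices nor its label.\<close>

lemma cyl_par:
  assumes X: "ob False X" and w: "w \<in> cel (cyl X) n"
  shows "par (cyl X) n (fn (gamma_at k X) n (fn (proj X) n w)) w"
  unfolding par_def
proof (intro conjI allI impI)
  note P = hom_fn(2)[OF cyl(4)[OF X]] and G = hom_fn(2)[OF gamma_at(1)[OF X]]
  note q = map_cel[OF P w]
  show "lab (cyl X) n (fn (gamma_at k X) n (fn (proj X) n w)) = lab (cyl X) n w"
    using map_lab[OF G q] map_lab[OF P w] by simp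
  fix f assume f: "box 0 n f"
  show "res (cyl X) 0 n f (fn (gamma_at k X) n (fn (proj X) n w)) = res (cyl X) 0 n f w"
    unfolding map_res[OF G f q, symmetric] map_res[OF P f w, symmetric]
    by (rule cyl_vertex[OF X res_cel[OF ob_object[OF cyl(2)[OF X]] f w]])
qed

text \<open>An edge has a nonempty label, which lets the bit be read off; vertices do not
  distinguish the ends.\<close>

lemma gamma_at_eq:
  assumes X: "ob False (X :: ('u, 'l) lps)" and x: "x \<in> cel X (Suc 0)" "x' \<in> cel X (Suc 0)"
    and eq: "fn (gamma_at k X) (Suc 0) x = fn (gamma_at k' X) (Suc 0) x'"
  shows "k = k' \<and> x = x'"
proof -
  have "(emb (map (\<lambda>a. (a, k)) (lab X (Suc 0) x)) :: 'u) = emb (map (\<lambda>a. (a, k')) (lab X (Suc 0) x'))"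
    using gamma_at(2)[OF X x(1), of k] gamma_at(2)[OF X x(2), of k'] unfolding eq by simp
  then have "map (\<lambda>a. (a, k)) (lab X (Suc 0) x) = map (\<lambda>a. (a, k')) (lab X (Suc 0) x')"
    unfolding emb_V_eq .
  moreover have "lab X (Suc 0) x \<noteq> []" using length_lab[OF ob_object[OF X] x(1)] by auto
  ultimately have "k = k'" by (cases "lab X (Suc 0) x"; cases "lab X (Suc 0) x'") simp_all
  moreover have "x = x'" using gamma_at(3)[OF X x(1), of k] gamma_at(3)[OF X x(2), of k']
    unfolding eq by simp
  ultimately show ?thesis ..
qed

lemma V_times:
  assumes f: "f \<in> hom (Cat False) A B"
  shows "V_times f \<in> hom (Cat False) (cyl A) (cyl B)"
    and "a \<in> cel A n \<Longrightarrow> fn (V_times f) n (fn (gamma_at k A) n a) = fn (gamma_at k B) n (fn f n a)"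
proof -
  have A: "ob False A" and B: "ob False B" by (rule hom_fn(3)[OF f], rule hom_fn(4)[OF f])
  note cA = cyl[OF A] and cB = cyl[OF B]
  have s: "source (Cat False) (idm (Cat False) V_P) = (V_P :: ('u, 'l) lps)" "source (Cat False) f = A"
    using f by (simp_all add: idm_Cat hom_def)
  have v: "V_times f \<in> hom (Cat False) (cyl A) (cyl B) \<and>
      cmp (Cat False) (to_V B) (V_times f) = cmp (Cat False) (idm (Cat False) V_P) (to_V A) \<and>
      cmp (Cat False) (proj B) (V_times f) = cmp (Cat False) f (proj A)"
    using prod_map[OF product_cyl cB(1) product_cyl s cmp_hom[OF cA(3) idm_hom[OF V_P(1)]]
      cmp_hom[OF cA(4) f]]
    unfolding V_times_def P_cat_Cat .
  then show h: "V_times f \<in> hom (Cat False) (cyl A) (cyl B)" by (elim conjE)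
  assume a: "a \<in> cel A n"
  note ga = map_cel[OF hom_fn(2)[OF gamma_at(1)[OF A, of k]] a] and fa = map_cel[OF hom_fn(2)[OF f] a]
  show "fn (V_times f) n (fn (gamma_at k A) n a) = fn (gamma_at k B) n (fn f n a)"
  proof (rule cyl_eqI[OF B map_cel[OF hom_fn(2)[OF h] ga] map_cel[OF hom_fn(2)[OF gamma_at(1)[OF B]]
    fa]])
    have "fn (to_V B) n (fn (V_times f) n (fn (gamma_at k A) n a)) =
      fn (to_V A) n (fn (gamma_at k A) n a)"
      using fn_cmp[OF h cB(3) ga] v cmp_idm(2)[OF cA(3)] by metis
    then show "fn (to_V B) n (fn (V_times f) n (fn (gamma_at k A) n a)) =
      fn (to_V B) n (fn (gamma_at k B) n (fn f n a))"
      using gamma_at(2)[OF A a, of k] gamma_at(2)[OF B fa, of k] map_lab[OF hom_fn(2)[OF f] a] by simp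
    have "fn (proj B) n (fn (V_times f) n (fn (gamma_at k A) n a)) =
      fn f n (fn (proj A) n (fn (gamma_at k A) n a))"
      using fn_cmp[OF h cB(4) ga] fn_cmp[OF cA(4) f ga] v by metis
    then show "fn (proj B) n (fn (V_times f) n (fn (gamma_at k A) n a)) =
      fn (proj B) n (fn (gamma_at k B) n (fn f n a))"
      using gamma_at(3)[OF A a, of k] gamma_at(3)[OF B fa, of k] by simp
  qed
qed

lemma star_gamma:
  assumes f: "f \<in> hom (Cat False) A B"
  obtains Q i j where "is_pushout (Cat False) f (gamma_at k A) (Q, i, j)"
    "star_gamma k f \<in> hom (Cat False) Q (cyl B)"
    "cmp (Cat False) (star_gamma k f) i = gamma_at k B" "cmp (Cat False) (star_gamma k f) j = V_times f"
proof -
  have A: "ob False A" and B: "ob False B" by (rule hom_fn(3)[OF f], rule hom_fn(4)[OF f])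
  note g = gamma_at(1)[OF A, of k] and h = gamma_at(1)[OF B, of k] and v = V_times(1)[OF f]
  have s: "source (Cat False) f = A" "target (Cat False) f = B" using f by (simp_all add: hom_def)
  have sq: "cmp (Cat False) (gamma_at k B) f = cmp (Cat False) (V_times f) (gamma_at k A)"
    by (rule hom_eqI[OF cmp_hom[OF f h] cmp_hom[OF g v]]) (simp add: fn_cmp[OF f h] fn_cmp[OF g v]
      V_times(2)[OF f])
  obtain Q i j where Q: "pushout (Cat False) f (gamma_at k A) = (Q, i, j)" by (rule prod_cases3)
  note P = pushout_spec[OF pushout_exists[OF f g] Q]
  show ?thesis
    using that[OF P] corner[OF P Q f g h v sq] unfolding star_gamma_def P_cat_Cat s by blast
qed

text \<open>The edges of \<open>Q\<close> are those of \<open>B\<close> at the end \<open>k\<close>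
  and those of \<open>A\<close> at the opposite end, and bits keep the two kinds apart in
  \<open>cyl B\<close>. All vertices of \<open>Q\<close> come from \<open>B\<close>, and each cell
  of \<open>cyl B\<close> is parallel to the cell at the end \<open>k\<close> with the same
  projection.\<close>

lemma star_gamma_weq:
  assumes f: "f \<in> hom (Cat False) (A :: ('u, 'l) lps) B" and c: "cofib A B (fn f)"
  shows "\<exists>Q E. star_gamma k f \<in> hom (Cat False) Q E \<and> cofib Q E (fn (star_gamma k f)) \<and>
    weq Q E (fn (star_gamma k f))"
proof -
  have A: "ob False A" and B: "ob False B" by (rule hom_fn(3)[OF f], rule hom_fn(4)[OF f])
  note g = gamma_at(1)[OF A, of k] and v = V_times[OF f]
  obtain Q i j where P: "is_pushout (Cat False) f (gamma_at k A) (Q, i, j)"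
    and s: "star_gamma k f \<in> hom (Cat False) Q (cyl B)"
      "cmp (Cat False) (star_gamma k f) i = gamma_at k B"
      "cmp (Cat False) (star_gamma k f) j = V_times f" by (rule star_gamma[OF f])
  note i = is_pushoutD(1)[OF P f g] and j = is_pushoutD(2)[OF P f g] and sq = is_pushoutD(3)[OF P f g]
  let ?s = "fn (star_gamma k f)" and ?g = "\<lambda>k. fn (gamma_at k B)"
  have si: "?s n (fn i n y) = ?g k n y" if "y \<in> cel B n" for n y
    using fn_cmp[OF i s(1) that] unfolding s(2) by simp
  have sj: "?s n (fn j n w) = fn (V_times f) n w" if "w \<in> cel (cyl A) n" for n w
    using fn_cmp[OF j s(1) that] unfolding s(3) by simp
  have ij: "fn j n (fn (gamma_at k A) n a) = fn i n (fn f n a)" if "a \<in> cel A n" for n a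
    using fn_cmp[OF f i that] fn_cmp[OF g j that] unfolding sq by simp
  note fm = map_cel[OF hom_fn(2)[OF f]] and pm = map_cel[OF hom_fn(2)[OF cyl(4)[OF A]]]
    and gm = map_cel[OF hom_fn(2)[OF gamma_at(1)[OF A]]]
  have vert: "\<exists>y\<in>cel B 0. z = fn i 0 y" if z: "z \<in> cel Q 0" for z
    using pushout_surj[OF f g P z]
  proof (elim disjE bexE)
    fix w assume w: "w \<in> cel (cyl A) 0" "z = fn j 0 w"
    have "z = fn i 0 (fn f 0 (fn (proj A) 0 w))"
      using ij[OF pm[OF w(1)]] cyl_vertex[OF A w(1)] w(2) by simp
    then show ?thesis using fm[OF pm[OF w(1)]] by blast
  qed blast
  have edge: "(\<exists>y\<in>cel B (Suc 0). z = fn i (Suc 0) y \<and> ?s (Suc 0) z = ?g k (Suc 0) y) \<or>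
      (\<exists>a\<in>cel A (Suc 0). z = fn j (Suc 0) (fn (gamma_at (\<not> k) A) (Suc 0) a) \<and>
        ?s (Suc 0) z = ?g (\<not> k) (Suc 0) (fn f (Suc 0) a))" if z: "z \<in> cel Q (Suc 0)" for z
    using pushout_surj[OF f g P z]
  proof (elim disjE bexE)
    fix y assume "y \<in> cel B (Suc 0)" "z = fn i (Suc 0) y"
    then show ?thesis using si by blast
  next
    fix w assume w: "w \<in> cel (cyl A) (Suc 0)" "z = fn j (Suc 0) w"
    obtain k' where k': "fn (gamma_at k' A) (Suc 0) (fn (proj A) (Suc 0) w) = w"
      by (rule cyl_edge[OF A w(1)])
    let ?a = "fn (proj A) (Suc 0) w"
    note a = pm[OF w(1)]
    show ?thesis
    proof (cases "k' = k")
      case True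
      then have "z = fn i (Suc 0) (fn f (Suc 0) ?a)" using ij[OF a] k' w(2) by simp
      then show ?thesis using si[OF fm[OF a]] fm[OF a] by blast
    next
      case False
      then have "k' = (\<not> k)" by blast
      then have z: "z = fn j (Suc 0) (fn (gamma_at (\<not> k) A) (Suc 0) ?a)" using k' w(2) by simp
      have "?s (Suc 0) z = ?g (\<not> k) (Suc 0) (fn f (Suc 0) ?a)"
        unfolding z sj[OF gm[OF a]] by (rule v(2)[OF a])
      then show ?thesis using z a by blast
    qed
  qed
  have "cofib Q (cyl B) ?s"
    unfolding cofib_def
  proof (rule inj_onI)
    fix z z' assume z: "z \<in> cel Q (Suc 0)" and z': "z' \<in> cel Q (Suc 0)"
      and eq: "?s (Suc 0) z = ?s (Suc 0) z'"
    note gi = gamma_at_eq[OF B]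
    show "z = z'"
      using edge[OF z] edge[OF z']
    proof (elim disjE bexE conjE)
      fix y y' assume "y \<in> cel B (Suc 0)" "z = fn i (Suc 0) y" "?s (Suc 0) z = ?g k (Suc 0) y"
        "y' \<in> cel B (Suc 0)" "z' = fn i (Suc 0) y'" "?s (Suc 0) z' = ?g k (Suc 0) y'"
      then show ?thesis using gi[of y y' k k] eq by simp
    next
      \<comment> \<open>Edges at opposite ends cannot have the same image, by
        \<open>gamma_at_eq\<close>.\<close>
      fix y a assume "y \<in> cel B (Suc 0)" "?s (Suc 0) z = ?g k (Suc 0) y"
        "a \<in> cel A (Suc 0)" "?s (Suc 0) z' = ?g (\<not> k) (Suc 0) (fn f (Suc 0) a)"
      then show ?thesis using gi[OF _ fm, of y a k "\<not> k"] eq by simp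
    next
      fix y a assume "y \<in> cel B (Suc 0)" "?s (Suc 0) z' = ?g k (Suc 0) y"
        "a \<in> cel A (Suc 0)" "?s (Suc 0) z = ?g (\<not> k) (Suc 0) (fn f (Suc 0) a)"
      then show ?thesis using gi[OF _ fm, of y a k "\<not> k"] eq by simp
    next
      fix a a' assume a: "a \<in> cel A (Suc 0)" "z = fn j (Suc 0) (fn (gamma_at (\<not> k) A) (Suc 0) a)"
          "?s (Suc 0) z = ?g (\<not> k) (Suc 0) (fn f (Suc 0) a)"
        and a': "a' \<in> cel A (Suc 0)" "z' = fn j (Suc 0) (fn (gamma_at (\<not> k) A) (Suc 0) a')"
          "?s (Suc 0) z' = ?g (\<not> k) (Suc 0) (fn f (Suc 0) a')"
      have "fn f (Suc 0) a = fn f (Suc 0) a'"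
        using gi[OF fm[OF a(1)] fm[OF a'(1)], of "\<not> k" "\<not> k"] a(3) a'(3) eq by simp
      then have "a = a'" by (rule inj_onD[OF c[unfolded cofib_def] _ a(1) a'(1)])
      then show ?thesis using a(2) a'(2) by simp
    qed
  qed
  moreover have "weq Q (cyl B) ?s"
    unfolding weq_def
  proof (intro conjI allI ballI)
    show "inj_on (?s 0) (cel Q 0)"
    proof (rule inj_onI)
      fix z z' assume z: "z \<in> cel Q 0" and z': "z' \<in> cel Q 0" and eq: "?s 0 z = ?s 0 z'"
      obtain y where y: "y \<in> cel B 0" "z = fn i 0 y" using vert[OF z] by blast
      obtain y' where y': "y' \<in> cel B 0" "z' = fn i 0 y'" using vert[OF z'] by blast
      have "?g k 0 y = ?g k 0 y'" using eq unfolding y(2) y'(2) si[OF y(1)] si[OF y'(1)] .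
      then have "fn (proj B) 0 (?g k 0 y) = fn (proj B) 0 (?g k 0 y')" by simp
      then have "y = y'" unfolding gamma_at(3)[OF B y(1)] gamma_at(3)[OF B y'(1)] .
      then show "z = z'" using y(2) y'(2) by simp
    qed
    fix n w assume w: "w \<in> cel (cyl B) n"
    note q = map_cel[OF hom_fn(2)[OF cyl(4)[OF B]] w]
    show "\<exists>z\<in>cel Q n. par (cyl B) n (?s n z) w"
    proof (rule bexI)
      show "par (cyl B) n (?s n (fn i n (fn (proj B) n w))) w" unfolding si[OF q]
        by (rule cyl_par[OF B w])
      show "fn i n (fn (proj B) n w) \<in> cel Q n" by (rule map_cel[OF hom_fn(2)[OF i] q])
    qed
  qed
  ultimately show ?thesis using s(1) by blast
qed

text \<open>All maps out of an empty object agree, so a cocone under the pushout diagram is just a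
  pair of maps. Existence of coproducts and joint surjectivity of their injections are thus
  inherited from pushouts.\<close>

lemma coproduct_pushout:
  assumes Z: "ob b Z" "\<And>n. cel Z n = {}" and X: "ob b X" and Y: "ob b (Y :: ('u, 'l) lps)"
  shows "is_product (op_cat (Cat b)) X Y (P, i, j) \<longleftrightarrow>
    is_pushout (Cat b) (mk Z (\<lambda>n x. x) X) (mk Z (\<lambda>n x. x) Y) (P, i, j)"
proof -
  have m: "mk Z (\<lambda>n x. x) D \<in> hom (Cat b) Z D" if "ob b D" for D :: "('u, 'l) lps"
    by (rule mk_hom[OF Z(1) that], rule lps_mapI) (simp_all add: Z(2))
  have e: "cmp (Cat b) a (mk Z (\<lambda>n x. x) X) = cmp (Cat b) c (mk Z (\<lambda>n x. x) Y)"
    if "a \<in> hom (Cat b) X D" "c \<in> hom (Cat b) Y D" for a c and D :: "('u, 'l) lps"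
    by (rule hom_eqI[OF cmp_hom[OF m[OF X] that(1)] cmp_hom[OF m[OF Y] that(2)]]) (simp add: Z(2))
  have o: "obj (op_cat (Cat b)) = (obj (Cat b) :: ('u, 'l) lps set)"
    "\<And>g h. cmp (op_cat (Cat b)) g h = cmp (Cat b) h (g :: ('u, 'l) lmor)" by (simp_all add: op_cat_def)
  have e1: "(a \<in> hom (Cat b) X D \<and> c \<in> hom (Cat b) Y D \<and>
      cmp (Cat b) a (mk Z (\<lambda>n x. x) X) = cmp (Cat b) c (mk Z (\<lambda>n x. x) Y)) \<longleftrightarrow>
      a \<in> hom (Cat b) X D \<and> c \<in> hom (Cat b) Y D" for a c and D :: "('u, 'l) lps"
    using e by blast
  have e2: "(a \<in> hom (Cat b) X D \<and> c \<in> hom (Cat b) Y D \<and>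
      cmp (Cat b) a (mk Z (\<lambda>n x. x) X) = cmp (Cat b) c (mk Z (\<lambda>n x. x) Y) \<and> U) \<longleftrightarrow>
      a \<in> hom (Cat b) X D \<and> c \<in> hom (Cat b) Y D \<and> U" for a c U and D :: "('u, 'l) lps"
    using e by blast
  show ?thesis
    unfolding is_product_def is_pushout_def prod.case target_mk hom_op_cat o e1 e2 by (rule refl)
qed

lemma coproduct:
  assumes X: "ob False X" and Y: "ob False (Y :: ('u, 'l) lps)"
  obtains P i j where "product (op_cat (Cat False)) X Y = (P, i, j)"
    "is_product (op_cat (Cat False)) X Y (P, i, j)"
    "i \<in> hom (Cat False) X P" "j \<in> hom (Cat False) Y P"
    "\<forall>n. \<forall>z\<in>cel P n. (\<exists>x\<in>cel X n. z = fn i n x) \<or> (\<exists>y\<in>cel Y n. z = fn j n y)"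
proof -
  define Z :: "('u, 'l) lps" where "Z = place (ldiscrete ({} :: nat set))"
  have c: "cel Z n = {}" for n unfolding Z_def place_transport by auto
  have Z: "ob False Z" unfolding Z_def by (rule ob_place[OF small_nat lps_object_ldiscrete]) simp
  have m: "mk Z (\<lambda>n x. x) D \<in> hom (Cat False) Z D" if "ob False D" for D :: "('u, 'l) lps"
    by (rule mk_hom[OF Z that], rule lps_mapI) (simp_all add: c)
  have "\<exists>t. is_product (op_cat (Cat False)) X Y t"
    using pushout_exists[OF m[OF X] m[OF Y]] coproduct_pushout[OF Z c X Y] by (metis prod_cases3)
  note ex = product_spec[OF this]
  obtain P i j where P: "product (op_cat (Cat False)) X Y = (P, i, j)" by (rule prod_cases3)
  note p = ex[OF P]
  note u = p[unfolded coproduct_pushout[OF Z c X Y]]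
  show ?thesis
    by (rule that[OF P p is_pushoutD(1,2)[OF u m[OF X] m[OF Y]]])
      (intro allI ballI pushout_surj[OF m[OF X] m[OF Y] u])
qed

text \<open>Both ends of \<open>cyl B\<close> are attached now, and the two copies of a vertex of
  \<open>B\<close> become identified only through a vertex of \<open>A\<close>. As \<open>f\<close>
  is bijective on vertices, this reaches every vertex of \<open>B\<close>. The edges of
  \<open>Q\<close> all come from the two copies of \<open>B\<close>, and their bits make the map
  injective on them.\<close>

lemma star_gamma2_weq:
  assumes f: "f \<in> hom (Cat False) (A :: ('u, 'l) lps) B" and c: "cofib A B (fn f)"
    and w: "weq A B (fn f)"
  shows "\<exists>Q E. star_gamma2 f \<in> hom (Cat False) Q E \<and> cofib Q E (fn (star_gamma2 f)) \<and>
    weq Q E (fn (star_gamma2 f))"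
proof -
  have A: "ob False A" and B: "ob False B" by (rule hom_fn(3)[OF f], rule hom_fn(4)[OF f])
  obtain CA a0 a1 where pA: "product (op_cat (Cat False)) A A = (CA, a0, a1)"
      "is_product (op_cat (Cat False)) A A (CA, a0, a1)"
    and a: "a0 \<in> hom (Cat False) A CA" "a1 \<in> hom (Cat False) A CA"
      "\<forall>n. \<forall>z\<in>cel CA n. (\<exists>x\<in>cel A n. z = fn a0 n x) \<or> (\<exists>y\<in>cel A n. z = fn a1 n y)"
    by (rule coproduct[OF A A])
  obtain CB b0 b1 where pB: "product (op_cat (Cat False)) B B = (CB, b0, b1)"
      "is_product (op_cat (Cat False)) B B (CB, b0, b1)"
    and b: "b0 \<in> hom (Cat False) B CB" "b1 \<in> hom (Cat False) B CB"
      "\<forall>n. \<forall>z\<in>cel CB n. (\<exists>x\<in>cel B n. z = fn b0 n x) \<or> (\<exists>y\<in>cel B n. z = fn b1 n y)"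
    by (rule coproduct[OF B B])
  have op_cmp: "cmp (op_cat (Cat False)) g h = cmp (Cat False) h g" for g h :: "('u, 'l) lmor"
    by (simp add: op_cat_def)
  have g2: "gamma2_at X \<in> hom (Cat False) P (cyl X) \<and> cmp (Cat False) (gamma2_at X) p0 =
    gamma_at False X \<and>
      cmp (Cat False) (gamma2_at X) p1 = gamma_at True X"
    if "product (op_cat (Cat False)) X X = (P, p0, p1)"
      "is_product (op_cat (Cat False)) X X (P, p0, p1)" "ob False X"
    for X P p0 p1
    using pairing[OF that(2,1), of "gamma_at False X" "cyl X" "gamma_at True X"] gamma_at(1)[OF that(3)]
    unfolding gamma2_at_def P_cat_Cat copairing_def hom_op_cat op_cmp by blast
  note gA = g2[OF pA A] and gB = g2[OF pB B]
  have s: "source (Cat False) f = A" "target (Cat False) f = B" "source (op_cat (Cat False)) f = B"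
    using f by (simp_all add: hom_def op_cat_def)
  have ff: "coprod_map (Cat False) f f \<in> hom (Cat False) CA CB \<and>
      cmp (Cat False) (coprod_map (Cat False) f f) a0 = cmp (Cat False) b0 f \<and>
      cmp (Cat False) (coprod_map (Cat False) f f) a1 = cmp (Cat False) b1 f"
    using prod_map[OF pB(1) pA(2,1) s(3) s(3)] cmp_hom[OF f b(1)] cmp_hom[OF f b(2)]
    unfolding coprod_map_def hom_op_cat op_cmp by blast
  let ?ff = "coprod_map (Cat False) f f"
  have ff1: "?ff \<in> hom (Cat False) CA CB" and gA1: "gamma2_at A \<in> hom (Cat False) CA (cyl A)"
    and gB1: "gamma2_at B \<in> hom (Cat False) CB (cyl B)" using ff gA gB by blast+
  \<comment> \<open>The injections of both coproducts are indexed by the end, so that the two copies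
    can be treated at once.\<close>
  define \<alpha> where "\<alpha> k = (if k then a1 else a0)" for k
  define \<beta> where "\<beta> k = (if k then b1 else b0)" for k
  have \<alpha>: "\<alpha> k \<in> hom (Cat False) A CA" and \<beta>: "\<beta> k \<in> hom (Cat False) B CB"
    and ga: "cmp (Cat False) (gamma2_at A) (\<alpha> k) = gamma_at k A"
      and gb: "cmp (Cat False) (gamma2_at B) (\<beta> k) = gamma_at k B"
    and fa: "cmp (Cat False) ?ff (\<alpha> k) = cmp (Cat False) (\<beta> k) f" for k
    using a(1,2) b(1,2) gA gB ff by (cases k; simp add: \<alpha>_def \<beta>_def)+
  have sA: "\<exists>k. \<exists>x\<in>cel A n. z = fn (\<alpha> k) n x" if "z \<in> cel CA n" for n z
    using bspec[OF spec[OF a(3)] that] unfolding \<alpha>_def by (metis (full_types))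
  have sB: "\<exists>k. \<exists>x\<in>cel B n. z = fn (\<beta> k) n x" if "z \<in> cel CB n" for n z
    using bspec[OF spec[OF b(3)] that] unfolding \<beta>_def by (metis (full_types))
  have ga': "fn (gamma2_at A) n (fn (\<alpha> k) n x) = fn (gamma_at k A) n x" if "x \<in> cel A n" for k n x
    using fn_cmp[OF \<alpha> gA1 that] unfolding ga by simp
  have gb': "fn (gamma2_at B) n (fn (\<beta> k) n x) = fn (gamma_at k B) n x" if "x \<in> cel B n" for k n x
    using fn_cmp[OF \<beta> gB1 that] unfolding gb by simp
  have fa': "fn ?ff n (fn (\<alpha> k) n x) = fn (\<beta> k) n (fn f n x)" if "x \<in> cel A n" for k n x
    using fn_cmp[OF \<alpha> ff1 that] fn_cmp[OF f \<beta> that] unfolding fa by simp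
  note v = V_times[OF f]
  have sq: "cmp (Cat False) (gamma2_at B) ?ff = cmp (Cat False) (V_times f) (gamma2_at A)"
  proof (rule hom_eqI[OF cmp_hom[OF ff1 gB1] cmp_hom[OF gA1 v(1)]])
    fix n z assume z: "z \<in> cel CA n"
    then obtain k x where x: "x \<in> cel A n" "z = fn (\<alpha> k) n x" using sA by blast
    show "fn (cmp (Cat False) (gamma2_at B) ?ff) n z =
      fn (cmp (Cat False) (V_times f) (gamma2_at A)) n z"
      unfolding fn_cmp[OF ff1 gB1 z] fn_cmp[OF gA1 v(1) z]
        unfolding x(2) fa'[OF x(1)] ga'[OF x(1)] v(2)[OF x(1)]
      by (rule gb'[OF map_cel[OF hom_fn(2)[OF f] x(1)]])
  qed
  obtain Q i j where Q: "pushout (Cat False) ?ff (gamma2_at A) = (Q, i, j)" by (rule prod_cases3)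
  note P = pushout_spec[OF pushout_exists[OF ff1 gA1] Q]
  have s3: "star_gamma2 f \<in> hom (Cat False) Q (cyl B) \<and> cmp (Cat False) (star_gamma2 f) i = gamma2_at B"
    using corner[OF P Q ff1 gA1 gB1 v(1) sq] unfolding star_gamma2_def P_cat_Cat s by blast
  then have s1: "star_gamma2 f \<in> hom (Cat False) Q (cyl B)"
    and s2: "cmp (Cat False) (star_gamma2 f) i = gamma2_at B"
    by blast+
  note i = is_pushoutD(1)[OF P ff1 gA1] and j = is_pushoutD(2)[OF P ff1 gA1]
    and ij = is_pushoutD(3)[OF P ff1 gA1]
  let ?s = "fn (star_gamma2 f)" and ?i = "\<lambda>k n y. fn i n (fn (\<beta> k) n y)"
  note \<beta>m = map_cel[OF hom_fn(2)[OF \<beta>]] and fm = map_cel[OF hom_fn(2)[OF f]]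
    and pm = map_cel[OF hom_fn(2)[OF cyl(4)[OF A]]] and \<alpha>m = map_cel[OF hom_fn(2)[OF \<alpha>]]
  have si: "?s n (?i k n y) = fn (gamma_at k B) n y" if "y \<in> cel B n" for k n y
    using fn_cmp[OF i s1 \<beta>m[OF that]] gb'[OF that] unfolding s2 by simp
  have ij': "fn j n (fn (gamma_at k A) n x) = ?i k n (fn f n x)" if "x \<in> cel A n" for k n x
    using fn_cmp[OF ff1 i \<alpha>m[OF that]] fn_cmp[OF gA1 j \<alpha>m[OF that]] fa'[OF that] ga'[OF that]
      unfolding ij by simp
  have edge: "\<exists>k. \<exists>y\<in>cel B (Suc 0). z = ?i k (Suc 0) y" if z: "z \<in> cel Q (Suc 0)" for z
    using pushout_surj[OF ff1 gA1 P z]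
  proof (elim disjE bexE)
    fix t assume t: "t \<in> cel CB (Suc 0)" "z = fn i (Suc 0) t"
    then show ?thesis using sB[OF t(1)] by blast
  next
    fix t assume t: "t \<in> cel (cyl A) (Suc 0)" "z = fn j (Suc 0) t"
    obtain k where k: "fn (gamma_at k A) (Suc 0) (fn (proj A) (Suc 0) t) = t"
      by (rule cyl_edge[OF A t(1)])
    have "z = ?i k (Suc 0) (fn f (Suc 0) (fn (proj A) (Suc 0) t))"
      using ij'[OF pm[OF t(1)], of k] k t(2) by simp
    then show ?thesis using fm[OF pm[OF t(1)]] by blast
  qed
  have bij: "bij_betw (fn f 0) (cel A 0) (cel B 0)"
    by (rule weq_bij[OF ob_object[OF B] hom_fn(2)[OF f] w])
  have vert: "\<exists>y\<in>cel B 0. z = ?i False 0 y" if z: "z \<in> cel Q 0" for z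
    using pushout_surj[OF ff1 gA1 P z]
  proof (elim disjE bexE)
    fix t assume t: "t \<in> cel CB 0" "z = fn i 0 t"
    obtain k y where y: "y \<in> cel B 0" "t = fn (\<beta> k) 0 y" using sB[OF t(1)] by blast
    \<comment> \<open>The vertex comes from \<open>A\<close>, and in the cylinder of
      \<open>A\<close> its copies at both ends are equal. This leads from the copy \<open>k\<close>
      of \<open>B\<close> to the copy \<open>False\<close>.\<close>
    obtain x where x: "x \<in> cel A 0" "y = fn f 0 x" using bij y(1) unfolding bij_betw_def by blast
    have "z = fn j 0 (fn (gamma_at k A) 0 x)" unfolding t(2) y(2) x(2) by (rule ij'[OF x(1), symmetric])
    also have "fn (gamma_at k A) 0 x = fn (gamma_at False A) 0 x"
      using cyl_vertex[OF A map_cel[OF hom_fn(2)[OF gamma_at(1)[OF A]] x(1)], of False k]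
        gamma_at(3)[OF A x(1), of k] by simp
    also have "fn j 0 (fn (gamma_at False A) 0 x) = ?i False 0 y" unfolding x(2) by (rule ij'[OF x(1)])
    finally show ?thesis using y(1) by blast
  next
    fix t assume t: "t \<in> cel (cyl A) 0" "z = fn j 0 t"
    have "z = ?i False 0 (fn f 0 (fn (proj A) 0 t))"
      using ij'[OF pm[OF t(1)], of False] cyl_vertex[OF A t(1), of False] t(2) by simp
    then show ?thesis using fm[OF pm[OF t(1)]] by blast
  qed
  have "cofib Q (cyl B) ?s"
    unfolding cofib_def
  proof (rule inj_onI)
    fix z z' assume z: "z \<in> cel Q (Suc 0)" and z': "z' \<in> cel Q (Suc 0)"
      and eq: "?s (Suc 0) z = ?s (Suc 0) z'"
    obtain k y where y: "y \<in> cel B (Suc 0)" "z = ?i k (Suc 0) y" using edge[OF z] by blast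
    obtain k' y' where y': "y' \<in> cel B (Suc 0)" "z' = ?i k' (Suc 0) y'" using edge[OF z'] by blast
    have "k = k' \<and> y = y'"
      using gamma_at_eq[OF B y(1) y'(1), of k k'] si[OF y(1)] si[OF y'(1)] eq y(2) y'(2) by simp
    then show "z = z'" using y(2) y'(2) by simp
  qed
  moreover have "weq Q (cyl B) ?s"
    unfolding weq_def
  proof (intro conjI allI ballI)
    show "inj_on (?s 0) (cel Q 0)"
    proof (rule inj_onI)
      fix z z' assume z: "z \<in> cel Q 0" and z': "z' \<in> cel Q 0" and eq: "?s 0 z = ?s 0 z'"
      obtain y where y: "y \<in> cel B 0" "z = ?i False 0 y" using vert[OF z] by blast
      obtain y' where y': "y' \<in> cel B 0" "z' = ?i False 0 y'" using vert[OF z'] by blast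
      have "fn (gamma_at False B) 0 y = fn (gamma_at False B) 0 y'"
        using eq unfolding y(2) y'(2) si[OF y(1)] si[OF y'(1)] .
      then have "fn (proj B) 0 (fn (gamma_at False B) 0 y) =
        fn (proj B) 0 (fn (gamma_at False B) 0 y')" by simp
      then have "y = y'" unfolding gamma_at(3)[OF B y(1)] gamma_at(3)[OF B y'(1)] .
      then show "z = z'" using y(2) y'(2) by simp
    qed
    fix n t assume t: "t \<in> cel (cyl B) n"
    note q = map_cel[OF hom_fn(2)[OF cyl(4)[OF B]] t]
    show "\<exists>z\<in>cel Q n. par (cyl B) n (?s n z) t"
    proof (rule bexI)
      show "par (cyl B) n (?s n (?i False n (fn (proj B) n t))) t" unfolding si[OF q]
        by (rule cyl_par[OF B t])
      show "?i False n (fn (proj B) n t) \<in> cel Q n" by (rule map_cel[OF hom_fn(2)[OF i] \<beta>m[OF q]])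
    qed
  qed
  ultimately show ?thesis using s1 by blast
qed

section \<open>Injectivity with respect to \<open>Lambda\<close>\<close>

text \<open>A generating cofibration need not be a weak equivalence; \<open>star_gamma\<close> turns
  it into one, and \<open>star_gamma2\<close> preserves the property.\<close>

lemma Lambda_weq:
  assumes "f \<in> (Lambda_n n :: ('u, 'l) lmor set)"
  shows "\<exists>A B. f \<in> hom (Cat False) A B \<and> cofib A B (fn f) \<and> weq A B (fn f)"
  using assms
proof (induction n arbitrary: f)
  case 0
  then obtain k i where i: "i \<in> (gen_cofs :: ('u, 'l) lmor set)" "f = star_gamma k i" by auto
  obtain A \<iota> B where *: "i = (mk A \<iota> B :: ('u, 'l) lmor)" "ob True A" "ob True B" "lps_map A B \<iota>"
    "cofib A B \<iota>"
    using gen_cofs_HDA[OF i(1)] by blast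
  have h: "i \<in> hom (Cat False) A B" unfolding *(1)
    by (rule mk_hom[OF ob_weaken[OF *(2)] ob_weaken[OF *(3)] *(4)])
  have "inj_on (fn i (Suc 0)) (cel A (Suc 0)) \<longleftrightarrow> inj_on (\<iota> (Suc 0)) (cel A (Suc 0))"
    by (rule inj_on_cong) (simp add: *(1) fn_mk)
  then have "cofib A B (fn i)" using *(5) unfolding cofib_def by simp
  then show ?case unfolding i(2) by (rule star_gamma_weq[OF h])
next
  case (Suc n)
  then obtain g where g: "g \<in> Lambda_n n" "f = star_gamma2 g" by auto
  obtain A B where "g \<in> hom (Cat False) A B" "cofib A B (fn g)" "weq A B (fn g)"
    using Suc.IH[OF g(1)] by blast
  then show ?case unfolding g(2) by (rule star_gamma2_weq)
qed

text \<open>The lifting lemma asks for the HDA paradigm of \<open>X\<close> alone, so it applies to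
  the maps of \<open>Lambda\<close> although their sources and targets are formed in
  \<open>P_cat\<close>.\<close>

lemma fibr_injective:
  assumes X: "ob True (X :: ('u, 'l) lps)" and f: "fibr X"
  shows "injective P_cat Lambda X"
  unfolding injective_def P_cat_Cat
proof (intro ballI)
  fix l g :: "('u, 'l) lmor" assume l: "l \<in> Lambda"
    and g: "g \<in> hom (Cat False) (source (Cat False) l) X"
  obtain A B where h: "l \<in> hom (Cat False) A B" "cofib A B (fn l)" "weq A B (fn l)"
    using l Lambda_weq unfolding Lambda_def by blast
  have s: "source (Cat False) l = A" "target (Cat False) l = B" using h(1) by (simp_all add: hom_def)
  note g = g[unfolded s]
  have A: "ob False A" and B: "ob False B" by (rule hom_fn(3)[OF h(1)], rule hom_fn(4)[OF h(1)])
  have "lab X n (fn g n a) = lab B n (fn l n a)" if "a \<in> cel A n" for n a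
    using map_lab[OF hom_fn(2)[OF g] that] map_lab[OF hom_fn(2)[OF h(1)] that] by simp
  from lift_weq_cofib_fib[OF ob_object[OF A] ob_object[OF B] ob_object[OF X] ob_hda1[OF X]
    lps_object_lwords
      hom_fn(2)[OF h(1)] h(2,3) lps_map_lab[OF ob_object[OF X]] f hom_fn(2)[OF g]
        lps_map_lab[OF ob_object[OF B]] this]
  obtain e where e: "lps_map B X e" "\<forall>n. \<forall>a\<in>cel A n. e n (fn l n a) = fn g n a" by blast
  note eh = mk_hom[OF B ob_weaken[OF X] e(1)]
  have "cmp (Cat False) (mk B e X) l = g"
  proof (rule hom_eqI[OF cmp_hom[OF h(1) eh] g])
    fix n a assume a: "a \<in> cel A n"
    show "fn (cmp (Cat False) (mk B e X) l) n a = fn g n a"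
      unfolding fn_cmp[OF h(1) eh a] fn_mk[OF map_cel[OF hom_fn(2)[OF h(1)] a]] using e(2) a by blast
  qed
  then show "\<exists>h\<in>hom (Cat False) (target (Cat False) l) X. cmp (Cat False) h l = g" using eh
    unfolding s by blast
qed

text \<open>
  A shell \<open>b\<close> and a cell \<open>x\<close> with the same vertices and label define a map from the cylinder of
  the boundary: on edges it is \<open>b\<close> at one end and \<open>x\<close> at the other, and the cells of higher
  dimension, which join edges of both ends, are supplied by induction.  The end \<open>x\<close> extends to the
  cube, so injectivity extends the map to the cylinder of the cube, and the other end of this
  extension fills \<open>b\<close>.
\<close>

lemma injective_fibr:
  assumes X: "ob True (X :: ('u, 'l) lps)" and inj: "injective P_cat Lambda X"
  shows "fibr X"
proof -
  note Xo = ob_object[OF X] and Xh = ob_hda1[OF X]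
  \<comment> \<open>A cell of \<open>lwords\<close> is its own label, so over \<open>lwords\<close>
    the cell to be reached is the label of \<open>x\<close>.\<close>
  have "fills X lwords (lab X) n b (lab X n x)"
    if "n \<ge> Suc 0" "x \<in> cel X n" "shell X n b" "over lwords (lab X) n b (lab X n x)"
      "\<forall>f. box 0 n f \<longrightarrow> b 0 f = res X 0 n f x" for n x b
    using that
  proof (induction n arbitrary: x b rule: less_induct)
    case (less n)
    note x = less.prems(2) and b = less.prems(3) and ov = less.prems(4)
    have b0: "b 0 f = res X 0 n f x" if "box 0 n f" for f using less.prems(5) that by blast
    have bl: "lab X m (b m f) = word_act m n f (lab X n x)" if "box m n f" "m < n" for m f
      using ov that by (simp add: over_def)
    show ?case
    proof (cases "n = Suc 0")
      case True
      \<comment> \<open>The proper faces of an edge are vertices, where \<open>b\<close> agrees with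
        \<open>x\<close>; so \<open>x\<close> is the filler.\<close>
      have "res X m n f x = b m f" if "box m n f" "m < n" for m f
      proof -
        have "m = 0" using that(2) True by simp
        then show ?thesis using b0 that(1) by simp
      qed
      then show ?thesis using x by (intro fillsI[of x]) auto
    next
      case False
      then have n: "n \<ge> 2" using less.prems(1) by simp
      define as where "as = lab X n x"
      have las: "length as = n" unfolding as_def by (rule length_lab[OF Xo x])
      define A where "A = (place (lboundary as) :: ('u, 'l) lps)"
      define B where "B = (place (lcube as) :: ('u, 'l) lps)"
      define f where "f = (place_map (lboundary as) (lcube as) (\<lambda>n x. x) :: ('u, 'l) lmor)"
      have A: "ob b A" and B: "ob b B" for b unfolding A_def B_def
        by (rule ob_place_lboundary, rule ob_place_lcube)
      have Ac: "cel A m = emb ` {g. box m n g \<and> m < n}" and Bc: "cel B m = emb ` {g. box m n g}" for m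
        unfolding A_def B_def by (simp_all add: place_transport las)
      have Br: "res B l m g (emb h) = emb (cb l h g)" for l m g h
        unfolding B_def by (simp add: place_transport)
      have "lps_map (lboundary as) (lcube as) (\<lambda>n x. x)" by (rule lps_mapI) auto
      then have f: "f \<in> hom (Cat False) A B" unfolding f_def A_def B_def
        by (intro place_map_hom[OF small_box small_box lps_object_lboundary lps_object_lcube]) simp
      have fn_f: "fn f m a = a" if "a \<in> cel A m" for m a
      proof -
        have "fn f m a = emb (inv emb a :: bool list \<Rightarrow> bool list)" unfolding f_def place_map_mk
          by (rule fn_mk[OF that[unfolded A_def]])
        then show ?thesis using that unfolding Ac by auto
      qed
      have "f \<in> gen_cofs" unfolding f_def gen_cofs_def using las n by auto
      then have "star_gamma False f \<in> Lambda_n 0" by simp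
      then have sL: "star_gamma False f \<in> Lambda" unfolding Lambda_def by blast
      obtain Q i j where P: "is_pushout (Cat False) f (gamma_at False A) (Q, i, j)"
        and s: "star_gamma False f \<in> hom (Cat False) Q (cyl B)"
          "cmp (Cat False) (star_gamma False f) i = gamma_at False B"
          "cmp (Cat False) (star_gamma False f) j = V_times f" by (rule star_gamma[OF f])
      note g = gamma_at[OF A] and V = V_times[OF f]
      note i = is_pushoutD(1)[OF P f g(1)] and j = is_pushoutD(2)[OF P f g(1)]
      note pr = hom_fn(2)[OF cyl(4)[OF A]]
      note pm = map_cel[OF pr]
      define bA where "bA m a = b m (inv emb a)" for m and a :: 'u
      define xB where "xB m c = res X m n (inv emb c) x" for m and c :: 'u
      have "lps_map (lboundary as) X b" unfolding lps_map_lboundary_iff las using b bl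
        by (simp add: as_def)
      then have bA: "lps_map A X bA" unfolding bA_def A_def
        by (rule lps_map_comp[OF lps_isoD(2)[OF place_iso[OF small_box lps_object_lboundary]]])
      have "lps_map (lcube as) X (\<lambda>m g. res X m n g x)" by (rule yoneda[OF Xo x as_def[symmetric]])
      then have xB: "lps_map B X xB" unfolding xB_def B_def
        by (rule lps_map_comp[OF lps_isoD(2)[OF place_iso[OF small_box lps_object_lcube]]])
      have AB: "a \<in> cel B m" if "a \<in> cel A m" for a m using that unfolding Ac Bc by blast
      have xA: "lps_map A X xB"
        using lps_map_comp[OF hom_fn(2)[OF f] xB]
        by (rule lps_map_cong[OF ob_object[OF A]]) (simp add: fn_f)
      have bx: "bA 0 a = xB 0 a" if "a \<in> cel A 0" for a
        using that b0 unfolding Ac bA_def xB_def by auto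
      \<comment> \<open>The test asks whether the edge lies at the end \<open>True\<close>;
        otherwise it lies at the end \<open>False\<close>.\<close>
      define ue where "ue w = (if w = fn (gamma_at True A) (Suc 0) (fn (proj A) (Suc 0) w)
        then bA (Suc 0) (fn (proj A) (Suc 0) w) else xB (Suc 0) (fn (proj A) (Suc 0) w))" for w
      \<comment> \<open>By \<open>bx\<close> the maps \<open>bA\<close> and \<open>xB\<close> agree
        on vertices, so either end gives the same value.\<close>
      define uv where "uv w = bA 0 (fn (proj A) 0 w)" for w
      have "\<exists>u. lps_map (cyl A) X u \<and> (\<forall>n. \<forall>y\<in>cel (cyl A) n. lab X n (u n y) = lab (cyl A) n y) \<and>
        (\<forall>y\<in>cel (cyl A) 0. u 0 y = uv y) \<and> (\<forall>y\<in>cel (cyl A) (Suc 0). u (Suc 0) y = ue y)"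
      proof (rule extend_from_edges[OF ob_object[OF cyl(2)[OF A]]
        Xo Xh lps_object_lwords lps_map_lab[OF Xo]
            lps_map_lab[OF ob_object[OF cyl(2)[OF A]]]])
        fix y assume y: "y \<in> cel (cyl A) 0"
        show "uv y \<in> cel X 0 \<and> lab X 0 (uv y) = lab (cyl A) 0 y"
          unfolding uv_def using map_cel[OF bA pm[OF y]] map_lab[OF bA pm[OF y]] map_lab[OF pr y]
            by simp
      next
        fix y assume y: "y \<in> cel (cyl A) (Suc 0)"
        show "ue y \<in> cel X (Suc 0) \<and> lab X (Suc 0) (ue y) = lab (cyl A) (Suc 0) y"
          unfolding ue_def using map_cel[OF bA pm[OF y]] map_lab[OF bA pm[OF y]] map_cel[OF xA pm[OF y]]
            map_lab[OF xA pm[OF y]] map_lab[OF pr y] by simp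
        fix h assume h: "box 0 (Suc 0) h"
        have "res X 0 (Suc 0) h (bA (Suc 0) (fn (proj A) (Suc 0) y)) = uv (res (cyl A) 0 (Suc 0) h y)"
          unfolding uv_def map_res[OF pr h y] by (rule map_res[OF bA h pm[OF y], symmetric])
        moreover have "res X 0 (Suc 0) h (xB (Suc 0) (fn (proj A) (Suc 0) y)) =
          uv (res (cyl A) 0 (Suc 0) h y)"
          unfolding uv_def map_res[OF pr h y] bx[OF res_cel[OF ob_object[OF A] h pm[OF y]]]
          by (rule map_res[OF xA h pm[OF y], symmetric])
        ultimately show "res X 0 (Suc 0) h (ue y) = uv (res (cyl A) 0 (Suc 0) h y)" unfolding ue_def
          by simp
      next
        fix m y b'
        assume m: "2 \<le> m" and y: "y \<in> cel (cyl A) m"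
          and b': "shell X m b'" "over lwords (lab X) m b' (lab (cyl A) m y)"
          and b0': "\<And>h. box 0 m h \<Longrightarrow> b' 0 h = uv (res (cyl A) 0 m h y)"
        \<comment> \<open>The cylinder of the boundary has cells only in dimensions below
          \<open>n\<close>. The induction hypothesis therefore fills its shells, with the image
          under \<open>xB\<close> of the projected cell as certificate.\<close>
        have mn: "m < n" using pm[OF y] unfolding Ac by blast
        have l: "lab X m (xB m (fn (proj A) m y)) = lab (cyl A) m y"
          using map_lab[OF xA pm[OF y]] map_lab[OF pr y] by simp
        have "b' 0 h = res X 0 m h (xB m (fn (proj A) m y))" if h: "box 0 m h" for h
          unfolding b0'[OF h] uv_def map_res[OF pr h y] bx[OF res_cel[OF ob_object[OF A] h pm[OF y]]]
          by (rule map_res[OF xA h pm[OF y]])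
        then show "fills X lwords (lab X) m b' (lab (cyl A) m y)"
          using less.IH[OF mn _ map_cel[OF xA pm[OF y]] b'(1)] m b'(2) unfolding l by simp
      qed
      then obtain u where u: "lps_map (cyl A) X u" "\<forall>y\<in>cel (cyl A) 0. u 0 y = uv y"
          "\<forall>y\<in>cel (cyl A) (Suc 0). u (Suc 0) y = ue y" by blast
      note gm = map_cel[OF hom_fn(2)[OF g(1)]]
      have uF: "u m (fn (gamma_at False A) m a) = xB m a" if "a \<in> cel A m" for m a
      proof (rule maps_eqI[OF ob_object[OF A] Xo Xh lps_map_comp[OF hom_fn(2)[OF g(1)] u(1)]
        xA _ _ that])
        fix a assume a: "a \<in> cel A 0"
        show "u 0 (fn (gamma_at False A) 0 a) = xB 0 a"
          using u(2) gm[OF a] g(3)[OF a] bx[OF a] unfolding uv_def by simp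
      next
        fix a assume a: "a \<in> cel A (Suc 0)"
        have "fn (gamma_at False A) (Suc 0) a \<noteq> fn (gamma_at True A) (Suc 0) a"
          using gamma_at_eq[OF A a a, of False True] by auto
        then show "u (Suc 0) (fn (gamma_at False A) (Suc 0) a) = xB (Suc 0) a"
          using u(3) gm[OF a] g(3)[OF a] unfolding ue_def by simp
      qed
      have uT: "u m (fn (gamma_at True A) m a) = bA m a" if "a \<in> cel A m" for m a
      proof (rule maps_eqI[OF ob_object[OF A] Xo Xh lps_map_comp[OF hom_fn(2)[OF g(1)] u(1)]
        bA _ _ that])
        fix a assume a: "a \<in> cel A 0"
        show "u 0 (fn (gamma_at True A) 0 a) = bA 0 a"
          using u(2) gm[OF a] g(3)[OF a] unfolding uv_def by simp
      next
        fix a assume a: "a \<in> cel A (Suc 0)"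
        show "u (Suc 0) (fn (gamma_at True A) (Suc 0) a) = bA (Suc 0) a"
          using u(3) gm[OF a] g(3)[OF a] unfolding ue_def by simp
      qed
      note xh = mk_hom[OF B ob_weaken[OF X] xB] and uh = mk_hom[OF cyl(2)[OF A] ob_weaken[OF X] u(1)]
      \<comment> \<open>At the end \<open>False\<close> the map \<open>u\<close> is the restriction
        of \<open>xB\<close>, so the two glue to a map on the source of
        \<open>star_gamma False f\<close>.\<close>
      have "cmp (Cat False) (mk B xB X) f = cmp (Cat False) (mk (cyl A) u X) (gamma_at False A)"
      proof (rule hom_eqI[OF cmp_hom[OF f xh] cmp_hom[OF g(1) uh]])
        fix m a assume a: "a \<in> cel A m"
        show "fn (cmp (Cat False) (mk B xB X) f) m a =
          fn (cmp (Cat False) (mk (cyl A) u X) (gamma_at False A)) m a"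
          unfolding fn_cmp[OF f xh a] fn_cmp[OF g(1) uh a] fn_mk[OF gm[OF a]] uF[OF a] fn_f[OF a]
          by (rule fn_mk[OF AB[OF a]])
      qed
      from is_pushoutD(4)[OF P f g(1) xh uh this]
      obtain k where k: "k \<in> hom (Cat False) Q X" "cmp (Cat False) k j = mk (cyl A) u X"
        by (elim ex1E) blast
      have st: "source (Cat False) (star_gamma False f) = Q"
        "target (Cat False) (star_gamma False f) = cyl B"
        using s(1) by (simp_all add: hom_def)
      obtain e where e: "e \<in> hom (Cat False) (cyl B) X" "cmp (Cat False) e (star_gamma False f) = k"
        using inj sL k(1) unfolding injective_def P_cat_Cat st[symmetric] by blast
      note gB = gamma_at[OF B]
      have top: "top_cell n \<in> cel B n" unfolding Bc using box_id by blast
      note G = lps_map_comp[OF hom_fn(2)[OF gB(1)[of True]] hom_fn(2)[OF e(1)]]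
      \<comment> \<open>The top cell of the cube is taken at the end \<open>True\<close>, where the
        extension restricts to \<open>b\<close> on the boundary.\<close>
      define z where "z = fn e n (fn (gamma_at True B) n (top_cell n))"
      have zc: "z \<in> cel X n" unfolding z_def by (rule map_cel[OF G top])
      have "lab X n z = lab B n (top_cell n)" unfolding z_def by (rule map_lab[OF G top])
      also have "\<dots> = lab X n x"
        unfolding B_def as_def[symmetric] using las word_act_id[of as n] by (simp add: place_transport)
      finally have zl: "lab X n z = lab X n x" .
      \<comment> \<open>A proper face lies in the boundary. On its cylinder the extension
        \<open>e\<close> is \<open>u\<close>, by way of \<open>Q\<close>, and at the end
        \<open>True\<close> the map \<open>u\<close> is \<open>bA\<close>.\<close>
      have "res X m n h z = b m h" if h: "box m n h" "m < n" for m h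
      proof -
        have a: "emb h \<in> cel A m" unfolding Ac using h by blast
        have "res X m n h z = fn e m (fn (gamma_at True B) m (res B m n h (top_cell n)))"
          unfolding z_def by (rule map_res[OF G h(1) top, symmetric])
        also have "res B m n h (top_cell n) = fn f m (emb h)"
          unfolding Br cb_id_left[OF h(1)] fn_f[OF a] ..
        also have "fn e m (fn (gamma_at True B) m (fn f m (emb h))) =
          fn e m (fn (V_times f) m (fn (gamma_at True A) m (emb h)))"
          unfolding V(2)[OF a] ..
        also have "fn (V_times f) m (fn (gamma_at True A) m (emb h)) =
          fn (star_gamma False f) m (fn j m (fn (gamma_at True A) m (emb h)))"
          using fn_cmp[OF j s(1) gm[OF a]] unfolding s(3) .
        also have "fn e m \<dots> = fn k m (fn j m (fn (gamma_at True A) m (emb h)))"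
          using fn_cmp[OF s(1) e(1) map_cel[OF hom_fn(2)[OF j] gm[OF a]]] unfolding e(2) by simp
        also have "\<dots> = u m (fn (gamma_at True A) m (emb h))"
          using fn_cmp[OF j k(1) gm[OF a]] unfolding k(2) fn_mk[OF gm[OF a]] by simp
        also have "\<dots> = bA m (emb h)" by (rule uT[OF a])
        finally show ?thesis unfolding bA_def by simp
      qed
      then show ?thesis using zc zl by (intro fillsI[of z]) auto
    qed
  qed
  then show ?thesis unfolding fib_def by auto
qed

end

theorem theorem9p5:
  assumes "universe TYPE('u)"
    and "small TYPE('u) (UNIV :: 'l set)"
  shows "(\<exists>!M :: ('u, 'l) lmor model_data.
      combinatorial_model_structure TYPE('u) HDA M \<and>
      cofs M = llp HDA (rlp HDA gen_cofs) \<and>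
      (\<forall>X\<in>obj HDA. fibrant HDA M X \<longleftrightarrow> injective P_cat Lambda X)) \<and>
    (\<forall>M :: ('u, 'l) lmor model_data.
      combinatorial_model_structure TYPE('u) HDA M \<and>
      cofs M = llp HDA (rlp HDA gen_cofs) \<and>
      (\<forall>X\<in>obj HDA. fibrant HDA M X \<longleftrightarrow> injective P_cat Lambda X) \<longrightarrow>
      (\<forall>X\<in>obj HDA. cofibrant HDA M X))"
proof -
  interpret small_labels "TYPE('u)" "TYPE('l)" by unfold_locales (rule assms)+
  \<comment> \<open>On \<open>HDA\<close> the description by shells replaces injectivity, both for
    existence and for uniqueness.\<close>
  have Lambda: "injective P_cat Lambda X \<longleftrightarrow> fibr X" if "ob True X" for X :: "('u, 'l) lps"
    using fibr_injective[OF that] injective_fibr[OF that] by blast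
  have O: "X \<in> obj HDA \<longleftrightarrow> ob True X" for X :: "('u, 'l) lps" unfolding HDA_Cat by (rule obj_Cat)
  show ?thesis
  proof (intro conjI allI impI; (elim conjE)?)
    show "\<exists>!M :: ('u, 'l) lmor model_data. combinatorial_model_structure TYPE('u) HDA M \<and>
      cofs M = llp HDA (rlp HDA gen_cofs) \<and>
      (\<forall>X\<in>obj HDA. fibrant HDA M X \<longleftrightarrow> injective P_cat Lambda X)"
    proof (rule ex1I[of _ hda_model])
      have "cofs hda_model = llp HDA (rlp HDA (gen_cofs :: ('u, 'l) lmor set))"
        by (simp add: hda_model_def)
      then show "combinatorial_model_structure TYPE('u) HDA (hda_model :: ('u, 'l) lmor model_data) \<and>
        cofs hda_model = llp HDA (rlp HDA (gen_cofs :: ('u, 'l) lmor set)) \<and>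
        (\<forall>X\<in>obj HDA. fibrant HDA hda_model (X :: ('u, 'l) lps) \<longleftrightarrow> injective P_cat Lambda X)"
        using combinatorial_hda_model fibrant_hda_model Lambda by (simp add: O)
    next
      fix M :: "('u, 'l) lmor model_data"
      assume M: "combinatorial_model_structure TYPE('u) HDA M \<and> cofs M = llp HDA (rlp HDA gen_cofs) \<and>
        (\<forall>X\<in>obj HDA. fibrant HDA M X \<longleftrightarrow> injective P_cat Lambda X)"
      then have "model_structure TYPE('u) HDA M" unfolding combinatorial_model_structure_def by blast
      then interpret model_cat HDA M by (rule model_structure_model_cat)
      interpret hda_model_cat "TYPE('u)" "TYPE('l)" M
        by unfold_locales (use M Lambda in \<open>simp_all add: O\<close>)
      show "M = hda_model" by (rule model_unique)
    qed
  next
    fix M :: "('u, 'l) lmor model_data"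
    assume "cofs M = llp HDA (rlp HDA gen_cofs)"
    then show "\<forall>X\<in>obj HDA. cofibrant HDA M X" using cofibrant_all by (simp add: O)
  qed
qed

end
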